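(* Let $\mathbb F\in\{\mathbb R,\mathbb C,\mathbb H\}$, $d=\dim_{\mathbb R}\mathbb F$, $q\ge1$, and let $p\ge 2q$ be an integer. Then for all $\lambda\in\mathbb C^q$ and $t\in\mathbb R^q$ the spherical function $\varphi^p_\lambda(a_t)=\int_K e^{(i\lambda-\rho^{BC})(H(a_tk))}\,dk$ of the Grassmannian $G/K=\mathcal G_{p,q}(\mathbb F)$ can be written as $$\varphi_\lambda^{p}(a_t)=\int_{U_0(q,\mathbb F)\times B_q}\Delta_{(i\lambda-\rho^{BC})/2}(g_t(u,w))\,dm_p(w)\,du ,$$ where $du$ is the normalized Haar measure on $U_0(q,\mathbb F)$ and $$g_t(u,w)=u^{-1}(\cosh\underline t+\sinh\underline t\,w)^*(\cosh\underline t+\sinh\underline t\,w)u .$$ The same formula holds with $g_t(u,w)$ replaced by $$\widetilde g_t(u,w)=u^{-1}(\cosh\underline t+\sinh\underline t\,w)(\cosh\underline t+\sinh\underline t\,w)^*u .$$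
   Context: $M_q(\mathbb F)$ is the set of $q\times q$ matrices over $\mathbb F$, $X^*=\overline X^t$, $U(q,\mathbb F)=\{X\in M_q(\mathbb F):X^*X=I_q\}$, and $U_0(q,\mathbb F)$ is its identity component. $G$ is $SO_0(q,p)$, $SU(q,p)$, $Sp(q,p)$ for $\mathbb F=\mathbb R,\mathbb C,\mathbb H$ respectively, realized as the identity component of the group of ($\mathbb F$-linear, determinant-one) isometries of the form $|x_1|^2+\dots+|x_q|^2-|x_{q+1}|^2-\dots-|x_{p+q}|^2$ on $\mathbb F^{p+q}$. $K$ is the maximal compact subgroup of $(q,p)$-block diagonal matrices $SO(q)\times SO(p)$, $S(U(q)\times U(p))$, $Sp(q)\times Sp(p)$ respectively, with normalized Haar measure $dk$. For $t\in\mathbb R^q$ let $\underline t=\mathrm{diag}(t_1,\dots,t_q)$, $\cosh\underline t=\mathrm{diag}(\cosh t_i)$, $\sinh\underline t=\mathrm{diag}(\sinh t_i)$, and, in $(q,q,p-q)$-block form, $$H_t=\begin{pmatrix}0&\underline t&0\\ \underline t&0&0\\0&0&0\end{pmatrix},\qquad a_t=\exp(H_t)=\begin{pmatrix}\cosh\underline t&\sinh\underline t&0\\ \sinh\underline t&\cosh\underline t&0\\0&0&I_{p-q}\end{pmatrix}.$$ $\mathfrak a=\{H_t:t\in\mathbb R^q\}$ and $\mathfrak a^*_{\mathbb C}\cong\mathbb C^q$ via $\lambda(H_t)=\sum_r\lambda_rt_r$. With $f_i(H_t)=t_i$, the positive restricted roots are $f_i$, $2f_i$ ($1\le i\le q$),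 $f_i\pm f_j$ ($i<j$), with multiplicities $d(p-q)$, $d-1$, $d$, and the weighted half sum of positive roots is $\rho^{BC}=\sum_{i=1}^q(\frac d2(p+q+2-2i)-1)f_i$. $\mathfrak n$ is the sum of the positive root spaces, $N=\exp\mathfrak n$, $A=\exp\mathfrak a$, $G=KAN$ is the Iwasawa decomposition, and $H(g)\in\mathfrak a$ is the unique element with $g\in K\exp(H(g))N$. For a positive definite Hermitian $x\in M_q(\mathbb F)$ and $\lambda\in\mathbb C^q$, $\Delta_\lambda(x)=\Delta_1(x)^{\lambda_1-\lambda_2}\cdots\Delta_{q-1}(x)^{\lambda_{q-1}-\lambda_q}\Delta_q(x)^{\lambda_q}$, where $\Delta_r(x)$ is the determinant of the upper left $r\times r$ block; for $\mathbb F=\mathbb H$, $\det(A)=(\det_{\mathbb C}A)^{1/2}$ with $A\in M_r(\mathbb H)$ viewed as a complex $2r\times 2r$ matrix. $B_q=\{w\in M_q(\mathbb F):w^*w<I\}$ (i.e. $I-w^*w$ is strictly positive definite), and $m_p$ is the probability measure on $B_q$ $$dm_p(w)=\frac1{\kappa_{pd/2}}\Delta(I-w^*w)^{pd/2-\gamma}\,dw,\qquad \gamma=d\bigl(q-\tfrac12\bigr)+1,\qquad \kappa_{pd/2}=\int_{B_q}\Delta(I-w^*w)^{pd/2-\gamma}dw,$$ with $\Delta=\Delta_q$ the determinant and $dw$ Lebesgue measure on $M_q(\mathbb F)\cong\mathbb R^{dq^2}$. *)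

theory Defs
  imports "HOL-Probability.Probability"
begin

section \<open>Quaternions\<close>

text \<open>The quaternion $z + w j$ with complex $z, w$, where $j z = \bar z j$ and $j^2 = -1$.\<close>

datatype quat = Quat (qfst: complex) (qsnd: complex)

lemma quat_eq_iff: "x = y \<longleftrightarrow> qfst x = qfst y \<and> qsnd x = qsnd y"
  by (cases x; cases y) auto

instantiation quat :: real_inner
begin

definition "0 = Quat 0 0"
definition "x + y = Quat (qfst x + qfst y) (qsnd x + qsnd y)"
definition "- x = Quat (- qfst x) (- qsnd x)"
definition "x - y = Quat (qfst x - qfst y) (qsnd x - qsnd y)"
definition "r *\<^sub>R x = Quat (r *\<^sub>R qfst x) (r *\<^sub>R qsnd x)"
definition "x \<bullet> y = qfst x \<bullet> qfst y + qsnd x \<bullet> qsnd y"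
definition "norm (x::quat) = sqrt (x \<bullet> x)"
definition "sgn (x::quat) = inverse (norm x) *\<^sub>R x"
definition "dist x y = norm (x - y)" for x y :: quat
definition "(uniformity :: (quat \<times> quat) filter) =
  (INF e\<in>{0 <..}. principal {(x, y). dist x y < e})"
definition "open (U::quat set) \<longleftrightarrow>
  (\<forall>x\<in>U. eventually (\<lambda>(x', y). x' = x \<longrightarrow> y \<in> U) uniformity)"

lemmas quat_linear_defs = zero_quat_def plus_quat_def uminus_quat_def minus_quat_def
  scaleR_quat_def inner_quat_def

instance
proof
  fix x y z :: quat and r s :: real
  show "x + y + z = x + (y + z)" "x + y = y + x" "0 + x = x" "- x + x = 0" "x - y = x + - y"
    "r *\<^sub>R (x + y) = r *\<^sub>R x + r *\<^sub>R y" "(r + s) *\<^sub>R x = r *\<^sub>R x + s *\<^sub>R x"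
    "r *\<^sub>R s *\<^sub>R x = (r * s) *\<^sub>R x" "1 *\<^sub>R x = x"
    by (simp_all add: quat_linear_defs quat_eq_iff algebra_simps)
  show "x \<bullet> y = y \<bullet> x" "(x + y) \<bullet> z = x \<bullet> z + y \<bullet> z" "(r *\<^sub>R x) \<bullet> y = r * (x \<bullet> y)" "0 \<le> x \<bullet> x"
    by (simp_all add: quat_linear_defs inner_commute inner_add_left algebra_simps)
  show "x \<bullet> x = 0 \<longleftrightarrow> x = 0"
    by (simp add: quat_linear_defs quat_eq_iff add_nonneg_eq_0_iff)
  show "norm x = sqrt (x \<bullet> x)" "dist x y = norm (x - y)" "sgn x = inverse (norm x) *\<^sub>R x"
    by (simp_all add: norm_quat_def dist_quat_def sgn_quat_def)
qed (rule uniformity_quat_def open_quat_def)+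

end

instantiation quat :: real_normed_div_algebra
begin

definition "1 = Quat 1 0"
definition "x * y = Quat (qfst x * qfst y - qsnd x * cnj (qsnd y))
                         (qfst x * qsnd y + qsnd x * cnj (qfst y))"
definition "inverse x = Quat (cnj (qfst x) /\<^sub>R (norm x)\<^sup>2) (- qsnd x /\<^sub>R (norm x)\<^sup>2)"
definition "x div y = x * inverse y" for x y :: quat

lemma norm_quat_sq: "(norm x)\<^sup>2 = (cmod (qfst x))\<^sup>2 + (cmod (qsnd x))\<^sup>2" for x :: quat
  by (simp add: norm_quat_def inner_quat_def power2_norm_eq_inner)

instance
proof
  fix x y z :: quat and r :: real
  show "x * y * z = x * (y * z)" "1 * x = x" "x * 1 = x"
    "(x + y) * z = x * z + y * z" "x * (y + z) = x * y + x * z" "(0::quat) \<noteq> 1"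
    "r *\<^sub>R x * y = r *\<^sub>R (x * y)" "x * r *\<^sub>R y = r *\<^sub>R (x * y)"
    by (simp_all add: times_quat_def one_quat_def quat_linear_defs quat_eq_iff algebra_simps)
  show "x div y = x * inverse y" by (rule divide_quat_def)
  show "inverse (0::quat) = 0"
    by (simp add: inverse_quat_def zero_quat_def)
  have cc: "z * cnj z = of_real ((cmod z)\<^sup>2)" for z :: complex
    by (simp only: complex_norm_square[symmetric] of_real_power)
  have n: "of_real ((norm x)\<^sup>2) = qfst x * cnj (qfst x) + qsnd x * cnj (qsnd x)" for x :: quat
    by (simp add: norm_quat_sq cc)
  show "inverse x * x = 1" "x * inverse x = 1" if "x \<noteq> 0"
  proof -
    have nz: "complex_of_real ((norm x)\<^sup>2) \<noteq> 0" using that by simp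
    thus "inverse x * x = 1" "x * inverse x = 1"
      by (simp_all add: inverse_quat_def times_quat_def one_quat_def scaleR_conv_of_real
          n[symmetric] field_simps del: of_real_power)
  qed
  have "complex_of_real ((norm (x * y))\<^sup>2) = of_real ((norm x)\<^sup>2 * (norm y)\<^sup>2)"
    unfolding of_real_mult n by (simp add: times_quat_def algebra_simps)
  hence "(norm (x * y))\<^sup>2 = (norm x * norm y)\<^sup>2"
    by (simp only: of_real_eq_iff power_mult_distrib)
  thus "norm (x * y) = norm x * norm y"
    by (simp add: power2_eq_iff_nonneg)
qed

end

instantiation quat :: euclidean_space
begin

definition "Basis = (\<lambda>b. Quat b 0) ` Basis \<union> Quat 0 ` Basis"

instance
proof
  show "(Basis :: quat set) \<noteq> {}" "finite (Basis :: quat set)"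
    by (simp_all add: Basis_quat_def)
  show "u \<bullet> v = (if u = v then 1 else 0)" if "u \<in> Basis" "v \<in> Basis" for u v :: quat
    using that by (auto simp: Basis_quat_def inner_quat_def inner_Basis split: if_splits)
  show "(\<forall>u\<in>Basis. x \<bullet> u = 0) \<longleftrightarrow> x = 0" for x :: quat
    by (auto simp: Basis_quat_def inner_quat_def ball_Un zero_quat_def quat_eq_iff
        euclidean_all_zero_iff)
qed

end

lemma DIM_quat: "DIM(quat) = 4"
proof -
  have "card ((\<lambda>b. Quat b 0) ` Basis \<union> Quat 0 ` Basis) = 2 * DIM(complex)"
    by (subst card_Un_disjoint) (auto simp: card_image inj_on_def)
  thus ?thesis by (simp add: Basis_quat_def)
qed

definition qcnj :: "quat \<Rightarrow> quat"
  where "qcnj x = Quat (cnj (qfst x)) (- qsnd x)"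


section \<open>The fields R, C, H\<close>

text \<open>The types of this class are exactly the isometric copies of the reals, the complex numbers
  and the quaternions with their conjugation \<open>star\<close>; \<^typ>\<open>real\<close>, \<^typ>\<open>complex\<close> and \<^typ>\<open>quat\<close>
  are the three canonical instances.\<close>

class rch = real_normed_div_algebra + euclidean_space +
  fixes to_quat :: "'a \<Rightarrow> quat" and star :: "'a \<Rightarrow> 'a"
  assumes to_quat_add: "to_quat (x + y) = to_quat x + to_quat y"
    and to_quat_scaleR: "to_quat (r *\<^sub>R x) = r *\<^sub>R to_quat x"
    and to_quat_mult: "to_quat (x * y) = to_quat x * to_quat y"
    and to_quat_one: "to_quat 1 = 1"
    and to_quat_inner: "to_quat x \<bullet> to_quat y = x \<bullet> y"
    and to_quat_star: "to_quat (star x) = qcnj (to_quat x)"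
    and range_to_quat: "range to_quat \<in> {range (\<lambda>r. Quat (complex_of_real r) 0), range (\<lambda>z. Quat z 0), UNIV}"

instantiation real :: rch
begin
definition "to_quat r = Quat (complex_of_real r) 0"
definition "star (r::real) = r"
instance
  by standard (auto simp: to_quat_real_def star_real_def quat_linear_defs times_quat_def
      one_quat_def qcnj_def scaleR_conv_of_real inner_complex_def)
end

instantiation complex :: rch
begin
definition "to_quat z = Quat z 0"
definition "star (z::complex) = cnj z"
instance
  by standard (auto simp: to_quat_complex_def star_complex_def quat_linear_defs times_quat_def
      one_quat_def qcnj_def)
end

instantiation quat :: rch
begin
definition "to_quat (x::quat) = x"
definition "star (x::quat) = qcnj x"
instance
  by standard (auto simp: to_quat_quat_def star_quat_def)
end


section \<open>Matrices\<close>

text \<open>Written with \<open>vec\<close> since the notation \<open>'a^'n\<close> fixes the sort of \<open>'n\<close> at each occurrence.\<close>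

type_synonym ('a, 'n) sqmat = "(('a, 'n) vec, 'n) vec"

text \<open>Square matrices of size $q + p$, where $q$ is the size of \<open>'q\<close> and $p$ that of \<open>'q + 's\<close>.\<close>

type_synonym ('a, 'q, 's) bigmat = "('a, 'q + 'q + 's) sqmat"

definition ctrans :: "'f::rch^'n^'m \<Rightarrow> 'f^'m^'n"
  where "ctrans X = (\<chi> i j. star (X$j$i))"

text \<open>The matrix $A + B j$ over H, with $A$ and $B$ complex, as the complex matrix with block rows
  $(A, B)$ and $(-\bar B, \bar A)$.\<close>

definition cmat :: "('f::rch, 'n::finite) sqmat \<Rightarrow> (complex, 'n + 'n) sqmat"
  where "cmat X = (\<chi> a b. case (a, b) of
      (Inl i, Inl j) \<Rightarrow> qfst (to_quat (X$i$j))
    | (Inl i, Inr j) \<Rightarrow> qsnd (to_quat (X$i$j))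
    | (Inr i, Inl j) \<Rightarrow> - cnj (qsnd (to_quat (X$i$j)))
    | (Inr i, Inr j) \<Rightarrow> cnj (qfst (to_quat (X$i$j))))"

text \<open>The determinant: the square root of the complex determinant over H, the usual one otherwise
  (where \<open>qfst (to_quat x)\<close> is just \<open>x\<close> as a complex number).\<close>

definition fdet :: "('f::rch, 'n::finite) sqmat \<Rightarrow> complex"
  where "fdet X = (if DIM('f) = 4 then csqrt (det (cmat X))
                   else det (\<chi> i j. qfst (to_quat (X$i$j))))"

text \<open>\<open>v \<bullet> (X *v v)\<close> is the real part of $v^* X v$, and equals it for Hermitian \<open>X\<close>.\<close>

definition pos_def :: "('f::rch, 'n::finite) sqmat \<Rightarrow> bool"
  where "pos_def X \<longleftrightarrow> ctrans X = X \<and> (\<forall>v. v \<noteq> 0 \<longrightarrow> v \<bullet> (X *v v) > 0)"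

text \<open>Matrix exponential; the library's \<open>exp\<close> needs a normed algebra type, and \<open>*\<close> on
  \<open>vec\<close> types is componentwise.\<close>

definition mexp :: "('f::rch, 'n::finite) sqmat \<Rightarrow> ('f, 'n) sqmat"
  where "mexp X = (\<Sum>k. (1 / fact k) *\<^sub>R (((**) X ^^ k) (mat 1)))"

definition rdiag :: "('q \<Rightarrow> real) \<Rightarrow> ('f::rch, 'q::finite) sqmat"
  where "rdiag a = (\<chi> i j. if i = j then of_real (a i) else 0)"

definition unitary_group :: "('f::rch, 'n::finite) sqmat set"
  where "unitary_group = {X. ctrans X ** X = mat 1}"

definition unitary_group0 :: "('f::rch, 'n::finite) sqmat set"
  where "unitary_group0 = connected_component_set unitary_group (mat 1)"

definition normalized_haar :: "('f::rch, 'n::finite) sqmat set \<Rightarrow> ('f, 'n) sqmat measure \<Rightarrow> bool"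
  where "normalized_haar S \<mu> \<longleftrightarrow> prob_space \<mu> \<and> space \<mu> = S \<and> sets \<mu> = sets (restrict_space borel S) \<and>
    (\<forall>g\<in>S. \<forall>A\<in>sets \<mu>. emeasure \<mu> ((**) g ` A) = emeasure \<mu> A)"


section \<open>Coordinates\<close>

text \<open>Index sets \<open>{1..q}\<close> are finite linearly ordered types: \<open>pos i\<close> is the (1-based) position of
  the index \<open>i\<close>, and \<open>coord v r\<close> the \<open>r\<close>-th coordinate of \<open>v\<close>.\<close>

definition pos :: "'q::{finite,linorder} \<Rightarrow> nat"
  where "pos i = card {j. j \<le> i}"

definition coord :: "('a, 'q::{finite,linorder}) vec \<Rightarrow> nat \<Rightarrow> 'a"
  where "coord v r = v $ (THE i. pos i = r)"

text \<open>Upper left \<open>r \<times> r\<close> minor. As matrix sizes are types, the block is completed by an identity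
  block, which does not change the determinant. For Hermitian \<open>x\<close> the minor is real.\<close>

definition Delta :: "nat \<Rightarrow> ('f::rch, 'q::{finite,linorder}) sqmat \<Rightarrow> real"
  where "Delta r x = Re (fdet (\<chi> i j. if pos i \<le> r \<and> pos j \<le> r then x$i$j
                                        else if i = j then 1 else 0))"

definition Delta_power :: "(complex, 'q) vec \<Rightarrow> ('f::rch, 'q::{finite,linorder}) sqmat \<Rightarrow> complex"
  where "Delta_power \<mu> x =
    (\<Prod>r = 1..<CARD('q). complex_of_real (Delta r x) powr (coord \<mu> r - coord \<mu> (r + 1))) *
    complex_of_real (Delta CARD('q) x) powr coord \<mu> CARD('q)"


section \<open>The group\<close>

text \<open>Coordinates of $F^{q+p}$ are split as \<open>'q + 'q + 's\<close> with \<open>CARD('q) = q\<close> and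
  \<open>CARD('s) = p - q\<close>, so that the \<open>Inl\<close>-part has size $q$ and the \<open>Inr\<close>-part has size $p$.\<close>

definition Jform :: "('f::rch, 'q::finite, 's::finite) bigmat"
  where "Jform = (\<chi> a b. if a = b then (case a of Inl _ \<Rightarrow> 1 | Inr _ \<Rightarrow> -1) else 0)"

definition G_group :: "('f::rch, 'q::finite, 's::finite) bigmat set"
  where "G_group =
    connected_component_set {X. ctrans X ** Jform ** X = Jform \<and> fdet X = 1} (mat 1)"

definition K_group :: "('f::rch, 'q::finite, 's::finite) bigmat set"
  where "K_group = {X \<in> G_group. \<forall>i j. X $ Inl i $ Inr j = 0 \<and> X $ Inr j $ Inl i = 0}"

definition Hmat :: "(real, 'q) vec \<Rightarrow> ('f::rch, 'q::finite, 's::finite) bigmat"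
  where "Hmat t = (\<chi> a b. case (a, b) of
      (Inl i, Inr (Inl j)) \<Rightarrow> (if i = j then of_real (t$i) else 0)
    | (Inr (Inl i), Inl j) \<Rightarrow> (if i = j then of_real (t$i) else 0)
    | _ \<Rightarrow> 0)"

definition a_elt :: "(real, 'q) vec \<Rightarrow> ('f::rch, 'q::finite, 's::finite) bigmat"
  where "a_elt t = mexp (Hmat t)"

definition lie_algebra :: "('f::rch, 'n::finite) sqmat set \<Rightarrow> ('f, 'n) sqmat set"
  where "lie_algebra S = {X. \<forall>s::real. mexp (s *\<^sub>R X) \<in> S}"

text \<open>Linear functionals on \<open>\<aa>\<close> are written as functions of \<open>t\<close>, where \<open>\<aa> = range Hmat\<close>.
  The functionals \<open>2 f\<^sub>i\<close> are roots only for $d > 1$; for $d = 1$ their root space is zero.\<close>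

definition positive_roots :: "((real, 'q::{finite,linorder}) vec \<Rightarrow> real) set"
  where "positive_roots =
    (\<Union>i. {\<lambda>t. t$i, \<lambda>t. 2 * t$i}) \<union> (\<Union>(i, j)\<in>{(i, j). i < j}. {\<lambda>t. t$i + t$j, \<lambda>t. t$i - t$j})"

definition root_space ::
  "((real, 'q) vec \<Rightarrow> real) \<Rightarrow> ('f::rch, 'q::finite, 's::finite) bigmat set"
  where "root_space \<alpha> =
    {X \<in> lie_algebra G_group. \<forall>t. Hmat t ** X - X ** Hmat t = \<alpha> t *\<^sub>R X}"

definition N_group :: "('f::rch, 'q::{finite,linorder}, 's::finite) bigmat set"
  where "N_group = mexp ` span (\<Union>\<alpha>\<in>positive_roots. root_space \<alpha>)"

text \<open>The Iwasawa projection $H(g)$, given by the \<open>t\<close> with $H(g) = H_t$.\<close>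

definition iwasawa_H ::
  "('f::rch, 'q::{finite,linorder}, 's::finite) bigmat \<Rightarrow> (real, 'q) vec"
  where "iwasawa_H g = (THE t. \<exists>k\<in>K_group. \<exists>n\<in>N_group. g = k ** a_elt t ** n)"

text \<open>\<open>rho_BC d p\<close> is $\rho^{BC}$, with $q$ given by the type.\<close>

definition rho_BC :: "nat \<Rightarrow> nat \<Rightarrow> (complex, 'q::{finite,linorder}) vec"
  where "rho_BC d p =
    (\<chi> i. of_real (real d / 2 * (real p + real CARD('q) + 2 - 2 * real (pos i)) - 1))"

text \<open>Spherical function $\varphi_\lambda^p$ at \<open>g\<close>; \<open>\<mu>\<close> is to be the normalized Haar measure of K.\<close>

definition spherical_function ::
  "('f::rch, 'q::{finite,linorder}, 's::finite) bigmat measure \<Rightarrow> (complex, 'q) vec \<Rightarrow>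
    ('f, 'q, 's) bigmat \<Rightarrow> complex"
  where "spherical_function \<mu> l g =
    (\<integral>k. exp (\<Sum>r\<in>UNIV. (\<i> *s l - rho_BC DIM('f) CARD('q + 's)) $ r * of_real (iwasawa_H (g ** k) $ r)) \<partial>\<mu>)"


section \<open>The ball and its measures\<close>

definition B_ball :: "('f::rch, 'q::finite) sqmat set"
  where "B_ball = {w. pos_def (mat 1 - ctrans w ** w)}"

text \<open>Unnormalized density; the determinant is \<open>Delta CARD('q)\<close>.\<close>

definition m_weight :: "nat \<Rightarrow> ('f::rch, 'q::{finite,linorder}) sqmat \<Rightarrow> real"
  where "m_weight p w =
    (let d = real DIM('f); \<gamma> = d * (real CARD('q) - 1 / 2) + 1
     in Delta CARD('q) (mat 1 - ctrans w ** w) powr (real p * d / 2 - \<gamma>))"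

definition m_kappa :: "('f::rch, 'q::{finite,linorder}) sqmat itself \<Rightarrow> nat \<Rightarrow> real"
  where "m_kappa _ p = (\<integral>w. m_weight p w \<partial>(restrict_space lborel (B_ball :: ('f, 'q) sqmat set)))"

definition m_measure :: "nat \<Rightarrow> ('f::rch, 'q::{finite,linorder}) sqmat measure"
  where "m_measure p = density (restrict_space lborel B_ball)
    (\<lambda>w. ennreal (m_weight p w / m_kappa TYPE(('f, 'q) sqmat) p))"

definition cosh_sinh :: "(real, 'q) vec \<Rightarrow> ('f::rch, 'q::finite) sqmat \<Rightarrow> ('f, 'q) sqmat"
  where "cosh_sinh t w = rdiag (\<lambda>i. cosh (t$i)) + rdiag (\<lambda>i. sinh (t$i)) ** w"

definition g_mat :: "(real, 'q) vec \<Rightarrow> ('f::rch, 'q::finite) sqmat \<Rightarrow> ('f, 'q) sqmat \<Rightarrow> ('f, 'q) sqmat"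
  where "g_mat t u w = matrix_inv u ** ctrans (cosh_sinh t w) ** cosh_sinh t w ** u"

definition g_tilde :: "(real, 'q) vec \<Rightarrow> ('f::rch, 'q::finite) sqmat \<Rightarrow> ('f, 'q) sqmat \<Rightarrow> ('f, 'q) sqmat"
  where "g_tilde t u w = matrix_inv u ** cosh_sinh t w ** ctrans (cosh_sinh t w) ** u"

end

theory Submission
  imports Defs
begin

text \<open>The integrand of the spherical function at $a_t k$ depends on $k$ only through two blocks. Let $u$
  be the upper left $q \times q$ block of $k \in K$ and $x$ the upper left $q \times q$ block of its
  lower right $p \times p$ block. The vectors $e_j + e_{q+j}$ span a subspace on which $N$ acts by
  unipotent upper triangular matrices and $a_t$ by the $e^{t_j}$, while $K$ acts on the first $q$ coordinates
  by unitary matrices: if $g = k' a_s n$ and $M$ is formed by the first $q$ coordinates of the $g(e_j + e_{q+j})$, then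
  $M = u' e^{s} T$ with unitary $u'$ and unipotent upper triangular $T$. Hence the minors of $M^* M$ are
  $\Delta_r(M^* M) = e^{2(s_1 + \dots + s_r)}$, and the exponential in the spherical function is
  the power function of $M^* M$ (\<open>iwasawa_Delta\<close>). For $g = a_t k$ one has
  $M = \cosh(t) u + \sinh(t) x = (\cosh(t) + \sinh(t) w) u$ with $w = x u^{-1}$, whose Gram matrix is $g_t(u, w)$.

  It remains to show that $(u, w)$ is distributed according to $du \otimes dm_p$ (\<open>law_of_blocks\<close>). For this
  $k$ is compared with a Lebesgue distributed $p \times q$ matrix $Z$. If $Z = V T$ with
  orthonormal columns $V$ and $T^2 = Z^* Z$, then $V$ is the image of the standard columns
  under an element of $K$ with trivial first block, so right invariance identifies the upper block of $k Z$ with $x T$,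
  jointly with $u$ (\<open>haar_act_gram\<close>). On the other hand $kZ$ is again Lebesgue distributed, and for
  $Z = (Z_1, Z_2)$ the Wishart integral turns $Z_2$ into the density $\det(A - Z_1^* Z_1)^{n/2 \cdot d - \kappa}$
  of $A = Z^* Z$; the substitution $Z_1 = w A^{1/2}$ gives the density of $m_p$
  (\<open>gram_window\<close>). Restricting to $Z^* Z$ near the identity makes $T$ almost the identity, which yields an inequality
  between the mass of a set for one law and the mass of its neighbourhood for the other; this already forces
  the laws to agree (\<open>block_inequality\<close>, \<open>prob_measure_eqI_neighbourhoods\<close>).
  The Wishart integral itself follows from the uniqueness of relatively invariant measures on
  positive definite matrices (\<open>relatively_invariant_proportional\<close>).

  Finally $M M^* = v M^* M v^*$ for a $v$ in the identity component of the unitary group (\<open>cosh_sinh_swap\<close>),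
  so for fixed $w$ the two versions of $g_t$ have the same integral over $u$.\<close>

section \<open>The division algebras\<close>

lemma quat_sel [simp]:
  "qfst 0 = 0" "qsnd 0 = 0" "qfst 1 = 1" "qsnd 1 = 0"
  "qfst (x + y) = qfst x + qfst y" "qsnd (x + y) = qsnd x + qsnd y"
  "qfst (x - y) = qfst x - qfst y" "qsnd (x - y) = qsnd x - qsnd y"
  "qfst (- x) = - qfst x" "qsnd (- x) = - qsnd x"
  "qfst (r *\<^sub>R x) = r *\<^sub>R qfst x" "qsnd (r *\<^sub>R x) = r *\<^sub>R qsnd x"
  "qfst (x * y) = qfst x * qfst y - qsnd x * cnj (qsnd y)"
  "qsnd (x * y) = qfst x * qsnd y + qsnd x * cnj (qfst y)"
  "qfst (qcnj x) = cnj (qfst x)" "qsnd (qcnj x) = - qsnd x"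
  by (simp_all add: quat_linear_defs one_quat_def times_quat_def qcnj_def)

lemma qcnj_mult: "qcnj (x * y) = qcnj y * qcnj x"
  by (simp add: quat_eq_iff algebra_simps)

lemma qcnj_qcnj: "qcnj (qcnj x) = x"
  by (simp add: quat_eq_iff)

lemma inner_quat_mult_left: "(a * b :: quat) \<bullet> c = b \<bullet> (qcnj a * c)"
  by (simp add: inner_quat_def inner_complex_def algebra_simps)

lemma inner_quat_mult_right: "(a * b :: quat) \<bullet> c = a \<bullet> (c * qcnj b)"
  by (simp add: inner_quat_def inner_complex_def algebra_simps)

lemma linear_to_quat: "linear (to_quat :: 'f::rch \<Rightarrow> quat)"
  by (rule linearI) (auto simp: to_quat_add to_quat_scaleR)

lemmas to_quat_0 [simp] = linear_0[OF linear_to_quat]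
  and to_quat_minus = linear_neg[OF linear_to_quat]
  and to_quat_diff = linear_diff[OF linear_to_quat]
  and to_quat_sum = linear_sum[OF linear_to_quat]

lemma to_quat_eq_iff: "to_quat x = to_quat y \<longleftrightarrow> x = (y :: 'f::rch)"
proof
  assume "to_quat x = to_quat y"
  hence "to_quat (x - y) = 0" by (simp add: to_quat_diff)
  hence "(x - y) \<bullet> (x - y) = 0" using to_quat_inner[of "x - y" "x - y"] by simp
  thus "x = y" by simp
qed simp

lemmas to_quat_simps = to_quat_add to_quat_scaleR to_quat_mult to_quat_one to_quat_star
  to_quat_minus to_quat_diff

lemma star_add: "star (x + y) = star x + star (y :: 'f::rch)"
  by (subst to_quat_eq_iff[symmetric]) (simp add: to_quat_simps quat_eq_iff)

lemma star_scaleR: "star (r *\<^sub>R x) = r *\<^sub>R star (x :: 'f::rch)"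
  by (subst to_quat_eq_iff[symmetric]) (simp add: to_quat_simps quat_eq_iff)

lemma star_mult: "star (x * y) = star y * star (x :: 'f::rch)"
  by (subst to_quat_eq_iff[symmetric]) (simp add: to_quat_simps qcnj_mult)

lemma star_star [simp]: "star (star x) = (x :: 'f::rch)"
  by (subst to_quat_eq_iff[symmetric]) (simp add: to_quat_simps qcnj_qcnj)

lemma star_1 [simp]: "star 1 = (1 :: 'f::rch)"
  by (subst to_quat_eq_iff[symmetric]) (simp add: to_quat_simps quat_eq_iff)

lemma linear_star: "linear (star :: 'f::rch \<Rightarrow> 'f)"
  by (rule linearI) (auto simp: star_add star_scaleR)

lemmas star_0 [simp] = linear_0[OF linear_star]
  and star_minus = linear_neg[OF linear_star]
  and star_diff = linear_diff[OF linear_star]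
  and star_sum = linear_sum[OF linear_star]

lemma star_of_real [simp]: "star (of_real r :: 'f::rch) = of_real r"
  by (simp add: of_real_def star_scaleR)

lemma inner_mult_left_star: "(a * b) \<bullet> c = b \<bullet> (star a * (c :: 'f::rch))"
  by (simp add: to_quat_inner[of "a * b" c, symmetric] to_quat_inner[of b "star a * c", symmetric]
      to_quat_simps inner_quat_mult_left)

lemma inner_star_star: "star a \<bullet> star b = a \<bullet> (b :: 'f::rch)"
  by (simp add: to_quat_inner[of "star a" "star b", symmetric] to_quat_inner[of a b, symmetric]
      to_quat_simps inner_quat_def inner_complex_def)

lemma norm_star [simp]: "norm (star a) = norm (a :: 'f::rch)"
  by (simp add: norm_eq_sqrt_inner inner_star_star)

lemma star_fixed: "star x = x \<Longrightarrow> x = of_real (x \<bullet> (1 :: 'f::rch))"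
proof -
  assume "star x = x"
  hence "qcnj (to_quat x) = to_quat x" by (metis to_quat_star)
  hence "Im (qfst (to_quat x)) = 0" and "qsnd (to_quat x) = 0"
    by (auto simp: quat_eq_iff qcnj_def complex_eq_iff)
  moreover have "x \<bullet> 1 = Re (qfst (to_quat x))"
    by (simp add: to_quat_inner[of x 1, symmetric] to_quat_simps inner_quat_def inner_complex_def)
  ultimately show ?thesis
    unfolding of_real_def
    by (subst to_quat_eq_iff[symmetric]) (simp add: to_quat_simps quat_eq_iff complex_eq_iff)
qed

lemma star_mult_self: "star x * x = of_real ((norm (x :: 'f::rch))\<^sup>2)"
proof -
  have "star (star x * x) = star x * x" by (simp add: star_mult)
  from star_fixed[OF this] have "star x * x = of_real ((star x * x) \<bullet> 1)" .
  also have "(star x * x) \<bullet> 1 = x \<bullet> x" by (simp add: inner_mult_left_star)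
  finally show ?thesis by (simp add: power2_norm_eq_inner)
qed

lemma mult_star_self: "x * star x = of_real ((norm (x :: 'f::rch))\<^sup>2)"
  using star_mult_self[of "star x"] by simp

lemma of_real_mult_comm: "of_real r * x = x * (of_real r :: 'f::rch)"
  by (simp add: of_real_def)

lemma DIM1_real: "DIM('f::rch) = 1 \<Longrightarrow> x = of_real (x \<bullet> (1::'f))"
proof -
  assume "DIM('f) = 1"
  then obtain b where b: "(Basis :: 'f set) = {b}" by (metis card_1_singletonE)
  have 1: "x = (x \<bullet> b) *\<^sub>R b" for x :: 'f
    using euclidean_representation[of x] unfolding b by simp
  have "1 = ((1::'f) \<bullet> b) *\<^sub>R b" by (rule 1)
  moreover have "b \<bullet> b = 1" using b inner_same_Basis[of b] by blast
  ultimately have "(1 \<bullet> b) * (1 \<bullet> b) = (1::'f) \<bullet> 1" by (metis inner_commute inner_scaleR_left)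
  hence one: "(1 \<bullet> b) * (1 \<bullet> b) = 1" by (simp add: dot_square_norm)
  have "x = (x \<bullet> b) *\<^sub>R b" by (rule 1)
  also have "\<dots> = ((x \<bullet> b) * (1 \<bullet> b)) *\<^sub>R ((1 \<bullet> b) *\<^sub>R b)" using one by (simp add: mult.assoc)
  also have "\<dots> = ((x \<bullet> b) * (1 \<bullet> b)) *\<^sub>R 1" using \<open>1 = ((1::'f) \<bullet> b) *\<^sub>R b\<close> by simp
  also have "(x \<bullet> b) * (1 \<bullet> b) = x \<bullet> 1"
    using \<open>1 = ((1::'f) \<bullet> b) *\<^sub>R b\<close> by (metis inner_scaleR_right mult.commute)
  finally show ?thesis by (simp add: of_real_def)
qed

lemma DIM_not_4_qsnd: "DIM('f::rch) \<noteq> 4 \<Longrightarrow> qsnd (to_quat (x::'f)) = 0"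
proof -
  assume d: "DIM('f) \<noteq> 4"
  have "range (to_quat :: 'f \<Rightarrow> quat) \<noteq> UNIV"
  proof
    assume s: "range (to_quat :: 'f \<Rightarrow> quat) = UNIV"
    have i: "inj (to_quat :: 'f \<Rightarrow> quat)" by (auto simp: inj_def to_quat_eq_iff)
    have "dim (range (to_quat :: 'f \<Rightarrow> quat)) = dim (UNIV :: 'f set)"
      by (rule dim_image_eq) (use i linear_to_quat in auto)
    thus False using d s DIM_quat by (simp)
  qed
  hence "range (to_quat :: 'f \<Rightarrow> quat) \<in> {range (\<lambda>r. Quat (complex_of_real r) 0), range (\<lambda>z. Quat z 0)}"
    using range_to_quat by auto
  hence "to_quat x \<in> range (\<lambda>r. Quat (complex_of_real r) 0) \<union> range (\<lambda>z. Quat z 0)" by blast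
  thus ?thesis by auto
qed

section \<open>Matrices over the division algebras\<close>

lemma matrix_nth: "(A ** B) $ i $ j = (\<Sum>k\<in>UNIV. A $ i $ k * B $ k $ j)"
  by (simp add: matrix_matrix_mult_def)

lemma matrix_vec_nth: "(A *v x) $ i = (\<Sum>k\<in>UNIV. A $ i $ k * x $ k)"
  by (simp add: matrix_vector_mult_def)

lemma ctrans_nth [simp]: "ctrans X $ i $ j = star (X $ j $ i)"
  by (simp add: ctrans_def)

lemma mat_nth: "mat c $ i $ j = (if i = j then c else 0)"
  by (simp add: mat_def)

lemma rdiag_nth: "rdiag a $ i $ j = (if i = j then of_real (a i) else 0)"
  by (simp add: rdiag_def)

lemma ctrans_mult: "ctrans (X ** Y) = ctrans Y ** ctrans (X :: ('f::rch, 'n::finite) vec^'m)"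
  by (simp add: vec_eq_iff matrix_nth star_sum star_mult)

lemma ctrans_ctrans [simp]: "ctrans (ctrans X) = X"
  by (simp add: vec_eq_iff)

lemma ctrans_mat1 [simp]: "ctrans (mat 1) = mat 1"
  by (auto simp: vec_eq_iff mat_nth)

lemma ctrans_rdiag [simp]: "ctrans (rdiag a) = rdiag a"
  by (auto simp: vec_eq_iff rdiag_nth)

lemma linear_ctrans: "linear (ctrans :: 'f::rch^'n::finite^'m::finite \<Rightarrow> _)"
  by (rule linearI) (auto simp: vec_eq_iff star_add star_scaleR)

lemmas ctrans_add = linear_add[OF linear_ctrans]
  and ctrans_scaleR = linear_cmul[OF linear_ctrans]
  and ctrans_diff = linear_diff[OF linear_ctrans]
  and ctrans_minus = linear_neg[OF linear_ctrans]
  and ctrans_0 [simp] = linear_0[OF linear_ctrans]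
  and ctrans_sum = linear_sum[OF linear_ctrans]

lemma matrix_add_rdistrib: "(B + C) ** A = B ** A + (C :: 'a::ring_1^'n^'m) ** A"
  by (simp add: vec_eq_iff matrix_nth algebra_simps sum.distrib)

lemma matrix_diff_ldistrib: "A ** (B - C) = A ** B - A ** (C :: 'a::ring_1^'n^'m)"
  by (simp add: vec_eq_iff matrix_nth algebra_simps sum_subtractf)

lemma matrix_diff_rdistrib: "(B - C) ** A = B ** A - (C :: 'a::ring_1^'n^'m) ** A"
  by (simp add: vec_eq_iff matrix_nth algebra_simps sum_subtractf)

lemma matrix_scaleR_left: "(r *\<^sub>R A) ** B = r *\<^sub>R (A ** (B :: 'a::real_algebra_1^'n^'m))"
  by (simp add: vec_eq_iff matrix_nth scaleR_sum_right)

lemma matrix_scaleR_right: "A ** (r *\<^sub>R B) = r *\<^sub>R (A ** (B :: 'a::real_algebra_1^'n^'m))"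
  by (simp add: vec_eq_iff matrix_nth scaleR_sum_right)

lemma bilinear_matrix_mult:
  "bilinear ((**) :: 'f::rch^'n::finite^'m::finite \<Rightarrow> 'f^'k::finite^'n \<Rightarrow> _)"
  unfolding bilinear_def
  by (intro conjI allI linearI)
     (simp_all add: matrix_add_ldistrib matrix_add_rdistrib matrix_scaleR_left matrix_scaleR_right)

lemma bounded_bilinear_matrix_mult:
  "bounded_bilinear ((**) :: 'f::rch^'n::finite^'m::finite \<Rightarrow> 'f^'k::finite^'n \<Rightarrow> _)"
  using bilinear_matrix_mult bilinear_conv_bounded_bilinear by blast

lemma linear_matrix_vec: "linear ((*v) (X :: 'f::rch^'n::finite^'m::finite))"
  by (rule linearI)
     (simp_all add: vec_eq_iff matrix_vec_nth sum.distrib algebra_simps scaleR_sum_right)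

lemma bilinear_matrix_vec:
  "bilinear ((*v) :: 'f::rch^'n::finite^'m::finite \<Rightarrow> _)"
  unfolding bilinear_def
  by (intro conjI allI linearI)
     (simp_all add: vec_eq_iff matrix_vec_nth sum.distrib algebra_simps scaleR_sum_right)

lemma bounded_bilinear_matrix_vec:
  "bounded_bilinear ((*v) :: 'f::rch^'n::finite^'m::finite \<Rightarrow> _)"
  using bilinear_matrix_vec bilinear_conv_bounded_bilinear by blast

lemma continuous_on_matrix_mult [continuous_intros]:
  fixes f :: "'a::topological_space \<Rightarrow> 'f::rch^'n::finite^'m::finite" and g :: "_ \<Rightarrow> 'f^'k::finite^'n"
  assumes "continuous_on S f" "continuous_on S g"
  shows "continuous_on S (\<lambda>x. f x ** g x)"
  using bounded_bilinear.continuous_on[OF bounded_bilinear_matrix_mult assms] .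

lemma continuous_on_matrix_vec [continuous_intros]:
  fixes f :: "'a::topological_space \<Rightarrow> 'f::rch^'n::finite^'m::finite" and g :: "_ \<Rightarrow> 'f^'n"
  assumes "continuous_on S f" "continuous_on S g"
  shows "continuous_on S (\<lambda>x. f x *v g x)"
  using bounded_bilinear.continuous_on[OF bounded_bilinear_matrix_vec assms] .

lemma continuous_on_ctrans [continuous_intros]:
  fixes f :: "'a::topological_space \<Rightarrow> 'f::rch^'n::finite^'m::finite"
  assumes "continuous_on S f"
  shows "continuous_on S (\<lambda>x. ctrans (f x))"
  using bounded_linear.continuous_on[OF linear_conv_bounded_linear[THEN iffD1, OF linear_ctrans] assms] .

lemma continuous_on_star [continuous_intros]:
  fixes f :: "'a::topological_space \<Rightarrow> 'f::rch"
  assumes "continuous_on S f"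
  shows "continuous_on S (\<lambda>x. star (f x))"
  using bounded_linear.continuous_on[OF linear_conv_bounded_linear[THEN iffD1, OF linear_star] assms] .

lemma continuous_on_to_quat [continuous_intros]:
  fixes f :: "'a::topological_space \<Rightarrow> 'f::rch"
  assumes "continuous_on S f"
  shows "continuous_on S (\<lambda>x. to_quat (f x))"
  using bounded_linear.continuous_on[OF linear_conv_bounded_linear[THEN iffD1, OF linear_to_quat] assms] .

lemma linear_qfst: "linear qfst" and linear_qsnd: "linear qsnd"
  by (auto intro!: linearI)

lemma continuous_on_qfst [continuous_intros]:
  "continuous_on S f \<Longrightarrow> continuous_on S (\<lambda>x. qfst (f x :: quat))"
  for f :: "'a::topological_space \<Rightarrow> quat"
  using bounded_linear.continuous_on[OF linear_conv_bounded_linear[THEN iffD1, OF linear_qfst]] by blast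

lemma continuous_on_qsnd [continuous_intros]:
  "continuous_on S f \<Longrightarrow> continuous_on S (\<lambda>x. qsnd (f x :: quat))"
  for f :: "'a::topological_space \<Rightarrow> quat"
  using bounded_linear.continuous_on[OF linear_conv_bounded_linear[THEN iffD1, OF linear_qsnd]] by blast

lemma inner_matrix_vec: "(X *v v) \<bullet> w = v \<bullet> (ctrans X *v (w :: 'f::rch^'m::finite))"
proof -
  have "(X *v v) \<bullet> w = (\<Sum>i\<in>UNIV. \<Sum>k\<in>UNIV. v $ k \<bullet> (star (X $ i $ k) * w $ i))"
    by (simp add: inner_vec_def matrix_vec_nth inner_sum_left inner_mult_left_star)
  also have "\<dots> = (\<Sum>k\<in>UNIV. \<Sum>i\<in>UNIV. v $ k \<bullet> (star (X $ i $ k) * w $ i))" by (rule sum.swap)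
  finally show ?thesis by (simp add: inner_vec_def matrix_vec_nth inner_sum_right)
qed

lemma inner_matrix_left:
  "(X ** Y) \<bullet> Z = Y \<bullet> (ctrans X ** (Z :: 'f::rch^'k::finite^'m::finite))"
proof -
  have "(X ** Y) \<bullet> Z = (\<Sum>i\<in>UNIV. \<Sum>j\<in>UNIV. \<Sum>k\<in>UNIV. Y $ k $ j \<bullet> (star (X $ i $ k) * Z $ i $ j))"
    by (simp add: inner_vec_def matrix_nth inner_sum_left inner_mult_left_star)
  also have "\<dots> = (\<Sum>i\<in>UNIV. \<Sum>k\<in>UNIV. \<Sum>j\<in>UNIV. Y $ k $ j \<bullet> (star (X $ i $ k) * Z $ i $ j))"
    by (intro sum.cong refl sum.swap)
  also have "\<dots> = (\<Sum>k\<in>UNIV. \<Sum>i\<in>UNIV. \<Sum>j\<in>UNIV. Y $ k $ j \<bullet> (star (X $ i $ k) * Z $ i $ j))"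
    by (rule sum.swap)
  also have "\<dots> = (\<Sum>k\<in>UNIV. \<Sum>j\<in>UNIV. \<Sum>i\<in>UNIV. Y $ k $ j \<bullet> (star (X $ i $ k) * Z $ i $ j))"
    by (intro sum.cong refl sum.swap)
  finally show ?thesis by (simp add: inner_vec_def matrix_nth inner_sum_right)
qed

lemma inner_ctrans: "ctrans X \<bullet> ctrans Y = X \<bullet> (Y :: 'f::rch^'k::finite^'m::finite)"
  unfolding inner_vec_def by (subst sum.swap) (simp add: inner_star_star)

lemma inner_matrix_right:
  "(X ** Y) \<bullet> Z = X \<bullet> (Z ** ctrans (Y :: 'f::rch^'k::finite^'m::finite))"
proof -
  have "(X ** Y) \<bullet> Z = (ctrans Y ** ctrans X) \<bullet> ctrans Z"
    by (metis ctrans_mult inner_ctrans)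
  also have "\<dots> = ctrans X \<bullet> (Y ** ctrans Z)" by (simp add: inner_matrix_left)
  also have "\<dots> = X \<bullet> (Z ** ctrans Y)" by (metis ctrans_mult ctrans_ctrans inner_ctrans)
  finally show ?thesis .
qed

lemma norm_ctrans [simp]: "norm (ctrans X) = norm (X :: 'f::rch^'k::finite^'m::finite)"
  by (simp add: norm_eq_sqrt_inner inner_ctrans)

lemma norm_isometry_left:
  assumes "ctrans U ** U = mat 1"
  shows "norm (U ** X) = norm (X :: 'f::rch^'k::finite^'m::finite)"
  by (simp add: norm_eq_sqrt_inner inner_matrix_left matrix_mul_assoc assms)

lemma norm_isometry_right:
  assumes "U ** ctrans U = mat 1"
  shows "norm (X ** U) = norm (X :: 'f::rch^'k::finite^'m::finite)"
  by (simp add: norm_eq_sqrt_inner inner_matrix_right matrix_mul_assoc[symmetric] assms)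

lemma norm_isometry_vec:
  assumes "ctrans U ** U = mat 1"
  shows "norm (U *v x) = norm (x :: 'f::rch^'m::finite)"
  by (simp add: norm_eq_sqrt_inner inner_matrix_vec matrix_vector_mul_assoc assms)

lemma matrix_vec_axis: "X *v axis j c = (\<chi> i. X $ i $ j * (c :: 'f::rch))"
  by (simp add: vec_eq_iff matrix_vec_nth axis_def if_distrib[where f="\<lambda>x. _ * x"] cong: if_cong)

lemma matrix_eqI_vec: "(\<And>v. X *v v = Y *v v) \<Longrightarrow> X = (Y :: 'f::rch^'n::finite^'m)"
proof -
  assume a: "\<And>v. X *v v = Y *v v"
  have "X $ i $ j = Y $ i $ j" for i j
    using a[of "axis j 1"] by (simp add: matrix_vec_axis vec_eq_iff)
  thus ?thesis by (simp add: vec_eq_iff)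
qed

text \<open>Over a noncommutative division algebra there is no adjugate matrix; instead, an injective
  real-linear endomorphism of a finite dimensional space is onto.\<close>

lemma matrix_left_inverse_imp_right:
  fixes X Y :: "('f::rch, 'n::finite) sqmat"
  assumes "X ** Y = mat 1"
  shows "Y ** X = mat 1"
proof -
  have "X *v (Y *v v) = v" for v by (simp add: matrix_vector_mul_assoc assms)
  hence "inj ((*v) Y)" by (metis injI)
  hence s: "surj ((*v) Y)" by (rule linear_inj_imp_surj[OF linear_matrix_vec])
  show ?thesis
  proof (rule matrix_eqI_vec)
    fix v
    obtain w where "v = Y *v w" using s by blast
    thus "(Y ** X) *v v = mat 1 *v v"
      by (simp add: matrix_vector_mul_assoc[symmetric] \<open>\<And>v. X *v (Y *v v) = v\<close>)
  qed
qed

lemma inj_imp_matrix_inverse: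
  fixes X :: "('f::rch, 'n::finite) sqmat"
  assumes "\<And>v. X *v v = 0 \<Longrightarrow> v = 0"
  obtains Y where "X ** Y = mat 1" "Y ** X = mat 1"
proof -
  have "inj ((*v) X)" using assms linear_injective_0[OF linear_matrix_vec] by blast
  hence s: "surj ((*v) X)" by (rule linear_inj_imp_surj[OF linear_matrix_vec])
  hence "\<forall>j. \<exists>y. X *v y = axis j 1" by (metis surj_def)
  then obtain y where y: "\<And>j. X *v y j = axis j 1" by metis
  let ?Y = "\<chi> i j. y j $ i"
  have "(X ** ?Y) $ i $ j = mat 1 $ i $ j" for i j
  proof -
    have "(X ** ?Y) $ i $ j = (X *v y j) $ i" by (simp add: matrix_nth matrix_vec_nth)
    thus ?thesis by (simp add: y axis_def mat_nth)
  qed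
  hence "X ** ?Y = mat 1" by (simp add: vec_eq_iff)
  with that matrix_left_inverse_imp_right show ?thesis by blast
qed

lemma unitary_groupD:
  assumes "U \<in> unitary_group"
  shows "ctrans U ** U = mat 1" "U ** ctrans U = mat 1"
  using assms matrix_left_inverse_imp_right[of "ctrans U" U] by (auto simp: unitary_group_def)

lemma unitary_group_mult: "U \<in> unitary_group \<Longrightarrow> V \<in> unitary_group \<Longrightarrow> U ** V \<in> unitary_group"
  by (simp add: unitary_group_def ctrans_mult matrix_mul_assoc)
     (metis matrix_mul_assoc matrix_mul_rid)

lemma unitary_group_ctrans: "U \<in> unitary_group \<Longrightarrow> ctrans U \<in> unitary_group"
  using unitary_groupD(2) by (auto simp: unitary_group_def)

lemma unitary_group_1 [simp]: "mat 1 \<in> unitary_group"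
  by (simp add: unitary_group_def)

lemma matrix_inv_unitary: "U \<in> unitary_group \<Longrightarrow> matrix_inv U = ctrans U"
  unfolding matrix_inv_def
  by (rule some_equality) (auto simp: unitary_groupD,
      metis matrix_mul_assoc matrix_mul_lid matrix_mul_rid unitary_groupD(1))

lemma rdiag_mult: "rdiag a ** rdiag b = (rdiag (\<lambda>i. a i * b i) :: ('f::rch,'n::finite) sqmat)"
  by (auto simp: vec_eq_iff matrix_nth rdiag_nth if_distrib[where f="\<lambda>x. x * _"] 
      if_distrib[where f="\<lambda>x. _ * x"] cong: if_cong)

lemma rdiag_1: "rdiag (\<lambda>_. 1) = mat 1"
  by (auto simp: vec_eq_iff rdiag_nth mat_nth)

lemma rdiag_mult_nth:
  "(rdiag a ** X) $ i $ j = a i *\<^sub>R X $ i $ (j::'m::finite)"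
  "(X' ** rdiag a) $ k $ i = a i *\<^sub>R X' $ k $ (i::'n::finite)" for X :: "'f::rch^'m^'n"
proof -
  have "(rdiag a ** X) $ i $ j = (\<Sum>k\<in>UNIV. if k = i then of_real (a i) * X $ i $ j else 0)"
    unfolding matrix_nth by (rule sum.cong) (auto simp: rdiag_nth)
  thus "(rdiag a ** X) $ i $ j = a i *\<^sub>R X $ i $ j" by (simp add: of_real_def)
  have "(X' ** rdiag a) $ k $ i = (\<Sum>l\<in>UNIV. if l = i then X' $ k $ i * of_real (a i) else 0)"
    unfolding matrix_nth by (rule sum.cong) (auto simp: rdiag_nth)
  thus "(X' ** rdiag a) $ k $ i = a i *\<^sub>R X' $ k $ i" by (simp add: of_real_def)
qed

section \<open>Determinants\<close>

text \<open>The complex determinant underlying \<open>fdet\<close>. It is multiplicative, whereas \<open>fdet\<close> involves the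
  branch of the square root.\<close>

definition cdet :: "('f::rch, 'n::finite) sqmat \<Rightarrow> complex"
  where "cdet X = (if DIM('f) = 4 then det (cmat X) else det (\<chi> i j. qfst (to_quat (X$i$j))))"

lemma fdet_cdet: "fdet (X :: ('f::rch, 'n::finite) sqmat) = (if DIM('f) = 4 then csqrt (cdet X) else cdet X)"
  by (simp add: fdet_def cdet_def)

lemma sum_UNIV_Plus: "(\<Sum>k\<in>(UNIV :: ('a::finite + 'b::finite) set). f k) = (\<Sum>k\<in>UNIV. f (Inl k)) + (\<Sum>k\<in>UNIV. f (Inr k))"
  using sum.Plus[of UNIV UNIV f] by simp

lemma prod_UNIV_Plus: "(\<Prod>k\<in>(UNIV :: ('a::finite + 'b::finite) set). f k) = (\<Prod>k\<in>UNIV. f (Inl k)) * (\<Prod>k\<in>UNIV. f (Inr k))"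
  using prod.Plus[of UNIV UNIV f] by simp

lemma qfst_sum: "qfst (sum f S) = (\<Sum>i\<in>S. qfst (f i))"
  and qsnd_sum: "qsnd (sum f S) = (\<Sum>i\<in>S. qsnd (f i))"
  using linear_sum[OF linear_qfst] linear_sum[OF linear_qsnd] by auto

lemma cmat_mult: "cmat (X ** Y) = cmat X ** cmat (Y :: ('f::rch, 'n::finite) sqmat)"
proof -
  have "cmat (X ** Y) $ a $ b = (cmat X ** cmat Y) $ a $ b" for a b
    by (cases a; cases b)
       (simp_all add: cmat_def matrix_nth sum_UNIV_Plus to_quat_sum to_quat_mult qfst_sum qsnd_sum
         sum_subtractf sum.distrib sum_negf cnj_sum algebra_simps)
  thus ?thesis by (simp add: vec_eq_iff)
qed

lemma cmat_mat1: "cmat (mat 1 :: ('f::rch, 'n::finite) sqmat) = mat 1"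
proof -
  have "cmat (mat 1 :: ('f::rch, 'n::finite) sqmat) $ a $ b = mat 1 $ a $ b" for a b
    by (cases a; cases b) (auto simp: cmat_def mat_nth to_quat_one)
  thus ?thesis by (simp add: vec_eq_iff)
qed

lemma cdet_mult: "cdet (X ** Y) = cdet X * cdet (Y :: ('f::rch, 'n::finite) sqmat)"
proof (cases "DIM('f) = 4")
  case True
  thus ?thesis by (simp add: cdet_def cmat_mult det_mul)
next
  case False
  have "(\<chi> i j. qfst (to_quat ((X ** Y)$i$j))) = (\<chi> i j. qfst (to_quat (X$i$j))) ** (\<chi> i j. qfst (to_quat (Y$i$j)))"
    using DIM_not_4_qsnd[OF False]
    by (simp add: vec_eq_iff matrix_nth to_quat_sum to_quat_mult qfst_sum)
  thus ?thesis using False by (simp add: cdet_def det_mul)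
qed

lemma cdet_1 [simp]: "cdet (mat 1 :: ('f::rch, 'n::finite) sqmat) = 1"
proof (cases "DIM('f) = 4")
  case True
  thus ?thesis by (simp add: cdet_def cmat_mat1)
next
  case False
  have "(\<chi> i j. qfst (to_quat ((mat 1 :: ('f, 'n) sqmat)$i$j))) = mat 1"
    by (auto simp: vec_eq_iff mat_nth to_quat_one)
  thus ?thesis using False by (simp add: cdet_def)
qed

lemma det_cnj: "det (\<chi> i j. cnj (A $ i $ j)) = cnj (det (A :: complex^'n::finite^'n))"
  by (simp add: det_def cnj_sum)

lemma cdet_ctrans: "cdet (ctrans X) = cnj (cdet (X :: ('f::rch, 'n::finite) sqmat))"
proof (cases "DIM('f) = 4")
  case True
  have "cmat (ctrans X) $ a $ b = cnj (transpose (cmat X) $ a $ b)" for a b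
    by (cases a; cases b) (simp_all add: cmat_def transpose_def to_quat_star)
  hence "cmat (ctrans X) = (\<chi> i j. cnj (transpose (cmat X) $ i $ j))"
    by (simp add: vec_eq_iff)
  thus ?thesis using True by (simp add: cdet_def det_cnj)
next
  case False
  have "(\<chi> i j. qfst (to_quat (ctrans X$i$j))) = (\<chi> i j. cnj (transpose (\<chi> i j. qfst (to_quat (X$i$j))) $ i $ j))"
    by (simp add: vec_eq_iff to_quat_star transpose_def)
  thus ?thesis using False by (simp add: cdet_def det_cnj)
qed

lemma cdet_diag:
  fixes X :: "('f::rch, 'n::finite) sqmat"
  assumes "\<And>i j. i \<noteq> j \<Longrightarrow> X $ i $ j = 0" "\<And>i. qsnd (to_quat (X $ i $ i)) = 0"
  shows "cdet X = (if DIM('f) = 4 then (\<Prod>i\<in>UNIV. of_real ((cmod (qfst (to_quat (X $ i $ i))))\<^sup>2))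
    else \<Prod>i\<in>UNIV. qfst (to_quat (X $ i $ i)))"
proof (cases "DIM('f) = 4")
  case True
  have "qsnd (to_quat (X $ i $ j)) = 0" for i j
    by (cases "i = j") (simp_all add: assms)
  hence "cmat X $ a $ b = 0" if "a \<noteq> b" for a b
    using that by (cases a; cases b) (auto simp: cmat_def assms(1))
  hence "det (cmat X) = (\<Prod>a\<in>UNIV. cmat X $ a $ a)" by (rule det_diagonal)
  also have "\<dots> = (\<Prod>i\<in>UNIV. qfst (to_quat (X$i$i))) * (\<Prod>i\<in>UNIV. cnj (qfst (to_quat (X$i$i))))"
    by (simp add: prod_UNIV_Plus cmat_def)
  also have "\<dots> = (\<Prod>i\<in>UNIV. of_real ((cmod (qfst (to_quat (X $ i $ i))))\<^sup>2))"
    by (simp add: prod.distrib[symmetric] complex_norm_square del: of_real_power)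
  finally show ?thesis using True by (simp add: cdet_def)
next
  case False
  thus ?thesis using assms by (simp add: cdet_def det_diagonal)
qed

lemma qfst_to_quat_of_real: "to_quat (of_real r :: 'f::rch) = Quat (of_real r) 0"
  by (simp add: of_real_def to_quat_scaleR to_quat_one quat_eq_iff)

lemma cdet_rdiag: "cdet (rdiag a :: ('f::rch, 'n::finite) sqmat) = of_real ((\<Prod>i\<in>UNIV. a i) ^ (if DIM('f) = 4 then 2 else 1))"
  by (subst cdet_diag) (auto simp: rdiag_nth qfst_to_quat_of_real prod_power_distrib)

lemma continuous_on_det:
  fixes f :: "'a::topological_space \<Rightarrow> complex^'n::finite^'n"
  assumes "\<And>i j. continuous_on S (\<lambda>x. f x $ i $ j)"
  shows "continuous_on S (\<lambda>x. det (f x))"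
  unfolding det_def by (intro continuous_intros assms)

lemma continuous_on_vec_nth2:
  fixes f :: "'a::topological_space \<Rightarrow> 'f::topological_space^'n^'m"
  assumes "continuous_on S f"
  shows "continuous_on S (\<lambda>x. f x $ i $ j)"
  by (intro continuous_on_component assms)

lemma continuous_on_cdet [continuous_intros]:
  fixes f :: "'a::topological_space \<Rightarrow> ('f::rch,'n::finite) sqmat"
  assumes "continuous_on S f"
  shows "continuous_on S (\<lambda>x. cdet (f x))"
proof (cases "DIM('f) = 4")
  case True
  have "continuous_on S (\<lambda>x. cmat (f x) $ a $ b)" for a b
    unfolding cmat_def
    by (cases a; cases b) (auto intro!: continuous_intros continuous_on_vec_nth2 assms)
  thus ?thesis using True unfolding cdet_def by (auto intro!: continuous_on_det)
next
  case False
  thus ?thesis unfolding cdet_def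
    by (auto intro!: continuous_on_det continuous_intros continuous_on_vec_nth2 assms)
qed

text \<open>The absolute value of the determinant, the scalar factor by which volumes change.\<close>

definition adet :: "('f::rch, 'n::finite) sqmat \<Rightarrow> real"
  where "adet X = cmod (cdet X) powr (if DIM('f) = 4 then 1 / 2 else 1)"

lemma adet_mult: "adet (X ** Y) = adet X * adet Y"
  by (simp add: adet_def cdet_mult norm_mult powr_mult)

lemma adet_1 [simp]: "adet (mat 1) = 1"
  by (simp add: adet_def)

lemma adet_nonneg [simp]: "0 \<le> adet X"
  by (simp add: adet_def)

lemma adet_ctrans [simp]: "adet (ctrans X) = adet X"
  by (simp add: adet_def cdet_ctrans)

lemma adet_unitary: "U \<in> unitary_group \<Longrightarrow> adet U = 1"
proof -
  assume "U \<in> unitary_group"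
  hence "adet (ctrans U ** U) = 1" by (simp add: unitary_groupD)
  hence "adet U * adet U = 1" by (simp add: adet_mult)
  thus ?thesis using adet_nonneg[of U] by (metis abs_of_nonneg abs_square_eq_1 power2_eq_square)
qed

lemma adet_rdiag: "adet (rdiag a :: ('f::rch, 'n::finite) sqmat) = \<bar>\<Prod>i\<in>UNIV. a i\<bar>"
proof -
  have "cmod (cdet (rdiag a :: ('f::rch, 'n::finite) sqmat)) = \<bar>\<Prod>i\<in>UNIV. a i\<bar> ^ (if DIM('f) = 4 then 2 else 1)"
    by (simp add: cdet_rdiag norm_power prod_norm[symmetric] del: of_real_power of_real_prod)
  thus ?thesis by (auto simp: adet_def powr_half_sqrt)
qed

lemma continuous_on_adet [continuous_intros]:
  fixes f :: "'a::topological_space \<Rightarrow> ('f::rch,'n::finite) sqmat"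
  assumes "continuous_on S f"
  shows "continuous_on S (\<lambda>x. adet (f x))"
  unfolding adet_def by (intro continuous_intros continuous_on_powr' assms) auto

section \<open>Positive definite matrices\<close>

lemma pos_defD:
  assumes "pos_def X"
  shows "ctrans X = X" "v \<noteq> 0 \<Longrightarrow> v \<bullet> (X *v v) > 0"
  using assms by (auto simp: pos_def_def)

lemma pos_def_congruence:
  fixes A T :: "('f::rch, 'n::finite) sqmat"
  assumes "pos_def A" "\<And>v. T *v v = 0 \<Longrightarrow> v = 0"
  shows "pos_def (ctrans T ** A ** T)"
proof -
  have "v \<bullet> ((ctrans T ** A ** T) *v v) = (T *v v) \<bullet> (A *v (T *v v))" for v
    by (simp add: inner_matrix_vec matrix_vector_mul_assoc[symmetric])
  thus ?thesis using assms by (auto simp: pos_def_def ctrans_mult matrix_mul_assoc)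
qed

lemma invertible_inj:
  fixes T S :: "('f::rch, 'n::finite) sqmat"
  assumes "S ** T = mat 1" "T *v v = 0"
  shows "v = 0"
  by (metis assms linear_0 linear_matrix_vec matrix_vector_mul_assoc matrix_vector_mul_lid)

lemma pos_def_congruence_iff:
  fixes A T S :: "('f::rch, 'n::finite) sqmat"
  assumes "S ** T = mat 1"
  shows "pos_def (ctrans T ** A ** T) \<longleftrightarrow> pos_def A"
proof
  have TS: "T ** S = mat 1" by (rule matrix_left_inverse_imp_right[OF assms])
  assume "pos_def (ctrans T ** A ** T)"
  hence "pos_def (ctrans S ** (ctrans T ** A ** T) ** S)"
    by (rule pos_def_congruence) (rule invertible_inj[OF TS])
  also have "ctrans S ** (ctrans T ** A ** T) ** S = ctrans (T ** S) ** A ** (T ** S)"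
    by (simp add: ctrans_mult matrix_mul_assoc)
  finally show "pos_def A" by (simp add: TS)
qed (rule pos_def_congruence, assumption, rule invertible_inj[OF assms])

lemma pos_def_gram:
  assumes "\<And>v. T *v v = 0 \<Longrightarrow> v = (0 :: 'f::rch^'n::finite)"
  shows "pos_def (ctrans T ** (T :: 'f^'n^'m::finite))"
proof -
  have "v \<bullet> ((ctrans T ** T) *v v) = (T *v v) \<bullet> (T *v v)" for v
    by (simp add: inner_matrix_vec matrix_vector_mul_assoc[symmetric])
  thus ?thesis using assms by (auto simp: pos_def_def ctrans_mult)
qed

lemma pos_def_inverse:
  fixes A :: "('f::rch, 'n::finite) sqmat"
  assumes "pos_def A"
  obtains Y where "A ** Y = mat 1" "Y ** A = mat 1"
proof (rule inj_imp_matrix_inverse)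
  show "v = 0" if "A *v v = 0" for v
    using assms that by (metis inner_zero_right less_irrefl pos_defD(2))
qed

lemma rdiag_vec: "rdiag a *v v = (\<chi> i. a i *\<^sub>R v $ i)"
proof -
  have "(rdiag a *v v) $ i = (\<Sum>k\<in>UNIV. if k = i then of_real (a i) * v $ i else 0)" for i
    unfolding matrix_vec_nth by (rule sum.cong) (auto simp: rdiag_nth)
  thus ?thesis by (simp add: vec_eq_iff of_real_def)
qed

lemma pos_def_rdiag: "pos_def (rdiag a :: ('f::rch, 'n::finite) sqmat) \<longleftrightarrow> (\<forall>i. a i > 0)"
proof
  assume p: "pos_def (rdiag a :: ('f, 'n) sqmat)"
  show "\<forall>i. a i > 0"
  proof
    fix i
    have "(axis i 1 :: 'f^'n) \<noteq> 0" by (simp add: axis_eq_0_iff)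
    from pos_defD(2)[OF p this] show "a i > 0"
      by (simp add: rdiag_vec inner_axis' dot_square_norm)
  qed
next
  assume a: "\<forall>i. a i > 0"
  have "0 < v \<bullet> (rdiag a *v v)" if nz: "v \<noteq> 0" for v :: "'f^'n"
  proof -
    obtain i where i: "v $ i \<noteq> 0" using nz by (metis vec_eq_iff zero_index)
    have "0 < (\<Sum>i\<in>UNIV. a i * (v $ i \<bullet> v $ i))"
    proof (rule sum_pos2[where i=i])
      show "0 < a i * (v $ i \<bullet> v $ i)" using a i by simp
      show "0 \<le> a k * (v $ k \<bullet> v $ k)" for k using a by (intro mult_nonneg_nonneg) (auto simp: less_imp_le)
    qed auto
    thus ?thesis by (simp add: rdiag_vec inner_vec_def)
  qed
  thus "pos_def (rdiag a :: ('f, 'n) sqmat)" by (simp add: pos_def_def)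
qed

text \<open>The Hermitian form with values in the division algebra; its real part is the inner product.\<close>

definition hdot :: "'f::rch^'n::finite \<Rightarrow> 'f^'n \<Rightarrow> 'f"
  where "hdot x y = (\<Sum>k\<in>UNIV. star (x $ k) * y $ k)"

lemma hdot_star: "star (hdot x y) = hdot y x"
  by (simp add: hdot_def star_sum star_mult)

lemma hdot_matrix: "hdot x (A *v y) = hdot (ctrans A *v x) (y :: 'f::rch^'n::finite)"
proof -
  have "hdot x (A *v y) = (\<Sum>k\<in>UNIV. \<Sum>l\<in>UNIV. star (x $ k) * A $ k $ l * y $ l)"
    by (simp add: hdot_def matrix_vec_nth sum_distrib_left mult.assoc)
  also have "\<dots> = (\<Sum>l\<in>UNIV. \<Sum>k\<in>UNIV. star (x $ k) * A $ k $ l * y $ l)" by (rule sum.swap)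
  finally show ?thesis
    by (simp add: hdot_def matrix_vec_nth star_sum star_mult sum_distrib_right)
qed

lemma linear_hdot: "linear (hdot x)"
  by (rule linearI) (simp_all add: hdot_def sum.distrib algebra_simps scaleR_sum_right)

lemma hdot_scaleR_left: "hdot (r *\<^sub>R x) y = r *\<^sub>R hdot x y"
  by (simp add: hdot_def star_scaleR scaleR_sum_right)

lemma hdot_self: "hdot x x = of_real ((norm x)\<^sup>2)"
  by (simp add: hdot_def star_mult_self norm_vec_def L2_set_def sum_nonneg)

lemma hdot_columns: "(ctrans (\<chi> i j. x j $ i) ** (\<chi> i j. y j $ i)) $ i $ j = hdot (x i) (y j :: 'f::rch^'n::finite)"
  by (simp add: matrix_nth hdot_def)

lemma orthogonal_extension_exists:
  fixes y :: "'n::finite \<Rightarrow> 'f::rch^'n"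
  assumes "j0 \<notin> J"
  obtains v where "v \<noteq> 0" "\<And>j. j \<in> J \<Longrightarrow> hdot (y j) v = 0"
proof -
  let ?f = "\<lambda>v. (\<chi> i. if i \<in> J then hdot (y i) v else 0) :: 'f^'n"
  have lin: "linear ?f"
    by (rule linearI) (simp_all add: vec_eq_iff linear_add[OF linear_hdot] linear_cmul[OF linear_hdot])
  have "\<not> inj ?f"
  proof
    assume "inj ?f"
    hence "surj ?f" by (rule linear_inj_imp_surj[OF lin])
    then obtain v where v: "axis j0 1 = ?f v" by (rule surjE)
    have "?f v $ j0 = 1" unfolding v[symmetric] by (simp add: axis_def)
    thus False using assms by simp
  qed
  then obtain v where "?f v = 0" "v \<noteq> 0" using linear_injective_0[OF lin] by blast
  have "hdot (y j) v = 0" if "j \<in> J" for j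
  proof -
    have "?f v $ j = 0" by (simp only: \<open>?f v = 0\<close> zero_index)
    thus ?thesis using that by simp
  qed
  with \<open>v \<noteq> 0\<close> that show ?thesis by blast
qed

lemma linear_coeff_zero:
  fixes b c :: real
  assumes "\<And>s. 0 \<le> 2 * s * b + s\<^sup>2 * c"
  shows "b = 0"
proof (rule ccontr)
  assume "b \<noteq> 0"
  define e where "e = \<bar>c\<bar> + 1"
  have e: "e > 0" "c < e" by (auto simp: e_def)
  have "0 \<le> 2 * (- b / e) * b + (- b / e)\<^sup>2 * c" by (rule assms)
  also have "\<dots> \<le> 2 * (- b / e) * b + (- b / e)\<^sup>2 * e"
    using e by (intro add_left_mono mult_left_mono) auto
  also have "\<dots> = - (b\<^sup>2 / e)" using e by (simp add: field_simps power2_eq_square)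
  finally show False using \<open>b \<noteq> 0\<close> e by (simp add: divide_le_0_iff)
qed

text \<open>A maximizer of the quadratic form on the unit sphere of an invariant subspace is an eigenvector.\<close>

lemma eigenvector_in_invariant_subspace:
  fixes A :: "('f::rch, 'n::finite) sqmat"
  assumes A: "ctrans A = A" and C: "subspace C" "\<And>v. v \<in> C \<Longrightarrow> A *v v \<in> C" "w0 \<in> C" "w0 \<noteq> 0"
  obtains v a where "v \<in> C" "norm v = 1" "A *v v = a *\<^sub>R v"
proof -
  let ?q = "\<lambda>v. v \<bullet> (A *v v)"
  have "compact (C \<inter> sphere 0 1)"
    using closed_subspace[OF C(1)] compact_sphere by (rule closed_Int_compact)
  moreover have "C \<inter> sphere 0 1 \<noteq> {}"
    using C(3,4) subspace_scale[OF C(1,3), of "1 / norm w0"] by (auto intro!: exI[of _ "(1 / norm w0) *\<^sub>R w0"])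
  moreover have "continuous_on (C \<inter> sphere 0 1) ?q" by (intro continuous_intros)
  ultimately obtain v where "v \<in> C \<inter> sphere 0 1" "\<forall>x\<in>C \<inter> sphere 0 1. ?q x \<le> ?q v"
    using continuous_attains_sup[of "C \<inter> sphere 0 1" ?q] by blast
  hence v: "v \<in> C" "norm v = 1" and max: "\<And>x. x \<in> C \<Longrightarrow> norm x = 1 \<Longrightarrow> ?q x \<le> ?q v"
    by auto
  define a where "a = ?q v"
  have bound: "?q x \<le> a * (norm x)\<^sup>2" if "x \<in> C" for x
  proof (cases "x = 0")
    case False
    have "?q ((1 / norm x) *\<^sub>R x) \<le> a"
      unfolding a_def by (rule max) (use False that C(1) in \<open>auto intro: subspace_scale\<close>)
    thus ?thesis using False
      by (simp add: linear_cmul[OF linear_matrix_vec] field_simps power2_eq_square)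
  qed (simp add: linear_0[OF linear_matrix_vec])
  define w where "w = A *v v - a *\<^sub>R v"
  have w: "w \<in> C" unfolding w_def using C(1,2) v(1) by (intro subspace_diff subspace_scale) auto
  have sym: "x \<bullet> (A *v y) = y \<bullet> (A *v x)" for x y
    by (metis A inner_commute inner_matrix_vec)
  have "0 \<le> 2 * s * (a * (v \<bullet> w) - w \<bullet> (A *v v)) + s\<^sup>2 * (a * (norm w)\<^sup>2 - ?q w)" for s
  proof -
    have "?q (v + s *\<^sub>R w) \<le> a * (norm (v + s *\<^sub>R w))\<^sup>2"
      by (rule bound) (use C(1) v(1) w in \<open>auto intro: subspace_add subspace_scale\<close>)
    moreover have "?q (v + s *\<^sub>R w) = ?q v + 2 * s * (w \<bullet> (A *v v)) + s\<^sup>2 * ?q w"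
      using sym[of v w] by (simp add: linear_add[OF linear_matrix_vec] linear_cmul[OF linear_matrix_vec]
          inner_add_left inner_add_right algebra_simps power2_eq_square)
    moreover have "(norm (v + s *\<^sub>R w))\<^sup>2 = 1 + 2 * s * (v \<bullet> w) + s\<^sup>2 * (norm w)\<^sup>2"
    proof -
      have "v \<bullet> v = 1" using v(2) by (simp add: dot_square_norm)
      thus ?thesis unfolding power2_norm_eq_inner
        by (simp add: inner_add_left inner_add_right inner_commute algebra_simps power2_eq_square)
    qed
    ultimately show ?thesis unfolding a_def by (simp add: algebra_simps)
  qed
  hence "a * (v \<bullet> w) - w \<bullet> (A *v v) = 0" by (rule linear_coeff_zero)
  moreover have "w \<bullet> w = w \<bullet> (A *v v) - a * (v \<bullet> w)"
    by (subst (2) w_def) (simp only: inner_diff_right inner_scaleR_right inner_commute[of w v])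
  ultimately have "w \<bullet> w = 0" by simp
  hence "A *v v = a *\<^sub>R v" by (simp add: w_def)
  with that v show ?thesis by blast
qed

text \<open>Eigenvectors are split off one after another: the orthogonal complement of those already found
  is invariant.\<close>

lemma spectral_theorem:
  fixes A :: "('f::rch, 'n::finite) sqmat"
  assumes A: "ctrans A = A"
  obtains U a where "U \<in> unitary_group" "A = U ** rdiag a ** ctrans U"
proof -
  have "\<exists>y a. (\<forall>i\<in>J. \<forall>j\<in>J. hdot (y i) (y j) = (if i = j then 1 else 0)) \<and> (\<forall>j\<in>J. A *v y j = a j *\<^sub>R y j)"
    if "finite J" for J :: "'n set"
    using that
  proof (induction J)
    case (insert k J)
    then obtain y a where y: "\<And>i j. i \<in> J \<Longrightarrow> j \<in> J \<Longrightarrow> hdot (y i) (y j) = (if i = j then 1 else 0)"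
      and a: "\<And>j. j \<in> J \<Longrightarrow> A *v y j = a j *\<^sub>R y j" by blast
    define C where "C = {v. \<forall>j\<in>J. hdot (y j) v = 0}"
    have C: "subspace C"
      unfolding C_def subspace_def
      by (auto simp: linear_add[OF linear_hdot] linear_cmul[OF linear_hdot] linear_0[OF linear_hdot])
    have inv: "A *v v \<in> C" if "v \<in> C" for v
      using that by (auto simp: C_def hdot_matrix A a hdot_scaleR_left)
    obtain w0 where "w0 \<noteq> 0" "\<And>j. j \<in> J \<Longrightarrow> hdot (y j) w0 = 0"
      using orthogonal_extension_exists[OF insert(2), of y] by blast
    hence "w0 \<in> C" "w0 \<noteq> 0" by (simp_all add: C_def)
    from eigenvector_in_invariant_subspace[OF A C inv this] obtain v b where
      v: "v \<in> C" "norm v = 1" "A *v v = b *\<^sub>R v" by metis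
    have yv: "hdot (y j) v = 0" "hdot v (y j) = 0" if "j \<in> J" for j
    proof -
      show "hdot (y j) v = 0" using v(1) that by (simp add: C_def)
      thus "hdot v (y j) = 0" by (metis hdot_star star_0)
    qed
    have vv: "hdot v v = 1" by (simp add: hdot_self v)
    show ?case
      by (rule exI[of _ "y(k := v)"], rule exI[of _ "a(k := b)"])
         (use insert(2) y a yv v vv in auto)
  qed simp
  from this[OF finite[of UNIV]] obtain y :: "'n \<Rightarrow> 'f^'n" and a :: "'n \<Rightarrow> real" where "\<forall>i\<in>UNIV. \<forall>j\<in>UNIV. hdot (y i) (y j) = (if i = j then 1 else 0)"
    "\<forall>j\<in>UNIV. A *v y j = a j *\<^sub>R y j" by blast
  hence y: "\<And>i j. hdot (y i) (y j) = (if i = j then 1 else 0)"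
    and a: "\<And>j. A *v y j = a j *\<^sub>R y j" by blast+
  define U where "U = (\<chi> i j. y j $ i)"
  have U: "U \<in> unitary_group"
    by (simp add: unitary_group_def U_def vec_eq_iff hdot_columns y mat_nth)
  have "(A ** U) $ i $ j = (U ** rdiag a) $ i $ j" for i j
  proof -
    have "(A ** U) $ i $ j = (A *v y j) $ i" by (simp add: U_def matrix_nth matrix_vec_nth)
    thus ?thesis by (simp add: a rdiag_mult_nth U_def)
  qed
  hence "A ** U = U ** rdiag a" by (simp add: vec_eq_iff)
  hence "A ** (U ** ctrans U) = U ** rdiag a ** ctrans U" by (simp add: matrix_mul_assoc)
  with U that show ?thesis by (simp add: unitary_groupD)
qed

lemma spectral_pos_def:
  fixes A :: "('f::rch, 'n::finite) sqmat"
  assumes A: "pos_def A"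
  obtains U a where "U \<in> unitary_group" "\<And>i. a i > 0" "A = U ** rdiag a ** ctrans U"
proof -
  obtain U a where U: "U \<in> unitary_group" and eq: "A = U ** rdiag a ** ctrans U"
    using spectral_theorem pos_defD(1)[OF A] by metis
  have "pos_def (ctrans (ctrans U) ** rdiag a ** ctrans U)" using A eq by simp
  hence "pos_def (rdiag a :: ('f, 'n) sqmat)"
    using pos_def_congruence_iff[of U "ctrans U" "rdiag a"] unitary_groupD[OF U] by simp
  hence "\<And>i. a i > 0" by (simp add: pos_def_rdiag)
  with U eq that show ?thesis by blast
qed

lemma unitary_inj: "U \<in> unitary_group \<Longrightarrow> U *v v = 0 \<Longrightarrow> v = 0"
  using invertible_inj unitary_groupD(1) by metis

text \<open>The columns of \<open>U\<close> are eigenvectors of $g^* g$, with eigenvalues the squares of the \<open>s i\<close>.\<close>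

lemma singular_value_decomposition:
  fixes g :: "('f::rch, 'n::finite) sqmat"
  assumes "\<And>v. g *v v = 0 \<Longrightarrow> v = 0"
  obtains W s U where "W \<in> unitary_group" "U \<in> unitary_group" "\<And>i. s i > 0" "g = W ** rdiag s ** ctrans U"
proof -
  obtain U a where U: "U \<in> unitary_group" and a: "\<And>i. a i > 0"
    and eq: "ctrans g ** g = U ** rdiag a ** ctrans U"
    using spectral_pos_def[OF pos_def_gram[OF assms]] by metis
  let ?s = "\<lambda>i. sqrt (a i)"
  define W where "W = g ** U ** rdiag (\<lambda>i. 1 / ?s i)"
  have nz: "sqrt (a i) \<noteq> 0" for i using a[of i] by simp
  have "ctrans W ** W = rdiag (\<lambda>i. 1 / ?s i) ** (ctrans U ** (ctrans g ** g) ** U) ** rdiag (\<lambda>i. 1 / ?s i)"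
    by (simp add: W_def ctrans_mult matrix_mul_assoc)
  also have "ctrans U ** (ctrans g ** g) ** U = (ctrans U ** U) ** rdiag a ** (ctrans U ** U)"
    by (simp only: eq matrix_mul_assoc)
  also have "\<dots> = rdiag a" by (simp add: unitary_groupD[OF U])
  also have "rdiag (\<lambda>i. 1 / ?s i) ** rdiag a ** rdiag (\<lambda>i. 1 / ?s i) = (rdiag (\<lambda>i. 1 / ?s i * a i * (1 / ?s i)) :: ('f,'n) sqmat)"
    by (simp add: rdiag_mult)
  also have "(\<lambda>i. 1 / ?s i * a i * (1 / ?s i)) = (\<lambda>i. 1)"
    using a by (auto simp: fun_eq_iff field_simps less_imp_le) (metis less_irrefl)
  finally have W: "W \<in> unitary_group" by (simp add: unitary_group_def rdiag_1)
  have "W ** rdiag ?s ** ctrans U = g ** U ** (rdiag (\<lambda>i. 1 / ?s i) ** rdiag ?s) ** ctrans U"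
    by (simp add: W_def matrix_mul_assoc)
  also have "rdiag (\<lambda>i. 1 / ?s i) ** rdiag ?s = (mat 1 :: ('f,'n) sqmat)"
    using nz by (simp add: rdiag_mult rdiag_1 del: real_sqrt_eq_0_iff)
  also have "g ** U ** mat 1 ** ctrans U = g ** (U ** ctrans U)" by (simp add: matrix_mul_assoc)
  finally have "g = W ** rdiag ?s ** ctrans U" by (simp add: unitary_groupD[OF U])
  with W U a that[of W U ?s] show ?thesis by auto
qed

lemma norm_matrix_mono:
  fixes X Y :: "'f::real_normed_vector^'n^'m"
  assumes "\<And>i j. norm (X $ i $ j) \<le> norm (Y $ i $ j)"
  shows "norm X \<le> norm Y"
  unfolding norm_vec_def by (intro L2_set_mono) (auto simp: assms intro!: L2_set_mono)

text \<open>The estimate holds since $|\sqrt a - 1| \le |a - 1|$ for each eigenvalue.\<close>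

lemma pos_def_sqrt:
  fixes A :: "('f::rch, 'n::finite) sqmat"
  assumes A: "pos_def A"
  obtains T where "pos_def T" "T ** T = A" "norm (T - mat 1) \<le> norm (A - mat 1)"
proof -
  obtain U a where U: "U \<in> unitary_group" and a: "\<And>i. a i > 0" and eq: "A = U ** rdiag a ** ctrans U"
    using spectral_pos_def[OF A] by metis
  define s where "s i = sqrt (a i)" for i
  have s: "s i > 0" "s i * s i = a i" for i using a[of i] by (auto simp: s_def)
  define T where "T = U ** rdiag s ** ctrans U"
  have "pos_def (ctrans (ctrans U) ** rdiag s ** ctrans U)"
    by (rule pos_def_congruence)
       (use s U unitary_group_ctrans in \<open>auto simp: pos_def_rdiag intro: unitary_inj\<close>)
  hence T: "pos_def T" by (simp add: T_def)
  have "T ** T = U ** rdiag s ** (ctrans U ** U) ** rdiag s ** ctrans U"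
    by (simp add: T_def matrix_mul_assoc)
  also have "\<dots> = U ** (rdiag s ** rdiag s) ** ctrans U" by (simp add: unitary_groupD[OF U] matrix_mul_assoc)
  also have "\<dots> = A" by (simp add: rdiag_mult s eq)
  finally have TT: "T ** T = A" .
  have nrm: "norm (U ** rdiag b ** ctrans U - mat 1) = norm (rdiag b - mat 1 :: ('f,'n) sqmat)" for b
  proof -
    have "U ** rdiag b ** ctrans U - mat 1 = U ** (rdiag b - mat 1) ** ctrans U"
      by (simp add: matrix_diff_ldistrib matrix_diff_rdistrib unitary_groupD[OF U])
    thus ?thesis
      by (simp add: norm_isometry_right norm_isometry_left unitary_groupD[OF U])
  qed
  have "norm (rdiag s - mat 1 :: ('f,'n) sqmat) \<le> norm (rdiag a - mat 1 :: ('f,'n) sqmat)"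
  proof (rule norm_matrix_mono)
    fix i j
    have "\<bar>s i - 1\<bar> \<le> \<bar>s i - 1\<bar> * (s i + 1)" using s(1)[of i] mult_left_mono[of 1 "s i + 1" "\<bar>s i - 1\<bar>"] by simp
    also have "\<dots> = \<bar>a i - 1\<bar>"
    proof -
      have "a i - 1 = (s i - 1) * (s i + 1)" using s(2)[of i] by (simp add: algebra_simps)
      thus ?thesis using s(1)[of i] by (simp add: abs_mult)
    qed
    finally have "norm (of_real (s i) - 1 :: 'f) \<le> norm (of_real (a i) - 1 :: 'f)"
      by (metis norm_of_real of_real_1 of_real_diff)
    thus "norm ((rdiag s - mat 1 :: ('f,'n) sqmat) $ i $ j) \<le> norm ((rdiag a - mat 1 :: ('f,'n) sqmat) $ i $ j)"
      by (auto simp: rdiag_nth mat_nth)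
  qed
  hence "norm (T - mat 1) \<le> norm (A - mat 1)" by (simp add: T_def eq nrm)
  with T TT that show ?thesis by blast
qed

text \<open>By the spectral theorem the complex determinant is positive, so over the quaternions the principal
  branch of its root is the positive one.\<close>

lemma fdet_pos_def:
  fixes A :: "('f::rch, 'n::finite) sqmat"
  assumes A: "pos_def A"
  shows "fdet A = of_real (adet A)" "adet A > 0"
proof -
  obtain U a where U: "U \<in> unitary_group" and a: "\<And>i. a i > 0" and eq: "A = U ** rdiag a ** ctrans U"
    using spectral_pos_def[OF A] by metis
  have p: "(\<Prod>i\<in>UNIV. a i) > 0" by (rule prod_pos) (use a in auto)
  have "cdet A = cdet (rdiag a :: ('f, 'n) sqmat) * cdet (U ** ctrans U)"
    by (simp add: eq cdet_mult mult_ac)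
  hence "cdet A = of_real ((\<Prod>i\<in>UNIV. a i) ^ (if DIM('f) = 4 then 2 else 1))"
    by (simp add: unitary_groupD[OF U] cdet_rdiag)
  hence "fdet A = of_real (\<Prod>i\<in>UNIV. a i)"
    using p by (auto simp: fdet_cdet csqrt_square simp flip: of_real_power of_real_prod)
  moreover have "adet A = (\<Prod>i\<in>UNIV. a i)"
    using p by (simp add: eq adet_mult adet_unitary[OF U] adet_rdiag)
  ultimately show "fdet A = of_real (adet A)" "adet A > 0" using p by auto
qed

lemma closed_hermitian: "closed {X :: ('f::rch, 'n::finite) sqmat. ctrans X = X}"
  by (intro closed_Collect_eq continuous_intros)

text \<open>By compactness of the sphere the positive definite matrices are a countable union of closed sets.\<close>

lemma pos_def_borel [measurable]: "Measurable.pred borel (pos_def :: ('f::rch, 'n::finite) sqmat \<Rightarrow> bool)"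
proof -
  have "pos_def X \<longleftrightarrow> ctrans X = X \<and> (\<exists>n::nat. \<forall>v\<in>sphere 0 1. inverse (real (Suc n)) \<le> v \<bullet> (X *v v))"
    (is "_ \<longleftrightarrow> _ \<and> ?R") for X :: "('f, 'n) sqmat"
  proof
    assume X: "pos_def X"
    have "compact (sphere (0 :: 'f^'n) 1)" "sphere (0 :: 'f^'n) 1 \<noteq> {}" by auto
    moreover have "continuous_on (sphere (0 :: 'f^'n) 1) (\<lambda>v. v \<bullet> (X *v v))" by (intro continuous_intros)
    ultimately obtain v where v: "v \<in> sphere 0 1" "\<forall>w\<in>sphere 0 1. v \<bullet> (X *v v) \<le> w \<bullet> (X *v w)"
      using continuous_attains_inf[of "sphere (0 :: 'f^'n) 1" "\<lambda>v. v \<bullet> (X *v v)"] by blast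
    have "v \<bullet> (X *v v) > 0" by (rule pos_defD(2)[OF X]) (use v(1) in auto)
    then obtain n where "inverse (real (Suc n)) < v \<bullet> (X *v v)" using reals_Archimedean by metis
    hence "\<forall>w\<in>sphere 0 1. inverse (real (Suc n)) \<le> w \<bullet> (X *v w)"
      using v(2) by (meson less_le_trans less_imp_le)
    hence ?R by blast
    thus "ctrans X = X \<and> ?R" using pos_defD(1)[OF X] by simp
  next
    assume "ctrans X = X \<and> ?R"
    then obtain n where n: "ctrans X = X" "\<And>v. v \<in> sphere 0 1 \<Longrightarrow> inverse (real (Suc n)) \<le> v \<bullet> (X *v v)" by blast
    have "0 < v \<bullet> (X *v v)" if "v \<noteq> 0" for v
    proof -
      have "0 < inverse (real (Suc n))" by simp
      also have "\<dots> \<le> ((1 / norm v) *\<^sub>R v) \<bullet> (X *v ((1 / norm v) *\<^sub>R v))" by (rule n(2)) (use that in auto)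
      finally have "0 < (1 / norm v) * ((1 / norm v) * (v \<bullet> (X *v v)))"
        by (simp add: linear_cmul[OF linear_matrix_vec])
      thus ?thesis using that by (simp add: zero_less_divide_iff)
    qed
    thus "pos_def X" using n(1) by (simp add: pos_def_def)
  qed
  hence eq: "{X :: ('f, 'n) sqmat. pos_def X} = {X. ctrans X = X} \<inter>
    (\<Union>n::nat. \<Inter>v\<in>sphere 0 1. {X. inverse (real (Suc n)) \<le> v \<bullet> (X *v v)})" by (simp add: set_eq_iff)
  have "closed {X :: ('f, 'n) sqmat. inverse (real (Suc n)) \<le> v \<bullet> (X *v v)}" for n and v :: "'f^'n"
    by (intro closed_Collect_le continuous_intros)
  hence cl: "closed (\<Inter>v\<in>sphere 0 1. {X :: ('f, 'n) sqmat. inverse (real (Suc n)) \<le> v \<bullet> (X *v v)})" for n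
    by blast
  have "{X :: ('f, 'n) sqmat. ctrans X = X} \<inter>
    (\<Union>n::nat. \<Inter>v\<in>sphere 0 1. {X. inverse (real (Suc n)) \<le> v \<bullet> (X *v v)}) \<in> sets borel"
    by (rule sets.Int[OF borel_closed[OF closed_hermitian] sets.countable_UN]) (use cl borel_closed in blast)
  with eq show ?thesis by (simp add: pred_def)
qed

section \<open>Unipotent matrices and principal minors\<close>

text \<open>The matrices that shift the level \<open>L\<close> of the indices by at least \<open>k\<close>; for \<open>k = 1\<close> these are the
  strictly block upper triangular matrices.\<close>

definition depth :: "('n \<Rightarrow> int) \<Rightarrow> int \<Rightarrow> ('f::rch, 'n::finite) sqmat \<Rightarrow> bool"
  where "depth L k X \<longleftrightarrow> (\<forall>a b. L b - L a < k \<longrightarrow> X $ a $ b = 0)"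

text \<open>Conjugation by the diagonal matrices with entries $s^{L(a)}$ preserves the determinant and
  contracts a unipotent matrix to the identity as $s$ tends to $0$.\<close>

lemma cdet_unipotent:
  fixes X :: "('f::rch, 'n::finite) sqmat"
  assumes "depth L 1 (X - mat 1)"
  shows "cdet X = 1"
proof -
  have X: "X $ a $ b = (if a = b then 1 else 0)" if "L b - L a < 1" for a b
    using assms that by (auto simp: depth_def mat_nth)
  define f where "f s = (\<chi> a b. s ^ nat (L b - L a) *\<^sub>R X $ a $ b)" for s :: real
  have cont: "continuous_on UNIV (\<lambda>s. cdet (f s))"
    unfolding f_def by (intro continuous_intros)
  have const: "cdet (f s) = cdet X" if s: "s > 0" for s
  proof -
    have "f s $ a $ b = (rdiag (\<lambda>a. s powr - of_int (L a)) ** X ** rdiag (\<lambda>b. s powr of_int (L b))) $ a $ b" for a b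
    proof (cases "L b - L a < 0")
      case True
      hence "a \<noteq> b" by auto
      thus ?thesis using X[of b a] True by (simp add: f_def rdiag_mult_nth)
    next
      case False
      hence "s powr - of_int (L a) * s powr of_int (L b) = s powr real (nat (L b - L a))"
        by (simp add: powr_add[symmetric])
      thus ?thesis using s by (simp add: f_def rdiag_mult_nth powr_realpow mult.commute)
    qed
    hence "f s = rdiag (\<lambda>a. s powr - of_int (L a)) ** X ** rdiag (\<lambda>b. s powr of_int (L b))"
      by (simp add: vec_eq_iff)
    hence "cdet (f s) = cdet X * cdet (rdiag (\<lambda>a. s powr - of_int (L a)) ** rdiag (\<lambda>b. s powr of_int (L b)) :: ('f,'n) sqmat)"
      by (simp add: cdet_mult)
    also have "rdiag (\<lambda>a. s powr - of_int (L a)) ** rdiag (\<lambda>b. s powr of_int (L b)) = (mat 1 :: ('f,'n) sqmat)"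
      using s by (simp add: rdiag_mult powr_add[symmetric] rdiag_1)
    finally show ?thesis by simp
  qed
  have "f 0 = mat 1"
    by (auto simp: f_def vec_eq_iff mat_nth power_0_left X)
  moreover have "((\<lambda>s. cdet (f s)) \<longlongrightarrow> cdet (f 0)) (at_right 0)"
    using cont by (meson UNIV_I at_le continuous_on_def subset_UNIV tendsto_mono)
  moreover have "((\<lambda>s. cdet (f s)) \<longlongrightarrow> cdet X) (at_right 0)"
    by (rule tendsto_eventually) (auto simp: eventually_at_filter const)
  ultimately show ?thesis
    using tendsto_unique[of "at_right (0::real)"] by (metis cdet_1 trivial_limit_at_right_real)
qed

lemma pos_inj: "pos i = pos j \<longleftrightarrow> i = (j :: 'q::{finite,linorder})"
  and pos_mono: "pos i \<le> pos j \<longleftrightarrow> i \<le> j"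
  and pos_strict_mono: "pos i < pos j \<longleftrightarrow> i < j"
proof -
  have m: "pos i < pos j" if "i < j" for i j :: 'q
  proof -
    have "{k. k \<le> i} \<subseteq> {k. k \<le> j}" "j \<in> {k. k \<le> j}" "j \<notin> {k. k \<le> i}" using that by auto
    hence "{k. k \<le> i} \<subset> {k. k \<le> j}" by blast
    thus ?thesis unfolding pos_def by (intro psubset_card_mono) auto
  qed
  thus "pos i = pos j \<longleftrightarrow> i = j" "pos i \<le> pos j \<longleftrightarrow> i \<le> j" "pos i < pos j \<longleftrightarrow> i < j"
    by (metis less_irrefl linorder_less_linear, metis leD leI less_irrefl linorder_less_linear order_less_imp_le le_less,
        metis less_asym less_irrefl linorder_less_linear)
qed

lemma pos_bounds: "1 \<le> pos i" "pos (i :: 'q::{finite,linorder}) \<le> CARD('q)"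
  unfolding pos_def by (auto simp: Suc_le_eq card_gt_0_iff intro: card_mono)

lemma pos_bij: "bij_betw pos (UNIV :: 'q::{finite,linorder} set) {1..CARD('q)}"
proof -
  have "inj (pos :: 'q \<Rightarrow> nat)" by (simp add: inj_def pos_inj)
  moreover have "range (pos :: 'q \<Rightarrow> nat) = {1..CARD('q)}"
  proof (rule card_subset_eq)
    show "range (pos :: 'q \<Rightarrow> nat) \<subseteq> {1..CARD('q)}" using pos_bounds by auto
    show "card (range (pos :: 'q \<Rightarrow> nat)) = card {1..CARD('q)}"
      using card_image[OF \<open>inj pos\<close>] by simp
  qed simp
  ultimately show ?thesis by (simp add: bij_betw_def)
qed

lemma coord_pos: "coord v (pos i) = v $ i"
  unfolding coord_def by (simp add: pos_inj)

text \<open>The principal submatrix on the indices in \<open>Q\<close>, completed by an identity block.\<close>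

definition compress :: "('n \<Rightarrow> bool) \<Rightarrow> ('f::rch, 'n::finite) sqmat \<Rightarrow> ('f, 'n) sqmat"
  where "compress Q x = (\<chi> i j. if Q i \<and> Q j then x$i$j else if i = j then 1 else 0)"

abbreviation trunc :: "nat \<Rightarrow> ('f::rch, 'q::{finite,linorder}) sqmat \<Rightarrow> ('f, 'q) sqmat"
  where "trunc r \<equiv> compress (\<lambda>i. pos i \<le> r)"

lemma Delta_trunc: "Delta r x = Re (fdet (trunc r x))"
  by (simp add: Delta_def compress_def)

lemma trunc_CARD: "trunc CARD('q) x = (x :: ('f::rch, 'q::{finite,linorder}) sqmat)"
  by (simp add: compress_def vec_eq_iff pos_bounds)

lemma pos_def_compress:
  fixes x :: "('f::rch, 'n::finite) sqmat"
  assumes x: "pos_def x"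
  shows "pos_def (compress Q x)"
proof -
  have xs: "star (x $ j $ i) = x $ i $ j" for i j
    by (metis ctrans_nth pos_defD(1)[OF x])
  have "0 < v \<bullet> (compress Q x *v v)" if "v \<noteq> 0" for v
  proof -
    define v1 where "v1 = (\<chi> i. if Q i then v $ i else 0)"
    define v2 where "v2 = (\<chi> i. if Q i then 0 else v $ i)"
    have "(compress Q x *v v) $ i = (if Q i then (x *v v1) $ i else v2 $ i)" for i
    proof (cases "Q i")
      case True
      thus ?thesis unfolding matrix_vec_nth
        by (auto simp: compress_def v1_def intro!: sum.cong)
    next
      case False
      have "(compress Q x *v v) $ i = (\<Sum>k\<in>UNIV. if k = i then v $ k else 0)"
        unfolding matrix_vec_nth by (rule sum.cong) (use False in \<open>auto simp: compress_def\<close>)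
      thus ?thesis using False by (simp add: v2_def)
    qed
    hence "v \<bullet> (compress Q x *v v) = (\<Sum>i\<in>UNIV. v1 $ i \<bullet> (x *v v1) $ i + v2 $ i \<bullet> v2 $ i)"
      unfolding inner_vec_def by (intro sum.cong) (auto simp: v1_def v2_def)
    hence eq: "v \<bullet> (compress Q x *v v) = v1 \<bullet> (x *v v1) + v2 \<bullet> v2"
      by (simp add: sum.distrib inner_vec_def)
    have "v1 \<noteq> 0 \<or> v2 \<noteq> 0" using that by (auto simp: vec_eq_iff v1_def v2_def)
    thus ?thesis
    proof
      assume "v1 \<noteq> 0"
      thus ?thesis using pos_defD(2)[OF x, of v1] unfolding eq by (simp add: add_pos_nonneg)
    next
      assume "v2 \<noteq> 0"
      thus ?thesis using pos_defD(2)[OF x, of v1] unfolding eq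
        by (cases "v1 = 0") (auto simp: add_pos_pos)
    qed
  qed
  thus ?thesis by (auto simp: pos_def_def vec_eq_iff compress_def xs)
qed

lemma Delta_pos_def:
  assumes "pos_def x"
  shows "Delta r x = adet (trunc r x)" "Delta r x > 0"
  using fdet_pos_def[OF pos_def_compress[OF assms, of "\<lambda>i. pos i \<le> r"]] by (simp_all add: Delta_trunc)

lemma Delta_CARD: "pos_def (x :: ('f::rch, 'q::{finite,linorder}) sqmat) \<Longrightarrow> Delta CARD('q) x = adet x"
  using Delta_pos_def(1)[of x "CARD('q)"] by (simp add: trunc_CARD)

lemma depth_pos: "depth (\<lambda>i::'a::{finite,linorder}. int (pos i)) 1 (T - mat 1) \<longleftrightarrow> (\<forall>i j. j \<le> i \<longrightarrow> T $ i $ j = (if i = j then 1 else 0))"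
proof -
  have "int (pos b) - int (pos a) < 1 \<longleftrightarrow> b \<le> a" for a b :: 'a
    using pos_mono[of b a] by linarith
  thus ?thesis by (auto simp: depth_def mat_nth)
qed

lemma trunc_LDL:
  fixes T :: "('f::rch, 'q::{finite,linorder}) sqmat"
  assumes T: "depth (\<lambda>i. int (pos i)) 1 (T - mat 1)"
  shows "trunc r (ctrans T ** rdiag d ** T) =
    ctrans (trunc r T) ** rdiag (\<lambda>i. if pos i \<le> r then d i else 1) ** trunc r T"
proof -
  have T0: "j \<le> i \<Longrightarrow> T $ i $ j = (if i = j then 1 else 0)" for i j using T by (simp add: depth_pos)
  let ?d = "\<lambda>i. if pos i \<le> r then d i else 1"
  have L: "(ctrans T ** rdiag d ** T) $ i $ j = (\<Sum>k\<in>UNIV. d k *\<^sub>R (star (T $ k $ i) * T $ k $ j))" for i j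
    by (simp add: matrix_nth[of "ctrans T ** rdiag d" T] rdiag_mult_nth)
  have R: "(ctrans (trunc r T) ** rdiag ?d ** trunc r T) $ i $ j =
      (\<Sum>k\<in>UNIV. ?d k *\<^sub>R (star (trunc r T $ k $ i) * trunc r T $ k $ j))" for i j
    by (simp add: matrix_nth[of "ctrans (trunc r T) ** rdiag ?d" "trunc r T"] rdiag_mult_nth)
  have "(ctrans (trunc r T) ** rdiag ?d ** trunc r T) $ i $ j = trunc r (ctrans T ** rdiag d ** T) $ i $ j" for i j
  proof (cases "pos i \<le> r \<and> pos j \<le> r")
    case True
    have "T $ k $ i = 0" if "\<not> pos k \<le> r" for k
      using that True T0[of i k] pos_mono[of i k] by force
    hence "(\<Sum>k\<in>UNIV. ?d k *\<^sub>R (star (trunc r T $ k $ i) * trunc r T $ k $ j)) =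
      (\<Sum>k\<in>UNIV. d k *\<^sub>R (star (T $ k $ i) * T $ k $ j))"
      by (intro sum.cong) (use True in \<open>auto simp: compress_def\<close>)
    thus ?thesis using True unfolding R by (simp add: compress_def L)
  next
    case False
    have "(\<Sum>k\<in>UNIV. ?d k *\<^sub>R (star (trunc r T $ k $ i) * trunc r T $ k $ j)) =
      (\<Sum>k\<in>UNIV. if k = i then (if i = j then 1 else 0) else 0)"
      by (intro sum.cong) (use False in \<open>auto simp: compress_def\<close>)
    thus ?thesis using False unfolding R by (auto simp: compress_def)
  qed
  thus ?thesis by (simp add: vec_eq_iff)
qed

text \<open>The principal minors of an upper triangular congruence of a diagonal matrix.\<close>

lemma Delta_LDL:
  fixes T :: "('f::rch, 'q::{finite,linorder}) sqmat"
  assumes T: "depth (\<lambda>i. int (pos i)) 1 (T - mat 1)" and d: "\<And>i. d i > 0"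
    and x: "pos_def (ctrans T ** rdiag d ** T)"
  shows "Delta r (ctrans T ** rdiag d ** T) = (\<Prod>i | pos i \<le> r. d i)"
proof -
  have "depth (\<lambda>i. int (pos i)) 1 (trunc r T - mat 1)"
    using T by (auto simp: depth_def compress_def mat_nth)
  hence "adet (trunc r T) = 1" by (simp add: adet_def cdet_unipotent)
  hence "Delta r (ctrans T ** rdiag d ** T) = \<bar>\<Prod>i\<in>UNIV. if pos i \<le> r then d i else 1\<bar>"
    by (simp add: Delta_pos_def[OF x] trunc_LDL[OF T] adet_mult adet_rdiag)
  also have "(\<Prod>i\<in>UNIV. if pos i \<le> r then d i else 1) = (\<Prod>i | pos i \<le> r. d i)"
    by (simp add: prod.If_cases)
  finally show ?thesis using d by (simp add: prod_pos abs_of_pos)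
qed

text \<open>Summation by parts over the positions of the indices.\<close>

lemma Delta_power_exp:
  fixes x :: "('f::rch, 'q::{finite,linorder}) sqmat" and \<mu> :: "(complex, 'q) vec"
  assumes "\<And>r. Delta r x = (\<Prod>i | pos i \<le> r. exp (2 * h i))"
  shows "Delta_power ((1 / 2) *s \<mu>) x = exp (\<Sum>i\<in>UNIV. \<mu> $ i * of_real (h i))"
proof -
  let ?q = "CARD('q)"
  define s where "s r = (\<Sum>i | pos i \<le> r. h i)" for r
  have pw: "complex_of_real (Delta r x) powr c = exp (2 * of_real (s r) * c)" for r c
  proof -
    have "Delta r x = exp (2 * s r)"
      by (simp add: assms s_def exp_sum[symmetric] sum_distrib_left)
    thus ?thesis by (simp add: powr_def exp_of_real[symmetric] Ln_of_real mult_ac)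
  qed
  define m where "m r = coord \<mu> r" for r
  define g where "g r = h (THE i. pos i = r)" for r
  have half: "coord ((1 / 2) *s \<mu>) r = m r / 2" for r by (simp add: coord_def m_def)
  have s_eq: "s r = (\<Sum>k=1..r. g k)" if "r \<le> ?q" for r
  proof -
    have "bij_betw pos {i :: 'q. pos i \<le> r} {1..r}"
      using pos_bij[where 'q='q] that
      by (auto simp: bij_betw_def inj_on_def pos_inj image_iff) (metis atLeastAtMost_iff imageE le_trans)
    hence "(\<Sum>k=1..r. g k) = (\<Sum>i | pos i \<le> r. g (pos (i :: 'q)))" by (rule sum.reindex_bij_betw[symmetric])
    thus ?thesis by (simp add: s_def g_def pos_inj)
  qed
  have parts: "(\<Sum>r = 1..<n. of_real (\<Sum>k=1..r. g k) * (m r - m (r + 1))) + of_real (\<Sum>k=1..n. g k) * m n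
      = (\<Sum>r=1..n. m r * of_real (g r))" if "n \<ge> 1" for n
    using that
  proof (induction n rule: dec_induct)
    case (step n)
    thus ?case by (simp add: sum.atLeastLessThan_Suc algebra_simps)
  qed simp
  have "Delta_power ((1 / 2) *s \<mu>) x = exp ((\<Sum>r = 1..<?q. of_real (s r) * (m r - m (r + 1))) + of_real (s ?q) * m ?q)"
    by (simp add: Delta_power_def pw half exp_add exp_sum diff_divide_distrib[symmetric])
  also have "(\<Sum>r = 1..<?q. of_real (s r) * (m r - m (r + 1))) + of_real (s ?q) * m ?q = (\<Sum>r=1..?q. m r * of_real (g r))"
    using parts[of ?q] by (simp add: s_eq)
  also have "\<dots> = (\<Sum>i\<in>UNIV. m (pos (i :: 'q)) * of_real (g (pos i)))"
    by (rule sum.reindex_bij_betw[OF pos_bij, symmetric])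
  also have "\<dots> = (\<Sum>i\<in>UNIV. \<mu> $ i * of_real (h i))" by (simp add: m_def g_def coord_pos pos_inj)
  finally show ?thesis .
qed

section \<open>The matrix exponential\<close>

definition mpow :: "('f::rch, 'n::finite) sqmat \<Rightarrow> nat \<Rightarrow> ('f, 'n) sqmat"
  where "mpow X k = ((**) X ^^ k) (mat 1)"

lemma mpow_0 [simp]: "mpow X 0 = mat 1" and mpow_Suc: "mpow X (Suc k) = X ** mpow X k"
  by (simp_all add: mpow_def)

lemma mpow_1 [simp]: "mpow X (Suc 0) = X"
  by (simp add: mpow_Suc)

lemma mpow_add: "mpow X (i + j) = mpow X i ** mpow X j"
  by (induction i) (simp_all add: mpow_Suc matrix_mul_assoc)

lemma mpow_Suc2: "mpow X (Suc k) = mpow X k ** X"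
  using mpow_add[of X k 1] by simp

lemma mpow_scaleR: "mpow (r *\<^sub>R X) k = r ^ k *\<^sub>R mpow X k"
  by (induction k) (simp_all add: mpow_Suc matrix_scaleR_left matrix_scaleR_right)

lemma mexp_norm_summable:
  fixes X :: "('f::rch, 'n::finite) sqmat"
  shows "summable (\<lambda>k. norm ((1 / fact k) *\<^sub>R mpow X k))"
proof -
  obtain B where B: "B > 0" "\<And>(X :: ('f, 'n) sqmat) (Y :: ('f, 'n) sqmat). norm (X ** Y) \<le> norm X * norm Y * B"
    using bounded_bilinear.pos_bounded[OF bounded_bilinear_matrix_mult] by blast
  have "norm (mpow X k) \<le> norm (mat 1 :: ('f, 'n) sqmat) * (norm X * B) ^ k" for k
  proof (induction k)
    case (Suc k)
    have "norm (mpow X (Suc k)) \<le> norm X * B * norm (mpow X k)" using B(2)[of X "mpow X k"] by (simp add: mpow_Suc mult_ac)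
    also have "\<dots> \<le> norm X * B * (norm (mat 1 :: ('f, 'n) sqmat) * (norm X * B) ^ k)"
      using B(1) Suc.IH by (intro mult_left_mono) auto
    finally show ?case by (simp add: mult_ac)
  qed simp
  hence "norm (norm ((1 / fact k) *\<^sub>R mpow X k)) \<le> norm (mat 1 :: ('f, 'n) sqmat) * (inverse (fact k) * (norm X * B) ^ k)" for k
    by (simp add: field_simps divide_right_mono)
  thus ?thesis by (intro summable_comparison_test'[OF summable_mult[OF summable_exp]])
qed

lemma mexp_sums: "(\<lambda>k. (1 / fact k) *\<^sub>R mpow X k) sums mexp (X :: ('f::rch, 'n::finite) sqmat)"
  using summable_sums[OF summable_norm_cancel[OF mexp_norm_summable[of X]]] by (simp add: mexp_def mpow_def)

lemma mexp_sums_nth: "(\<lambda>k. (1 / fact k) *\<^sub>R mpow X k $ a $ b) sums mexp X $ a $ b"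
  using bounded_linear.sums[OF bounded_linear_vec_nth bounded_linear.sums[OF bounded_linear_vec_nth mexp_sums[of X]]]
  by simp

lemma mexp_intertwine:
  fixes A X Y :: "('f::rch, 'n::finite) sqmat"
  assumes "A ** X = Y ** A"
  shows "A ** mexp X = mexp Y ** A"
proof -
  have pow: "A ** mpow X k = mpow Y k ** A" for k
  proof (induction k)
    case (Suc k)
    have "A ** mpow X (Suc k) = Y ** (A ** mpow X k)" by (simp add: mpow_Suc matrix_mul_assoc assms)
    thus ?case by (simp add: Suc.IH mpow_Suc matrix_mul_assoc)
  qed simp
  have "(\<lambda>k. A ** ((1 / fact k) *\<^sub>R mpow X k)) sums (A ** mexp X)"
    by (rule bounded_linear.sums[OF bounded_bilinear.bounded_linear_right[OF bounded_bilinear_matrix_mult] mexp_sums])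
  moreover have "(\<lambda>k. ((1 / fact k) *\<^sub>R mpow Y k) ** A) sums (mexp Y ** A)"
    by (rule bounded_linear.sums[OF bounded_bilinear.bounded_linear_left[OF bounded_bilinear_matrix_mult] mexp_sums])
  ultimately show ?thesis
    by (simp add: matrix_scaleR_left matrix_scaleR_right pow sums_unique2)
qed

lemma mexp_conjugate:
  fixes A B X :: "('f::rch, 'n::finite) sqmat"
  assumes "A ** B = mat 1"
  shows "mexp (A ** X ** B) = A ** mexp X ** B"
proof -
  have BA: "B ** A = mat 1" by (rule matrix_left_inverse_imp_right[OF assms])
  have "A ** X = (A ** X ** B) ** A" by (simp add: matrix_mul_assoc[symmetric] BA)
  from mexp_intertwine[OF this] have "A ** mexp X ** B = mexp (A ** X ** B) ** (A ** B)"
    by (simp add: matrix_mul_assoc)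
  thus ?thesis by (simp add: assms)
qed

lemma mexp_ctrans: "ctrans (mexp X) = mexp (ctrans (X :: ('f::rch, 'n::finite) sqmat))"
proof -
  have pow: "ctrans (mpow X k) = mpow (ctrans X) k" for k
  proof (induction k)
    case (Suc k)
    thus ?case by (simp add: mpow_Suc ctrans_mult) (simp add: mpow_Suc2[symmetric] mpow_Suc)
  qed simp
  have "(\<lambda>k. ctrans ((1 / fact k) *\<^sub>R mpow X k)) sums ctrans (mexp X)"
    by (rule bounded_linear.sums[OF _ mexp_sums]) (use linear_ctrans linear_conv_bounded_linear in blast)
  moreover have "(\<lambda>k. ctrans ((1 / fact k) *\<^sub>R mpow X k)) = (\<lambda>k. (1 / fact k) *\<^sub>R mpow (ctrans X) k)"
    by (simp only: ctrans_scaleR pow)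
  ultimately show ?thesis using sums_unique2[OF _ mexp_sums] by metis
qed

text \<open>The Cauchy product of the two series, whose terms of positive degree vanish by the
  binomial theorem.\<close>

lemma mexp_minus: "mexp X ** mexp (- X) = mat (1 :: 'f::rch)"
  for X :: "(_, 'n::finite) vec ^ 'n"
proof -
  define x where "x k = (1 / fact k) *\<^sub>R mpow X k" for k
  define y where "y k = (1 / fact k) *\<^sub>R mpow (- X) k" for k
  have sum: "summable (\<lambda>k. norm (((1 / fact k) *\<^sub>R mpow Z k) $ a $ b))" for Z :: "('f, 'n) sqmat" and a b
  proof (rule summable_comparison_test'[OF mexp_norm_summable[of Z], where N=0])
    fix k
    let ?M = "(1 / fact k) *\<^sub>R mpow Z k"
    show "norm (norm (?M $ a $ b)) \<le> norm ?M"
      using Finite_Cartesian_Product.norm_nth_le[of "?M $ a" b] Finite_Cartesian_Product.norm_nth_le[of ?M a]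
      by (simp del: vector_scaleR_component)
  qed
  have sx: "summable (\<lambda>k. norm (x k $ a $ b))" and sy: "summable (\<lambda>k. norm (y k $ a $ b))" for a b
    unfolding x_def y_def by (rule sum)+
  have ex: "(\<Sum>k. x k $ a $ b) = mexp X $ a $ b" and ey: "(\<Sum>k. y k $ a $ b) = mexp (- X) $ a $ b" for a b
    using sums_unique[OF mexp_sums_nth[of X a b]] sums_unique[OF mexp_sums_nth[of "- X" a b]] by (simp_all add: x_def y_def)
  have my: "mpow (- X) k = (-1) ^ k *\<^sub>R mpow X k" for k
    using mpow_scaleR[of "-1" X k] by simp
  have conv: "(\<Sum>i\<le>n. x i ** y (n - i)) = (if n = 0 then mat 1 else 0)" for n
  proof -
    have "(\<Sum>i\<le>n. x i ** y (n - i)) = (\<Sum>i\<le>n. (1 / fact i * (1 / fact (n - i)) * (-1) ^ (n - i)) *\<^sub>R mpow X n)"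
      by (intro sum.cong refl)
         (simp add: x_def y_def my matrix_scaleR_left matrix_scaleR_right mpow_add[symmetric])
    also have "\<dots> = (\<Sum>i\<le>n. 1 / fact n * (of_nat (n choose i) * 1 ^ i * (-1) ^ (n - i))) *\<^sub>R mpow X n"
      unfolding scaleR_sum_left
      by (intro sum.cong refl) (simp add: binomial_fact field_simps)
    also have "(\<Sum>i\<le>n. (1 / fact n :: real) * (of_nat (n choose i) * 1 ^ i * (-1) ^ (n - i))) = 1 / fact n * (1 + (-1)) ^ n"
      using binomial_ring[of 1 "- 1 :: real" n] by (simp only: sum_distrib_left[symmetric])
    finally show ?thesis by (cases n) simp_all
  qed
  have "(mexp X ** mexp (- X)) $ a $ b = mat 1 $ a $ b" for a b
  proof -
    have "(\<lambda>n. \<Sum>c\<in>UNIV. \<Sum>i\<le>n. x i $ a $ c * y (n - i) $ c $ b) sums (\<Sum>c\<in>UNIV. mexp X $ a $ c * mexp (- X) $ c $ b)"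
      by (intro sums_sum) (use Cauchy_product_sums[OF sx sy] in \<open>simp add: ex ey\<close>)
    moreover have "(\<Sum>c\<in>UNIV. \<Sum>i\<le>n. x i $ a $ c * y (n - i) $ c $ b) = (\<Sum>i\<le>n. x i ** y (n - i)) $ a $ b" for n
      by (subst sum.swap) (simp add: matrix_nth)
    ultimately have "(\<lambda>n. (if n = 0 then mat 1 $ a $ b else 0)) sums (mexp X ** mexp (- X)) $ a $ b"
      by (simp add: conv matrix_nth if_distrib[where f="\<lambda>x. x $ a $ b"] cong: if_cong)
    moreover have "(\<lambda>n. (if n = 0 then (mat 1 :: ('f, 'n) sqmat) $ a $ b else 0)) sums mat 1 $ a $ b"
      using sums_single[of 0 "\<lambda>_. (mat 1 :: ('f, 'n) sqmat) $ a $ b"] by simp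
    ultimately show ?thesis by (rule sums_unique2)
  qed
  thus ?thesis by (simp add: vec_eq_iff)
qed

lemma mexp_0 [simp]: "mexp 0 = (mat 1 :: ('f::rch, 'n::finite) sqmat)"
proof -
  have "mpow (0 :: ('f, 'n) sqmat) k = (if k = 0 then mat 1 else 0)" for k by (cases k) (simp_all add: mpow_Suc)
  hence "(\<lambda>k. (1 / fact k) *\<^sub>R mpow (0 :: ('f, 'n) sqmat) k) = (\<lambda>k. if k = 0 then mat 1 else 0)" by auto
  thus ?thesis
    using sums_unique2[OF mexp_sums[of "0 :: ('f, 'n) sqmat"]] sums_single[of 0 "\<lambda>_. mat 1 :: ('f, 'n) sqmat"] by simp
qed

lemma continuous_on_mexp_ray:
  fixes X :: "('f::rch, 'n::finite) sqmat"
  shows "continuous_on {0..R} (\<lambda>r. mexp (r *\<^sub>R X))"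
proof (rule uniform_limit_theorem)
  show "uniform_limit {0..R} (\<lambda>n r. \<Sum>k<n. (1 / fact k) *\<^sub>R mpow (r *\<^sub>R X) k) (\<lambda>r. mexp (r *\<^sub>R X)) sequentially"
  proof -
    have "uniform_limit {0..R} (\<lambda>n r. \<Sum>k<n. (1 / fact k) *\<^sub>R mpow (r *\<^sub>R X) k)
      (\<lambda>r. \<Sum>k. (1 / fact k) *\<^sub>R mpow (r *\<^sub>R X) k) sequentially"
    proof (rule Weierstrass_m_test)
      show "norm ((1 / fact k) *\<^sub>R mpow (r *\<^sub>R X) k) \<le> norm ((1 / fact k) *\<^sub>R mpow (R *\<^sub>R X) k)"
        if "r \<in> {0..R}" for k r
        using that by (auto simp: mpow_scaleR abs_mult intro!: mult_right_mono divide_right_mono power_mono)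
    qed (rule mexp_norm_summable)
    thus ?thesis by (simp add: mexp_sums[THEN sums_unique])
  qed
  show "\<forall>\<^sub>F n in sequentially. continuous_on {0..R} (\<lambda>r. \<Sum>k<n. (1 / fact k) *\<^sub>R mpow (r *\<^sub>R X) k)"
    unfolding mpow_scaleR by (intro always_eventually allI continuous_intros)
qed simp

lemma mexp_rdiag: "mexp (rdiag w) = (rdiag (\<lambda>a. exp (w a)) :: ('f::rch, 'n::finite) sqmat)"
proof -
  have pow: "mpow (rdiag w) k = (rdiag (\<lambda>a. w a ^ k) :: ('f, 'n) sqmat)" for k
    by (induction k) (simp_all add: mpow_Suc rdiag_mult rdiag_1)
  have sums: "(\<lambda>k. (1 / fact k) *\<^sub>R mpow (rdiag w :: ('f, 'n) sqmat) k $ a $ b) sums rdiag (\<lambda>a. exp (w a)) $ a $ b" for a b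
  proof (cases "a = b")
    case True
    have "(\<lambda>k. of_real (w a ^ k /\<^sub>R fact k) :: 'f) sums of_real (exp (w a))"
      by (rule sums_of_real[OF exp_converges])
    thus ?thesis using True by (simp add: pow rdiag_nth scaleR_conv_of_real divide_inverse mult.commute)
  qed (simp add: pow rdiag_nth)
  have "mexp (rdiag w) $ a $ b = (rdiag (\<lambda>a. exp (w a)) :: ('f, 'n) sqmat) $ a $ b" for a b
    by (rule sums_unique2[OF mexp_sums_nth sums])
  thus ?thesis by (simp add: vec_eq_iff)
qed

section \<open>Depth with respect to a level function\<close>

lemma depth_mult:
  assumes "depth L j X" "depth L k Y"
  shows "depth L (j + k) (X ** Y)"
  unfolding depth_def
proof (intro allI impI)
  fix a b assume ab: "L b - L a < j + k"
  have "X $ a $ c * Y $ c $ b = 0" for c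
  proof (cases "L c - L a < j")
    case True thus ?thesis using assms(1) by (simp add: depth_def)
  next
    case False
    hence "L b - L c < k" using ab by linarith
    thus ?thesis using assms(2) by (simp add: depth_def)
  qed
  thus "(X ** Y) $ a $ b = 0" unfolding matrix_nth by (intro sum.neutral) simp
qed

lemma depth_mono: "depth L j X \<Longrightarrow> k \<le> j \<Longrightarrow> depth L k X"
  by (auto simp: depth_def)

lemma depth_add: "depth L k X \<Longrightarrow> depth L k Y \<Longrightarrow> depth L k (X + Y)"
  and depth_diff: "depth L k X \<Longrightarrow> depth L k Y \<Longrightarrow> depth L k (X - Y)"
  and depth_minus: "depth L k X \<Longrightarrow> depth L k (- X)"
  and depth_scaleR: "depth L k X \<Longrightarrow> depth L k (r *\<^sub>R X)"
  and depth_0: "depth L k 0"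
  by (auto simp: depth_def)

lemma depth_unipotent_0: "depth L 1 (X - mat 1) \<Longrightarrow> depth L 0 X"
  by (auto simp: depth_def mat_nth)

lemma depth_unipotent_mult:
  assumes "depth L 1 (X - mat 1)" "depth L 1 (Y - mat 1)"
  shows "depth L 1 (X ** Y - mat 1)"
proof -
  have eq: "X ** Y - mat 1 = (X - mat 1) ** Y + (Y - mat 1)" by (simp add: matrix_diff_rdistrib)
  have "depth L 1 ((X - mat 1) ** Y)"
    using depth_mult[OF assms(1) depth_unipotent_0[OF assms(2)]] by simp
  thus ?thesis unfolding eq using assms(2) by (rule depth_add)
qed

lemma depth_mpow: "depth L 1 Y \<Longrightarrow> depth L (int n) (mpow Y n)"
proof (induction n)
  case 0
  show ?case by (auto simp: depth_def mat_nth)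
next
  case (Suc n)
  from depth_mult[OF Suc.prems Suc.IH[OF Suc.prems]] show ?case by (simp add: mpow_Suc)
qed

lemma depth_mexp:
  fixes Y :: "('f::rch, 'n::finite) sqmat"
  assumes "depth L 1 Y"
  shows "depth L 1 (mexp Y - mat 1)"
  unfolding depth_def
proof (intro allI impI)
  fix a b assume ab: "L b - L a < 1"
  have "(1 / fact k) *\<^sub>R mpow Y k $ a $ b = (if k = 0 then mat 1 $ a $ b else 0)" for k
    using depth_mono[OF depth_mpow[OF assms, of k], of 1] ab by (cases k) (auto simp: depth_def)
  hence "(\<lambda>k. if k = 0 then mat 1 $ a $ b else 0) sums mexp Y $ a $ b"
    using mexp_sums_nth[of Y a b] by simp
  hence "mexp Y $ a $ b = mat 1 $ a $ b"
    using sums_single[of 0 "\<lambda>_. (mat 1 :: ('f, 'n) sqmat) $ a $ b"] sums_unique2 by fastforce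
  thus "(mexp Y - mat 1) $ a $ b = 0" by simp
qed

text \<open>To leading order, adding a matrix of depth \<open>k\<close> in the exponent adds it to the exponential.\<close>

lemma depth_mexp_perturb:
  fixes Y Z :: "('f::rch, 'n::finite) sqmat"
  assumes Y: "depth L 1 Y" and Z: "depth L k Z" and k: "1 \<le> k"
  shows "depth L (k + 1) (mexp (Y + Z) - mexp Y - Z)"
proof -
  have YZ: "depth L 1 (Y + Z)" using Y depth_mono[OF Z k] by (rule depth_add)
  have D: "depth L (k + 1) (mpow (Y + Z) (Suc (Suc n)) - mpow Y (Suc (Suc n)))" for n
  proof -
    have step: "mpow (Y + Z) (Suc m) - mpow Y (Suc m) = (Y + Z) ** (mpow (Y + Z) m - mpow Y m) + Z ** mpow Y m" for m
      by (simp add: mpow_Suc matrix_diff_ldistrib matrix_add_rdistrib)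
    have zm: "depth L (k + 1) (Z ** mpow Y (Suc m))" for m
      using depth_mono[OF depth_mult[OF Z depth_mpow[OF Y, of "Suc m"]]] by simp
    have one: "depth L k (mpow (Y + Z) (Suc m) - mpow Y (Suc m))" for m
    proof (induction m)
      case 0
      show ?case using Z by simp
    next
      case (Suc m)
      show ?case unfolding step[of "Suc m"]
        using depth_mono[OF depth_mult[OF YZ Suc.IH], of k] depth_mono[OF zm[of m], of k] by (simp add: depth_add)
    qed
    show ?thesis unfolding step[of "Suc n"]
      using depth_mult[OF YZ one[of n]] zm[of n] by (simp add: depth_add add.commute)
  qed
  show ?thesis unfolding depth_def
  proof (intro allI impI)
    fix a b assume ab: "L b - L a < k + 1"
    have "(1 / fact n) *\<^sub>R mpow (Y + Z) n $ a $ b - (1 / fact n) *\<^sub>R mpow Y n $ a $ b = (if n = 1 then Z $ a $ b else 0)" for n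
    proof -
      consider "n = 0" | "n = 1" | m where "n = Suc (Suc m)" by (metis One_nat_def not0_implies_Suc)
      thus ?thesis
      proof cases
        case 3
        hence "(mpow (Y + Z) n - mpow Y n) $ a $ b = 0" using D[of m] ab by (simp add: depth_def)
        thus ?thesis using 3 by simp
      qed simp_all
    qed
    moreover have "(\<lambda>n. (1 / fact n) *\<^sub>R mpow (Y + Z) n $ a $ b - (1 / fact n) *\<^sub>R mpow Y n $ a $ b) sums
        (mexp (Y + Z) $ a $ b - mexp Y $ a $ b)"
      by (intro sums_diff mexp_sums_nth)
    ultimately have "mexp (Y + Z) $ a $ b - mexp Y $ a $ b = Z $ a $ b"
      using sums_unique2[OF _ sums_single[of 1 "\<lambda>_. Z $ a $ b"]] by simp
    thus "(mexp (Y + Z) - mexp Y - Z) $ a $ b = 0" by simp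
  qed
qed

lemma unipotent_inj:
  fixes U :: "('f::rch, 'n::finite) sqmat"
  assumes U: "depth L 1 (U - mat 1)" and v: "U *v v = 0"
  shows "v = 0"
proof (rule ccontr)
  assume "v \<noteq> 0"
  hence ne: "{a. v $ a \<noteq> 0} \<noteq> {}" by (auto simp: vec_eq_iff)
  define m where "m = Max (L ` {a. v $ a \<noteq> 0})"
  have "m \<in> L ` {a. v $ a \<noteq> 0}" unfolding m_def by (rule Max_in) (use ne in auto)
  then obtain a where a: "v $ a \<noteq> 0" "L a = m" by auto
  have le: "L b \<le> m" if "v $ b \<noteq> 0" for b unfolding m_def by (rule Max_ge) (use that in auto)
  have "(U - mat 1) $ a $ b * v $ b = 0" for b
  proof (cases "v $ b = 0")
    case False
    hence "L b - L a < 1" using le[of b] a(2) by simp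
    hence "(U - mat 1) $ a $ b = 0" using U unfolding depth_def by blast
    thus ?thesis by simp
  qed simp
  hence "((U - mat 1) *v v) $ a = 0" unfolding matrix_vec_nth by (intro sum.neutral) blast
  hence "(U *v v) $ a = v $ a" by (simp add: matrix_vector_mult_diff_rdistrib)
  thus False using v a by simp
qed

lemma unipotent_inverse:
  fixes U :: "('f::rch, 'n::finite) sqmat"
  assumes U: "depth L 1 (U - mat 1)"
  obtains V where "U ** V = mat 1" "V ** U = mat 1" "depth L 1 (V - mat 1)"
proof -
  obtain V where V: "U ** V = mat 1" "V ** U = mat 1"
    using inj_imp_matrix_inverse unipotent_inj[OF U] by metis
  have "depth L 1 (V - mat 1)"
  proof (rule ccontr)
    assume "\<not> depth L 1 (V - mat 1)"
    then obtain a0 b where "L b - L a0 < 1" "(V - mat 1) $ a0 $ b \<noteq> 0" by (auto simp: depth_def)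
    hence ne: "{a. L b - L a < 1 \<and> (V - mat 1) $ a $ b \<noteq> 0} \<noteq> {}" by blast
    define m where "m = Max (L ` {a. L b - L a < 1 \<and> (V - mat 1) $ a $ b \<noteq> 0})"
    have "m \<in> L ` {a. L b - L a < 1 \<and> (V - mat 1) $ a $ b \<noteq> 0}" unfolding m_def by (rule Max_in) (use ne in auto)
    then obtain a where a: "L b - L a < 1" "(V - mat 1) $ a $ b \<noteq> 0" "L a = m" by auto
    have max: "L c \<le> m" if "L b - L c < 1" "(V - mat 1) $ c $ b \<noteq> 0" for c
      unfolding m_def by (rule Max_ge) (use that in auto)
    have "(U - mat 1) $ a $ c * V $ c $ b = 0" for c
    proof (cases "L c - L a < 1")
      case True
      thus ?thesis using U by (simp add: depth_def)
    next
      case False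
      hence "(V - mat 1) $ c $ b = 0" "c \<noteq> b" using max[of c] a by auto
      thus ?thesis by (simp add: mat_nth)
    qed
    hence "((U - mat 1) ** V) $ a $ b = 0" unfolding matrix_nth by (intro sum.neutral) blast
    hence "(V - mat 1) $ a $ b = 0" using V by (simp add: matrix_diff_rdistrib)
    thus False using a by simp
  qed
  with V that show ?thesis by blast
qed

text \<open>The factorization of a positive definite matrix along a flag: each column of \<open>U\<close> is a
  basis vector corrected by lower levels so as to become orthogonal to them.\<close>

lemma block_LDL:
  fixes S :: "('f::rch, 'n::finite) sqmat" and L :: "'n \<Rightarrow> int"
  assumes S: "pos_def S"
  obtains U where "depth L 1 (U - mat 1)" "\<And>a c. L a \<noteq> L c \<Longrightarrow> (ctrans U ** S ** U) $ a $ c = 0"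
proof -
  have "\<exists>u. (\<forall>a. L c \<le> L a \<longrightarrow> u $ a = (if a = c then 1 else 0)) \<and> (\<forall>a. L a < L c \<longrightarrow> (S *v u) $ a = 0)" for c
  proof -
    define Q where "Q a \<longleftrightarrow> L a < L c" for a
    obtain Y where Y: "compress Q S ** Y = mat 1"
      using pos_def_inverse[OF pos_def_compress[OF S, of Q]] by metis
    define y where "y = (\<chi> a. if Q a then - S $ a $ c else 0)"
    define z where "z = Y *v y"
    have z: "compress Q S *v z = y" by (simp add: z_def matrix_vector_mul_assoc Y)
    have z0: "z $ a = 0" if "\<not> Q a" for a
    proof -
      have "(compress Q S *v z) $ a = (\<Sum>k\<in>UNIV. if k = a then z $ a else 0)"
        unfolding matrix_vec_nth by (rule sum.cong) (use that in \<open>auto simp: compress_def\<close>)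
      thus ?thesis using that by (simp add: z y_def)
    qed
    have "(S *v (z + axis c 1)) $ a = 0" if "Q a" for a
    proof -
      have "(S *v z) $ a = (compress Q S *v z) $ a"
        unfolding matrix_vec_nth by (rule sum.cong) (use that z0 in \<open>auto simp: compress_def\<close>)
      thus ?thesis using that by (simp add: z y_def linear_add[OF linear_matrix_vec] matrix_vec_axis)
    qed
    moreover have "(z + axis c 1) $ a = (if a = c then 1 else 0)" if "\<not> Q a" for a
      using z0[OF that] by (simp add: axis_def)
    ultimately show ?thesis unfolding Q_def by (intro exI[of _ "z + axis c 1"]) auto
  qed
  then obtain u where u: "\<And>c a. L c \<le> L a \<Longrightarrow> u c $ a = (if a = c then 1 else 0)"
    "\<And>c a. L a < L c \<Longrightarrow> (S *v u c) $ a = 0" by metis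
  define U where "U = (\<chi> a c. u c $ a)"
  have dU: "depth L 1 (U - mat 1)" by (auto simp: depth_def U_def mat_nth u)
  have SU: "(S ** U) $ a $ c = 0" if "L a < L c" for a c
    using u(2)[OF that] by (simp add: U_def matrix_nth matrix_vec_nth)
  have less: "(ctrans U ** S ** U) $ a $ c = 0" if "L a < L c" for a c
  proof -
    have "ctrans U $ a $ i * (S ** U) $ i $ c = 0" for i
    proof (cases "L i < L c")
      case False
      hence "U $ i $ a = 0" using that u(1)[of a i] by (auto simp: U_def)
      thus ?thesis by simp
    qed (simp add: SU)
    thus ?thesis unfolding matrix_mul_assoc[symmetric] matrix_nth[of "ctrans U"] by (intro sum.neutral) blast
  qed
  have "ctrans (ctrans U ** S ** U) = ctrans U ** S ** U"
    by (simp add: ctrans_mult pos_defD(1)[OF S] matrix_mul_assoc)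
  hence "(ctrans U ** S ** U) $ a $ c = 0" if "L a \<noteq> L c" for a c
    using less[of a c] less[of c a] that by (metis ctrans_nth linorder_neqE_linordered_idom star_0)
  with dU that show ?thesis by blast
qed

section \<open>A basis of weight vectors\<close>

text \<open>The basis change by \<open>Pmat\<close> replaces $e_i, e_{q+i}$ by the isotropic vectors
  $(e_i \pm e_{q+i})/\sqrt 2$, on which \<open>Hmat t\<close> acts by the weights $\pm t_i$. The involution \<open>flip\<close>
  exchanges the two, and \<open>lev\<close> orders the basis so that positive roots raise the level.\<close>

definition flip :: "'q + 'q + 's \<Rightarrow> 'q + 'q + 's"
  where "flip a = (case a of Inl i \<Rightarrow> Inr (Inl i) | Inr (Inl i) \<Rightarrow> Inl i | Inr (Inr k) \<Rightarrow> Inr (Inr k))"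

definition lev :: "'q::{finite,linorder} + 'q + 's \<Rightarrow> int"
  where "lev a = (case a of Inl i \<Rightarrow> int (pos i) - int (CARD('q) + 1)
    | Inr (Inl i) \<Rightarrow> int (CARD('q) + 1) - int (pos i) | Inr (Inr k) \<Rightarrow> 0)"

definition wt :: "(real, 'q::finite) vec \<Rightarrow> 'q + 'q + 's \<Rightarrow> real"
  where "wt t a = (case a of Inl i \<Rightarrow> t $ i | Inr (Inl i) \<Rightarrow> - (t $ i) | Inr (Inr k) \<Rightarrow> 0)"

lemma flip_simps [simp]:
  "flip (Inl i) = Inr (Inl i)" "flip (Inr (Inl i)) = Inl i" "flip (Inr (Inr k)) = Inr (Inr k)"
  by (simp_all add: flip_def)

lemma wt_simps [simp]: "wt t (Inl i) = t $ i" "wt t (Inr (Inl i)) = - (t $ i)" "wt t (Inr (Inr k)) = 0"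
  by (simp_all add: wt_def)

lemma lev_simps:
  "lev (Inl (i :: 'q::{finite,linorder})) = int (pos i) - int (CARD('q) + 1)"
  "lev (Inr (Inl (i :: 'q))) = int (CARD('q) + 1) - int (pos i)" "lev (Inr (Inr k)) = 0"
  by (simp_all add: lev_def)

lemma idx_cases:
  obtains (pl) i where "a = Inl i" | (mi) i where "a = Inr (Inl i)" | (mid) k where "a = Inr (Inr k)"
  by (metis sum.exhaust)

lemma flip_flip [simp]: "flip (flip a) = a"
  by (cases a rule: idx_cases) auto

lemma flip_eq_iff: "flip a = b \<longleftrightarrow> a = flip b"
  by (metis flip_flip)

lemma lev_flip [simp]: "lev (flip a) = - lev a"
  by (cases a rule: idx_cases) (auto simp: lev_simps)

lemma wt_flip [simp]: "wt t (flip a) = - wt t a"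
  by (cases a rule: idx_cases) auto

text \<open>The real matrices that are combinations of a diagonal matrix and \<open>flip\<close>.\<close>

definition fmat :: "('q + 'q + 's \<Rightarrow> real) \<Rightarrow> ('q + 'q + 's \<Rightarrow> real) \<Rightarrow> ('f::rch, 'q::finite, 's::finite) bigmat"
  where "fmat c d = (\<chi> a b. of_real ((if a = b then c a else 0) + (if flip a = b then d a else 0)))"

lemma fmat_left: "(fmat c d ** X) $ a $ b = c a *\<^sub>R X $ a $ b + d a *\<^sub>R X $ (flip a) $ b"
proof -
  have "(fmat c d ** X) $ a $ b = (\<Sum>k\<in>UNIV. (if k = a then c a *\<^sub>R X $ a $ b else 0)
      + (if k = flip a then d a *\<^sub>R X $ (flip a) $ b else 0))"
    unfolding matrix_nth fmat_def
    by (intro sum.cong) (auto simp: algebra_simps scaleR_conv_of_real)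
  thus ?thesis by (simp add: sum.distrib)
qed

lemma fmat_right: "(X ** fmat c d) $ a $ b = c b *\<^sub>R X $ a $ b + d (flip b) *\<^sub>R X $ a $ (flip b)"
proof -
  have "(X ** fmat c d) $ a $ b = (\<Sum>k\<in>UNIV. (if k = b then c b *\<^sub>R X $ a $ b else 0)
      + (if k = flip b then d (flip b) *\<^sub>R X $ a $ (flip b) else 0))"
    unfolding matrix_nth fmat_def
    by (intro sum.cong) (auto simp: algebra_simps scaleR_conv_of_real flip_eq_iff of_real_mult_comm)
  thus ?thesis by (simp add: sum.distrib)
qed

lemma fmat_mult: "fmat c d ** fmat c' d' =
    (fmat (\<lambda>a. c a * c' a + d a * d' (flip a)) (\<lambda>a. c a * d' a + d a * c' (flip a)) :: ('f::rch, 'q::finite, 's::finite) bigmat)"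
proof -
  have "(fmat c d ** fmat c' d' :: ('f, 'q, 's) bigmat) $ a $ b =
    fmat (\<lambda>a. c a * c' a + d a * d' (flip a)) (\<lambda>a. c a * d' a + d a * c' (flip a)) $ a $ b" for a b
    unfolding fmat_left
    by (auto simp: fmat_def scaleR_conv_of_real algebra_simps of_real_mult_comm[of "d _" "of_real _"])
  thus ?thesis by (simp add: vec_eq_iff)
qed

lemma fmat_eqI:
  assumes "\<And>i. c (Inl i) = c' (Inl i) \<and> d (Inl i) = d' (Inl i)"
    "\<And>i. c (Inr (Inl i)) = c' (Inr (Inl i)) \<and> d (Inr (Inl i)) = d' (Inr (Inl i))"
    "\<And>k. c (Inr (Inr k)) + d (Inr (Inr k)) = c' (Inr (Inr k)) + d' (Inr (Inr k))"
  shows "fmat c d = fmat c' d'"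
proof -
  have "(if a = b then c a else 0) + (if flip a = b then d a else 0) =
      (if a = b then c' a else 0) + (if flip a = b then d' a else 0)" for a b
    using assms by (cases a rule: idx_cases) auto
  thus ?thesis by (simp add: fmat_def)
qed

lemma fmat_1: "mat 1 = fmat (\<lambda>_. 1) (\<lambda>_. 0)"
  and fmat_rdiag: "rdiag w = fmat w (\<lambda>_. 0)"
  by (auto simp: fmat_def vec_eq_iff mat_nth rdiag_nth)

lemma fmat_ctrans: "ctrans (fmat c d) = (fmat c (\<lambda>a. d (flip a)) :: ('f::rch, 'q::finite, 's::finite) bigmat)"
proof -
  have "ctrans (fmat c d :: ('f, 'q, 's) bigmat) $ a $ b = fmat c (\<lambda>a. d (flip a)) $ a $ b" for a b
    by (auto simp: fmat_def flip_eq_iff star_add)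
  thus ?thesis by (simp add: vec_eq_iff)
qed

definition Pmat :: "('f::rch, 'q::finite, 's::finite) bigmat"
  where "Pmat = fmat (\<lambda>a. case a of Inl i \<Rightarrow> sqrt (1 / 2) | Inr (Inl i) \<Rightarrow> - sqrt (1 / 2) | Inr (Inr k) \<Rightarrow> 1)
    (\<lambda>a. case a of Inl i \<Rightarrow> sqrt (1 / 2) | Inr (Inl i) \<Rightarrow> sqrt (1 / 2) | Inr (Inr k) \<Rightarrow> 0)"

definition sg :: "'q + 'q + 's \<Rightarrow> real"
  where "sg a = (case a of Inr (Inr k) \<Rightarrow> -1 | _ \<Rightarrow> 1)"

definition Jflip :: "('f::rch, 'q::finite, 's::finite) bigmat"
  where "Jflip = fmat (\<lambda>_. 0) sg"

lemma sg_simps [simp]: "sg (Inl i) = 1" "sg (Inr (Inl j)) = 1" "sg (Inr (Inr k)) = -1" "sg (flip a) = sg a" "sg a * sg a = 1"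
  by (simp_all add: sg_def flip_def split: sum.splits)

lemma Jform_fmat: "Jform = fmat (\<lambda>a. case a of Inl i \<Rightarrow> 1 | Inr j \<Rightarrow> -1) (\<lambda>_. 0)"
  by (auto simp: Jform_def fmat_def vec_eq_iff split: sum.splits)

lemma Hmat_fmat: "Hmat t = fmat (\<lambda>_. 0) (\<lambda>a. case a of Inl i \<Rightarrow> t $ i | Inr (Inl i) \<Rightarrow> t $ i | Inr (Inr k) \<Rightarrow> 0)"
  by (auto simp: Hmat_def fmat_def vec_eq_iff flip_def split: sum.splits)

lemma Pmat_Pmat: "Pmat ** Pmat = mat 1"
  unfolding Pmat_def fmat_mult fmat_1 by (rule fmat_eqI) auto

lemma Pmat_Jform: "Pmat ** Jform ** Pmat = Jflip"
  unfolding Pmat_def fmat_mult Jform_fmat Jflip_def by (rule fmat_eqI) auto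

lemma Pmat_Hmat: "Pmat ** Hmat t ** Pmat = rdiag (wt t)"
  unfolding Pmat_def fmat_mult Hmat_fmat fmat_rdiag by (rule fmat_eqI) (auto simp: algebra_simps)

lemma Jflip_Jflip: "Jflip ** Jflip = mat 1"
  unfolding Jflip_def fmat_mult fmat_1 by (rule fmat_eqI) auto

lemma Jform_Jform: "Jform ** Jform = mat 1"
  unfolding Jform_fmat fmat_mult fmat_1 by (rule fmat_eqI) auto

lemma ctrans_Pmat [simp]: "ctrans Pmat = Pmat"
  unfolding Pmat_def fmat_ctrans by (rule fmat_eqI) auto

lemma ctrans_Jflip [simp]: "ctrans Jflip = Jflip"
  unfolding Jflip_def fmat_ctrans by (rule fmat_eqI) auto

lemma ctrans_Jform [simp]: "ctrans Jform = Jform"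
  unfolding Jform_fmat fmat_ctrans by (rule fmat_eqI) auto

definition cP :: "('f::rch, 'q::finite, 's::finite) bigmat \<Rightarrow> ('f, 'q, 's) bigmat"
  where "cP X = Pmat ** X ** Pmat"

lemma cP_cP [simp]: "cP (cP X) = X"
proof -
  have "cP (cP X) = (Pmat ** Pmat) ** X ** (Pmat ** Pmat)" by (simp add: cP_def matrix_mul_assoc)
  thus ?thesis by (simp add: Pmat_Pmat)
qed

lemma cP_mult: "cP (X ** Y) = cP X ** cP Y"
proof -
  have "cP X ** cP Y = Pmat ** X ** (Pmat ** Pmat) ** Y ** Pmat" by (simp add: cP_def matrix_mul_assoc)
  thus ?thesis by (simp add: Pmat_Pmat cP_def matrix_mul_assoc)
qed

lemma cP_1 [simp]: "cP (mat 1) = mat 1"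
  by (simp add: cP_def Pmat_Pmat)

lemma cP_ctrans: "ctrans (cP X) = cP (ctrans X)"
  by (simp add: cP_def ctrans_mult matrix_mul_assoc)

lemma cP_mexp: "mexp (cP X) = cP (mexp X)"
  unfolding cP_def by (rule mexp_conjugate[OF Pmat_Pmat])

lemma linear_cP: "linear cP"
  unfolding cP_def
  by (rule linearI) (simp_all add: matrix_add_ldistrib matrix_add_rdistrib matrix_scaleR_left matrix_scaleR_right)

lemma cdet_cP: "cdet (cP X) = cdet X"
proof -
  have "cdet (cP X) = cdet X * cdet (Pmat ** Pmat :: ('a, 'b, 'c) bigmat)"
    by (simp add: cP_def cdet_mult mult_ac)
  thus ?thesis by (simp add: Pmat_Pmat)
qed

text \<open>The adjoint with respect to the form \<open>Jflip\<close>, which is the given form in the new basis.\<close>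

definition tau :: "('f::rch, 'q::finite, 's::finite) bigmat \<Rightarrow> ('f, 'q, 's) bigmat"
  where "tau X = Jflip ** ctrans X ** Jflip"

lemma tau_nth: "tau X $ a $ b = (sg a * sg b) *\<^sub>R star (X $ (flip b) $ (flip a))"
  by (simp add: tau_def Jflip_def fmat_right fmat_left mult.commute)

lemma tau_mult: "tau (X ** Y) = tau Y ** tau X"
proof -
  have "tau Y ** tau X = Jflip ** ctrans Y ** (Jflip ** Jflip) ** ctrans X ** Jflip"
    by (simp add: tau_def matrix_mul_assoc)
  thus ?thesis by (simp add: Jflip_Jflip tau_def ctrans_mult matrix_mul_assoc)
qed

lemma tau_tau [simp]: "tau (tau X) = X"
proof -
  have "tau (tau X) = (Jflip ** Jflip) ** X ** (Jflip ** Jflip)"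
    by (simp add: tau_def ctrans_mult matrix_mul_assoc)
  thus ?thesis by (simp add: Jflip_Jflip)
qed

lemma tau_1 [simp]: "tau (mat 1) = mat 1"
  by (simp add: tau_def Jflip_Jflip)

lemma linear_tau: "linear tau"
  unfolding tau_def
  by (rule linearI) (simp_all add: ctrans_add ctrans_scaleR matrix_add_ldistrib matrix_add_rdistrib
    matrix_scaleR_left matrix_scaleR_right)

lemma tau_mexp: "tau (mexp X) = mexp (tau X)"
  unfolding tau_def mexp_conjugate[OF Jflip_Jflip] mexp_ctrans ..

lemma depth_tau: "depth lev k X \<Longrightarrow> depth lev k (tau X)"
  by (simp add: depth_def tau_nth)

section \<open>The isometry group\<close>

definition isom_group :: "('f::rch, 'q::finite, 's::finite) bigmat set"
  where "isom_group = {X. ctrans X ** Jform ** X = Jform \<and> fdet X = 1}"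

lemma G_group_eq: "G_group = connected_component_set isom_group (mat 1)"
  by (simp add: G_group_def isom_group_def)

lemma fdet_1_iff: "fdet X = 1 \<longleftrightarrow> cdet X = 1"
  by (auto simp: fdet_cdet)

lemma isometry_tau_iff: "ctrans X ** Jform ** X = Jform \<longleftrightarrow> tau (cP X) ** cP X = mat 1"
proof -
  have "cP (ctrans X ** Jform ** X) = ctrans (cP X) ** Jflip ** cP X"
    by (simp add: cP_mult cP_ctrans) (simp add: cP_def Pmat_Jform)
  hence "Jflip ** cP (ctrans X ** Jform ** X) = tau (cP X) ** cP X"
    by (simp add: tau_def matrix_mul_assoc)
  moreover have "Jflip ** cP Jform = mat 1" by (simp add: cP_def Pmat_Jform Jflip_Jflip)
  moreover have "Y = cP (Jflip ** (Jflip ** cP Y))" for Y :: "('a, 'b, 'c) bigmat"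
    by (simp add: matrix_mul_assoc Jflip_Jflip)
  ultimately show ?thesis by metis
qed

lemma isom_group_iff: "X \<in> isom_group \<longleftrightarrow> tau (cP X) ** cP X = mat 1 \<and> cdet X = 1"
  by (simp add: isom_group_def isometry_tau_iff fdet_1_iff)

lemma isom_group_1: "mat 1 \<in> isom_group"
  by (simp add: isom_group_iff)

lemma isom_group_mult:
  assumes "X \<in> isom_group" "Y \<in> isom_group"
  shows "X ** Y \<in> isom_group"
proof -
  have "tau (cP (X ** Y)) ** cP (X ** Y) = tau (cP Y) ** (tau (cP X) ** cP X) ** cP Y"
    by (simp add: cP_mult tau_mult matrix_mul_assoc)
  thus ?thesis using assms by (simp add: isom_group_iff cdet_mult)
qed

lemma cP_Hmat: "cP (Hmat t) = rdiag (wt t)"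
  by (simp add: cP_def Pmat_Hmat)

definition isom_inv :: "('f::rch, 'q::finite, 's::finite) bigmat \<Rightarrow> ('f, 'q, 's) bigmat"
  where "isom_inv X = Jform ** ctrans X ** Jform"

lemma isom_inv:
  assumes "X \<in> isom_group"
  shows "isom_inv X ** X = mat 1" "X ** isom_inv X = mat 1" "isom_inv X \<in> isom_group"
proof -
  have "isom_inv X ** X = Jform ** (ctrans X ** Jform ** X)" by (simp add: isom_inv_def matrix_mul_assoc)
  also have "\<dots> = mat 1" using assms by (simp add: isom_group_def Jform_Jform)
  finally show 1: "isom_inv X ** X = mat 1" .
  show 2: "X ** isom_inv X = mat 1" by (rule matrix_left_inverse_imp_right[OF 1])
  have "X ** isom_inv X ** Jform = X ** Jform ** ctrans X ** (Jform ** Jform)"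
    by (simp add: isom_inv_def matrix_mul_assoc)
  hence 3: "X ** Jform ** ctrans X = Jform" using 2 by (simp add: Jform_Jform)
  have "ctrans (isom_inv X) ** Jform ** isom_inv X = Jform ** X ** (Jform ** Jform ** Jform) ** ctrans X ** Jform"
    by (simp add: isom_inv_def ctrans_mult matrix_mul_assoc)
  also have "\<dots> = Jform ** (X ** Jform ** ctrans X) ** Jform" by (simp add: Jform_Jform matrix_mul_assoc)
  also have "\<dots> = Jform" by (simp only: 3 Jform_Jform matrix_mul_lid)
  finally have "ctrans (isom_inv X) ** Jform ** isom_inv X = Jform" .
  moreover have "cdet (isom_inv X) * cdet X = 1" using 1 by (metis cdet_mult cdet_1)
  ultimately show "isom_inv X \<in> isom_group" using assms by (simp add: isom_group_def fdet_1_iff)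
qed

lemma connected_subset_G:
  assumes "connected S" "mat 1 \<in> S" "S \<subseteq> isom_group"
  shows "S \<subseteq> G_group"
  unfolding G_group_eq by (rule connected_component_maximal[OF assms(2,1,3)])

lemma G_subset_isom: "G_group \<subseteq> isom_group"
  unfolding G_group_eq by (rule connected_component_subset)

lemma G_1: "mat 1 \<in> G_group"
  unfolding G_group_eq using isom_group_1 by (simp add: connected_component_refl)

lemma connected_G: "connected G_group"
  unfolding G_group_eq by (rule connected_connected_component)

lemma G_mult:
  assumes "X \<in> G_group" "Y \<in> G_group"
  shows "X ** Y \<in> G_group"
proof -
  let ?S = "(\<lambda>Z. X ** Z) ` G_group \<union> G_group"
  have "connected ((\<lambda>Z. X ** Z) ` G_group)"
    by (intro connected_continuous_image continuous_intros connected_G)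
  moreover have "X \<in> (\<lambda>Z. X ** Z) ` G_group" using G_1 by force
  ultimately have "connected ?S" using connected_G assms by (intro connected_Un) auto
  moreover have "?S \<subseteq> isom_group" using G_subset_isom isom_group_mult assms by blast
  ultimately have "?S \<subseteq> G_group" using G_1 by (intro connected_subset_G) auto
  thus ?thesis using assms by blast
qed

lemma G_inv:
  assumes "X \<in> G_group"
  shows "isom_inv X \<in> G_group"
proof -
  have "connected (isom_inv ` G_group)"
    unfolding isom_inv_def by (intro connected_continuous_image continuous_intros connected_G)
  moreover have "mat 1 \<in> isom_inv ` G_group"
    by (rule image_eqI[OF _ G_1]) (simp add: isom_inv_def Jform_Jform)
  moreover have "isom_inv ` G_group \<subseteq> isom_group" using G_subset_isom isom_inv by blast
  ultimately have "isom_inv ` G_group \<subseteq> G_group" by (intro connected_subset_G)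
  thus ?thesis using assms by blast
qed

section \<open>The subgroups A and N\<close>

lemma a_elt_cP: "cP (a_elt t) = rdiag (\<lambda>a. exp (wt t a))"
  by (simp add: a_elt_def cP_mexp[symmetric]) (simp add: cP_def Pmat_Hmat mexp_rdiag)

lemma a_elt_eq: "a_elt t = cP (rdiag (\<lambda>a. exp (wt t a)))"
  by (metis a_elt_cP cP_cP)

lemma sum_wt: "(\<Sum>a\<in>UNIV. wt t (a :: 'q::finite + 'q + 's::finite)) = 0"
  by (simp add: sum_UNIV_Plus sum_negf)

lemma wt_scaleR: "wt (r *\<^sub>R t) a = r * wt t a"
  by (cases a rule: idx_cases) auto

lemma a_elt_isom: "a_elt t \<in> isom_group"
proof -
  have "cdet (cP (a_elt t :: ('a, 'b, 'c) bigmat)) = 1"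
    unfolding a_elt_cP cdet_rdiag by (simp add: exp_sum[symmetric] sum_wt)
  moreover have "tau (rdiag (\<lambda>a. exp (wt t a))) = (rdiag (\<lambda>a. exp (- wt t a)) :: ('a, 'b, 'c) bigmat)"
    by (auto simp: vec_eq_iff tau_nth rdiag_nth flip_eq_iff)
  hence "tau (cP (a_elt t)) ** cP (a_elt t) = (mat 1 :: ('a, 'b, 'c) bigmat)"
    by (simp add: a_elt_cP rdiag_mult exp_minus rdiag_1)
  ultimately show ?thesis by (simp add: isom_group_iff cdet_cP)
qed

lemma a_elt_G: "a_elt t \<in> G_group"
proof -
  let ?f = "\<lambda>r. a_elt (r *\<^sub>R t) :: ('a, 'b, 'c) bigmat"
  have "continuous_on UNIV ?f"
    unfolding a_elt_eq cP_def rdiag_def wt_scaleR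
    by (intro continuous_intros continuous_on_vec_lambda, rename_tac a b, case_tac "a = b")
       (auto intro!: continuous_intros)
  hence "connected (range ?f)" by (rule connected_continuous_image) simp
  moreover have "mat 1 \<in> range ?f"
    by (rule image_eqI[of _ _ 0]) (simp_all add: a_elt_eq wt_scaleR[of 0, simplified] rdiag_1)
  moreover have "range ?f \<subseteq> isom_group" using a_elt_isom by blast
  ultimately have "range ?f \<subseteq> G_group" by (rule connected_subset_G)
  moreover have "a_elt t \<in> range ?f" by (rule image_eqI[of _ _ 1]) simp_all
  ultimately show ?thesis by blast
qed

text \<open>The functional $\tau$ with $\tau_i = q + 1 - i$ recovers \<open>lev\<close>, hence is positive on all positive
  roots.\<close>

definition height :: "(real, 'q::{finite,linorder}) vec"
  where "height = (\<chi> i. real (CARD('q) + 1) - real (pos i))"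

lemma wt_height: "wt height a = - of_int (lev a)"
  by (cases a rule: idx_cases) (auto simp: height_def lev_simps)

lemma positive_root_height:
  assumes "\<alpha> \<in> positive_roots"
  shows "\<alpha> height \<ge> 1"
proof -
  have h: "(height :: (real, 'a) vec) $ i \<ge> 1" for i
    using pos_bounds(2)[of i] by (simp add: height_def)
  from assms consider i where "\<alpha> = (\<lambda>t. t $ i)" | i where "\<alpha> = (\<lambda>t. 2 * t $ i)"
    | i j where "i < j" "\<alpha> = (\<lambda>t. t $ i + t $ j)" | i j where "i < j" "\<alpha> = (\<lambda>t. t $ i - t $ j)"
    unfolding positive_roots_def by blast
  thus ?thesis
  proof cases
    case 1 thus ?thesis using h by simp
  next
    case (2 i) thus ?thesis using h[of i] by simp
  next
    case (3 i j) thus ?thesis using h[of i] h[of j] by simp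
  next
    case (4 i j)
    hence "pos i < pos j" by (simp add: pos_strict_mono)
    thus ?thesis using 4(2) by (simp add: height_def)
  qed
qed

lemma level_difference_root:
  assumes "lev a < lev b"
  shows "(\<lambda>t. wt t a - wt t b) \<in> positive_roots"
proof -
  have one: "(\<lambda>t. t $ i) \<in> positive_roots" and two: "(\<lambda>t. 2 * t $ i) \<in> positive_roots" for i :: 'a
    unfolding positive_roots_def by blast+
  have diff: "(\<lambda>t. t $ i - t $ j) \<in> positive_roots" if "i < j" for i j :: 'a
    using that unfolding positive_roots_def by blast
  have sum1: "(\<lambda>t. t $ i + t $ j) \<in> positive_roots" if "i < j" for i j :: 'a
    using that unfolding positive_roots_def by blast
  have sum: "(\<lambda>t. t $ i + t $ j) \<in> positive_roots" for i j :: 'a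
    using sum1[of i j] sum1[of j i] two[of j] by (cases i j rule: linorder_cases) (simp_all add: add.commute)
  have b: "int (pos i) < int CARD('a) + 1" for i :: 'a using pos_bounds(2)[of i] by simp
  show ?thesis
  proof (cases a rule: idx_cases)
    case (pl i)
    show ?thesis
    proof (cases b rule: idx_cases)
      case (pl j)
      thus ?thesis using assms \<open>a = Inl i\<close> diff by (simp add: lev_simps pos_strict_mono)
    qed (use pl sum one in simp_all)
  next
    case (mi i)
    show ?thesis
    proof (cases b rule: idx_cases)
      case (pl j)
      thus ?thesis using assms mi b[of i] b[of j] by (simp add: lev_simps)
    next
      case (mi j)
      hence "j < i" using assms \<open>a = Inr (Inl i)\<close> by (simp add: lev_simps pos_strict_mono)
      thus ?thesis using mi \<open>a = Inr (Inl i)\<close> diff by simp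
    next
      case (mid k)
      thus ?thesis using assms mi b[of i] by (simp add: lev_simps)
    qed
  next
    case (mid k)
    show ?thesis
    proof (cases b rule: idx_cases)
      case (pl j)
      thus ?thesis using assms mid b[of j] by (simp add: lev_simps)
    qed (use assms mid one in \<open>simp_all add: lev_simps\<close>)
  qed
qed

text \<open>In the weight basis $\mathfrak n$ consists of strictly upper triangular matrices.\<close>

lemma root_space_depth:
  assumes "\<alpha> \<in> positive_roots" "Z \<in> root_space \<alpha>"
  shows "depth lev 1 (cP Z)"
proof -
  have "cP (Hmat t ** Z - Z ** Hmat t) = cP (\<alpha> t *\<^sub>R Z)" for t using assms(2) by (simp add: root_space_def)
  hence "rdiag (wt t) ** cP Z - cP Z ** rdiag (wt t) = \<alpha> t *\<^sub>R cP Z" for t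
    unfolding linear_diff[OF linear_cP] linear_cmul[OF linear_cP] cP_mult cP_Hmat .
  hence "(rdiag (wt height) ** cP Z - cP Z ** rdiag (wt height)) $ a $ b = (\<alpha> height *\<^sub>R cP Z) $ a $ b" for a b
    by simp
  hence eq: "(wt height a - wt height b) *\<^sub>R cP Z $ a $ b = \<alpha> height *\<^sub>R cP Z $ a $ b" for a b
    by (simp add: rdiag_mult_nth algebra_simps)
  show ?thesis unfolding depth_def
  proof (intro allI impI)
    fix a b :: "'a + 'a + 'c" assume "lev b - lev a < 1"
    hence "lev b \<le> lev a" by simp
    hence "wt height a - wt height b \<le> 0" by (simp add: wt_height)
    hence "wt height a - wt height b \<noteq> \<alpha> height" using positive_root_height[OF assms(1)] by linarith
    thus "cP Z $ a $ b = 0" using eq[of a b] by simp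
  qed
qed

lemma N_unipotent:
  assumes "n \<in> N_group"
  shows "depth lev 1 (cP n - mat 1)"
proof -
  obtain X where X: "X \<in> span (\<Union>\<alpha>\<in>positive_roots. root_space \<alpha>)" "n = mexp X"
    using assms by (auto simp: N_group_def)
  from X(1) have "depth lev 1 (cP X)"
  proof (induction X rule: span_induct)
    case base
    show ?case
      by (auto simp: subspace_def linear_0[OF linear_cP] linear_add[OF linear_cP] linear_cmul[OF linear_cP]
          intro: depth_0 depth_add depth_scaleR)
  next
    case (step X)
    thus ?case using root_space_depth by blast
  qed
  thus ?thesis using depth_mexp by (simp add: X(2) cP_mexp[symmetric])
qed

lemma exp_nilpotent_G:
  assumes "depth lev 1 Y" "tau Y = - Y"
  shows "mexp (cP Y) \<in> G_group"
proof -
  let ?f = "\<lambda>r. mexp (r *\<^sub>R cP Y)"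
  have "?f r \<in> isom_group" for r
  proof -
    have d: "depth lev 1 (r *\<^sub>R Y)" using assms(1) by (rule depth_scaleR)
    have f: "?f r = cP (mexp (r *\<^sub>R Y))" by (simp add: cP_mexp[symmetric] linear_cmul[OF linear_cP])
    have "tau (mexp (r *\<^sub>R Y)) ** mexp (r *\<^sub>R Y) = mexp (- (r *\<^sub>R Y)) ** mexp (- (- (r *\<^sub>R Y)))"
      by (simp add: tau_mexp linear_cmul[OF linear_tau] assms(2))
    also have "\<dots> = mat 1" by (rule mexp_minus)
    finally show ?thesis
      by (simp add: f isom_group_iff cdet_cP cdet_unipotent[OF depth_mexp[OF d]])
  qed
  moreover have "connected (?f ` {0..1})"
    by (rule connected_continuous_image[OF continuous_on_mexp_ray]) simp
  moreover have "mat 1 \<in> ?f ` {0..1}" by (rule image_eqI[of _ _ 0]) simp_all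
  ultimately have "?f ` {0..1} \<subseteq> G_group" by (intro connected_subset_G) auto
  moreover have "mexp (cP Y) \<in> ?f ` {0..1}" by (rule image_eqI[of _ _ 1]) simp_all
  ultimately show ?thesis by blast
qed

text \<open>The exponential map is onto: successive corrections by the component of lowest depth of the
  error, which lies in the Lie algebra because \<open>tau\<close> respects the depth.\<close>

lemma unipotent_logarithm:
  fixes V :: "('f::rch, 'q::{finite,linorder}, 's::finite) bigmat"
  assumes V: "depth lev 1 (V - mat 1)" "tau V ** V = mat 1"
  obtains Y where "depth lev 1 Y" "tau Y = - Y" "mexp Y = V"
proof -
  have "\<exists>Y. depth lev 1 Y \<and> tau Y = - Y \<and> depth lev (int k + 1) (V - mexp Y)" for k
  proof (induction k)
    case 0
    show ?case using V(1) by (intro exI[of _ 0]) (simp add: depth_0 linear_0[OF linear_tau])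
  next
    case (Suc k)
    then obtain Y where Y: "depth lev 1 Y" "tau Y = - Y" "depth lev (int k + 1) (V - mexp Y)" by blast
    define e where "e = mexp Y"
    define R where "R = V - e"
    have te: "tau e = mexp (- Y)" by (simp add: e_def tau_mexp Y(2))
    have ee: "e ** tau e = mat 1" by (simp only: te) (simp only: e_def mexp_minus)
    have uV: "depth lev 1 (tau V - mat 1)" and ue: "depth lev 1 (tau e - mat 1)"
      using depth_tau[OF V(1)] depth_tau[OF depth_mexp[OF Y(1)]]
      by (simp_all add: linear_diff[OF linear_tau] e_def)
    have dR: "depth lev (int k + 1) R" using Y(3) by (simp add: R_def e_def)
    have "tau R = tau V - tau e" by (simp add: R_def linear_diff[OF linear_tau])
    also have "\<dots> = tau V ** (e ** tau e) - (tau V ** V) ** tau e" by (simp add: ee V(2))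
    also have "\<dots> = - (tau V ** R ** tau e)"
      by (simp add: R_def matrix_diff_ldistrib matrix_diff_rdistrib matrix_mul_assoc)
    finally have "tau R + R = R - tau V ** R ** tau e" by simp
    also have "\<dots> = - ((tau V - mat 1) ** R ** tau e + R ** (tau e - mat 1))"
      by (simp add: matrix_diff_ldistrib matrix_diff_rdistrib)
    finally have eq: "tau R + R = - ((tau V - mat 1) ** R ** tau e + R ** (tau e - mat 1))" .
    have "depth lev (1 + (int k + 1) + 0) ((tau V - mat 1) ** R ** tau e)"
      by (intro depth_mult uV dR depth_unipotent_0 ue)
    moreover have "depth lev ((int k + 1) + 1) (R ** (tau e - mat 1))"
      by (intro depth_mult ue dR)
    ultimately have sym: "depth lev (int k + 2) (tau R + R)"
      unfolding eq by (intro depth_minus depth_add) (simp_all add: add.commute)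
    define Z where "Z = (\<chi> a b. if lev b - lev a = int k + 1 then R $ a $ b else 0)"
    have dZ: "depth lev (int k + 1) Z" by (simp add: depth_def Z_def)
    have "tau Z $ a $ b = (- Z) $ a $ b" for a b
    proof (cases "lev b - lev a = int k + 1")
      case True
      hence "(tau R + R) $ a $ b = 0" using sym by (simp add: depth_def)
      hence "tau R $ a $ b = - R $ a $ b" by (simp add: eq_neg_iff_add_eq_0)
      thus ?thesis using True by (simp add: tau_nth Z_def)
    next
      case False
      thus ?thesis by (simp add: tau_nth Z_def)
    qed
    hence tZ: "tau Z = - Z" by (simp add: vec_eq_iff)
    have "depth lev (int k + 2) (R - Z)" using dR by (auto simp: depth_def Z_def)
    moreover have "depth lev (int k + 2) (mexp (Y + Z) - mexp Y - Z)"
      using depth_mexp_perturb[OF Y(1) dZ] by (simp add: add.commute add.left_commute)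
    ultimately have "depth lev (int k + 2) ((R - Z) - (mexp (Y + Z) - mexp Y - Z))" by (rule depth_diff)
    hence "depth lev (int (Suc k) + 1) (V - mexp (Y + Z))" by (simp add: R_def e_def algebra_simps)
    moreover have "depth lev 1 (Y + Z)" using Y(1) depth_mono[OF dZ] by (simp add: depth_add)
    moreover have "tau (Y + Z) = - (Y + Z)" by (simp add: linear_add[OF linear_tau] Y(2) tZ)
    ultimately show ?case by blast
  qed
  from this[of "2 * CARD('q) + 2"] obtain Y where Y: "depth lev 1 Y" "tau Y = - Y"
    and d: "depth lev (int (2 * CARD('q) + 2) + 1) (V - mexp Y)" by blast
  have lb: "\<bar>lev a\<bar> \<le> int CARD('q) + 1" for a :: "'q + 'q + 's"
  proof (cases a rule: idx_cases)
    case (pl i)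
    thus ?thesis using pos_bounds[of i] by (simp add: lev_simps abs_le_iff)
  next
    case (mi i)
    thus ?thesis using pos_bounds[of i] by (simp add: lev_simps abs_le_iff)
  qed (simp add: lev_simps)
  have "lev b - lev a < int (2 * CARD('q) + 2) + 1" for a b :: "'q + 'q + 's"
    using lb[of a] lb[of b] by simp
  hence "V - mexp Y = 0" using d by (simp add: depth_def vec_eq_iff)
  with Y that show ?thesis by simp
qed

lemma finite_positive_roots: "finite (positive_roots :: ((real, 'q::{finite,linorder}) vec \<Rightarrow> real) set)"
  unfolding positive_roots_def by (auto intro!: finite_UN_I)

text \<open>Sorting the entries of \<open>Y\<close> by the difference of the weights of row and column gives root vectors.\<close>

lemma nilpotent_in_span:
  fixes Y :: "('f::rch, 'q::{finite,linorder}, 's::finite) bigmat"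
  assumes Y: "depth lev 1 Y" "tau Y = - Y"
  shows "cP Y \<in> span (\<Union>\<alpha>\<in>positive_roots. root_space \<alpha>)"
proof -
  define w :: "'q + 'q + 's \<Rightarrow> 'q + 'q + 's \<Rightarrow> (real, 'q) vec \<Rightarrow> real"
    where "w a b = (\<lambda>t. wt t a - wt t b)" for a b
  define C where "C \<alpha> = (\<chi> a b. if w a b = \<alpha> then Y $ a $ b else 0)" for \<alpha>
  have wflip: "w (flip b) (flip a) = w a b" for a b by (simp add: w_def fun_eq_iff)
  have Csub: "cP (C \<alpha>) \<in> root_space \<alpha>" for \<alpha>
  proof -
    have d: "depth lev 1 (C \<alpha>)" using Y(1) by (simp add: depth_def C_def)
    have "tau (C \<alpha>) $ a $ b = (- C \<alpha>) $ a $ b" for a b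
      using arg_cong[OF Y(2), of "\<lambda>M. M $ a $ b"] by (auto simp: tau_nth C_def wflip)
    hence t: "tau (C \<alpha>) = - C \<alpha>" by (simp add: vec_eq_iff)
    have "mexp (s *\<^sub>R cP (C \<alpha>)) \<in> G_group" for s
    proof -
      have "mexp (cP (s *\<^sub>R C \<alpha>)) \<in> G_group"
        by (rule exp_nilpotent_G[OF depth_scaleR[OF d]]) (simp add: linear_cmul[OF linear_tau] t)
      thus ?thesis by (simp add: linear_cmul[OF linear_cP])
    qed
    moreover have "Hmat t ** cP (C \<alpha>) - cP (C \<alpha>) ** Hmat t = \<alpha> t *\<^sub>R cP (C \<alpha>)" for t
    proof -
      have "(rdiag (wt t) ** C \<alpha> - C \<alpha> ** rdiag (wt t)) $ a $ b = (\<alpha> t *\<^sub>R C \<alpha>) $ a $ b" for a b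
        by (auto simp: rdiag_mult_nth C_def w_def algebra_simps)
      hence "rdiag (wt t) ** C \<alpha> - C \<alpha> ** rdiag (wt t) = \<alpha> t *\<^sub>R C \<alpha>" by (simp add: vec_eq_iff)
      hence "cP (rdiag (wt t) ** C \<alpha> - C \<alpha> ** rdiag (wt t)) = \<alpha> t *\<^sub>R cP (C \<alpha>)"
        by (simp add: linear_cmul[OF linear_cP])
      moreover have "cP (rdiag (wt t)) = (Hmat t :: ('f, 'q, 's) bigmat)" unfolding Pmat_Hmat[symmetric] cP_def[symmetric] by simp
      ultimately show ?thesis by (simp add: linear_diff[OF linear_cP] cP_mult)
    qed
    ultimately show ?thesis by (simp add: root_space_def lie_algebra_def)
  qed
  have "Y $ a $ b = (\<Sum>\<alpha>\<in>positive_roots. C \<alpha>) $ a $ b" for a b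
  proof -
    have "(\<Sum>\<alpha>\<in>positive_roots. C \<alpha>) $ a $ b = (\<Sum>\<alpha>\<in>positive_roots. if w a b = \<alpha> then Y $ a $ b else 0)"
      by (simp add: C_def)
    also have "\<dots> = (if w a b \<in> positive_roots then Y $ a $ b else 0)"
      by (rule sum.delta'[OF finite_positive_roots])
    also have "\<dots> = Y $ a $ b"
    proof (cases "lev a < lev b")
      case True
      thus ?thesis using level_difference_root[OF True] by (simp add: w_def)
    next
      case False
      thus ?thesis using Y(1) by (simp add: depth_def)
    qed
    finally show ?thesis by simp
  qed
  hence "Y = (\<Sum>\<alpha>\<in>positive_roots. C \<alpha>)" by (simp add: vec_eq_iff)
  hence "cP Y = (\<Sum>\<alpha>\<in>positive_roots. cP (C \<alpha>))" by (simp add: linear_sum[OF linear_cP])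
  also have "\<dots> \<in> span (\<Union>\<alpha>\<in>positive_roots. root_space \<alpha>)"
    by (intro span_sum span_base) (use Csub in blast)
  finally show ?thesis .
qed

lemma unipotent_isometry_N:
  assumes "depth lev 1 (V - mat 1)" "tau V ** V = mat 1"
  shows "cP V \<in> N_group" "cP V \<in> G_group"
proof -
  obtain Y where Y: "depth lev 1 Y" "tau Y = - Y" "mexp Y = V" using unipotent_logarithm[OF assms] .
  have "cP V = mexp (cP Y)" by (simp add: cP_mexp Y(3))
  thus "cP V \<in> N_group" "cP V \<in> G_group"
    using nilpotent_in_span[OF Y(1,2)] exp_nilpotent_G[OF Y(1,2)] by (auto simp: N_group_def)
qed

section \<open>The Iwasawa decomposition\<close>

lemma lev_eq_cases:
  assumes "lev a = lev b" "a \<noteq> b"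
  obtains k l where "a = Inr (Inr k)" "b = Inr (Inr l)"
proof -
  have b: "int (pos i) < int CARD('a) + 1" for i :: 'a using pos_bounds(2)[of i] by simp
  have "(\<exists>k. a = Inr (Inr k)) \<and> (\<exists>l. b = Inr (Inr l))"
  proof (cases a rule: idx_cases)
    case (pl i)
    show ?thesis
    proof (cases b rule: idx_cases)
      case (pl j)
      thus ?thesis using assms \<open>a = Inl i\<close> by (simp add: lev_simps pos_inj)
    next
      case (mi j)
      thus ?thesis using assms pl b[of i] b[of j] by (simp add: lev_simps)
    next
      case (mid k)
      thus ?thesis using assms pl b[of i] by (simp add: lev_simps)
    qed
  next
    case (mi i)
    show ?thesis
    proof (cases b rule: idx_cases)
      case (pl j)
      thus ?thesis using assms mi b[of i] b[of j] by (simp add: lev_simps)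
    next
      case (mi j)
      thus ?thesis using assms \<open>a = Inr (Inl i)\<close> by (simp add: lev_simps pos_inj)
    next
      case (mid k)
      thus ?thesis using assms mi b[of i] by (simp add: lev_simps)
    qed
  next
    case (mid k)
    show ?thesis
    proof (cases b rule: idx_cases)
      case (pl j)
      thus ?thesis using assms mid b[of j] by (simp add: lev_simps)
    next
      case (mi j)
      thus ?thesis using assms mid b[of j] by (simp add: lev_simps)
    qed (use mid in simp)
  qed
  with that show ?thesis by blast
qed

text \<open>The factorization along the flag of weight vectors is unique, so it inherits the
  symmetry of the matrix under \<open>tau\<close>: its unipotent factor is an isometry and its diagonal factor
  is inverse to its reflection.\<close>

lemma symmetric_LDL:
  fixes S :: "('f::rch, 'q::{finite,linorder}, 's::finite) bigmat"
  assumes S: "pos_def S" and SJS: "S ** Jflip ** S = Jflip"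
  obtains V t where "depth lev 1 (V - mat 1)" "tau V ** V = mat 1"
    "S = ctrans V ** rdiag (\<lambda>a. exp (2 * wt t a)) ** V"
proof -
  obtain U where U: "depth lev 1 (U - mat 1)" and off: "\<And>a c. lev a \<noteq> lev c \<Longrightarrow> (ctrans U ** S ** U) $ a $ c = 0"
    using block_LDL[OF S, of lev] by metis
  define b where "b = ctrans U ** S ** U"
  have b: "pos_def b" unfolding b_def by (rule pos_def_congruence[OF S unipotent_inj[OF U]])
  have b0: "b $ a $ c = 0" if "lev a \<noteq> lev c" for a c using off[OF that] by (simp add: b_def)
  obtain V where UV: "U ** V = mat 1" "V ** U = mat 1" and V: "depth lev 1 (V - mat 1)"
    using unipotent_inverse[OF U] by metis
  define c where "c = Jflip ** b ** Jflip"
  define m where "m = tau U ** U"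
  define x where "x = V ** tau V"
  have tu: "depth lev 1 (tau W - mat 1)" if "depth lev 1 (W - mat 1)" for W :: "('f, 'q, 's) bigmat"
    using depth_tau[OF that] by (simp add: linear_diff[OF linear_tau])
  have dm: "depth lev 1 (m - mat 1)" unfolding m_def by (intro depth_unipotent_mult tu U)
  have dx: "depth lev 1 (x - mat 1)" unfolding x_def by (intro depth_unipotent_mult tu V)
  have "x ** m = V ** (tau V ** tau U) ** U" by (simp add: x_def m_def matrix_mul_assoc)
  hence xm: "x ** m = mat 1" by (simp add: tau_mult[symmetric] UV)
  have cnth: "c $ a $ d = (sg a * sg d) *\<^sub>R b $ (flip a) $ (flip d)" for a d
    by (simp add: c_def Jflip_def fmat_right fmat_left mult.commute)
  have bxc: "b ** x ** c = Jflip ** m ** Jflip"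
  proof -
    have "b ** x ** c = ctrans U ** S ** (U ** V) ** Jflip ** (ctrans V ** (Jflip ** Jflip) ** ctrans U) ** S ** U ** Jflip"
      by (simp add: b_def x_def c_def tau_def matrix_mul_assoc)
    also have "ctrans V ** (Jflip ** Jflip) ** ctrans U = ctrans (U ** V)"
      by (simp add: ctrans_mult Jflip_Jflip)
    also have "ctrans U ** S ** (U ** V) ** Jflip ** ctrans (U ** V) ** S ** U ** Jflip
        = ctrans U ** (S ** Jflip ** S) ** U ** Jflip"
      by (simp add: UV matrix_mul_assoc)
    also have "\<dots> = (Jflip ** Jflip) ** ctrans U ** Jflip ** U ** Jflip" by (simp add: SJS Jflip_Jflip)
    also have "\<dots> = Jflip ** m ** Jflip" by (simp add: m_def tau_def matrix_mul_assoc)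
    finally show ?thesis .
  qed
  \<comment> \<open>The left side is block upper triangular, the right side is lower unipotent.\<close>
  have "(b ** x ** c) $ a $ d = mat 1 $ a $ d" for a d
  proof (cases "lev d < lev a")
    case True
    have "depth lev 0 b" "depth lev 0 c" using b0 by (auto simp: depth_def cnth)
    hence "depth lev (0 + 0 + 0) (b ** x ** c)"
      by (intro depth_mult depth_unipotent_0[OF dx])
    hence "(b ** x ** c) $ a $ d = 0" using True by (simp add: depth_def)
    thus ?thesis using True by (auto simp: mat_nth)
  next
    case False
    hence "(m - mat 1) $ (flip a) $ (flip d) = 0" using dm by (simp add: depth_def)
    hence "m $ (flip a) $ (flip d) = (if a = d then 1 else 0)" by (simp add: mat_nth) (metis flip_flip)
    thus ?thesis unfolding bxc by (simp add: Jflip_def fmat_right fmat_left mat_nth mult.commute)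
  qed
  hence "b ** (x ** c) = mat 1" by (simp add: vec_eq_iff matrix_mul_assoc)
  hence "x ** (c ** b) = mat 1" using matrix_left_inverse_imp_right by (metis matrix_mul_assoc)
  hence "c ** b ** x = mat 1" by (rule matrix_left_inverse_imp_right)
  hence "c ** b ** (x ** m) = m" by (simp add: matrix_mul_assoc)
  hence mcb: "m = c ** b" by (simp add: xm)
  have "m $ a $ d = mat 1 $ a $ d" for a d
  proof (cases "lev a = lev d")
    case True
    thus ?thesis using dm by (simp add: depth_def)
  next
    case False
    have "c $ a $ j * b $ j $ d = 0" for j
      using False b0[of j d] b0[of "flip a" "flip j"] by (cases "lev j = lev d") (auto simp: cnth)
    hence "(c ** b) $ a $ d = 0" unfolding matrix_nth by (intro sum.neutral) blast
    thus ?thesis using False by (auto simp: mcb mat_nth)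
  qed
  hence m1: "m = mat 1" by (simp add: vec_eq_iff)
  have cb: "c ** b = mat 1" using mcb m1 by simp
  have "V = (tau U ** U) ** V" using m1 by (simp add: m_def)
  also have "\<dots> = tau U ** (U ** V)" by (simp add: matrix_mul_assoc)
  finally have VtU: "V = tau U" by (simp add: UV)
  have tV: "tau V ** V = mat 1" using UV by (simp add: VtU)
  have middle: "b *v axis (Inr (Inr k)) 1 = axis (Inr (Inr k)) 1" for k
  proof -
    define e where "e = (axis (Inr (Inr k)) 1 :: 'f^('q + 'q + 's))"
    have lev0: "lev a = 0 \<longleftrightarrow> (\<exists>l. a = Inr (Inr l))" for a :: "'q + 'q + 's"
      using lev_eq_cases[of a "Inr (Inr k)"] by (metis lev_simps(3))
    have be0: "(b *v e) $ a = 0" if "lev a \<noteq> 0" for a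
      using b0[of a "Inr (Inr k)"] that by (simp add: e_def matrix_vec_axis lev_simps)
    have cy: "c *v y = b *v y" if y: "\<And>a. lev a \<noteq> 0 \<Longrightarrow> y $ a = 0" for y
    proof -
      have eq: "c $ a $ j * y $ j = b $ a $ j * y $ j" for a j
      proof (cases "lev j = 0")
        case True
        then obtain l where l: "j = Inr (Inr l)" using lev0 by auto
        show ?thesis
        proof (cases "lev a = 0")
          case True
          then obtain l' where "a = Inr (Inr l')" using lev0 by auto
          thus ?thesis by (simp add: cnth l)
        next
          case False
          thus ?thesis using b0[of a j] b0[of "flip a" "flip j"] True by (simp add: cnth)
        qed
      qed (simp add: y)
      show ?thesis unfolding vec_eq_iff matrix_vec_nth by (intro allI sum.cong refl eq)
    qed
    have "b *v (b *v e) = c *v (b *v e)" by (rule cy[symmetric]) (rule be0)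
    also have "\<dots> = e" by (simp add: matrix_vector_mul_assoc cb)
    finally have bbe: "b *v (b *v e) = e" .
    define w where "w = b *v e - e"
    have "b *v w = - w" by (simp add: w_def linear_diff[OF linear_matrix_vec] bbe)
    hence "w \<bullet> (b *v w) \<le> 0" by simp
    hence "w = 0" using pos_defD(2)[OF b, of w] by fastforce
    thus ?thesis by (simp add: w_def e_def)
  qed
  have mid: "b $ a $ (Inr (Inr k)) = (if a = Inr (Inr k) then 1 else 0)" for a k
    using arg_cong[OF middle[of k], of "\<lambda>v. v $ a"] unfolding matrix_vec_axis by (simp add: axis_def)
  define \<beta> where "\<beta> a = b $ a $ a \<bullet> 1" for a
  have diag: "b $ a $ a = of_real (\<beta> a)" for a
    unfolding \<beta>_def by (rule star_fixed) (metis b ctrans_nth pos_defD(1))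
  have \<beta>0: "\<beta> a > 0" for a
  proof -
    have "(axis a 1 :: 'f^('q + 'q + 's)) \<noteq> 0" by (simp add: axis_eq_0_iff)
    from pos_defD(2)[OF b this] show ?thesis
      by (simp add: matrix_vec_axis inner_axis' \<beta>_def inner_commute)
  qed
  have offdiag: "b $ a $ d = 0" if "a \<noteq> d" for a d
  proof (cases "lev a = lev d")
    case True
    from lev_eq_cases[OF this that] obtain k l where "a = Inr (Inr k)" "d = Inr (Inr l)" by metis
    thus ?thesis using that by (simp add: mid)
  qed (rule b0)
  have \<beta>mid: "\<beta> (Inr (Inr k)) = 1" for k
    by (simp add: \<beta>_def mid dot_square_norm)
  have \<beta>flip: "\<beta> (flip a) * \<beta> a = 1" if "\<not> (\<exists>k. a = Inr (Inr k))" for a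
  proof -
    have caa: "c $ a $ a = of_real (\<beta> (flip a))" by (simp add: cnth diag)
    have "(c ** b) $ a $ a = (\<Sum>j\<in>UNIV. if j = a then of_real (\<beta> (flip a) * \<beta> a) else 0)"
      unfolding matrix_nth by (intro sum.cong) (auto simp: caa diag offdiag)
    hence "(of_real (\<beta> (flip a) * \<beta> a) :: 'f) = 1" by (simp add: cb mat_nth)
    thus ?thesis by (simp only: of_real_eq_1_iff)
  qed
  define t where "t = (\<chi> i :: 'q. ln (\<beta> (Inl i)) / 2)"
  have "exp (2 * wt t a) = \<beta> a" for a
  proof (cases a rule: idx_cases)
    case (pl i)
    thus ?thesis using \<beta>0[of a] by (simp add: t_def)
  next
    case (mi i)
    have "\<beta> (Inl i) * \<beta> a = 1" using \<beta>flip[of a] mi by simp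
    hence "\<beta> a = inverse (\<beta> (Inl i))" by (metis inverse_unique)
    thus ?thesis using \<beta>0[of "Inl i"] mi by (simp add: t_def exp_minus)
  next
    case (mid k)
    thus ?thesis by (simp add: \<beta>mid)
  qed
  hence "b $ a $ d = rdiag (\<lambda>a. exp (2 * wt t a)) $ a $ d" for a d
    by (cases "a = d") (simp_all add: rdiag_nth diag offdiag)
  hence bt: "b = rdiag (\<lambda>a. exp (2 * wt t a))" by (simp add: vec_eq_iff)
  have "ctrans V ** b ** V = ctrans (U ** V) ** S ** (U ** V)"
    by (simp add: b_def ctrans_mult matrix_mul_assoc)
  hence "S = ctrans V ** rdiag (\<lambda>a. exp (2 * wt t a)) ** V" using UV bt by simp
  with V tV that show ?thesis by blast
qed

lemma unitary_isometry_block: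
  assumes "ctrans k ** k = mat 1" "k \<in> isom_group"
  shows "k $ Inl i $ Inr j = 0" "k $ Inr j $ Inl i = 0"
proof -
  have "k ** ctrans k = mat 1" by (rule matrix_left_inverse_imp_right[OF assms(1)])
  hence "Jform ** k = k ** (ctrans k ** Jform ** k)" by (simp add: matrix_mul_assoc)
  also have "\<dots> = k ** Jform" using assms(2) by (simp add: isom_group_def)
  finally have "(Jform ** k) $ a $ b = (k ** Jform) $ a $ b" for a b by simp
  from this[of "Inl i" "Inr j"] this[of "Inr j" "Inl i"]
  show "k $ Inl i $ Inr j = 0" "k $ Inr j $ Inl i = 0"
    by (simp_all add: Jform_fmat fmat_left fmat_right)
       (metis add.right_neutral diff_0 eq_neg_iff_add_eq_0 scaleR_2 scaleR_eq_0_iff zero_neq_numeral)+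
qed

lemma K_unitary:
  assumes "k \<in> K_group"
  shows "ctrans k ** k = mat 1"
proof -
  have k: "k \<in> isom_group" using assms G_subset_isom by (auto simp: K_group_def)
  have "(Jform ** k) $ a $ b = (k ** Jform) $ a $ b" for a b
    using assms by (cases a; cases b) (auto simp: Jform_fmat fmat_left fmat_right K_group_def)
  hence "Jform ** k = k ** Jform" by (simp add: vec_eq_iff)
  hence "ctrans k ** k ** Jform = ctrans k ** Jform ** k" by (metis matrix_mul_assoc)
  hence "ctrans k ** k ** Jform ** Jform = Jform ** Jform" using k by (simp add: isom_group_def)
  thus ?thesis by (simp add: matrix_mul_assoc[symmetric] Jform_Jform)
qed

text \<open>\<open>topblk g\<close> holds the first $q$ coordinates of the images of the vectors $e_j + e_{q+j}$, which
  span a subspace on which \<open>N_group\<close> acts by upper triangular matrices.\<close>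

definition topblk :: "('f::rch, 'q::finite, 's::finite) bigmat \<Rightarrow> ('f, 'q) sqmat"
  where "topblk g = (\<chi> i j. g $ Inl i $ Inl j + g $ Inl i $ Inr (Inl j))"

definition blk1 :: "('f::rch, 'q::finite, 's::finite) bigmat \<Rightarrow> ('f, 'q) sqmat"
  where "blk1 g = (\<chi> i j. g $ Inl i $ Inl j)"

lemma blk1_unitary: "k \<in> K_group \<Longrightarrow> blk1 k \<in> unitary_group"
proof -
  assume k: "k \<in> K_group"
  have "(ctrans (blk1 k) ** blk1 k) $ i $ j = (ctrans k ** k) $ Inl i $ Inl j" for i j
    using k by (simp add: matrix_nth blk1_def sum_UNIV_Plus K_group_def)
  thus ?thesis by (simp add: unitary_group_def K_unitary[OF k] vec_eq_iff mat_nth)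
qed

text \<open>The factor \<open>k\<close> has no off-diagonal blocks, and \<open>n\<close> acts on the span of the $e_j + e_{q+j}$ by an
  upper triangular matrix.\<close>

lemma topblk_iwasawa:
  assumes k: "k \<in> K_group" and n: "n \<in> N_group" and g: "g = k ** a_elt t ** n"
  obtains T where "depth (\<lambda>i. int (pos i)) 1 (T - mat 1)" "topblk g = blk1 k ** rdiag (\<lambda>i. exp (t $ i)) ** T"
proof -
  define N where "N = cP n"
  have N: "depth lev 1 (N - mat 1)" unfolding N_def by (rule N_unipotent[OF n])
  define T where "T = (\<chi> i j. N $ Inl i $ Inl j)"
  have "depth (\<lambda>i. int (pos i)) 1 (T - mat 1)"
    using N by (auto simp: depth_def T_def mat_nth lev_simps dest: spec[of _ "Inl _"])
  moreover have "topblk g $ i $ j = (blk1 k ** rdiag (\<lambda>i. exp (t $ i)) ** T) $ i $ j" for i j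
  proof -
    have nP: "n = Pmat ** N ** Pmat" using cP_cP[of n] by (simp add: N_def cP_def)
    have "g ** Pmat = k ** Pmat ** rdiag (\<lambda>a. exp (wt t a)) ** (Pmat ** Pmat) ** N ** (Pmat ** Pmat)"
      by (subst g, subst nP) (simp add: a_elt_eq cP_def matrix_mul_assoc)
    hence gP: "g ** Pmat = (k ** Pmat ** rdiag (\<lambda>a. exp (wt t a))) ** N" by (simp add: Pmat_Pmat)
    have low: "N $ Inr a $ Inl j = 0" for a
    proof -
      have "lev (Inl j :: 'b + 'b + 'c) < 0" using pos_bounds(2)[of j] by (simp add: lev_simps)
      moreover have "0 \<le> lev (Inr a :: 'b + 'b + 'c)"
      proof (cases a)
        case (Inl i)
        thus ?thesis using pos_bounds(2)[of i] by (simp add: lev_simps)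
      qed (simp add: lev_simps)
      ultimately have "(N - mat 1) $ Inr a $ Inl j = 0" using N by (simp add: depth_def)
      thus ?thesis by (simp add: mat_nth)
    qed
    have kP: "(k ** Pmat) $ Inl i $ Inl l = sqrt (1 / 2) *\<^sub>R k $ Inl i $ Inl l" for l
      using k by (simp add: Pmat_def fmat_right K_group_def)
    have "(g ** Pmat) $ Inl i $ Inl j = (\<Sum>l\<in>UNIV. (exp (t $ l) * sqrt (1 / 2)) *\<^sub>R k $ Inl i $ Inl l * N $ Inl l $ Inl j)"
      unfolding gP matrix_nth[of _ N] by (simp add: sum_UNIV_Plus low rdiag_mult_nth kP)
    also have "\<dots> = sqrt (1 / 2) *\<^sub>R (blk1 k ** rdiag (\<lambda>i. exp (t $ i)) ** T) $ i $ j"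
      unfolding matrix_nth[of _ T] by (simp add: T_def rdiag_mult_nth blk1_def scaleR_sum_right mult.commute)
    finally have "sqrt (1 / 2) *\<^sub>R topblk g $ i $ j = sqrt (1 / 2) *\<^sub>R (blk1 k ** rdiag (\<lambda>i. exp (t $ i)) ** T) $ i $ j"
      by (simp add: Pmat_def fmat_right topblk_def scaleR_add_right)
    thus ?thesis by simp
  qed
  ultimately show ?thesis using that by (metis vec_eq_iff)
qed

lemma rdiag_inj: "(\<And>i. a i \<noteq> 0) \<Longrightarrow> rdiag a *v v = 0 \<Longrightarrow> v = 0"
  by (simp add: rdiag_vec vec_eq_iff)

lemma topblk_minors:
  assumes k: "k \<in> K_group" and n: "n \<in> N_group" and g: "g = k ** a_elt t ** n"
  shows "pos_def (ctrans (topblk g) ** topblk g)"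
    "Delta r (ctrans (topblk g) ** topblk g) = (\<Prod>i | pos i \<le> r. exp (2 * t $ i))"
proof -
  obtain T where T: "depth (\<lambda>i. int (pos i)) 1 (T - mat 1)"
    and eq: "topblk g = blk1 k ** rdiag (\<lambda>i. exp (t $ i)) ** T"
    using topblk_iwasawa[OF assms] by metis
  have "v = 0" if "topblk g *v v = 0" for v
  proof -
    have "blk1 k *v (rdiag (\<lambda>i. exp (t $ i)) *v (T *v v)) = 0"
      using that by (simp add: eq matrix_vector_mul_assoc matrix_mul_assoc)
    hence "rdiag (\<lambda>i. exp (t $ i)) *v (T *v v) = 0" by (rule unitary_inj[OF blk1_unitary[OF k]])
    hence "T *v v = 0" by (rule rdiag_inj[rotated]) simp
    thus ?thesis by (rule unipotent_inj[OF T])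
  qed
  thus 1: "pos_def (ctrans (topblk g) ** topblk g)" by (rule pos_def_gram)
  have "ctrans (topblk g) ** topblk g = ctrans T ** rdiag (\<lambda>i. exp (t $ i)) ** (ctrans (blk1 k) ** blk1 k)
      ** rdiag (\<lambda>i. exp (t $ i)) ** T"
    by (simp add: eq ctrans_mult matrix_mul_assoc)
  also have "\<dots> = ctrans T ** (rdiag (\<lambda>i. exp (t $ i)) ** rdiag (\<lambda>i. exp (t $ i))) ** T"
    by (simp add: unitary_groupD[OF blk1_unitary[OF k]] matrix_mul_assoc)
  also have "\<dots> = ctrans T ** rdiag (\<lambda>i. exp (2 * t $ i)) ** T"
    by (simp add: rdiag_mult mult_exp_exp)
  finally have 2: "ctrans (topblk g) ** topblk g = ctrans T ** rdiag (\<lambda>i. exp (2 * t $ i)) ** T" .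
  show "Delta r (ctrans (topblk g) ** topblk g) = (\<Prod>i | pos i \<le> r. exp (2 * t $ i))"
    unfolding 2 by (rule Delta_LDL[OF T]) (use 1 2 in auto)
qed

text \<open>The factorization \<open>symmetric_LDL\<close> is applied to $g^* g$; what remains of \<open>g\<close> after removal of the unipotent
  factor and of the root of the diagonal factor is a unitary isometry.\<close>

lemma iwasawa_exists:
  assumes g: "g \<in> G_group"
  obtains k t n where "k \<in> K_group" "n \<in> N_group" "g = k ** a_elt t ** n"
proof -
  define X where "X = cP g"
  have gi: "g \<in> isom_group" using g G_subset_isom by blast
  have tX: "tau X ** X = mat 1" using gi by (simp add: isom_group_iff X_def)
  hence Xt: "X ** tau X = mat 1" by (rule matrix_left_inverse_imp_right)
  have XJX: "ctrans X ** Jflip ** X = Jflip"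
  proof -
    have "Jflip ** (tau X ** X) = (Jflip ** Jflip) ** ctrans X ** Jflip ** X" by (simp add: tau_def matrix_mul_assoc)
    thus ?thesis by (simp add: tX Jflip_Jflip)
  qed
  have XJX': "X ** Jflip ** ctrans X = Jflip"
  proof -
    have "(X ** tau X) ** Jflip = X ** Jflip ** ctrans X ** (Jflip ** Jflip)" by (simp add: tau_def matrix_mul_assoc)
    thus ?thesis by (simp add: Xt Jflip_Jflip)
  qed
  define S where "S = ctrans X ** X"
  have "pos_def S" unfolding S_def by (rule pos_def_gram) (rule invertible_inj[OF tX])
  moreover have "S ** Jflip ** S = Jflip"
  proof -
    have "S ** Jflip ** S = ctrans X ** (X ** Jflip ** ctrans X) ** X" by (simp add: S_def matrix_mul_assoc)
    thus ?thesis by (simp add: XJX XJX')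
  qed
  ultimately obtain V t where V: "depth lev 1 (V - mat 1)" "tau V ** V = mat 1"
    and S: "S = ctrans V ** rdiag (\<lambda>a. exp (2 * wt t a)) ** V"
    by (rule symmetric_LDL)
  define n where "n = cP V"
  have n: "n \<in> N_group" "n \<in> G_group" using unipotent_isometry_N[OF V] by (simp_all add: n_def)
  hence ni: "n \<in> isom_group" using G_subset_isom by blast
  define k where "k = g ** isom_inv n ** isom_inv (a_elt t)"
  have kG: "k \<in> G_group" unfolding k_def by (intro G_mult G_inv g n a_elt_G)
  have gk: "g = k ** a_elt t ** n"
  proof -
    have "k ** a_elt t ** n = g ** isom_inv n ** (isom_inv (a_elt t) ** a_elt t) ** n"
      by (simp add: k_def matrix_mul_assoc)
    also have "\<dots> = g ** (isom_inv n ** n)" by (simp add: isom_inv(1)[OF a_elt_isom] matrix_mul_assoc)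
    finally show ?thesis by (simp add: isom_inv(1)[OF ni])
  qed
  define A where "A = (rdiag (\<lambda>a. exp (wt t a)) :: ('a, 'b, 'c) bigmat)"
  define A' where "A' = (rdiag (\<lambda>a. exp (- wt t a)) :: ('a, 'b, 'c) bigmat)"
  have AA: "A ** A' = mat 1" "A' ** A = mat 1" by (simp_all add: A_def A'_def rdiag_mult exp_minus rdiag_1)
  have VV: "V ** tau V = mat 1" by (rule matrix_left_inverse_imp_right[OF V(2)])
  have "X = cP k ** A ** V" by (simp add: X_def gk cP_mult a_elt_cP A_def n_def)
  hence "X ** tau V ** A' = cP k ** A ** (V ** tau V) ** A'" by (simp add: matrix_mul_assoc)
  also have "\<dots> = cP k ** (A ** A')" by (simp add: VV matrix_mul_assoc)
  finally have ck: "cP k = X ** tau V ** A'" by (simp add: AA)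
  have "ctrans (cP k) ** cP k = A' ** ctrans (tau V) ** S ** tau V ** A'"
    by (simp add: ck S_def ctrans_mult matrix_mul_assoc A'_def)
  also have "S = ctrans V ** (A ** A) ** V"
    by (simp add: S A_def rdiag_mult mult_exp_exp)
  also have "A' ** ctrans (tau V) ** (ctrans V ** (A ** A) ** V) ** tau V ** A'
      = A' ** ctrans (V ** tau V) ** A ** A ** (V ** tau V) ** A'"
    by (simp add: ctrans_mult matrix_mul_assoc)
  also have "\<dots> = (A' ** A) ** (A ** A')" by (simp add: VV matrix_mul_assoc)
  finally have "ctrans (cP k) ** cP k = mat 1" by (simp add: AA)
  hence "cP (ctrans k ** k) = mat 1" by (simp add: cP_mult cP_ctrans)
  hence ku: "ctrans k ** k = mat 1" by (metis cP_cP cP_1)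
  have "k \<in> K_group"
    using kG G_subset_isom unitary_isometry_block[OF ku] by (auto simp: K_group_def)
  with gk n(1) that show ?thesis by blast
qed

text \<open>The minors of the Gram matrix of \<open>topblk g\<close> determine the component in \<open>A\<close>.\<close>

lemma iwasawa_unique:
  assumes "k \<in> K_group" "n \<in> N_group" "g = k ** a_elt t ** n"
    and "k' \<in> K_group" "n' \<in> N_group" "g = k' ** a_elt t' ** n'"
  shows "t = t'"
proof -
  have "t $ i = t' $ i" for i
  proof -
    let ?L = "{j. pos j \<le> pos i - 1}"
    have split: "{j. pos j \<le> pos i} = insert i ?L" "i \<notin> ?L" "finite ?L"
      using pos_bounds(1)[of i] by (auto simp: pos_inj[symmetric])
    have eq: "(\<Prod>i | pos i \<le> r. exp (2 * t $ i)) = (\<Prod>i | pos i \<le> r. exp (2 * t' $ i))" for r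
      using topblk_minors(2)[OF assms(1-3), of r] topblk_minors(2)[OF assms(4-6), of r] by simp
    have "exp (2 * t $ i) * (\<Prod>i\<in>?L. exp (2 * t $ i)) = exp (2 * t' $ i) * (\<Prod>i\<in>?L. exp (2 * t' $ i))"
      using eq[of "pos i"] unfolding split(1) prod.insert[OF split(3,2)] .
    moreover have "(\<Prod>i\<in>?L. exp (2 * t' $ i)) \<noteq> 0" by (simp add: prod_zero_iff)
    ultimately have "exp (2 * t $ i) = exp (2 * t' $ i)" unfolding eq[of "pos i - 1"] by simp
    thus ?thesis by simp
  qed
  thus ?thesis by (simp add: vec_eq_iff)
qed

text \<open>This turns the integrand of the spherical function into a power function.\<close>

lemma iwasawa_Delta:
  assumes g: "g \<in> G_group"
  shows "Delta_power ((1 / 2) *s \<mu>) (ctrans (topblk g) ** topblk g) =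
      exp (\<Sum>i\<in>UNIV. \<mu> $ i * of_real (iwasawa_H g $ i))"
proof -
  obtain k t n where d: "k \<in> K_group" "n \<in> N_group" "g = k ** a_elt t ** n" by (rule iwasawa_exists[OF g])
  have "iwasawa_H g = t"
    unfolding iwasawa_H_def
    by (rule the_equality) (use d iwasawa_unique in blast)+
  thus ?thesis using topblk_minors(2)[OF d] by (simp add: Delta_power_exp)
qed

section \<open>Uniformly distributed measures\<close>

lemma sets_restrict_borelI: "B \<in> sets borel \<Longrightarrow> B \<inter> S \<in> sets (restrict_space borel S)"
  unfolding sets_restrict_space by (metis Int_commute imageI)

text \<open>Otherwise countably many null sets of this form would cover \<open>S\<close>.\<close>

lemma ball_measure_positive:
  fixes M :: "'a::euclidean_space measure"
  assumes M: "finite_measure M" "space M = S" "sets M = sets (restrict_space borel S)" "emeasure M S \<noteq> 0"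
    and r: "r > 0" and x0: "x0 \<in> S" and eq: "\<And>x. x \<in> S \<Longrightarrow> emeasure M (ball x r \<inter> S) = emeasure M (ball x0 r \<inter> S)"
  shows "emeasure M (ball x0 r \<inter> S) \<noteq> 0"
proof
  assume z: "emeasure M (ball x0 r \<inter> S) = 0"
  let ?F = "(\<lambda>x. ball x r) ` S"
  have "open B" if "B \<in> ?F" for B using that by auto
  from Lindelof[OF this] obtain F' where F': "F' \<subseteq> ?F" "countable F'" "\<Union>F' = \<Union>?F" by blast
  have "(\<Union>B\<in>F'. B \<inter> S) \<in> null_sets M"
  proof (rule null_sets_UN'[OF F'(2)])
    fix B assume "B \<in> F'"
    then obtain x where x: "x \<in> S" "B = ball x r" using F'(1) by auto
    have "ball x r \<inter> S \<in> sets M" unfolding M(3) by (rule sets_restrict_borelI) simp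
    thus "B \<inter> S \<in> null_sets M" using eq[OF x(1)] z x(2) by (auto simp: null_sets_def)
  qed
  moreover have "(\<Union>B\<in>F'. B \<inter> S) = S"
  proof -
    have "S \<subseteq> \<Union>?F" using r by auto
    thus ?thesis using F'(3) by blast
  qed
  ultimately show False using M(4) by (simp add: null_sets_def)
qed

text \<open>If all balls of a given radius with centre in \<open>S\<close> have the same mass for each of two measures
  of equal total mass, then the measures coincide: comparing the two orders of integration of the
  indicator of pairs of points at distance less than $r$ bounds the mass of a closed set by the mass of its
  $r$-neighbourhood.\<close>

lemma uniformly_distributed_le:
  fixes M N :: "'a::euclidean_space measure"
  assumes M: "finite_measure M" "space M = S" "sets M = sets (restrict_space borel S)"
    and N: "finite_measure N" "space N = S" "sets N = sets (restrict_space borel S)"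
    and mass: "emeasure M S = emeasure N S"
    and Mb: "\<And>x y r. x \<in> S \<Longrightarrow> y \<in> S \<Longrightarrow> r > 0 \<Longrightarrow> emeasure M (ball x r \<inter> S) = emeasure M (ball y r \<inter> S)"
    and Nb: "\<And>x y r. x \<in> S \<Longrightarrow> y \<in> S \<Longrightarrow> r > 0 \<Longrightarrow> emeasure N (ball x r \<inter> S) = emeasure N (ball y r \<inter> S)"
    and C: "closed C"
  shows "emeasure M (C \<inter> S) \<le> emeasure N (C \<inter> S)"
proof (cases "emeasure M S = 0")
  case True
  hence "emeasure M (C \<inter> S) = 0"
    by (metis Int_lower2 M(2) emeasure_mono le_zero_eq sets.top)
  thus ?thesis by simp
next
  case False
  hence "S \<noteq> {}" by auto
  then obtain x0 where x0: "x0 \<in> S" by blast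
  interpret M: finite_measure M by fact
  interpret N: finite_measure N by fact
  interpret P: pair_sigma_finite M N ..
  have inS: "A \<inter> S \<in> sets M" "A \<inter> S \<in> sets N" if "A \<in> sets borel" for A
    unfolding M(3) N(3) using that by (auto intro: sets_restrict_borelI)
  have idm: "(\<lambda>x. x) \<in> borel_measurable M" "(\<lambda>x. x) \<in> borel_measurable N"
    by (simp_all add: measurable_cong_sets[OF M(3) refl] measurable_cong_sets[OF N(3) refl] measurable_restrict_space1)
  have dm: "(\<lambda>(x, y). indicator C' x * (if dist x y < r then 1 else 0) :: ennreal) \<in> borel_measurable (M \<Otimes>\<^sub>M N)"
    if "C' \<in> sets borel" for C' r
  proof -
    have f: "(\<lambda>p. fst p) \<in> M \<Otimes>\<^sub>M N \<rightarrow>\<^sub>M borel" and s: "(\<lambda>p. snd p) \<in> M \<Otimes>\<^sub>M N \<rightarrow>\<^sub>M borel"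
      using measurable_compose[OF measurable_fst idm(1)] measurable_compose[OF measurable_snd idm(2)] by auto
    show ?thesis unfolding case_prod_beta using f s that by measurable
  qed
  have key: "(\<integral>\<^sup>+x. indicator C' x * emeasure N (ball x r \<inter> S) \<partial>M) = (\<integral>\<^sup>+y. emeasure M (C' \<inter> ball y r \<inter> S) \<partial>N)"
    if C': "C' \<in> sets borel" for C' r
  proof -
    have "(\<integral>\<^sup>+x. indicator C' x * emeasure N (ball x r \<inter> S) \<partial>M) =
        (\<integral>\<^sup>+x. \<integral>\<^sup>+y. indicator C' x * (if dist x y < r then 1 else 0) \<partial>N \<partial>M)"
    proof (rule nn_integral_cong)
      fix x
      have "(\<integral>\<^sup>+y. indicator C' x * (if dist x y < r then 1 else 0) \<partial>N) = (\<integral>\<^sup>+y. indicator C' x * indicator (ball x r \<inter> S) y \<partial>N)"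
        by (rule nn_integral_cong) (auto simp: indicator_def N(2))
      also have "\<dots> = indicator C' x * emeasure N (ball x r \<inter> S)"
        using inS(2)[of "ball x r"] by (subst nn_integral_cmult_indicator) auto
      finally show "indicator C' x * emeasure N (ball x r \<inter> S) =
        (\<integral>\<^sup>+y. indicator C' x * (if dist x y < r then 1 else 0) \<partial>N)" by simp
    qed
    also have "\<dots> = (\<integral>\<^sup>+y. \<integral>\<^sup>+x. indicator C' x * (if dist x y < r then 1 else 0) \<partial>M \<partial>N)"
      by (rule P.Fubini'[OF dm[OF C'], symmetric])
    also have "\<dots> = (\<integral>\<^sup>+y. emeasure M (C' \<inter> ball y r \<inter> S) \<partial>N)"
    proof (rule nn_integral_cong)
      fix y
      have "(\<integral>\<^sup>+x. indicator C' x * (if dist x y < r then 1 else 0) \<partial>M) = (\<integral>\<^sup>+x. indicator (C' \<inter> ball y r \<inter> S) x \<partial>M)"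
        by (rule nn_integral_cong) (auto simp: indicator_def M(2) dist_commute)
      also have "\<dots> = emeasure M (C' \<inter> ball y r \<inter> S)"
        using inS(1)[of "C' \<inter> ball y r"] C' by (subst nn_integral_indicator) auto
      finally show "(\<integral>\<^sup>+x. indicator C' x * (if dist x y < r then 1 else 0) \<partial>M) = emeasure M (C' \<inter> ball y r \<inter> S)" .
    qed
    finally show ?thesis .
  qed
  have bound: "emeasure M (C \<inter> S) \<le> emeasure N ((\<Union>x\<in>C. ball x r) \<inter> S)" if r: "r > 0" for r
  proof -
    define cM where "cM = emeasure M (ball x0 r \<inter> S)"
    define cN where "cN = emeasure N (ball x0 r \<inter> S)"
    have N_b: "emeasure N (ball x r \<inter> S) = cN" and M_b: "emeasure M (ball x r \<inter> S) = cM" if "x \<in> S" for x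
      using Mb[OF that x0 r] Nb[OF that x0 r] by (simp_all add: cM_def cN_def)
    have S0: "emeasure M S \<noteq> \<infinity>" using M(2) M.emeasure_finite by auto
    have c1: "(\<integral>\<^sup>+x. indicator C' x * emeasure N (ball x r \<inter> S) \<partial>M) = cN * emeasure M (C' \<inter> S)" if "C' \<in> sets borel" for C'
    proof -
      have "(\<integral>\<^sup>+x. indicator C' x * emeasure N (ball x r \<inter> S) \<partial>M) = (\<integral>\<^sup>+x. cN * indicator (C' \<inter> S) x \<partial>M)"
        by (rule nn_integral_cong) (auto simp: M(2) N_b indicator_def)
      also have "\<dots> = cN * emeasure M (C' \<inter> S)" using inS(1)[OF that] by (rule nn_integral_cmult_indicator)
      finally show ?thesis .
    qed
    have "cN * emeasure M S = (\<integral>\<^sup>+y. emeasure M (UNIV \<inter> ball y r \<inter> S) \<partial>N)"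
      using key[of UNIV r] c1[of UNIV] by simp
    also have "\<dots> = (\<integral>\<^sup>+y. cM * indicator S y \<partial>N)"
      by (rule nn_integral_cong) (auto simp: N(2) M_b)
    also have "\<dots> = cM * emeasure N S" using N(2) by (subst nn_integral_cmult_indicator) auto
    finally have "cN * emeasure M S = cM * emeasure M S" using mass by simp
    hence cc: "cN = cM"
      using False S0 by (metis ennreal_mult_cancel_left mult.commute top.not_eq_extremum infinity_ennreal_def)
    have cM0: "cM \<noteq> 0" unfolding cM_def
      by (rule ball_measure_positive[OF M False r x0]) (rule Mb[OF _ x0 r])
    have cMf: "cM \<noteq> \<infinity>" unfolding cM_def using M.emeasure_finite by auto
    have "cN * emeasure M (C \<inter> S) = (\<integral>\<^sup>+y. emeasure M (C \<inter> ball y r \<inter> S) \<partial>N)"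
      using key[of C r] c1[of C] C by simp
    also have "\<dots> \<le> (\<integral>\<^sup>+y. cM * indicator ((\<Union>x\<in>C. ball x r) \<inter> S) y \<partial>N)"
    proof (rule nn_integral_mono)
      fix y assume "y \<in> space N"
      hence y: "y \<in> S" by (simp add: N(2))
      show "emeasure M (C \<inter> ball y r \<inter> S) \<le> cM * indicator ((\<Union>x\<in>C. ball x r) \<inter> S) y"
      proof (cases "y \<in> (\<Union>x\<in>C. ball x r)")
        case True
        have "emeasure M (C \<inter> ball y r \<inter> S) \<le> emeasure M (ball y r \<inter> S)"
          by (rule emeasure_mono) (use inS(1)[of "ball y r"] in auto)
        thus ?thesis using True y M_b[OF y] by simp
      next
        case False
        hence "C \<inter> ball y r = {}" by (auto simp: dist_commute)
        thus ?thesis by simp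
      qed
    qed
    also have "\<dots> = cM * emeasure N ((\<Union>x\<in>C. ball x r) \<inter> S)"
      by (rule nn_integral_cmult_indicator[OF inS(2)]) (auto intro!: borel_open)
    finally have "cM * emeasure M (C \<inter> S) \<le> cM * emeasure N ((\<Union>x\<in>C. ball x r) \<inter> S)" using cc by simp
    thus ?thesis using cM0 cMf by (metis ennreal_mult_le_mult_iff infinity_ennreal_def)
  qed
  let ?A = "\<lambda>n::nat. (\<Union>x\<in>C. ball x (1 / real (Suc n))) \<inter> S"
  have "(\<Inter>n. ?A n) = C \<inter> S"
  proof
    show "C \<inter> S \<subseteq> (\<Inter>n. ?A n)" by auto
    show "(\<Inter>n. ?A n) \<subseteq> C \<inter> S"
    proof
      fix y assume y: "y \<in> (\<Inter>n. ?A n)"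
      have "\<exists>x\<in>C. dist x y < e" if "e > 0" for e
      proof -
        obtain n where "1 / real (Suc n) < e" using \<open>e > 0\<close> by (metis nat_approx_posE)
        moreover obtain x where "x \<in> C" "dist x y < 1 / real (Suc n)" using y by (auto simp: dist_commute)
        ultimately show ?thesis by force
      qed
      hence "y \<in> closure C" by (auto simp: closure_approachable)
      thus "y \<in> C \<inter> S" using y C by auto
    qed
  qed
  moreover have "(\<lambda>n. emeasure N (?A n)) \<longlonglongrightarrow> emeasure N (\<Inter>n. ?A n)"
  proof (rule Lim_emeasure_decseq)
    show "range ?A \<subseteq> sets N" by (auto intro!: inS borel_open)
    show "decseq ?A"
    proof (rule decseq_SucI)
      fix n
      have "1 / real (Suc (Suc n)) \<le> 1 / real (Suc n)" by (simp add: frac_le)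
      hence "ball x (1 / real (Suc (Suc n))) \<subseteq> ball x (1 / real (Suc n))" for x :: 'a by (rule subset_ball)
      thus "?A (Suc n) \<subseteq> ?A n" by blast
    qed
  qed auto
  ultimately have "(\<lambda>n. emeasure N (?A n)) \<longlonglongrightarrow> emeasure N (C \<inter> S)" by simp
  thus ?thesis by (rule LIMSEQ_le_const) (use bound in auto)
qed

lemma uniformly_distributed_unique:
  fixes M N :: "'a::euclidean_space measure"
  assumes M: "finite_measure M" "space M = S" "sets M = sets (restrict_space borel S)"
    and N: "finite_measure N" "space N = S" "sets N = sets (restrict_space borel S)"
    and mass: "emeasure M S = emeasure N S"
    and Mb: "\<And>x y r. x \<in> S \<Longrightarrow> y \<in> S \<Longrightarrow> r > 0 \<Longrightarrow> emeasure M (ball x r \<inter> S) = emeasure M (ball y r \<inter> S)"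
    and Nb: "\<And>x y r. x \<in> S \<Longrightarrow> y \<in> S \<Longrightarrow> r > 0 \<Longrightarrow> emeasure N (ball x r \<inter> S) = emeasure N (ball y r \<inter> S)"
  shows "M = N"
proof (rule measure_eqI_generator_eq[where E="{C \<inter> S |C. closed C}" and \<Omega>=S and A="\<lambda>_. S"])
  have gen: "sets (restrict_space borel S) = sigma_sets S {C \<inter> S |C. closed (C :: 'a set)}"
  proof -
    have "sets (restrict_space (borel :: 'a measure) S) = {(\<lambda>x. x) -` A \<inter> S |A. A \<in> sigma_sets UNIV (Collect closed)}"
      by (auto simp: sets_restrict_space borel_eq_closed sets_measure_of)
    also have "\<dots> = sigma_sets S {(\<lambda>x. x) -` A \<inter> S |A. A \<in> Collect closed}"
      by (rule sigma_sets_vimage_commute) auto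
    finally show ?thesis by simp
  qed
  show "Int_stable {C \<inter> S |C. closed (C :: 'a set)}"
  proof (rule Int_stableI)
    fix a b assume "a \<in> {C \<inter> S |C. closed C}" "b \<in> {C \<inter> S |C. closed C}"
    then obtain C D where "a = C \<inter> S" "b = D \<inter> S" "closed C" "closed D" by blast
    hence "a \<inter> b = (C \<inter> D) \<inter> S" "closed (C \<inter> D)" by auto
    thus "a \<inter> b \<in> {C \<inter> S |C. closed C}" by blast
  qed
  show "sets M = sigma_sets S {C \<inter> S |C. closed (C :: 'a set)}" "sets N = sigma_sets S {C \<inter> S |C. closed (C :: 'a set)}"
    using M(3) N(3) gen by simp_all
  show "emeasure M X = emeasure N X" if "X \<in> {C \<inter> S |C. closed C}" for X
  proof -
    obtain C where C: "X = C \<inter> S" "closed C" using \<open>X \<in> _\<close> by blast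
    have "emeasure M (C \<inter> S) \<le> emeasure N (C \<inter> S)"
      by (rule uniformly_distributed_le[OF M N mass Mb Nb C(2)])
    moreover have "emeasure N (C \<inter> S) \<le> emeasure M (C \<inter> S)"
      by (rule uniformly_distributed_le[OF N M mass[symmetric] Nb Mb C(2)])
    ultimately show ?thesis using C by simp
  qed
  show "range (\<lambda>_. S) \<subseteq> {C \<inter> S |C. closed (C :: 'a set)}" by (auto intro: exI[of _ UNIV])
  show "emeasure M S \<noteq> \<infinity>" using finite_measure.emeasure_finite[OF M(1)] by simp
qed auto

section \<open>Uniqueness of the normalized Haar measure\<close>

definition unitary_subgroup :: "('f::rch, 'n::finite) sqmat set \<Rightarrow> bool"
  where "unitary_subgroup S \<longleftrightarrow> S \<subseteq> unitary_group \<and> mat 1 \<in> S \<and>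
    (\<forall>x\<in>S. \<forall>y\<in>S. x ** y \<in> S) \<and> (\<forall>x\<in>S. ctrans x \<in> S)"

text \<open>Left translations by unitary matrices are isometries, hence permute the balls with centre in \<open>S\<close>.\<close>

lemma haar_balls:
  fixes S :: "('f::rch, 'n::finite) sqmat set"
  assumes S: "unitary_subgroup S" and \<mu>: "normalized_haar S \<mu>" and xy: "x \<in> S" "y \<in> S"
  shows "emeasure \<mu> (ball x r \<inter> S) = emeasure \<mu> (ball y r \<inter> S)"
proof -
  define g where "g = y ** ctrans x"
  have g: "g \<in> S" using S xy by (auto simp: g_def unitary_subgroup_def)
  have gU: "g \<in> unitary_group" and xU: "x \<in> unitary_group" using g xy S by (auto simp: unitary_subgroup_def)
  have gx: "g ** x = y" by (simp add: g_def matrix_mul_assoc[symmetric] unitary_groupD[OF xU])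
  have dist: "dist (g ** a) (g ** b) = dist a b" for a b
    by (simp add: dist_norm matrix_diff_ldistrib[symmetric] norm_isometry_left unitary_groupD[OF gU])
  have "(**) g ` (ball x r \<inter> S) = ball y r \<inter> S"
  proof
    show "(**) g ` (ball x r \<inter> S) \<subseteq> ball y r \<inter> S"
      using g S dist[of x] by (auto simp: unitary_subgroup_def gx)
    show "ball y r \<inter> S \<subseteq> (**) g ` (ball x r \<inter> S)"
    proof
      fix z assume z: "z \<in> ball y r \<inter> S"
      have gz: "g ** (ctrans g ** z) = z" by (simp add: matrix_mul_assoc unitary_groupD[OF gU])
      have "ctrans g ** z \<in> S" using S g z by (auto simp: unitary_subgroup_def)
      moreover have "dist x (ctrans g ** z) < r" using z dist[of x "ctrans g ** z"] by (simp add: gx gz)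
      ultimately show "z \<in> (**) g ` (ball x r \<inter> S)" using gz by (metis IntI image_eqI mem_ball)
    qed
  qed
  moreover have "ball x r \<inter> S \<in> sets \<mu>"
    using \<mu> sets_restrict_borelI[of "ball x r" S] by (simp add: normalized_haar_def)
  hence "emeasure \<mu> ((**) g ` (ball x r \<inter> S)) = emeasure \<mu> (ball x r \<inter> S)"
    using \<mu> g unfolding normalized_haar_def by blast
  ultimately show ?thesis by simp
qed

lemma haar_unique:
  fixes S :: "('f::rch, 'n::finite) sqmat set"
  assumes S: "unitary_subgroup S" and \<mu>: "normalized_haar S \<mu>" and \<nu>: "normalized_haar S \<nu>"
  shows "\<mu> = \<nu>"
proof (rule uniformly_distributed_unique)
  show "finite_measure \<mu>" "finite_measure \<nu>" using \<mu> \<nu> by (auto simp: normalized_haar_def prob_space_def)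
  show "space \<mu> = S" "space \<nu> = S" "sets \<mu> = sets (restrict_space borel S)" "sets \<nu> = sets (restrict_space borel S)"
    using \<mu> \<nu> by (auto simp: normalized_haar_def)
  show "emeasure \<mu> S = emeasure \<nu> S"
    using \<mu> \<nu> prob_space.emeasure_space_1 unfolding normalized_haar_def by metis
  show "emeasure \<mu> (ball x r \<inter> S) = emeasure \<mu> (ball y r \<inter> S)"
    and "emeasure \<nu> (ball x r \<inter> S) = emeasure \<nu> (ball y r \<inter> S)" if "x \<in> S" "y \<in> S" for x y r
    by (rule haar_balls[OF S \<mu> that], rule haar_balls[OF S \<nu> that])
qed

text \<open>Pushing a Haar measure forward along a surjective homomorphism, or along a right translation,
  gives a Haar measure again.\<close>

lemma haar_distr:
  fixes S :: "('f::rch, 'n::finite) sqmat set" and T :: "('f, 'm::finite) sqmat set"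
  assumes \<mu>: "normalized_haar S \<mu>" and \<nu>: "normalized_haar T \<nu>"
    and S: "unitary_subgroup S" and T: "unitary_subgroup T"
    and F: "continuous_on UNIV F" "F ` S \<subseteq> T"
    and equi: "\<And>g. g \<in> T \<Longrightarrow> \<exists>h\<in>S. \<forall>k\<in>S. F (h ** k) = g ** F k"
  shows "distr \<mu> \<nu> F = \<nu>"
proof (rule haar_unique[OF T _ \<nu>])
  have sp: "space \<mu> = S" "space \<nu> = T" "sets \<mu> = sets (restrict_space borel S)" "sets \<nu> = sets (restrict_space borel T)"
    using \<mu> \<nu> by (auto simp: normalized_haar_def)
  have "F \<in> restrict_space borel S \<rightarrow>\<^sub>M restrict_space borel T"
    by (rule measurable_restrict_space3) (use F in \<open>auto intro: borel_measurable_continuous_onI\<close>)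
  hence Fm: "F \<in> \<mu> \<rightarrow>\<^sub>M \<nu>" using sp measurable_cong_sets by blast
  show "normalized_haar T (distr \<mu> \<nu> F)"
    unfolding normalized_haar_def
  proof (intro conjI ballI)
    show "prob_space (distr \<mu> \<nu> F)"
      by (rule prob_space.prob_space_distr[OF _ Fm]) (use \<mu> in \<open>simp add: normalized_haar_def\<close>)
    show "space (distr \<mu> \<nu> F) = T" "sets (distr \<mu> \<nu> F) = sets (restrict_space borel T)" using sp by simp_all
    fix g A assume g: "g \<in> T" and A: "A \<in> sets (distr \<mu> \<nu> F)"
    hence A': "A \<in> sets \<nu>" by simp
    have gU: "g \<in> unitary_group" using g T by (auto simp: unitary_subgroup_def)
    have gA: "(**) g ` A \<in> sets \<nu>"
    proof -
      obtain B where B: "B \<in> sets borel" "A = B \<inter> T" using A' by (auto simp: sp sets_restrict_space)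
      have "(**) g ` A = ((**) (ctrans g) -` B) \<inter> T"
      proof
        show "(**) g ` A \<subseteq> ((**) (ctrans g) -` B) \<inter> T"
          using B T g by (auto simp: unitary_subgroup_def matrix_mul_assoc unitary_groupD[OF gU])
        show "((**) (ctrans g) -` B) \<inter> T \<subseteq> (**) g ` A"
        proof
          fix x assume x: "x \<in> ((**) (ctrans g) -` B) \<inter> T"
          have "g ** (ctrans g ** x) = x" by (simp add: matrix_mul_assoc unitary_groupD[OF gU])
          moreover have "ctrans g ** x \<in> A" using x B T g by (auto simp: unitary_subgroup_def)
          ultimately show "x \<in> (**) g ` A" by (metis image_eqI)
        qed
      qed
      moreover have "(**) (ctrans g) -` B \<in> sets borel"
        by (rule measurable_sets_borel[OF _ B(1)]) (intro borel_measurable_continuous_onI continuous_intros)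
      ultimately show ?thesis by (auto simp: sp sets_restrict_space)
    qed
    obtain h where h: "h \<in> S" "\<And>k. k \<in> S \<Longrightarrow> F (h ** k) = g ** F k" using equi[OF g] by blast
    have hU: "h \<in> unitary_group" using h S by (auto simp: unitary_subgroup_def)
    have "F -` ((**) g ` A) \<inter> S = (**) h ` (F -` A \<inter> S)"
    proof
      show "(**) h ` (F -` A \<inter> S) \<subseteq> F -` ((**) g ` A) \<inter> S"
        using h S by (auto simp: unitary_subgroup_def)
      show "F -` ((**) g ` A) \<inter> S \<subseteq> (**) h ` (F -` A \<inter> S)"
      proof
        fix k assume k: "k \<in> F -` ((**) g ` A) \<inter> S"
        define k' where "k' = ctrans h ** k"
        have k': "k' \<in> S" using k h S by (auto simp: unitary_subgroup_def k'_def)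
        have hk: "h ** k' = k" by (simp add: k'_def matrix_mul_assoc unitary_groupD[OF hU])
        obtain a where a: "a \<in> A" "F k = g ** a" using k by auto
        have "g ** F k' = g ** a" using h(2)[OF k'] a hk by simp
        hence "ctrans g ** (g ** F k') = ctrans g ** (g ** a)" by simp
        hence "F k' = a" by (simp add: matrix_mul_assoc unitary_groupD[OF gU])
        thus "k \<in> (**) h ` (F -` A \<inter> S)" using a k' hk by (metis IntI image_eqI vimageI)
      qed
    qed
    moreover have "F -` A \<inter> S \<in> sets \<mu>" using measurable_sets[OF Fm A'] sp by simp
    hence "emeasure \<mu> ((**) h ` (F -` A \<inter> S)) = emeasure \<mu> (F -` A \<inter> S)"
      using \<mu> h(1) unfolding normalized_haar_def by blast
    ultimately show "emeasure (distr \<mu> \<nu> F) ((**) g ` A) = emeasure (distr \<mu> \<nu> F) A"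
      using A' gA sp by (simp add: emeasure_distr[OF Fm])
  qed
qed

lemma haar_right_translation:
  fixes S :: "('f::rch, 'n::finite) sqmat set"
  assumes S: "unitary_subgroup S" and \<mu>: "normalized_haar S \<mu>" and h: "h \<in> S"
  shows "distr \<mu> \<mu> (\<lambda>k. k ** h) = \<mu>"
proof (rule haar_distr[OF \<mu> \<mu> S S])
  show "continuous_on UNIV (\<lambda>k. k ** h)" by (intro continuous_intros)
  show "(\<lambda>k. k ** h) ` S \<subseteq> S" using S h by (auto simp: unitary_subgroup_def)
  show "\<exists>h'\<in>S. \<forall>k\<in>S. h' ** k ** h = g ** (k ** h)" if "g \<in> S" for g
    using that by (auto simp: matrix_mul_assoc)
qed

section \<open>Quasi-reflections\<close>

text \<open>For unit \<open>z\<close> and \<open>c\<close> the unitary map that multiplies the line of \<open>z\<close> by \<open>c\<close> and fixes its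
  orthogonal complement.\<close>

definition qrefl :: "'f::rch^'n::finite \<Rightarrow> 'f \<Rightarrow> ('f, 'n) sqmat"
  where "qrefl z c = mat 1 + (\<chi> i j. z $ i * (c - 1) * star (z $ j))"

lemma qrefl_vec: "qrefl z c *v v = v + (\<chi> i. z $ i * (c - 1) * hdot z v)"
proof -
  have "((\<chi> i j. z $ i * (c - 1) * star (z $ j)) *v v) $ i = z $ i * (c - 1) * hdot z v" for i
    by (simp add: matrix_vec_nth hdot_def sum_distrib_left mult.assoc)
  thus ?thesis by (simp add: qrefl_def matrix_vector_mult_add_rdistrib vec_eq_iff)
qed

lemma hdot_scale_right: "hdot x (\<chi> i. z $ i * a) = hdot x z * a"
  by (simp add: hdot_def sum_distrib_right mult.assoc)

lemma hdot_add_right: "hdot x (y + z) = hdot x y + hdot x z"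
  by (rule linear_add[OF linear_hdot])

lemma qrefl_fixes: "hdot z v = 0 \<Longrightarrow> qrefl z c *v v = v"
  by (simp add: qrefl_vec vec_eq_iff)

lemma qrefl_1 [simp]: "qrefl z 1 = mat 1"
  by (simp add: qrefl_def vec_eq_iff)

lemma qrefl_mult: "norm z = 1 \<Longrightarrow> qrefl z c ** qrefl z c' = qrefl z (c * c')"
proof (rule matrix_eqI_vec)
  fix v assume "norm z = 1"
  hence zz: "hdot z z = 1" by (simp add: hdot_self)
  have "hdot z (\<chi> i. z $ i * (c' - 1) * hdot z v) = (c' - 1) * hdot z v"
    using hdot_scale_right[of z z "(c' - 1) * hdot z v"] by (simp add: zz mult.assoc)
  hence eq: "hdot z (v + (\<chi> i. z $ i * (c' - 1) * hdot z v)) = c' * hdot z v"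
    by (simp add: hdot_add_right left_diff_distrib)
  have "v $ i + z $ i * (c' - 1) * hdot z v + z $ i * (c - 1) * (c' * hdot z v)
      = v $ i + z $ i * (c * c' - 1) * hdot z v" for i
    by (simp add: algebra_simps)
  thus "(qrefl z c ** qrefl z c') *v v = qrefl z (c * c') *v v"
    by (simp add: matrix_vector_mul_assoc[symmetric] qrefl_vec eq vec_eq_iff)
qed

lemma ctrans_qrefl: "ctrans (qrefl z c) = qrefl z (star c)"
  by (auto simp: qrefl_def vec_eq_iff star_add star_mult star_diff mat_nth mult.assoc)

lemma star_unit: "norm c = 1 \<Longrightarrow> star c * c = 1" "norm c = 1 \<Longrightarrow> c * star c = (1 :: 'f::rch)"
  by (simp_all add: star_mult_self mult_star_self)

lemma qrefl_unitary: "norm z = 1 \<Longrightarrow> norm c = 1 \<Longrightarrow> qrefl z c \<in> unitary_group"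
  by (simp add: unitary_group_def ctrans_qrefl qrefl_mult star_unit)

lemma hdot_unitary: "U \<in> unitary_group \<Longrightarrow> hdot (U *v x) (U *v y) = hdot x y"
  using hdot_matrix[of "U *v x" U y] by (simp add: matrix_vector_mul_assoc unitary_groupD)

lemma qrefl_conjugate: "U \<in> unitary_group \<Longrightarrow> U ** qrefl z c ** ctrans U = qrefl (U *v z) c"
proof (rule matrix_eqI_vec)
  fix v assume U: "U \<in> unitary_group"
  have h: "hdot (U *v z) v = hdot z (ctrans U *v v)" by (simp add: hdot_matrix)
  have "U *v (\<chi> i. z $ i * a) = (\<chi> i. (U *v z) $ i * a)" for a
    by (simp add: vec_eq_iff matrix_vec_nth sum_distrib_right mult.assoc)
  from this[of "(c - 1) * hdot z (ctrans U *v v)"]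
  show "(U ** qrefl z c ** ctrans U) *v v = qrefl (U *v z) c *v v"
    by (simp add: matrix_vector_mul_assoc[symmetric] qrefl_vec linear_add[OF linear_matrix_vec] h mult.assoc)
       (simp add: matrix_vector_mul_assoc unitary_groupD[OF U])
qed

lemma hdot_inner: "hdot x y \<bullet> 1 = x \<bullet> y"
proof -
  have "(star (x $ k) * y $ k) \<bullet> 1 = x $ k \<bullet> y $ k" for k
    by (simp add: inner_mult_left_star) (rule inner_commute)
  thus ?thesis by (simp add: hdot_def inner_vec_def inner_sum_left)
qed

lemma star_plus_self: "a + star a = of_real (2 * (a \<bullet> (1 :: 'f::rch)))"
proof -
  have "a + star a = of_real ((a + star a) \<bullet> 1)" by (rule star_fixed) (simp add: star_add add.commute)
  moreover have "star a \<bullet> 1 = a \<bullet> 1" by (metis inner_star_star star_1)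
  ultimately show ?thesis by (simp add: inner_add_left)
qed

text \<open>A unit vector is mapped to another one by a quasi-reflection along their difference.\<close>

lemma qrefl_transitive:
  fixes x y :: "'f::rch^'n::finite"
  assumes xy: "norm x = 1" "norm y = 1" "x \<noteq> y"
  obtains r c where "r > 0" "norm (r *\<^sub>R (y - x)) = 1" "norm c = 1" "qrefl (r *\<^sub>R (y - x)) c *v x = y"
proof -
  define a where "a = hdot y x"
  define \<rho> where "\<rho> = (norm (y - x))\<^sup>2"
  have \<rho>: "\<rho> > 0" using xy by (simp add: \<rho>_def)
  have "\<rho> = (norm y)\<^sup>2 - 2 * (y \<bullet> x) + (norm x)\<^sup>2"
    by (simp add: \<rho>_def power2_norm_eq_inner inner_diff_left inner_diff_right inner_commute)
  hence \<rho>': "\<rho> = 2 - 2 * (a \<bullet> 1)" using xy by (simp add: a_def hdot_inner)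
  have a1: "a - 1 \<noteq> 0"
  proof
    assume "a - 1 = 0"
    hence "a = 1" by simp
    hence "\<rho> = 0" by (simp add: \<rho>' dot_square_norm)
    thus False using \<rho> by simp
  qed
  define c where "c = 1 + of_real \<rho> * inverse (a - 1)"
  have "c * (a - 1) = (a - 1) + of_real \<rho>" using a1 by (simp add: c_def distrib_right mult.assoc)
  also have "\<dots> = a - 1 + 2 - (a + star a)" by (simp add: \<rho>' star_plus_self)
  also have "\<dots> = - star (a - 1)" by (simp add: star_diff)
  finally have ca: "c * (a - 1) = - star (a - 1)" .
  hence "norm c * norm (a - 1) = norm (a - 1)" by (metis norm_minus_cancel norm_mult norm_star)
  hence c: "norm c = 1" using a1 by simp
  define r where "r = 1 / norm (y - x)"
  have r: "r > 0" "r * r * \<rho> = 1" using xy by (auto simp: r_def \<rho>_def power2_eq_square)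
  have hz: "hdot (r *\<^sub>R (y - x)) x = r *\<^sub>R (a - 1)"
  proof -
    have "hdot (y - x) x = hdot y x - hdot x x"
      by (simp add: hdot_def star_diff left_diff_distrib sum_subtractf)
    thus ?thesis using xy by (simp add: hdot_scaleR_left a_def hdot_self)
  qed
  have "qrefl (r *\<^sub>R (y - x)) c *v x = x + (r * r * \<rho>) *\<^sub>R (y - x)"
  proof -
    have "(c - 1) * (a - 1) = of_real \<rho>" using a1 by (simp add: c_def mult.assoc)
    hence "(r *\<^sub>R (y - x)) $ i * (c - 1) * (r *\<^sub>R (a - 1)) = (r * r * \<rho>) *\<^sub>R (y - x) $ i" for i
      by (simp add: mult.assoc scaleR_conv_of_real[of \<rho>, symmetric]) (simp add: of_real_def)
    thus ?thesis by (simp add: qrefl_vec hz vec_eq_iff)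
  qed
  hence "qrefl (r *\<^sub>R (y - x)) c *v x = y" using r by simp
  moreover have "norm (r *\<^sub>R (y - x)) = 1" using xy by (simp add: r_def)
  ultimately show ?thesis using that r(1) c by blast
qed

lemma hdot_diff_scale_left: "hdot x v = 0 \<Longrightarrow> hdot y v = 0 \<Longrightarrow> hdot (r *\<^sub>R (y - x)) v = 0"
  by (simp add: hdot_scaleR_left) (simp add: hdot_def star_diff left_diff_distrib sum_subtractf)

lemma norm_axis_1 [simp]: "norm (axis i (1 :: 'f::rch) :: 'f^'n::finite) = 1"
proof -
  have "(norm (axis i (1 :: 'f) :: 'f^'n))\<^sup>2 = (norm (1 :: 'f))\<^sup>2"
    unfolding power2_norm_eq_inner inner_axis_axis by simp
  thus ?thesis by (simp only: power2_eq_iff_nonneg norm_ge_zero norm_one)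
qed

lemma hdot_axis: "hdot (axis i 1) v = v $ i" "hdot v (axis i 1) = star (v $ i)"
  by (simp_all add: hdot_def axis_def if_distrib[where f="\<lambda>x. x * _"] if_distrib[where f="\<lambda>x. _ * x"]
      if_distrib[where f=star] cong: if_cong)

text \<open>Quasi-reflections generate the unitary group: they move the columns one after another to the
  standard basis.\<close>

lemma unitary_induct [consumes 1, case_names one qrefl]:
  fixes u :: "('f::rch, 'n::finite) sqmat"
  assumes u: "u \<in> unitary_group"
    and 1: "\<Gamma> (mat 1)"
    and step: "\<And>v z c. v \<in> unitary_group \<Longrightarrow> \<Gamma> v \<Longrightarrow> norm z = 1 \<Longrightarrow> norm c = 1 \<Longrightarrow> \<Gamma> (v ** qrefl z c)"
  shows "\<Gamma> u"
proof -
  have "\<exists>h\<in>unitary_group. \<Gamma> (ctrans h) \<and> (\<forall>j\<in>J. h *v (u *v axis j 1) = axis j 1)" if "finite J" for J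
    using that
  proof (induction J)
    case empty
    show ?case using 1 by (intro bexI[of _ "mat 1"]) auto
  next
    case (insert k J)
    then obtain h where h: "h \<in> unitary_group" "\<Gamma> (ctrans h)" "\<And>j. j \<in> J \<Longrightarrow> h *v (u *v axis j 1) = axis j 1" by blast
    define x where "x = h *v (u *v axis k 1)"
    define y where "y = (axis k 1 :: 'f^'n)"
    have nx: "norm x = 1" "norm y = 1"
      using h(1) u by (simp_all add: x_def y_def norm_isometry_vec unitary_groupD)
    show ?case
    proof (cases "x = y")
      case True
      thus ?thesis using h by (intro bexI[of _ h]) (auto simp: x_def y_def)
    next
      case False
      obtain r c where z: "norm (r *\<^sub>R (y - x)) = 1" and c: "norm c = 1" and q: "qrefl (r *\<^sub>R (y - x)) c *v x = y"
        using qrefl_transitive[OF nx False] by metis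
      define g where "g = qrefl (r *\<^sub>R (y - x)) c"
      have g: "g \<in> unitary_group" unfolding g_def by (rule qrefl_unitary[OF z c])
      have fixJ: "g *v axis j 1 = axis j 1" if "j \<in> J" for j
        unfolding g_def
      proof (rule qrefl_fixes, rule hdot_diff_scale_left)
        have "j \<noteq> k" using that insert(2) by auto
        thus "hdot y (axis j 1) = 0" unfolding y_def hdot_axis by (simp add: axis_def)
        have "hdot x (axis j 1) = hdot x (h *v (u *v axis j 1))" by (simp add: h(3)[OF that])
        also have "\<dots> = hdot (axis k 1) (axis j 1 :: 'f^'n)" by (simp add: x_def hdot_unitary h(1) u)
        finally show "hdot x (axis j 1) = 0" using \<open>j \<noteq> k\<close> unfolding hdot_axis by (simp add: axis_def)
      qed
      have "ctrans (g ** h) = ctrans h ** qrefl (r *\<^sub>R (y - x)) (star c)"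
        by (simp add: ctrans_mult g_def ctrans_qrefl)
      hence "\<Gamma> (ctrans (g ** h))" using step[OF unitary_group_ctrans[OF h(1)] h(2) z, of "star c"] c by simp
      moreover have "(g ** h) *v (u *v axis j 1) = axis j 1" if "j \<in> insert k J" for j
      proof (cases "j = k")
        case True
        have "(g ** h) *v (u *v axis k 1) = g *v x" by (simp only: x_def matrix_vector_mul_assoc matrix_mul_assoc)
        thus ?thesis using True q by (simp only: g_def y_def)
      next
        case False
        hence j: "j \<in> J" using that by simp
        show ?thesis unfolding matrix_vector_mul_assoc[symmetric, of g h] h(3)[OF j] by (rule fixJ[OF j])
      qed
      ultimately show ?thesis using unitary_group_mult[OF g h(1)] by blast
    qed
  qed
  from this[of UNIV] obtain h where h: "h \<in> unitary_group" "\<Gamma> (ctrans h)"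
    and e: "\<And>j. h *v (u *v axis j 1) = axis j 1" by auto
  have "(h ** u) $ i $ j = mat 1 $ i $ j" for i j
  proof -
    have "((h ** u) *v axis j 1) $ i = axis j 1 $ i" using e[of j] by (simp only: matrix_vector_mul_assoc)
    thus ?thesis unfolding matrix_vec_axis by (simp add: axis_def mat_nth)
  qed
  hence "h ** u = mat 1" by (simp add: vec_eq_iff)
  hence "ctrans h ** (h ** u) = ctrans h" by simp
  hence "u = ctrans h" by (simp add: matrix_mul_assoc unitary_groupD[OF h(1)])
  thus ?thesis using h(2) by simp
qed

text \<open>A unitary map that takes \<open>z\<close> to \<open>z'\<close> conjugates one quasi-reflection into the other.\<close>

lemma cdet_qrefl_indep:
  fixes z z' :: "'f::rch^'n::finite"
  assumes "norm z = 1" "norm z' = 1"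
  shows "cdet (qrefl z c) = cdet (qrefl z' c)"
proof (cases "z = z'")
  case False
  obtain r b where "norm (r *\<^sub>R (z' - z)) = 1" "norm b = 1" and q: "qrefl (r *\<^sub>R (z' - z)) b *v z = z'"
    using qrefl_transitive[OF assms False] by metis
  define U where "U = qrefl (r *\<^sub>R (z' - z)) b"
  have U: "U \<in> unitary_group" unfolding U_def by (rule qrefl_unitary) fact+
  have "cdet (qrefl z' c) = cdet (U ** qrefl z c ** ctrans U)"
    by (simp only: qrefl_conjugate[OF U]) (simp add: U_def q)
  also have "\<dots> = cdet (qrefl z c) * cdet (U ** ctrans U)" by (simp add: cdet_mult mult_ac)
  finally show ?thesis by (simp add: unitary_groupD[OF U])
qed simp

lemma cdet_qrefl_pair:
  assumes "norm z = 1" "norm e = 1" "norm c = 1"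
  shows "cdet (qrefl e (star c) ** qrefl z c) = 1"
proof -
  have "cdet (qrefl e (star c) ** qrefl z c) = cdet (qrefl e (star c) ** qrefl e c)"
    using cdet_qrefl_indep[OF assms(1,2)] by (simp add: cdet_mult)
  thus ?thesis using assms by (simp add: qrefl_mult star_unit)
qed

lemma continuous_on_qrefl [continuous_intros]:
  fixes f :: "'a::topological_space \<Rightarrow> 'f::rch^'n::finite" and g :: "'a \<Rightarrow> 'f"
  assumes "continuous_on S f" "continuous_on S g"
  shows "continuous_on S (\<lambda>x. qrefl (f x) (g x))"
  unfolding qrefl_def by (intro continuous_intros continuous_on_vec_lambda assms)

section \<open>The identity component of the unitary group\<close>

lemma unitary0_connected_subset:
  assumes "connected S" "mat 1 \<in> S" "S \<subseteq> unitary_group"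
  shows "S \<subseteq> unitary_group0"
  unfolding unitary_group0_def by (rule connected_component_maximal[OF assms(2,1,3)])

lemma unitary0_subset: "unitary_group0 \<subseteq> unitary_group"
  unfolding unitary_group0_def by (rule connected_component_subset)

lemma unitary0_1: "mat 1 \<in> unitary_group0"
  unfolding unitary_group0_def by (simp add: connected_component_refl)

lemma connected_unitary0: "connected unitary_group0"
  unfolding unitary_group0_def by (rule connected_connected_component)

lemma unitary0_mult:
  assumes "X \<in> unitary_group0" "Y \<in> unitary_group0"
  shows "X ** Y \<in> unitary_group0"
proof -
  let ?S = "(\<lambda>Z. X ** Z) ` unitary_group0 \<union> unitary_group0"
  have "connected ((\<lambda>Z. X ** Z) ` unitary_group0)"
    by (intro connected_continuous_image continuous_intros connected_unitary0)
  moreover have "X \<in> (\<lambda>Z. X ** Z) ` unitary_group0" using unitary0_1 by force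
  ultimately have "connected ?S" using connected_unitary0 assms by (intro connected_Un) auto
  moreover have "?S \<subseteq> unitary_group" using unitary0_subset unitary_group_mult assms by blast
  ultimately have "?S \<subseteq> unitary_group0" using unitary0_1 by (intro unitary0_connected_subset) auto
  thus ?thesis using assms by blast
qed

lemma unitary0_ctrans:
  assumes "X \<in> unitary_group0"
  shows "ctrans X \<in> unitary_group0"
proof -
  have "connected (ctrans ` unitary_group0)"
    by (intro connected_continuous_image continuous_intros connected_unitary0)
  moreover have "mat 1 \<in> ctrans ` unitary_group0" by (rule image_eqI[OF _ unitary0_1]) simp
  moreover have "ctrans ` unitary_group0 \<subseteq> unitary_group" using unitary0_subset unitary_group_ctrans by blast
  ultimately have "ctrans ` unitary_group0 \<subseteq> unitary_group0" by (intro unitary0_connected_subset)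
  thus ?thesis using assms by blast
qed

lemma unitary_subgroup_unitary0: "unitary_subgroup unitary_group0"
  using unitary0_subset unitary0_1 unitary0_mult unitary0_ctrans by (auto simp: unitary_subgroup_def)

text \<open>For $d \<ge> 2$ the unit sphere of the division algebra is connected, so a quasi-reflection is
  connected to the identity by varying \<open>c\<close>.\<close>

lemma unitary0_full:
  assumes d: "2 \<le> DIM('f::rch)" and u: "u \<in> unitary_group"
  shows "u \<in> (unitary_group0 :: ('f, 'n::finite) sqmat set)"
  using u
proof (induction rule: unitary_induct)
  case (qrefl v z c)
  have "connected (qrefl z ` sphere (0 :: 'f) 1)"
    by (intro connected_continuous_image continuous_intros connected_sphere d)
  moreover have "mat 1 \<in> qrefl z ` sphere (0 :: 'f) 1" by (rule image_eqI[of _ _ 1]) auto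
  moreover have "qrefl z ` sphere (0 :: 'f) 1 \<subseteq> unitary_group" by (auto intro!: qrefl_unitary qrefl(2))
  ultimately have "qrefl z ` sphere (0 :: 'f) 1 \<subseteq> unitary_group0" by (rule unitary0_connected_subset)
  hence "qrefl z c \<in> unitary_group0" using qrefl(3) by auto
  with qrefl(4) show ?case by (rule unitary0_mult)
qed (rule unitary0_1)

lemma cdet_real:
  assumes "DIM('f::rch) = 1"
  shows "Im (cdet (X :: ('f, 'n::finite) sqmat)) = 0"
proof -
  have "cnj (qfst (to_quat x)) = qfst (to_quat x)" for x :: 'f
    by (subst (1 2) DIM1_real[OF assms, of x]) (simp add: qfst_to_quat_of_real)
  hence "cnj (cdet X) = cdet X" using assms by (simp add: cdet_def det_cnj[symmetric])
  thus ?thesis by (simp add: complex_eq_iff)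
qed

text \<open>Over the reals the determinant is a real continuous function, which cannot change its sign
  on a connected set without vanishing.\<close>

lemma cdet_positive_connected:
  fixes f :: "'a::topological_space \<Rightarrow> ('f::rch, 'n::finite) sqmat"
  assumes d: "DIM('f) = 1" and C: "connected C" "continuous_on C f" "x0 \<in> C" "cdet (f x0) = 1"
    and nz: "\<And>x. x \<in> C \<Longrightarrow> cdet (f x) \<noteq> 0" and x: "x \<in> C"
  shows "Re (cdet (f x)) > 0"
proof (rule ccontr)
  assume "\<not> Re (cdet (f x)) > 0"
  moreover have "connected ((\<lambda>x. Re (cdet (f x))) ` C)"
    by (intro connected_continuous_image continuous_intros C)
  moreover have "Re (cdet (f x)) \<in> (\<lambda>x. Re (cdet (f x))) ` C" "1 \<in> (\<lambda>x. Re (cdet (f x))) ` C"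
    using x C(3,4) by force+
  ultimately have "0 \<in> (\<lambda>x. Re (cdet (f x))) ` C"
    by (meson connected_contains_Icc atLeastAtMost_iff in_mono not_less zero_le_one)
  then obtain y where "y \<in> C" "Re (cdet (f y)) = 0" by auto
  thus False using nz[of y] cdet_real[OF d, of "f y"] by (simp add: complex_eq_iff)
qed

lemma cdet_unitary_norm:
  "u \<in> unitary_group \<Longrightarrow> cmod (cdet u) = 1"
proof -
  assume "u \<in> unitary_group"
  hence "cdet (ctrans u ** u) = 1" by (simp add: unitary_groupD)
  hence "cnj (cdet u) * cdet u = 1" by (simp add: cdet_mult cdet_ctrans)
  hence "of_real ((cmod (cdet u))\<^sup>2) = (1 :: complex)" by (simp add: complex_norm_square mult.commute del: of_real_power)
  hence "(cmod (cdet u))\<^sup>2 = 1" by (simp only: of_real_eq_1_iff)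
  thus ?thesis by (simp add: abs_square_eq_1)
qed

lemma cdet_unitary_positive:
  assumes "DIM('f::rch) = 1" "u \<in> (unitary_group :: ('f, 'n::finite) sqmat set)" "Re (cdet u) > 0"
  shows "cdet u = 1"
  using cdet_unitary_norm[OF assms(2)] cdet_real[OF assms(1), of u] assms(3)
  by (simp add: complex_eq_iff cmod_def)

lemma cdet_unitary0_real:
  assumes d: "DIM('f::rch) = 1" and u: "u \<in> (unitary_group0 :: ('f, 'n::finite) sqmat set)"
  shows "cdet u = 1"
proof (rule cdet_unitary_positive[OF d])
  show "u \<in> unitary_group" using u unitary0_subset by blast
  show "Re (cdet u) > 0"
  proof (rule cdet_positive_connected[OF d connected_unitary0 continuous_on_id unitary0_1 cdet_1 _ u])
    fix x :: "('f, 'n) sqmat" assume "x \<in> unitary_group0"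
    hence "cmod (cdet x) = 1" using cdet_unitary_norm unitary0_subset by blast
    thus "cdet x \<noteq> 0" by auto
  qed
qed

text \<open>Over the reals a unitary matrix of determinant one is a product of an even number of
  reflections, and pairs of reflections lie in the identity component.\<close>

lemma unitary0_real:
  assumes d: "DIM('f::rch) = 1" and u: "u \<in> unitary_group" "cdet u = 1"
  shows "u \<in> (unitary_group0 :: ('f, 'n::finite) sqmat set)"
proof -
  obtain i0 :: 'n where True by blast
  define e where "e = (axis i0 1 :: 'f^'n)"
  have ne: "norm e = 1" by (simp add: e_def)
  define \<rho> where "\<rho> = qrefl e (-1 :: 'f)"
  have \<rho>: "\<rho> \<in> unitary_group" "\<rho> ** \<rho> = mat 1" "ctrans \<rho> = \<rho>"
    using ne by (simp_all add: \<rho>_def qrefl_unitary qrefl_mult ctrans_qrefl star_minus)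
  have pair: "qrefl z (-1) ** \<rho> \<in> unitary_group0" if z: "norm z = 1" for z :: "'f^'n"
  proof (cases "DIM('f^'n) = 1")
    case True
    then obtain b where b: "(Basis :: ('f^'n) set) = {b}" by (metis card_1_singletonE)
    have nb: "norm b = 1" using b by (metis norm_Basis singletonI)
    have rep: "v = (v \<bullet> b) *\<^sub>R b" for v :: "'f^'n" using euclidean_representation[of v] unfolding b by simp
    have "qrefl v (-1) = qrefl b (-1)" if "norm v = 1" for v :: "'f^'n"
    proof -
      have "\<bar>v \<bullet> b\<bar> = 1" using that rep[of v] nb by (metis norm_scaleR mult.right_neutral)
      hence sq: "(v \<bullet> b) * (v \<bullet> b) = 1" by (metis abs_mult_self_eq mult_1)
      have "v $ i * (-1 - 1) * star (v $ j) = ((v \<bullet> b) * (v \<bullet> b)) *\<^sub>R (b $ i * (-1 - 1) * star (b $ j))" for i j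
        by (subst (1 2) rep[of v]) (simp add: star_scaleR)
      thus ?thesis by (simp add: qrefl_def sq)
    qed
    hence "qrefl z (-1) = \<rho>" using z ne by (simp add: \<rho>_def)
    thus ?thesis by (simp add: \<rho> unitary0_1)
  next
    case False
    hence "2 \<le> DIM('f^'n)" using DIM_positive[where 'a="'f^'n"] by linarith
    hence "connected ((\<lambda>z. qrefl z (-1) ** \<rho>) ` sphere (0 :: 'f^'n) 1)"
      by (intro connected_continuous_image continuous_intros connected_sphere)
    moreover have "mat 1 \<in> (\<lambda>z. qrefl z (-1) ** \<rho>) ` sphere (0 :: 'f^'n) 1"
      by (rule image_eqI[of _ _ e]) (use ne \<rho> in \<open>auto simp: \<rho>_def\<close>)
    moreover have "(\<lambda>z. qrefl z (-1) ** \<rho>) ` sphere (0 :: 'f^'n) 1 \<subseteq> unitary_group"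
      by (auto intro!: qrefl_unitary unitary_group_mult \<rho>(1))
    ultimately have "(\<lambda>z. qrefl z (-1) ** \<rho>) ` sphere (0 :: 'f^'n) 1 \<subseteq> unitary_group0"
      by (rule unitary0_connected_subset)
    thus ?thesis using z by auto
  qed
  have "u \<in> unitary_group0 \<or> u ** \<rho> \<in> unitary_group0"
    using u(1)
  proof (induction rule: unitary_induct)
    case (qrefl v z c)
    have "c = of_real (c \<bullet> 1)" by (rule DIM1_real[OF d])
    moreover from this have "\<bar>c \<bullet> 1\<bar> = 1" using qrefl(3) by (metis norm_of_real)
    hence "c \<bullet> 1 = 1 \<or> c \<bullet> 1 = -1" by linarith
    ultimately have "c = 1 \<or> c = -1" by (metis of_real_1 of_real_minus)
    thus ?case
    proof
      assume "c = 1"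
      thus ?case using qrefl(4) by simp
    next
      assume c: "c = -1"
      note p = pair[OF qrefl(2)]
      from qrefl(4) show ?case
      proof
        assume "v \<in> unitary_group0"
        from unitary0_mult[OF this p] show ?case by (simp add: c matrix_mul_assoc)
      next
        assume "v ** \<rho> \<in> unitary_group0"
        moreover have "ctrans (qrefl z (-1) ** \<rho>) \<in> unitary_group0" by (rule unitary0_ctrans[OF p])
        hence "\<rho> ** qrefl z (-1) \<in> unitary_group0" by (simp add: ctrans_mult \<rho> ctrans_qrefl star_minus)
        ultimately have "v ** \<rho> ** (\<rho> ** qrefl z (-1)) \<in> unitary_group0" by (rule unitary0_mult)
        moreover have "v ** \<rho> ** (\<rho> ** qrefl z (-1)) = v ** (\<rho> ** \<rho>) ** qrefl z (-1)" by (simp add: matrix_mul_assoc)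
        ultimately show ?case by (simp add: c \<rho>)
      qed
    qed
  qed (simp add: unitary0_1)
  moreover have "u ** \<rho> \<notin> unitary_group0"
  proof
    assume "u ** \<rho> \<in> unitary_group0"
    hence "cdet (u ** \<rho>) = 1" by (rule cdet_unitary0_real[OF d])
    hence c1: "cdet \<rho> = 1" using u by (simp add: cdet_mult)
    have "\<rho> = rdiag (\<lambda>i. if i = i0 then -1 else 1)"
      by (auto simp: \<rho>_def qrefl_def e_def vec_eq_iff axis_def mat_nth rdiag_nth)
    hence "cdet \<rho> = -1" using d by (simp add: cdet_rdiag prod.delta)
    thus False using c1 by simp
  qed
  ultimately show ?thesis by blast
qed

section \<open>The maximal compact subgroup\<close>

lemma ctrans_isom_inv:
  assumes "X \<in> isom_group" "X \<in> unitary_group"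
  shows "ctrans X = isom_inv X"
proof -
  have "isom_inv X = isom_inv X ** (X ** ctrans X)" by (simp add: unitary_groupD[OF assms(2)])
  also have "\<dots> = (isom_inv X ** X) ** ctrans X" by (simp add: matrix_mul_assoc)
  finally show ?thesis by (simp add: isom_inv(1)[OF assms(1)])
qed

lemma G_ctrans:
  assumes "X \<in> G_group" "X \<in> unitary_group"
  shows "ctrans X \<in> G_group"
  using G_inv[OF assms(1)] ctrans_isom_inv[OF _ assms(2)] assms(1) G_subset_isom by auto

lemma K_groupI:
  assumes "k \<in> G_group" "k \<in> unitary_group"
  shows "k \<in> K_group"
proof -
  have k: "ctrans k ** k = mat 1" "k \<in> isom_group" using assms G_subset_isom unitary_groupD(1) by blast+
  show ?thesis using assms(1) unitary_isometry_block[OF k] by (simp add: K_group_def)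
qed

lemma K_groupD: "k \<in> K_group \<Longrightarrow> k \<in> G_group" "k \<in> K_group \<Longrightarrow> k \<in> unitary_group"
  using K_unitary by (auto simp: K_group_def unitary_group_def)

lemma unitary_subgroup_K: "unitary_subgroup K_group"
  unfolding unitary_subgroup_def
proof (intro conjI ballI subsetI)
  fix x y :: "('a, 'b, 'c) bigmat" assume x: "x \<in> K_group" and y: "y \<in> K_group"
  show "x \<in> unitary_group" by (rule K_groupD(2)[OF x])
  show "x ** y \<in> K_group" by (rule K_groupI) (auto intro: G_mult unitary_group_mult K_groupD x y)
  show "ctrans x \<in> K_group" by (rule K_groupI) (auto intro: G_ctrans unitary_group_ctrans K_groupD x)
qed (auto intro: K_groupI G_1)

lemma blk1_mult: "k \<in> K_group \<Longrightarrow> blk1 (k ** l) = blk1 k ** blk1 l"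
  by (simp add: blk1_def vec_eq_iff matrix_nth sum_UNIV_Plus K_group_def)

lemma linear_blk1: "linear blk1"
  by (rule linearI) (simp_all add: blk1_def vec_eq_iff)

lemma continuous_on_blk1 [continuous_intros]:
  fixes f :: "'a::topological_space \<Rightarrow> ('f::rch,'q::finite,'s::finite) bigmat"
  assumes "continuous_on S f"
  shows "continuous_on S (\<lambda>x. blk1 (f x))"
  using bounded_linear.continuous_on[OF linear_conv_bounded_linear[THEN iffD1, OF linear_blk1] assms] .

definition emb_p :: "'f::rch^('q::finite + 's::finite) \<Rightarrow> 'f^('q + 'q + 's)"
  where "emb_p v = (\<chi> a. case a of Inl i \<Rightarrow> 0 | Inr j \<Rightarrow> v $ j)"

definition emb_q :: "'f::rch^'q::finite \<Rightarrow> 'f^('q + 'q + 's::finite)"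
  where "emb_q v = (\<chi> a. case a of Inl i \<Rightarrow> v $ i | Inr j \<Rightarrow> 0)"

lemma emb_nth [simp]: "emb_p v $ Inl i = 0" "emb_p v $ Inr j = v $ j" "emb_q w $ Inl i = w $ i" "emb_q w $ Inr j = 0"
  by (simp_all add: emb_p_def emb_q_def)

lemma norm_emb [simp]: "norm (emb_p v) = norm v" "norm (emb_q w :: 'f::rch^('q::finite + 'q + 's::finite)) = norm w"
  by (simp_all add: norm_vec_def L2_set_def sum_UNIV_Plus)

lemma linear_emb_p: "linear emb_p"
  by (rule linearI) (simp_all add: emb_p_def vec_eq_iff split: sum.split)

lemma continuous_on_emb_p: "continuous_on S emb_p"
  by (rule linear_continuous_on) (use linear_emb_p linear_conv_bounded_linear in blast)

lemma Jform_vec: "Jform *v x = (\<chi> a. case a of Inl i \<Rightarrow> x $ a | Inr j \<Rightarrow> - x $ a)"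
  unfolding Jform_fmat fmat_rdiag[symmetric] rdiag_vec by (auto simp: vec_eq_iff split: sum.split)

lemma Jform_emb: "Jform *v emb_p v = - emb_p v" "Jform *v emb_q w = emb_q w"
  by (auto simp: Jform_vec vec_eq_iff split: sum.split)

text \<open>A quasi-reflection along a vector of one of the two blocks is an isometry of the indefinite form.\<close>

lemma qrefl_isometry:
  assumes z: "norm z = 1" "norm c = 1" and J: "Jform *v z = z \<or> Jform *v z = - z"
  shows "ctrans (qrefl z c) ** Jform ** qrefl z c = Jform"
proof -
  have neg: "qrefl (- z) c = qrefl z c" by (simp add: qrefl_def star_minus)
  have "Jform \<in> unitary_group" by (simp add: unitary_group_def Jform_Jform)
  from qrefl_conjugate[OF this, of z c] have "Jform ** qrefl z c ** Jform = qrefl z c"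
    using J neg by auto
  hence "Jform ** qrefl z c ** Jform ** Jform = qrefl z c ** Jform" by simp
  hence "Jform ** qrefl z c = qrefl z c ** Jform" by (simp add: matrix_mul_assoc[symmetric] Jform_Jform)
  hence "ctrans (qrefl z c) ** Jform ** qrefl z c = (ctrans (qrefl z c) ** qrefl z c) ** Jform"
    by (simp add: matrix_mul_assoc[symmetric])
  thus ?thesis using unitary_groupD(1)[OF qrefl_unitary[OF z]] by simp
qed

lemma qrefl_pair_isom:
  assumes "norm z = 1" "norm e = 1" "norm c = 1"
    and "Jform *v z = z \<or> Jform *v z = - z" "Jform *v e = e \<or> Jform *v e = - e"
  shows "qrefl e (star c) ** qrefl z c \<in> isom_group"
proof -
  have 1: "ctrans (qrefl z c) ** Jform ** qrefl z c = Jform"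
    and 2: "ctrans (qrefl e (star c)) ** Jform ** qrefl e (star c) = Jform"
    using assms by (auto intro!: qrefl_isometry)
  have "ctrans (qrefl e (star c) ** qrefl z c) ** Jform ** (qrefl e (star c) ** qrefl z c)
    = ctrans (qrefl z c) ** (ctrans (qrefl e (star c)) ** Jform ** qrefl e (star c)) ** qrefl z c"
    by (simp add: ctrans_mult matrix_mul_assoc)
  thus ?thesis using cdet_qrefl_pair[OF assms(1-3)] by (simp add: 1 2 isom_group_def fdet_1_iff)
qed

text \<open>Moving \<open>v\<close> on the sphere to the last basis vector connects the product to the identity.\<close>

lemma qrefl_pair_G:
  fixes v e :: "'f::rch^('q::finite + 's::finite)"
  assumes v: "norm v = 1" and e: "norm e = 1" and c: "norm c = 1"
  shows "qrefl (emb_p e) (star c) ** qrefl (emb_p v) c \<in> G_group"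
proof -
  let ?f = "\<lambda>v. qrefl (emb_p e) (star c) ** qrefl (emb_p v) c"
  have "CARD('q) \<ge> 1" "CARD('s) \<ge> 1" by (simp_all add: Suc_leI)
  moreover have "CARD('q + 's) = CARD('q) + CARD('s)" by simp
  ultimately have "CARD('q + 's) \<ge> 2" by linarith
  moreover have "DIM('f) \<ge> 1" by (simp add: Suc_leI)
  ultimately have "2 * 1 \<le> CARD('q + 's) * DIM('f)" by (rule mult_le_mono)
  hence "2 \<le> DIM('f^('q + 's))" by simp
  hence "connected (?f ` sphere 0 1)"
    by (intro connected_continuous_image continuous_intros continuous_on_emb_p connected_sphere)
  moreover have "mat 1 \<in> ?f ` sphere 0 1"
    by (rule image_eqI[of _ _ e]) (use e c in \<open>auto simp: qrefl_mult star_unit\<close>)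
  moreover have "?f ` sphere 0 1 \<subseteq> isom_group"
    using e c by (auto intro!: qrefl_pair_isom simp: Jform_emb)
  ultimately have "?f ` sphere 0 1 \<subseteq> G_group" by (rule connected_subset_G)
  thus ?thesis using v by auto
qed

text \<open>The elements of \<open>K_group\<close> with trivial first block act transitively on the orthonormal systems of
  $q$ vectors of the second block. The correcting factor along a basis vector outside the
  system, available since $p > q$, keeps the determinant equal to one.\<close>

lemma K_transitive:
  fixes V :: "'q::finite \<Rightarrow> 'f::rch^('q + 'q + 's::finite)"
  assumes V: "\<And>i j. hdot (V i) (V j) = (if i = j then 1 else 0)" "\<And>j i. V j $ Inl i = 0"
  obtains k where "k \<in> K_group" "\<And>i. k *v axis (Inl i) 1 = axis (Inl i) 1"
    "\<And>j. k *v axis (Inr (Inl j)) 1 = V j"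
proof -
  obtain s0 :: 's where True by blast
  define e where "e = (axis (Inr s0) 1 :: 'f^('q + 's))"
  have ne: "norm e = 1" by (simp add: e_def)
  define H where "H = {h :: ('f, 'q, 's) bigmat. h \<in> G_group \<and> h \<in> unitary_group \<and> (\<forall>i. h *v axis (Inl i) 1 = axis (Inl i) 1)}"
  have "\<exists>h\<in>H. \<forall>j\<in>J. h *v V j = axis (Inr (Inl j)) 1" if "finite J" for J
    using that
  proof (induction J)
    case empty
    show ?case by (intro bexI[of _ "mat 1"]) (auto simp: H_def G_1)
  next
    case (insert k J)
    then obtain h where h: "h \<in> H" and hJ: "\<And>j. j \<in> J \<Longrightarrow> h *v V j = axis (Inr (Inl j)) 1" by blast
    have hG: "h \<in> G_group" and hU: "h \<in> unitary_group" and hI: "\<And>i. h *v axis (Inl i) 1 = axis (Inl i) 1"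
      using h by (auto simp: H_def)
    define x where "x = h *v V k"
    define y where "y = (axis (Inr (Inl k)) 1 :: 'f^('q + 'q + 's))"
    have "(norm (V k))\<^sup>2 = 1" using V(1)[of k k] by (simp add: hdot_self del: of_real_power) 
    hence nV: "norm (V k) = 1" by (simp add: abs_square_eq_1)
    have nx: "norm x = 1" and ny: "norm y = 1"
      by (simp_all add: x_def y_def norm_isometry_vec unitary_groupD[OF hU] nV)
    show ?case
    proof (cases "x = y")
      case True
      thus ?thesis using h hJ by (intro bexI[of _ h]) (auto simp: x_def y_def)
    next
      case False
      obtain r c where z: "norm (r *\<^sub>R (y - x)) = 1" and c: "norm c = 1" and q: "qrefl (r *\<^sub>R (y - x)) c *v x = y"
        using qrefl_transitive[OF nx ny False] by metis
      define z where "z = r *\<^sub>R (y - x)"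
      have x0: "x $ Inl i = 0" for i
      proof -
        have "hdot x (axis (Inl i) 1) = hdot x (h *v axis (Inl i) 1)" by (simp only: hI)
        also have "\<dots> = hdot (V k) (axis (Inl i) 1)" unfolding x_def by (rule hdot_unitary[OF hU])
        finally have "star (x $ Inl i) = 0" by (simp add: hdot_axis V(2))
        thus ?thesis by (metis star_0 star_star)
      qed
      have z0: "z $ Inl i = 0" for i by (simp add: z_def x0 y_def axis_def)
      define v where "v = (\<chi> j. z $ Inr j)"
      have zv: "z = emb_p v" by (simp add: vec_eq_iff emb_p_def v_def z0 split: sum.split)
      have nv: "norm v = 1" using z by (simp add: z_def[symmetric] zv)
      define g where "g = qrefl (emb_p e) (star c) ** qrefl z c"
      have gG: "g \<in> G_group" unfolding g_def zv by (rule qrefl_pair_G[OF nv ne c])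
      have gU: "g \<in> unitary_group" unfolding g_def zv
        by (intro unitary_group_mult qrefl_unitary) (simp_all add: ne nv c)
      have g_fix: "g *v w = w" if "hdot (emb_p e) w = 0" "hdot z w = 0" for w
        using that by (simp add: g_def matrix_vector_mul_assoc[symmetric] qrefl_fixes)
      have ee: "emb_p e = (axis (Inr (Inr s0)) 1 :: 'f^('q + 'q + 's))"
        by (auto simp: vec_eq_iff emb_p_def e_def axis_def split: sum.split)
      have "g *v axis (Inl i) 1 = axis (Inl i) 1" for i
        by (rule g_fix) (simp_all add: hdot_axis z0)
      hence "g ** h \<in> H"
        using gG gU hG hU hI by (auto simp: H_def matrix_vector_mul_assoc[symmetric] intro: G_mult unitary_group_mult)
      moreover have "(g ** h) *v V j = axis (Inr (Inl j)) 1" if "j \<in> insert k J" for j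
      proof (cases "j = k")
        case True
        have "(g ** h) *v V k = qrefl (emb_p e) (star c) *v (qrefl z c *v x)"
          by (simp only: g_def x_def matrix_vector_mul_assoc matrix_mul_assoc)
        also have "qrefl z c *v x = y" using q by (simp only: z_def)
        also have "qrefl (emb_p e) (star c) *v y = y"
          by (rule qrefl_fixes) (simp only: ee hdot_axis(1), simp add: y_def axis_def)
        finally show ?thesis using True by (simp add: y_def)
      next
        case False
        hence j: "j \<in> J" using that by simp
        have "hdot y (axis (Inr (Inl j)) 1) = 0"
          unfolding y_def hdot_axis using False by (simp add: axis_def)
        moreover have "hdot x (axis (Inr (Inl j)) 1) = hdot (V k) (V j)"
          unfolding x_def hJ[OF j, symmetric] by (rule hdot_unitary[OF hU])
        ultimately have "hdot z (axis (Inr (Inl j)) 1) = 0"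
          unfolding z_def using False V(1)[of k j] by (intro hdot_diff_scale_left) simp_all
        moreover have "hdot (emb_p e) (axis (Inr (Inl j)) 1) = 0"
          unfolding ee hdot_axis(1) by (simp add: axis_def)
        ultimately show ?thesis
          unfolding matrix_vector_mul_assoc[symmetric, of g h] hJ[OF j] by (intro g_fix)
      qed
      ultimately show ?thesis by blast
    qed
  qed
  from this[OF finite[of UNIV]] obtain h where h: "h \<in> H" and hV: "\<And>j. h *v V j = axis (Inr (Inl j)) 1" by blast
  have hG: "h \<in> G_group" and hU: "h \<in> unitary_group" and hI: "\<And>i. h *v axis (Inl i) 1 = axis (Inl i) 1"
    using h by (auto simp: H_def)
  have inv: "ctrans h *v (h *v w) = w" for w by (simp add: matrix_vector_mul_assoc unitary_groupD[OF hU])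
  have "ctrans h \<in> K_group"
    using G_ctrans[OF hG hU] unitary_group_ctrans[OF hU] by (rule K_groupI)
  moreover have "ctrans h *v axis (Inl i) 1 = axis (Inl i) 1" for i using inv[of "axis (Inl i) 1"] by (simp only: hI)
  moreover have "ctrans h *v axis (Inr (Inl j)) 1 = V j" for j using inv[of "V j"] by (simp only: hV)
  ultimately show ?thesis using that by blast
qed

lemma blk1_qrefl_pair:
  fixes e :: "'f::rch^('q::finite + 's::finite)"
  shows "blk1 (qrefl (emb_p e) c' ** qrefl (emb_q z) c) = qrefl z c"
proof -
  define X where "X = (qrefl (emb_q z) c :: ('f, 'q, 's) bigmat)"
  have "qrefl (emb_p e) c' $ Inl i $ b = mat 1 $ Inl i $ b" for i b by (simp add: qrefl_def)
  hence "(qrefl (emb_p e) c' ** X) $ Inl i $ Inl j = (mat 1 ** X) $ Inl i $ Inl j" for i j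
    by (simp only: matrix_nth)
  hence "blk1 (qrefl (emb_p e) c' ** X) = qrefl z c"
    by (simp add: blk1_def vec_eq_iff) (simp add: X_def qrefl_def mat_nth)
  thus ?thesis by (simp only: X_def)
qed

definition bdiag :: "('f::rch, 'q::finite) sqmat \<Rightarrow> ('f, 'q, 's::finite) bigmat"
  where "bdiag u = (\<chi> a b. case a of Inl i \<Rightarrow> (case b of Inl j \<Rightarrow> u $ i $ j | Inr j \<Rightarrow> 0)
    | Inr i \<Rightarrow> (case b of Inl j \<Rightarrow> 0 | Inr j \<Rightarrow> if i = j then 1 else 0))"

lemma bdiag_nth [simp]: "bdiag u $ Inl i $ Inl j = u $ i $ j" "bdiag u $ Inl i $ Inr l = 0"
  "bdiag u $ Inr k $ Inl j = 0" "bdiag u $ Inr k $ Inr l = (if k = l then 1 else 0)"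
  by (simp_all add: bdiag_def)

lemma bdiag_eqI:
  fixes X Y :: "('f::rch, 'q::finite, 's::finite) bigmat"
  assumes "\<And>i j. X $ Inl i $ Inl j = Y $ Inl i $ Inl j" "\<And>i j. X $ Inl i $ Inr j = Y $ Inl i $ Inr j"
    "\<And>i j. X $ Inr i $ Inl j = Y $ Inr i $ Inl j" "\<And>i j. X $ Inr i $ Inr j = Y $ Inr i $ Inr j"
  shows "X = Y"
proof -
  have "X $ a $ b = Y $ a $ b" for a b by (cases a; cases b) (simp_all add: assms)
  thus ?thesis by (simp add: vec_eq_iff)
qed

lemma bdiag_mult: "bdiag u ** bdiag v = bdiag (u ** v)"
  by (rule bdiag_eqI; unfold matrix_nth; subst sum_UNIV_Plus)
     (simp_all add: matrix_nth if_distrib[where f="\<lambda>x. x * _"] cong: if_cong)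

lemma bdiag_ctrans: "ctrans (bdiag u) = bdiag (ctrans u)"
  by (rule bdiag_eqI) simp_all

lemma bdiag_1: "bdiag (mat 1) = mat 1"
  by (rule bdiag_eqI) (simp_all add: mat_nth)

lemma blk1_bdiag: "blk1 (bdiag u) = u"
  by (simp add: blk1_def vec_eq_iff)

lemma bdiag_isometry:
  fixes u :: "('f::rch, 'q::finite) sqmat"
  assumes "u \<in> unitary_group"
  defines "B \<equiv> bdiag u :: ('f, 'q, 's::finite) bigmat"
  shows "ctrans B ** Jform ** B = Jform" "B \<in> unitary_group"
proof -
  show U: "B \<in> unitary_group"
    by (simp add: B_def unitary_group_def bdiag_ctrans bdiag_mult unitary_groupD[OF assms(1)] bdiag_1)
  have "Jform ** B = B ** Jform"
    unfolding B_def by (rule bdiag_eqI) (simp_all add: Jform_fmat fmat_left fmat_right)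
  hence "ctrans B ** (Jform ** B) = ctrans B ** (B ** Jform)" by simp
  hence "ctrans B ** Jform ** B = (ctrans B ** B) ** Jform"
    by (simp only: matrix_mul_assoc)
  thus "ctrans B ** Jform ** B = Jform" by (simp add: unitary_groupD[OF U])
qed

lemma continuous_on_bdiag: "continuous_on S bdiag"
  unfolding bdiag_def
  by (intro continuous_on_vec_lambda, rename_tac a b, case_tac a; case_tac b)
     (auto intro!: continuous_intros)

text \<open>The factors of \<open>u\<close> are extended to the second block in such a way that the determinant is one and a path to the
  identity exists.\<close>

lemma K_blk1_surj:
  fixes u :: "('f::rch, 'q::finite) sqmat"
  assumes u: "u \<in> unitary_group0"
  obtains k :: "('f, 'q, 's::finite) bigmat" where "k \<in> K_group" "blk1 k = u"
proof (cases "DIM('f) = 1")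
  case True
  let ?B = "bdiag ` (unitary_group0 :: ('f, 'q) sqmat set) :: ('f, 'q, 's) bigmat set"
  have "(bdiag v :: ('f, 'q, 's) bigmat) \<in> isom_group" if v: "v \<in> unitary_group0" for v :: "('f, 'q) sqmat"
  proof -
    have b: "(bdiag w :: ('f, 'q, 's) bigmat) \<in> unitary_group" if "w \<in> unitary_group0" for w :: "('f, 'q) sqmat"
      using that unitary0_subset bdiag_isometry(2) by blast
    have "Re (cdet (bdiag v :: ('f, 'q, 's) bigmat)) > 0"
    proof (rule cdet_positive_connected[OF True connected_unitary0 continuous_on_bdiag unitary0_1 _ _ v])
      fix w :: "('f, 'q) sqmat" assume "w \<in> unitary_group0"
      from cdet_unitary_norm[OF b[OF this]] show "cdet (bdiag w :: ('f, 'q, 's) bigmat) \<noteq> 0" by auto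
    qed (simp add: bdiag_1)
    hence "cdet (bdiag v :: ('f, 'q, 's) bigmat) = 1" by (rule cdet_unitary_positive[OF True b[OF v]])
    moreover have "v \<in> unitary_group" using v unitary0_subset by blast
    ultimately show ?thesis by (simp add: isom_group_def fdet_1_iff bdiag_isometry(1))
  qed
  hence "?B \<subseteq> isom_group" by blast
  moreover have "connected ?B" by (intro connected_continuous_image continuous_on_bdiag connected_unitary0)
  moreover have "mat 1 \<in> ?B" by (rule image_eqI[OF _ unitary0_1]) (simp add: bdiag_1)
  ultimately have "?B \<subseteq> G_group" by (intro connected_subset_G)
  hence "bdiag u \<in> (G_group :: ('f, 'q, 's) bigmat set)" using u by blast
  moreover have "bdiag u \<in> (unitary_group :: ('f, 'q, 's) bigmat set)" using u unitary0_subset bdiag_isometry(2) by blast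
  ultimately show ?thesis using that[OF K_groupI] by (simp add: blk1_bdiag)
next
  case False
  hence d: "2 \<le> DIM('f)" using DIM_positive[where 'a='f] by linarith
  obtain s0 :: 's where True by blast
  define e where "e = (axis (Inr s0) 1 :: 'f^('q + 's))"
  have ne: "norm e = 1" by (simp add: e_def)
  have "u \<in> unitary_group" using u unitary0_subset by blast
  hence "\<exists>k :: ('f, 'q, 's) bigmat. k \<in> K_group \<and> blk1 k = u"
  proof (induction rule: unitary_induct)
    case one
    show ?case by (rule exI[of _ "mat 1"]) (simp add: blk1_def vec_eq_iff mat_nth K_groupI G_1)
  next
    case (qrefl v z c)
    then obtain k :: "('f, 'q, 's) bigmat" where k: "k \<in> K_group" "blk1 k = v" by blast
    have nz: "norm z = 1" and nc: "norm c = 1" using qrefl by blast+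
    let ?f = "\<lambda>c. qrefl (emb_p e) (star c) ** qrefl (emb_q z) c :: ('f, 'q, 's) bigmat"
    have "connected (?f ` sphere 0 1)"
      by (intro connected_continuous_image continuous_intros connected_sphere d)
    moreover have "mat 1 \<in> ?f ` sphere 0 1" by (rule image_eqI[of _ _ 1]) auto
    moreover have "?f ` sphere 0 1 \<subseteq> isom_group"
      using ne nz by (auto intro!: qrefl_pair_isom simp: Jform_emb)
    ultimately have "?f ` sphere 0 1 \<subseteq> G_group" by (rule connected_subset_G)
    hence "?f c \<in> G_group" using nc by auto
    moreover have "?f c \<in> unitary_group"
      by (intro unitary_group_mult qrefl_unitary) (simp_all add: ne nz nc)
    ultimately have f: "?f c \<in> K_group" by (rule K_groupI)
    have "k ** ?f c \<in> K_group" using unitary_subgroup_K k f unfolding unitary_subgroup_def by blast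
    moreover have "blk1 (k ** ?f c) = v ** qrefl z c"
      by (simp add: blk1_mult[OF k(1)] k(2) blk1_qrefl_pair)
    ultimately show ?case by blast
  qed
  thus ?thesis using that by blast
qed

text \<open>Over the reals the determinant of the first block vanishes nowhere on the connected group, hence it
  is positive.\<close>

lemma blk1_K_unitary0:
  fixes k :: "('f::rch, 'q::finite, 's::finite) bigmat"
  assumes k: "k \<in> K_group"
  shows "blk1 k \<in> unitary_group0"
proof (cases "DIM('f) = 1")
  case False
  hence "2 \<le> DIM('f)" using DIM_positive[where 'a='f] by linarith
  thus ?thesis using blk1_unitary[OF k] by (rule unitary0_full)
next
  case True
  have nz: "cdet (blk1 g) \<noteq> 0" if g: "g \<in> G_group" for g :: "('f, 'q, 's) bigmat"
  proof -
    have g: "ctrans g ** Jform ** g = Jform" using that G_subset_isom by (auto simp: isom_group_def)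
    have "v = 0" if v: "blk1 g *v v = 0" for v
    proof -
      define x where "x = (emb_q v :: 'f^('q + 'q + 's))"
      define y where "y = g *v x"
      have y0: "y $ Inl i = 0" for i
      proof -
        have "y $ Inl i = (blk1 g *v v) $ i" by (simp add: y_def x_def matrix_vec_nth sum_UNIV_Plus blk1_def)
        thus ?thesis by (simp add: v)
      qed
      hence Jy: "Jform *v y = - y" by (auto simp: Jform_vec vec_eq_iff split: sum.split)
      have "y \<bullet> (Jform *v y) = x \<bullet> ((ctrans g ** Jform ** g) *v x)"
        by (simp add: y_def inner_matrix_vec matrix_vector_mul_assoc matrix_mul_assoc)
      also have "\<dots> = x \<bullet> x" by (simp add: g x_def Jform_emb)
      finally have "x \<bullet> x = - (y \<bullet> y)" by (simp add: Jy)
      hence "x \<bullet> x = 0" using inner_ge_zero[of x] inner_ge_zero[of y] by linarith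
      hence "norm x = 0" by simp
      hence "norm v = 0" by (simp only: x_def norm_emb)
      thus ?thesis by simp
    qed
    then obtain Y where "blk1 g ** Y = mat 1" using inj_imp_matrix_inverse by metis
    hence "cdet (blk1 g) * cdet Y = 1" by (metis cdet_mult cdet_1)
    thus ?thesis by auto
  qed
  have one: "cdet (blk1 (mat 1 :: ('f, 'q, 's) bigmat)) = 1"
  proof -
    have "blk1 (mat 1 :: ('f, 'q, 's) bigmat) = mat 1" by (simp add: blk1_def vec_eq_iff mat_nth)
    thus ?thesis by simp
  qed
  have "Re (cdet (blk1 k)) > 0"
    by (rule cdet_positive_connected[where f=blk1, OF True connected_G _ G_1 one nz K_groupD(1)[OF k]])
       (intro continuous_intros, assumption)
  hence "cdet (blk1 k) = 1" by (rule cdet_unitary_positive[OF True blk1_unitary[OF k]])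
  with blk1_unitary[OF k] show ?thesis by (rule unitary0_real[OF True])
qed

lemma haar_blk1:
  assumes "normalized_haar K_group \<mu>K" "normalized_haar unitary_group0 \<mu>U"
  shows "distr \<mu>K \<mu>U (blk1 :: ('f::rch, 'q::finite, 's::finite) bigmat \<Rightarrow> _) = \<mu>U"
proof (rule haar_distr[OF assms unitary_subgroup_K unitary_subgroup_unitary0])
  show "blk1 ` K_group \<subseteq> unitary_group0" using blk1_K_unitary0 by blast
  fix g :: "('f, 'q) sqmat" assume "g \<in> unitary_group0"
  then obtain h :: "('f, 'q, 's) bigmat" where "h \<in> K_group" "blk1 h = g" by (rule K_blk1_surj)
  thus "\<exists>h\<in>K_group. \<forall>k\<in>K_group. blk1 (h ** k :: ('f, 'q, 's) bigmat) = g ** blk1 k"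
    by (intro bexI[of _ h]) (simp_all add: blk1_mult)
qed (intro continuous_intros)

section \<open>Lebesgue measure under linear bijections\<close>

lemma emeasure_lborel_open_pos:
  fixes S :: "'a::euclidean_space set"
  assumes "open S" "x \<in> S"
  shows "emeasure lborel S > 0"
proof -
  obtain e where e: "e > 0" "ball x e \<subseteq> S" using assms open_contains_ball by blast
  have "0 < measure lborel (ball x e)" using content_ball_pos[OF e(1), of x] .
  hence "0 < emeasure lborel (ball x e)" by (metis measure_def enn2real_0 not_gr_zero less_irrefl)
  also have "\<dots> \<le> emeasure lborel S" using e assms by (intro emeasure_mono) auto
  finally show ?thesis .
qed

lemma nn_integral_translate:
  fixes c :: "'a::euclidean_space"
  assumes [measurable]: "f \<in> borel_measurable borel"
  shows "(\<integral>\<^sup>+x. f (x + c) \<partial>lborel) = (\<integral>\<^sup>+x. f x \<partial>lborel)"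
proof -
  have "(\<integral>\<^sup>+x. f x \<partial>lborel) = (\<integral>\<^sup>+x. f x \<partial>distr lborel borel ((+) c))" by (simp add: lborel_distr_plus)
  also have "\<dots> = (\<integral>\<^sup>+x. f (c + x) \<partial>lborel)" by (rule nn_integral_distr) auto
  finally show ?thesis by (simp add: add.commute)
qed

lemma linear_borel [measurable (raw)]:
  fixes L :: "'a::euclidean_space \<Rightarrow> 'b::euclidean_space"
  assumes "linear L"
  shows "L \<in> borel_measurable borel"
  using assms by (intro borel_measurable_continuous_onI linear_continuous_on) (simp add: linear_conv_bounded_linear)

text \<open>The constant by which integrals change when a linear bijection is composed with the integrand;
  it is the inverse of the absolute value of the determinant.\<close>

definition lfac :: "('a::euclidean_space \<Rightarrow> 'a) \<Rightarrow> real"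
  where "lfac L = measure lborel (L -` ball 0 1) / measure lborel (ball (0 :: 'a) 1)"

lemma ball_measure:
  "emeasure lborel (ball (0 :: 'a::euclidean_space) 1) = ennreal (measure lborel (ball (0 :: 'a) 1))"
  "0 < measure lborel (ball (0 :: 'a) 1)"
  using content_ball_pos[of 1 "0 :: 'a"] emeasure_lborel_ball_finite[of "0 :: 'a" 1]
  by (simp_all add: emeasure_eq_ennreal_measure top.not_eq_extremum)

text \<open>Integrate $f(Lx)$ against a translate of the indicator of the unit ball in both orders.\<close>

lemma nn_integral_lfac:
  fixes L :: "'a::euclidean_space \<Rightarrow> 'a"
  assumes L: "linear L" "inj L" and f [measurable]: "f \<in> borel_measurable borel"
  shows "lfac L > 0" "(\<integral>\<^sup>+x. f (L x) \<partial>lborel) = ennreal (lfac L) * (\<integral>\<^sup>+x. f x \<partial>lborel)"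
proof -
  have Lm [measurable]: "L \<in> borel_measurable borel" by (rule linear_borel[OF L(1)])
  obtain K where K: "linear K" "\<And>x. L (K x) = x"
    using linear_surjective_right_inverse[OF L(1) linear_inj_imp_surj[OF L]] by (auto simp: fun_eq_iff)
  define B where "B = ball (0 :: 'a) 1"
  have Bm [measurable]: "B \<in> sets borel" by (simp add: B_def)
  have op: "open (L -` B)"
    unfolding B_def by (rule open_vimage) (auto intro: linear_continuous_on simp: linear_conv_bounded_linear[symmetric] L)
  obtain b where b: "b > 0" "\<And>x. b * norm x \<le> norm (L x)" using linear_inj_bounded_below_pos[OF L] by blast
  have "L -` B \<subseteq> cball 0 (1 / b)"
  proof
    fix x assume "x \<in> L -` B"
    hence "b * norm x < 1" using b(2)[of x] by (simp add: B_def)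
    thus "x \<in> cball 0 (1 / b)" using b(1) by (simp add: field_simps)
  qed
  hence "bounded (L -` B)" by (rule bounded_subset[OF bounded_cball])
  hence fin: "emeasure lborel (L -` B) < \<infinity>" by (rule emeasure_bounded_finite)
  have pos: "emeasure lborel (L -` B) > 0"
    by (rule emeasure_lborel_open_pos[OF op, of 0]) (simp add: B_def linear_0[OF L(1)])
  have eLB: "emeasure lborel (L -` B) = ennreal (measure lborel (L -` B))"
    using fin by (simp add: emeasure_eq_ennreal_measure top.not_eq_extremum)
  have mLB: "0 < measure lborel (L -` B)" using pos eLB by (simp add: ennreal_zero_less_top)
  have eB: "emeasure lborel B = ennreal (measure lborel B)" "0 < measure lborel B"
    using ball_measure[where 'a='a] by (simp_all add: B_def)
  show "lfac L > 0" using mLB eB(2) by (simp add: lfac_def B_def)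
  have "emeasure lborel B * (\<integral>\<^sup>+x. f (L x) \<partial>lborel) = (\<integral>\<^sup>+x. f (L x) * emeasure lborel B \<partial>lborel)"
    by (subst nn_integral_multc) (auto simp: mult.commute)
  also have "\<dots> = (\<integral>\<^sup>+x. \<integral>\<^sup>+y. f (L x) * indicator B (y + - L x) \<partial>lborel \<partial>lborel)"
    by (subst nn_integral_cmult, measurable) (subst nn_integral_translate, auto)
  also have "\<dots> = (\<integral>\<^sup>+y. \<integral>\<^sup>+x. f (L x) * indicator B (y + - L x) \<partial>lborel \<partial>lborel)"
    by (rule lborel_pair.Fubini'[symmetric]) measurable
  also have "\<dots> = (\<integral>\<^sup>+y. \<integral>\<^sup>+x. f (L x + y) * indicator B (- L x) \<partial>lborel \<partial>lborel)"
  proof (rule nn_integral_cong)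
    fix y
    have "(\<integral>\<^sup>+x. f (L x) * indicator B (y + - L x) \<partial>lborel) =
        (\<integral>\<^sup>+x. f (L (x + K y)) * indicator B (y + - L (x + K y)) \<partial>lborel)"
      by (rule nn_integral_translate[symmetric]) measurable
    thus "(\<integral>\<^sup>+x. f (L x) * indicator B (y + - L x) \<partial>lborel) = (\<integral>\<^sup>+x. f (L x + y) * indicator B (- L x) \<partial>lborel)"
      by (simp add: linear_add[OF L(1)] K)
  qed
  also have "\<dots> = (\<integral>\<^sup>+x. \<integral>\<^sup>+y. f (L x + y) * indicator B (- L x) \<partial>lborel \<partial>lborel)"
    by (rule lborel_pair.Fubini') measurable
  also have "\<dots> = (\<integral>\<^sup>+x. (\<integral>\<^sup>+y. f y \<partial>lborel) * indicator (L -` B) x \<partial>lborel)"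
  proof (rule nn_integral_cong)
    fix x
    have 1: "(\<integral>\<^sup>+y. f (L x + y) * indicator B (- L x) \<partial>lborel) = (\<integral>\<^sup>+y. f (y + L x) \<partial>lborel) * indicator B (- L x)"
      by (subst nn_integral_multc) (auto simp: add.commute)
    have 2: "indicator B (- L x) = (indicator (L -` B) x :: ennreal)" by (simp add: B_def indicator_def)
    show "(\<integral>\<^sup>+y. f (L x + y) * indicator B (- L x) \<partial>lborel) = (\<integral>\<^sup>+y. f y \<partial>lborel) * indicator (L -` B) x"
      unfolding 1 nn_integral_translate[OF f] unfolding 2 ..
  qed
  also have "\<dots> = (\<integral>\<^sup>+y. f y \<partial>lborel) * emeasure lborel (L -` B)"
    by (rule nn_integral_cmult_indicator) (use op in auto)
  finally have "ennreal (measure lborel B) * (\<integral>\<^sup>+x. f (L x) \<partial>lborel) = ennreal (measure lborel (L -` B)) * (\<integral>\<^sup>+y. f y \<partial>lborel)"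
    by (simp add: eB(1) eLB mult.commute)
  hence "ennreal (1 / measure lborel B) * (ennreal (measure lborel B) * (\<integral>\<^sup>+x. f (L x) \<partial>lborel)) =
      ennreal (1 / measure lborel B) * (ennreal (measure lborel (L -` B)) * (\<integral>\<^sup>+y. f y \<partial>lborel))" by simp
  thus "(\<integral>\<^sup>+x. f (L x) \<partial>lborel) = ennreal (lfac L) * (\<integral>\<^sup>+x. f x \<partial>lborel)"
    using eB(2) by (simp add: mult.assoc[symmetric] ennreal_mult[symmetric] lfac_def B_def)
qed

lemma lfac_unique:
  fixes L :: "'a::euclidean_space \<Rightarrow> 'a"
  assumes L: "linear L" "inj L" and c: "c \<ge> 0"
    and eq: "\<And>f :: 'a \<Rightarrow> ennreal. f \<in> borel_measurable borel \<Longrightarrow> (\<integral>\<^sup>+x. f (L x) \<partial>lborel) = ennreal c * (\<integral>\<^sup>+x. f x \<partial>lborel)"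
  shows "lfac L = c"
proof -
  let ?f = "indicator (ball (0 :: 'a) 1) :: 'a \<Rightarrow> ennreal"
  let ?m = "measure lborel (ball (0 :: 'a) 1)"
  have m: "?f \<in> borel_measurable borel" by (rule borel_measurable_indicator) simp
  have "ennreal (lfac L) * (\<integral>\<^sup>+x. ?f x \<partial>lborel) = ennreal c * (\<integral>\<^sup>+x. ?f x \<partial>lborel)"
    using nn_integral_lfac(2)[OF L m] eq[OF m] by (simp only:)
  hence "ennreal (lfac L * ?m) = ennreal (c * ?m)"
    using nn_integral_lfac(1)[OF L m] c
    by (simp add: ball_measure(1) ennreal_mult[symmetric])
  hence "lfac L * ?m = c * ?m"
    using nn_integral_lfac(1)[OF L m] c by (subst (asm) ennreal_inj) auto
  thus ?thesis using ball_measure(2)[where 'a='a] by simp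
qed

lemma lfac_pos: "linear L \<Longrightarrow> inj L \<Longrightarrow> lfac L > 0"
  by (rule nn_integral_lfac(1)[where f="\<lambda>_. 0"]) auto

lemma lfac_compose:
  fixes L M :: "'a::euclidean_space \<Rightarrow> 'a"
  assumes L: "linear L" "inj L" and M: "linear M" "inj M"
  shows "lfac (\<lambda>x. L (M x)) = lfac L * lfac M"
proof (rule lfac_unique)
  have lm: "L \<in> borel_measurable borel" by (rule linear_borel[OF L(1)])
  show "linear (\<lambda>x. L (M x))" using linear_compose[OF M(1) L(1)] by (simp add: o_def)
  show "inj (\<lambda>x. L (M x))" using inj_compose[OF L(2) M(2)] by (simp add: o_def)
  show "lfac L * lfac M \<ge> 0" using lfac_pos[OF L] lfac_pos[OF M] by simp
  fix f :: "'a \<Rightarrow> ennreal" assume [measurable]: "f \<in> borel_measurable borel"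
  have fL: "(\<lambda>x. f (L x)) \<in> borel_measurable borel" using lm by measurable
  show "(\<integral>\<^sup>+x. f (L (M x)) \<partial>lborel) = ennreal (lfac L * lfac M) * (\<integral>\<^sup>+x. f x \<partial>lborel)"
    unfolding nn_integral_lfac(2)[OF M fL] nn_integral_lfac(2)[OF L \<open>f \<in> borel_measurable borel\<close>]
    using lfac_pos[OF L] lfac_pos[OF M] by (simp add: ennreal_mult less_imp_le mult.left_commute mult.assoc)
qed

lemma lfac_isometry:
  fixes L :: "'a::euclidean_space \<Rightarrow> 'a"
  assumes "linear L" "\<And>x. norm (L x) = norm x"
  shows "lfac L = 1" "inj L"
proof -
  have "L -` ball 0 1 = ball 0 1" using assms(2) by auto
  thus "lfac L = 1" using ball_measure(2)[where 'a='a] by (simp add: lfac_def)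
  show "inj L" using assms by (metis linear_injective_0 norm_eq_zero)
qed

lemma nn_integral_isometry:
  fixes L :: "'a::euclidean_space \<Rightarrow> 'a"
  assumes "linear L" "\<And>x. norm (L x) = norm x" "f \<in> borel_measurable borel"
  shows "(\<integral>\<^sup>+x. f (L x) \<partial>lborel) = (\<integral>\<^sup>+x. f x \<partial>lborel)"
  using nn_integral_lfac(2)[OF assms(1) lfac_isometry(2)[OF assms(1,2)] assms(3)] lfac_isometry(1)[OF assms(1,2)] by simp

lemma lfac_conjugate:
  fixes L M Q :: "'a::euclidean_space \<Rightarrow> 'a"
  assumes L: "linear L" "inj L" and M: "linear M" "inj M" and Q: "linear Q" "inj Q"
    and eq: "\<And>x. L (Q x) = Q (M x)"
  shows "lfac L = lfac M"
proof -
  have "lfac L * lfac Q = lfac Q * lfac M"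
  proof -
    have "lfac (\<lambda>x. L (Q x)) = lfac (\<lambda>x. Q (M x))" by (simp only: eq)
    thus ?thesis by (simp only: lfac_compose[OF L Q] lfac_compose[OF Q M])
  qed
  thus ?thesis using lfac_pos[OF Q] by simp
qed

lemma lfac_diagonal:
  fixes L :: "'a::euclidean_space \<Rightarrow> 'a"
  assumes L: "linear L" and l: "\<And>b. b \<in> Basis \<Longrightarrow> L b = l b *\<^sub>R b" "\<And>b. b \<in> Basis \<Longrightarrow> l b > 0"
  shows "lfac L = 1 / (\<Prod>b\<in>Basis. l b)" "inj L"
proof -
  have rep: "L x = (\<Sum>b\<in>Basis. (l b * (x \<bullet> b)) *\<^sub>R b)" for x
  proof -
    have "L x = L (\<Sum>b\<in>Basis. (x \<bullet> b) *\<^sub>R b)" by (simp add: euclidean_representation)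
    also have "\<dots> = (\<Sum>b\<in>Basis. (x \<bullet> b) *\<^sub>R L b)" by (simp add: linear_sum[OF L] linear_cmul[OF L])
    also have "\<dots> = (\<Sum>b\<in>Basis. (l b * (x \<bullet> b)) *\<^sub>R b)" by (rule sum.cong) (simp_all add: l mult.commute)
    finally show ?thesis .
  qed
  have coord: "L x \<bullet> b = l b * (x \<bullet> b)" if "b \<in> Basis" for x b
    unfolding rep using that by (simp add: inner_sum_left inner_Basis if_distrib cong: if_cong)
  show inj: "inj L"
    unfolding linear_injective_0[OF L]
  proof (intro allI impI)
    fix x assume "L x = 0"
    hence "l b * (x \<bullet> b) = 0" if "b \<in> Basis" for b using coord[OF that, of x] by simp
    hence "x \<bullet> b = 0" if "b \<in> Basis" for b using that l(2)[OF that] by force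
    thus "x = 0" using euclidean_all_zero_iff[of x] by blast
  qed
  define P where "P = (\<Prod>b\<in>Basis. l b)"
  have P: "P > 0" unfolding P_def by (rule prod_pos) (use l in auto)
  show "lfac L = 1 / (\<Prod>b\<in>Basis. l b)"
  proof (rule lfac_unique[OF L inj])
    show "0 \<le> 1 / (\<Prod>b\<in>Basis. l b)" using P by (simp add: P_def)
    fix f :: "'a \<Rightarrow> ennreal" assume f [measurable]: "f \<in> borel_measurable borel"
    have Lm [measurable]: "L \<in> borel_measurable borel" by (rule linear_borel[OF L])
    have "lborel = density (distr lborel borel (\<lambda>x. 0 + (\<Sum>j\<in>Basis. (l j * (x \<bullet> j)) *\<^sub>R j))) (\<lambda>_. ennreal (\<Prod>j\<in>Basis. \<bar>l j\<bar>))"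
      by (rule lborel_affine_euclidean) (use l in force)
    also have "(\<lambda>x. 0 + (\<Sum>j\<in>Basis. (l j * (x \<bullet> j)) *\<^sub>R j)) = L" by (simp add: rep fun_eq_iff)
    also have "(\<Prod>j\<in>Basis. \<bar>l j\<bar>) = P" unfolding P_def by (rule prod.cong) (use l in force)+
    finally have "lborel = density (distr lborel borel L) (\<lambda>_. ennreal P)" .
    hence "(\<integral>\<^sup>+x. f x \<partial>lborel) = (\<integral>\<^sup>+x. f x \<partial>density (distr lborel borel L) (\<lambda>_. ennreal P))" by metis
    also have "\<dots> = ennreal P * (\<integral>\<^sup>+x. f (L x) \<partial>lborel)"
      by (simp add: nn_integral_density nn_integral_distr nn_integral_cmult)
    finally have "ennreal (1 / P) * (\<integral>\<^sup>+x. f x \<partial>lborel) = ennreal (1 / P) * ennreal P * (\<integral>\<^sup>+x. f (L x) \<partial>lborel)"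
      by (simp add: mult.assoc)
    thus "(\<integral>\<^sup>+x. f (L x) \<partial>lborel) = ennreal (1 / (\<Prod>b\<in>Basis. l b)) * (\<integral>\<^sup>+x. f x \<partial>lborel)"
      using P by (simp add: ennreal_mult[symmetric] P_def[symmetric])
  qed
qed

lemma prod_Basis_vec:
  "(\<Prod>b\<in>(Basis :: ('a::euclidean_space^'n::finite) set). h b) = (\<Prod>i\<in>UNIV. \<Prod>e\<in>Basis. h (axis i e))"
proof -
  have eq: "(Basis :: ('a^'n) set) = (\<lambda>(i, e). axis i e) ` (UNIV \<times> Basis)"
    by (auto simp: Basis_vec_def)
  have inj: "inj_on (\<lambda>(i, e). axis i e) (UNIV \<times> (Basis :: 'a set))"
    by (auto simp: inj_on_def axis_eq_axis nonzero_Basis)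
  have "(\<Prod>b\<in>(Basis :: ('a^'n) set). h b) = (\<Prod>(i, e)\<in>UNIV \<times> Basis. h (axis i e))"
    unfolding eq by (subst prod.reindex[OF inj]) (simp add: case_prod_beta)
  thus ?thesis by (simp add: prod.cartesian_product)
qed

lemma Basis_vec_cases:
  assumes "b \<in> (Basis :: ('a::euclidean_space^'n::finite^'m::finite) set)"
  obtains i j e where "e \<in> Basis" "b = axis i (axis j e)"
  using assms by (auto simp: Basis_vec_def)

lemma axis2_nth: "axis i (axis j e) $ k $ l = (if k = i \<and> l = j then e else 0)"
  by (simp add: axis_def)

section \<open>Multiplication by a matrix\<close>

lemma adet_nonzero_inj:
  fixes g :: "('f::rch, 'n::finite) sqmat"
  assumes "adet g \<noteq> 0" "g *v v = 0"
  shows "v = 0"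
proof -
  have "ctrans (ctrans g ** g) = ctrans g ** g" by (simp add: ctrans_mult)
  then obtain U a where U: "U \<in> unitary_group" and eq: "ctrans g ** g = U ** rdiag a ** ctrans U"
    using spectral_theorem by metis
  have "adet (U ** rdiag a ** ctrans U) \<noteq> 0" unfolding eq[symmetric] using assms(1) by (simp add: adet_mult)
  hence "(\<Prod>i\<in>UNIV. a i) \<noteq> 0" by (simp add: adet_mult adet_rdiag)
  hence a: "a i \<noteq> 0" for i by simp
  have "(ctrans g ** g) *v v = 0"
    by (simp add: matrix_vector_mul_assoc[symmetric] assms(2) linear_0[OF linear_matrix_vec])
  hence "U *v (rdiag a *v (ctrans U *v v)) = 0" unfolding eq by (simp add: matrix_vector_mul_assoc matrix_mul_assoc)
  hence "rdiag a *v (ctrans U *v v) = 0" by (rule unitary_inj[OF U])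
  hence "ctrans U *v v = 0" by (rule rdiag_inj[OF a])
  thus ?thesis by (rule unitary_inj[OF unitary_group_ctrans[OF U]])
qed

lemma adet_nonzero_inverse:
  fixes g :: "('f::rch, 'n::finite) sqmat"
  assumes "adet g \<noteq> 0"
  obtains h where "g ** h = mat 1" "h ** g = mat 1"
  using inj_imp_matrix_inverse adet_nonzero_inj[OF assms] by metis

lemma linear_matrix_right: "linear (\<lambda>X :: 'f::rch^'n::finite^'m::finite. X ** g)"
  by (rule linearI) (simp_all add: matrix_add_rdistrib matrix_scaleR_left)

lemma linear_matrix_left: "linear (\<lambda>X :: 'f::rch^'n::finite^'m::finite. g ** X)"
  by (rule linearI) (simp_all add: matrix_add_ldistrib matrix_scaleR_right)

lemma inj_matrix_right:
  fixes g :: "('f::rch, 'n::finite) sqmat"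
  assumes "g ** h = mat 1"
  shows "inj (\<lambda>X :: 'f^'n^'m::finite. X ** g)"
  by (rule injI) (metis assms matrix_mul_assoc matrix_mul_rid)

lemma lfac_rdiag_right:
  fixes s :: "'n::finite \<Rightarrow> real"
  assumes s: "\<And>i. s i > 0"
  shows "lfac (\<lambda>X :: 'f::rch^'n^'m::finite. X ** rdiag s) = (\<Prod>i\<in>UNIV. s i) powr - (real DIM('f) * real CARD('m))"
proof -
  let ?L = "\<lambda>X :: 'f^'n^'m. X ** rdiag s"
  have Lax: "?L (axis i (axis j e)) = s j *\<^sub>R axis i (axis j e)" for i j e
    by (simp add: vec_eq_iff rdiag_mult_nth axis2_nth)
  define l where "l b = (?L b \<bullet> b)" for b
  have lax: "l (axis i (axis j e)) = s j" if "e \<in> Basis" for i j e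
    using that by (simp add: l_def Lax inner_axis_axis inner_same_Basis)
  have P: "(\<Prod>i\<in>UNIV. s i) > 0" by (rule prod_pos) (use s in auto)
  have "lfac ?L = 1 / (\<Prod>b\<in>Basis. l b)"
  proof (rule lfac_diagonal[OF linear_matrix_right])
    fix b assume "b \<in> (Basis :: ('f^'n^'m) set)"
    then obtain i j e where b: "e \<in> Basis" "b = axis i (axis j e)" by (rule Basis_vec_cases)
    show "?L b = l b *\<^sub>R b" "l b > 0" using s by (simp_all only: b Lax lax)
  qed
  also have "(\<Prod>b\<in>Basis. l b) = (\<Prod>i\<in>(UNIV :: 'm set). \<Prod>j\<in>UNIV. \<Prod>e\<in>(Basis :: 'f set). s j)"
    unfolding prod_Basis_vec by (intro prod.cong refl lax)
  also have "\<dots> = (\<Prod>j\<in>UNIV. s j) ^ (DIM('f) * CARD('m))"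
    by (simp add: prod_power_distrib power_mult)
  also have "\<dots> = (\<Prod>j\<in>UNIV. s j) powr (real DIM('f) * real CARD('m))"
    using P by (simp add: powr_realpow[symmetric])
  finally show ?thesis using P by (simp add: powr_minus_divide)
qed

lemma lfac_matrix_right:
  fixes g :: "('f::rch, 'n::finite) sqmat"
  assumes "adet g \<noteq> 0"
  shows "lfac (\<lambda>X :: 'f^'n^'m::finite. X ** g) = adet g powr - (real DIM('f) * real CARD('m))"
proof -
  obtain W s U where W: "W \<in> unitary_group" and U: "U \<in> unitary_group" and s: "\<And>i. s i > 0"
    and g: "g = W ** rdiag s ** ctrans U"
    using singular_value_decomposition[of g] adet_nonzero_inj[OF assms] by metis
  let ?R = "\<lambda>h. \<lambda>X :: 'f^'n^'m. X ** h"
  have u: "lfac (?R V) = 1" "inj (?R V)" if "V \<in> unitary_group" for V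
    using lfac_isometry[OF linear_matrix_right[of V]] norm_isometry_right unitary_groupD(2)[OF that] by blast+
  have s0: "s i \<noteq> 0" for i using s[of i] by simp
  have d: "inj (?R (rdiag s))"
    by (rule inj_matrix_right[of _ "rdiag (\<lambda>i. 1 / s i)"]) (simp add: rdiag_mult rdiag_1 s0)
  have U': "ctrans U \<in> unitary_group" by (rule unitary_group_ctrans[OF U])
  have "lfac (\<lambda>X. ?R (ctrans U) (?R (rdiag s) X)) = lfac (?R (rdiag s))"
    by (subst lfac_compose[OF linear_matrix_right u(2)[OF U'] linear_matrix_right d]) (simp add: u U')
  moreover have "inj (\<lambda>X. ?R (ctrans U) (?R (rdiag s) X))" using inj_compose[OF u(2)[OF U'] d] by (simp add: o_def)
  moreover have "linear (\<lambda>X. ?R (ctrans U) (?R (rdiag s) X))"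
    using linear_compose[OF linear_matrix_right linear_matrix_right] by (simp add: o_def)
  ultimately have "lfac (\<lambda>X. ?R (ctrans U) (?R (rdiag s) (?R W X))) = lfac (?R (rdiag s))"
    using lfac_compose[OF _ _ linear_matrix_right u(2)[OF W], of "\<lambda>X. ?R (ctrans U) (?R (rdiag s) X)"]
    by (simp add: u W)
  moreover have "(\<lambda>X. ?R (ctrans U) (?R (rdiag s) (?R W X))) = ?R g" by (simp add: g matrix_mul_assoc)
  moreover have "adet g = (\<Prod>i\<in>UNIV. s i)"
    using s by (simp add: g adet_mult adet_unitary W U adet_rdiag prod_pos less_imp_le prod_nonneg)
  ultimately show ?thesis using lfac_rdiag_right[OF s, where 'f='f and 'm='m] by simp
qed

lemma nn_integral_matrix_right:
  fixes g :: "('f::rch, 'n::finite) sqmat" and f :: "'f^'n^'m::finite \<Rightarrow> ennreal"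
  assumes g: "adet g \<noteq> 0" and f: "f \<in> borel_measurable borel"
  shows "(\<integral>\<^sup>+X. f (X ** g) \<partial>lborel) = ennreal (adet g powr - (real DIM('f) * real CARD('m))) * (\<integral>\<^sup>+X. f X \<partial>lborel)"
proof -
  obtain h where "g ** h = mat 1" using adet_nonzero_inverse[OF g] by metis
  from nn_integral_lfac(2)[OF linear_matrix_right inj_matrix_right[OF this] f]
  show ?thesis by (simp add: lfac_matrix_right[OF g])
qed

lemma nn_integral_ctrans:
  fixes f :: "('f::rch, 'n::finite) sqmat \<Rightarrow> ennreal"
  assumes "f \<in> borel_measurable borel"
  shows "(\<integral>\<^sup>+X. f (ctrans X) \<partial>lborel) = (\<integral>\<^sup>+X. f X \<partial>lborel)"
  by (rule nn_integral_isometry[OF linear_ctrans _ assms]) simp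

lemma nn_integral_matrix_left:
  fixes g :: "('f::rch, 'n::finite) sqmat" and f :: "('f, 'n) sqmat \<Rightarrow> ennreal"
  assumes g: "adet g \<noteq> 0" and f [measurable]: "f \<in> borel_measurable borel"
  shows "(\<integral>\<^sup>+X. f (g ** X) \<partial>lborel) = ennreal (adet g powr - (real DIM('f) * real CARD('n))) * (\<integral>\<^sup>+X. f X \<partial>lborel)"
proof -
  have [measurable]: "(\<lambda>X. f (ctrans X)) \<in> borel_measurable borel" "(\<lambda>X. f (g ** X)) \<in> borel_measurable borel"
    using linear_borel[OF linear_ctrans] linear_borel[OF linear_matrix_left] f measurable_compose by blast+
  have "(\<integral>\<^sup>+X. f (g ** X) \<partial>lborel) = (\<integral>\<^sup>+X. f (g ** ctrans X) \<partial>lborel)"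
    by (rule nn_integral_ctrans[symmetric]) measurable
  also have "\<dots> = (\<integral>\<^sup>+X. f (ctrans (X ** ctrans g)) \<partial>lborel)" by (simp add: ctrans_mult)
  also have "\<dots> = ennreal (adet g powr - (real DIM('f) * real CARD('n))) * (\<integral>\<^sup>+X. f (ctrans X) \<partial>lborel)"
    using nn_integral_matrix_right[of "ctrans g" "\<lambda>X. f (ctrans X)"] g by simp
  also have "(\<integral>\<^sup>+X. f (ctrans X) \<partial>lborel) = (\<integral>\<^sup>+X. f X \<partial>lborel)" by (rule nn_integral_ctrans[OF f])
  finally show ?thesis .
qed

section \<open>Rank deficient matrices\<close>

text \<open>Eigenvectors for distinct eigenvalues are linearly independent.\<close>

lemma finite_eigenvalues:
  fixes f :: "'a::euclidean_space \<Rightarrow> 'a"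
  assumes f: "linear f"
  shows "finite {r. \<exists>v. v \<noteq> 0 \<and> f v = r *\<^sub>R v}"
proof (rule ccontr)
  assume "infinite {r. \<exists>v. v \<noteq> 0 \<and> f v = r *\<^sub>R v}"
  then obtain R where R: "finite R" "card R = DIM('a) + 1" "R \<subseteq> {r. \<exists>v. v \<noteq> 0 \<and> f v = r *\<^sub>R v}"
    using infinite_arbitrarily_large[of _ "DIM('a) + 1"] by blast
  hence "\<forall>r\<in>R. \<exists>v. v \<noteq> 0 \<and> f v = r *\<^sub>R v" by blast
  from bchoice[OF this] obtain v where "\<forall>r\<in>R. v r \<noteq> 0 \<and> f (v r) = r *\<^sub>R v r" by blast
  hence v: "\<And>r. r \<in> R \<Longrightarrow> v r \<noteq> 0" "\<And>r. r \<in> R \<Longrightarrow> f (v r) = r *\<^sub>R v r" by blast+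
  have ind: "\<forall>r\<in>T. c r = 0" if "finite T" "T \<subseteq> R" "(\<Sum>r\<in>T. c r *\<^sub>R v r) = 0" for T c
    using that
  proof (induction T arbitrary: c)
    case (insert s T)
    have "f (\<Sum>r\<in>insert s T. c r *\<^sub>R v r) - s *\<^sub>R (\<Sum>r\<in>insert s T. c r *\<^sub>R v r) =
        (\<Sum>r\<in>insert s T. (c r * (r - s)) *\<^sub>R v r)"
      unfolding linear_sum[OF f] scaleR_sum_right sum_subtractf[symmetric]
      by (rule sum.cong) (use insert(4) v in \<open>auto simp: linear_cmul[OF f] algebra_simps\<close>)
    hence "(\<Sum>r\<in>T. (c r * (r - s)) *\<^sub>R v r) = 0"
      using insert.prems(2) insert(1,2) by (simp add: linear_0[OF f])
    hence "\<forall>r\<in>T. c r * (r - s) = 0"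
      using insert.IH[of "\<lambda>r. c r * (r - s)"] insert.prems(1) by simp
    hence T0: "\<forall>r\<in>T. c r = 0" using insert(2) by auto
    hence "(\<Sum>r\<in>T. c r *\<^sub>R v r) = 0" by simp
    hence "c s *\<^sub>R v s = 0" using insert.prems(2) insert(1,2) by simp
    thus ?case using T0 v(1)[of s] insert.prems(1) by simp
  qed simp
  have "inj_on v R"
  proof (rule inj_onI)
    fix r s assume rs: "r \<in> R" "s \<in> R" "v r = v s"
    have "r *\<^sub>R v r = f (v s)" unfolding rs(3)[symmetric] by (rule v(2)[OF rs(1), symmetric])
    also have "\<dots> = s *\<^sub>R v r" unfolding rs(3) by (rule v(2)[OF rs(2)])
    finally have "r *\<^sub>R v r = s *\<^sub>R v r" .
    thus "r = s" using v(1)[OF rs(1)] by simp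
  qed
  moreover have "independent (v ` R)"
  proof (rule independent_if_scalars_zero)
    show "finite (v ` R)" using R by simp
    fix g x assume "(\<Sum>x\<in>v ` R. g x *\<^sub>R x) = 0" "x \<in> v ` R"
    thus "g x = 0" using ind[OF R(1) subset_refl, of "\<lambda>r. g (v r)"] by (auto simp: sum.reindex[OF \<open>inj_on v R\<close>])
  qed
  hence "card (v ` R) \<le> DIM('a)" using independent_bound by blast
  ultimately show False using R(2) by (simp add: card_image)
qed

text \<open>Adding $r$ times a fixed injective matrix makes \<open>Z\<close> injective for all but finitely many $r$,
  and the measure is invariant under these translations.\<close>

lemma AE_gram_pos_def:
  assumes "CARD('q::finite) \<le> CARD('s::finite)"
  shows "AE Z in lborel. pos_def (ctrans Z ** (Z :: 'f::rch^'q^'s))"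
proof -
  obtain \<iota> :: "'q \<Rightarrow> 's" where \<iota>: "inj \<iota>"
    using assms card_le_inj[of "UNIV :: 'q set" "UNIV :: 's set"] by auto
  define E where "E = (\<chi> a j. if a = \<iota> j then 1 else (0 :: 'f))"
  define E' where "E' = (\<chi> j a. if a = \<iota> j then 1 else (0 :: 'f))"
  have E'E: "E' ** E = mat 1"
    using \<iota> by (auto simp: vec_eq_iff matrix_nth E'_def E_def mat_nth inj_eq if_distrib[where f="\<lambda>x. x * _"] cong: if_cong)
  define N where "N = {Z :: 'f^'q^'s. \<not> pos_def (ctrans Z ** Z)}"
  have cont: "continuous_on UNIV (\<lambda>Z :: 'f^'q^'s. ctrans Z ** Z)" by (intro continuous_intros)
  have "Measurable.pred borel (\<lambda>Z :: 'f^'q^'s. pos_def (ctrans Z ** Z))"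
    by (rule measurable_compose[OF borel_measurable_continuous_onI[OF cont] pos_def_borel])
  hence N [measurable]: "N \<in> sets borel" unfolding N_def by measurable
  have null: "(\<integral>\<^sup>+r. indicator N (Z + r *\<^sub>R E) * indicator {0..1::real} r \<partial>lborel) = 0" for Z
  proof -
    have "{r. Z + r *\<^sub>R E \<in> N} \<subseteq> uminus ` {r. \<exists>v. v \<noteq> 0 \<and> (E' ** Z) *v v = r *\<^sub>R v}"
    proof
      fix r assume "r \<in> {r. Z + r *\<^sub>R E \<in> N}"
      hence "\<not> (\<forall>v. (Z + r *\<^sub>R E) *v v = 0 \<longrightarrow> v = 0)"
        using pos_def_gram[of "Z + r *\<^sub>R E"] by (auto simp: N_def)
      then obtain v where v: "v \<noteq> 0" "(Z + r *\<^sub>R E) *v v = 0" by blast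
      have "E' *v ((Z + r *\<^sub>R E) *v v) = 0" by (simp only: v(2) linear_0[OF linear_matrix_vec])
      hence "(E' ** Z + r *\<^sub>R mat 1) *v v = 0"
        by (simp add: matrix_vector_mul_assoc matrix_add_ldistrib matrix_scaleR_right E'E)
      moreover have "(r *\<^sub>R mat 1) *v v = r *\<^sub>R v" by (simp add: vec_eq_iff matrix_vec_nth mat_nth if_distrib[where f="\<lambda>x. _ *\<^sub>R x"] if_distrib[where f="\<lambda>x. x * _"] cong: if_cong)
      ultimately have "(E' ** Z) *v v = (- r) *\<^sub>R v"
        by (simp add: matrix_vector_mult_add_rdistrib eq_neg_iff_add_eq_0)
      thus "r \<in> uminus ` {r. \<exists>v. v \<noteq> 0 \<and> (E' ** Z) *v v = r *\<^sub>R v}"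
        using v(1) by (intro image_eqI[of _ _ "- r"]) auto
    qed
    hence "finite {r. Z + r *\<^sub>R E \<in> N}"
      by (rule finite_subset) (intro finite_imageI finite_eigenvalues linear_matrix_vec)
    hence "{r. Z + r *\<^sub>R E \<in> N} \<in> null_sets lborel" by (rule finite_imp_null_set_lborel)
    hence "AE r in lborel. r \<notin> {r. Z + r *\<^sub>R E \<in> N}" by (rule AE_not_in)
    hence "(\<integral>\<^sup>+r. indicator N (Z + r *\<^sub>R E) * indicator {0..1::real} r \<partial>lborel) = (\<integral>\<^sup>+r. 0 \<partial>(lborel :: real measure))"
      by (intro nn_integral_cong_AE) (auto simp: indicator_def elim: eventually_mono)
    thus ?thesis by simp
  qed
  have "emeasure lborel N = (\<integral>\<^sup>+r. emeasure lborel N * indicator {0..1::real} r \<partial>lborel)"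
    by (subst nn_integral_cmult_indicator) auto
  also have "\<dots> = (\<integral>\<^sup>+r. \<integral>\<^sup>+Z. indicator N (Z + r *\<^sub>R E) * indicator {0..1::real} r \<partial>lborel \<partial>lborel)"
    by (intro nn_integral_cong) (subst nn_integral_multc, measurable, subst nn_integral_translate, auto)
  also have "\<dots> = (\<integral>\<^sup>+Z. \<integral>\<^sup>+r. indicator N (Z + r *\<^sub>R E) * indicator {0..1::real} r \<partial>lborel \<partial>lborel)"
    by (rule lborel_pair.Fubini') measurable
  also have "\<dots> = 0" by (simp add: null)
  finally have "N \<in> null_sets lborel" using N by (simp add: null_sets_def)
  from AE_not_in[OF this] show ?thesis by (simp add: N_def)
qed

section \<open>Lebesgue measure on Hermitian matrices\<close>

definition hermp :: "('f::rch, 'n::finite) sqmat \<Rightarrow> ('f, 'n) sqmat"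
  where "hermp X = (1 / 2) *\<^sub>R (X + ctrans X)"

definition skwp :: "('f::rch, 'n::finite) sqmat \<Rightarrow> ('f, 'n) sqmat"
  where "skwp X = (1 / 2) *\<^sub>R (X - ctrans X)"

text \<open>Integrals over Hermitian matrices are taken over all matrices, through the Hermitian part, with the
  skew part restricted to a ball. A congruence of the Hermitian part is then the linear bijection
  \<open>congr\<close> of the whole space.\<close>

definition congr :: "('f::rch, 'n::finite) sqmat \<Rightarrow> ('f, 'n) sqmat \<Rightarrow> ('f, 'n) sqmat"
  where "congr g X = ctrans g ** hermp X ** g + skwp X"

lemma hermp_add_skwp: "hermp X + skwp X = X"
  by (simp add: hermp_def skwp_def scaleR_add_right[symmetric])

lemma ctrans_hermp [simp]: "ctrans (hermp X) = hermp X"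
  by (simp add: hermp_def ctrans_scaleR ctrans_add add.commute)

lemma ctrans_skwp [simp]: "ctrans (skwp X) = - skwp X"
  by (simp add: skwp_def ctrans_scaleR ctrans_diff scaleR_minus_right[symmetric] del: scaleR_minus_right)

lemma linear_hermp: "linear hermp"
  by (rule linearI) (simp_all add: hermp_def ctrans_add ctrans_scaleR algebra_simps)

lemma linear_skwp: "linear skwp"
  by (rule linearI) (simp_all add: skwp_def ctrans_add ctrans_scaleR algebra_simps)

lemma hermp_hermitian: "ctrans A = A \<Longrightarrow> hermp A = A" "ctrans A = A \<Longrightarrow> skwp A = 0"
  by (simp_all add: hermp_def skwp_def)

lemma hermp_skew: "ctrans A = - A \<Longrightarrow> hermp A = 0" "ctrans A = - A \<Longrightarrow> skwp A = A"
  by (simp_all add: hermp_def skwp_def)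

lemma ctrans_congruence: "ctrans A = A \<Longrightarrow> ctrans (ctrans g ** A ** g) = ctrans g ** A ** g"
  by (simp add: ctrans_mult matrix_mul_assoc)

lemma hermp_congr: "hermp (congr g X) = ctrans g ** hermp X ** g" "skwp (congr g X) = skwp X"
  by (simp_all add: congr_def linear_add[OF linear_hermp] linear_add[OF linear_skwp]
      hermp_hermitian ctrans_congruence hermp_skew)

lemma congr_congr: "congr h (congr g X) = congr (g ** h) X"
  by (simp add: congr_def[of h] hermp_congr) (simp add: congr_def ctrans_mult matrix_mul_assoc)

lemma congr_1: "congr (mat 1) X = X"
  by (simp add: congr_def hermp_add_skwp)

lemma linear_congr: "linear (congr g)"
  unfolding congr_def
  by (rule linearI)
     (simp_all add: linear_add[OF linear_hermp] linear_add[OF linear_skwp] linear_cmul[OF linear_hermp] linear_cmul[OF linear_skwp]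
       matrix_add_ldistrib matrix_add_rdistrib matrix_scaleR_left matrix_scaleR_right scaleR_add_right)

lemma inj_congr: "g ** h = mat 1 \<Longrightarrow> inj (congr g)"
  by (rule injI) (metis congr_congr congr_1)

lemma inner_hermp_skwp: "hermp X \<bullet> skwp Y = 0"
proof -
  have "hermp X \<bullet> skwp Y = ctrans (hermp X) \<bullet> ctrans (skwp Y)" by (simp only: inner_ctrans)
  thus ?thesis by simp
qed

lemma norm_congr_unitary:
  assumes "U \<in> unitary_group"
  shows "norm (congr U X) = norm X"
proof -
  have split: "(norm Y)\<^sup>2 = (norm (hermp Y))\<^sup>2 + (norm (skwp Y))\<^sup>2" for Y :: "('a, 'b) sqmat"
  proof -
    have "(hermp Y + skwp Y) \<bullet> (hermp Y + skwp Y) = hermp Y \<bullet> hermp Y + skwp Y \<bullet> skwp Y"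
      by (simp add: inner_add_left inner_add_right inner_hermp_skwp inner_commute[of "skwp Y" "hermp Y"])
    thus ?thesis by (simp add: hermp_add_skwp power2_norm_eq_inner)
  qed
  have "norm (ctrans U ** hermp X ** U) = norm (hermp X)"
    by (simp add: norm_isometry_right norm_isometry_left unitary_groupD[OF assms])
  hence "(norm (congr U X))\<^sup>2 = (norm X)\<^sup>2" by (simp add: split[of "congr U X"] split[of X] hermp_congr)
  thus ?thesis by (simp add: power2_eq_iff_nonneg)
qed

text \<open>Twice the homogeneity degree of Lebesgue measure on Hermitian matrices, divided by $q$.\<close>

definition hexp :: "'f::rch itself \<Rightarrow> 'q::finite itself \<Rightarrow> real"
  where "hexp _ _ = real DIM('f) * (real CARD('q) - 1) + 2"

lemma prod_upper_pairs:
  fixes a :: "'q::{finite,linorder} \<Rightarrow> real"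
  shows "(\<Prod>i\<in>UNIV. \<Prod>j\<in>UNIV. if i < j then a i * a j else 1) = (\<Prod>i\<in>UNIV. a i) ^ (CARD('q) - 1)"
proof -
  have c: "card {j. i < j} + card {j. j < i} = CARD('q) - 1" for i :: 'q
  proof -
    have "card {j. i < j} + card {j. j < i} = card ({j. i < j} \<union> {j. j < i})"
      by (rule card_Un_disjoint[symmetric]) auto
    also have "{j. i < j} \<union> {j. j < i} = UNIV - {i}" by auto
    finally show ?thesis by (simp add: card_Diff_singleton)
  qed
  have "(\<Prod>i\<in>UNIV. \<Prod>j\<in>UNIV. if i < j then a i * a j else 1) =
      (\<Prod>i\<in>UNIV. \<Prod>j\<in>UNIV. (if i < j then a i else 1) * (if i < j then a j else 1))"
    by (intro prod.cong) auto
  also have "\<dots> = (\<Prod>i\<in>UNIV. \<Prod>j\<in>UNIV. if i < j then a i else 1) * (\<Prod>i\<in>UNIV. \<Prod>j\<in>UNIV. if i < j then a j else 1)"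
    by (simp add: prod.distrib)
  also have "(\<Prod>i\<in>UNIV. \<Prod>j\<in>UNIV. if i < j then a j else 1) = (\<Prod>j\<in>UNIV. \<Prod>i\<in>UNIV. if i < j then a j else 1)"
    by (rule prod.swap)
  also have "(\<Prod>j\<in>UNIV. \<Prod>i\<in>UNIV. if i < j then a j else 1) = (\<Prod>j\<in>UNIV. a j ^ card {i. i < j})"
    by (simp add: prod.If_cases)
  also have "(\<Prod>i\<in>UNIV. \<Prod>j\<in>UNIV. if i < j then a i else 1) = (\<Prod>i\<in>UNIV. a i ^ card {j. i < j})"
    by (simp add: prod.If_cases)
  also have "(\<Prod>i\<in>UNIV. a i ^ card {j. i < j}) * (\<Prod>j\<in>UNIV. a j ^ card {i. i < j})
      = (\<Prod>i\<in>UNIV. a i ^ card {j. i < j} * a i ^ card {j. j < i})"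
    by (simp add: prod.distrib)
  also have "\<dots> = (\<Prod>i\<in>UNIV. a i ^ (CARD('q) - 1))" by (simp add: power_add[symmetric] c)
  finally show ?thesis by (simp add: prod_power_distrib)
qed

text \<open>In the coordinates given by the entries above the diagonal and the real parts of the diagonal
  entries (Hermitian part), and by the remaining ones (skew part), the congruence by a real diagonal
  matrix is diagonal.\<close>

lemma lfac_congr_rdiag:
  fixes a :: "'q::{finite,linorder} \<Rightarrow> real"
  assumes a: "\<And>i. a i > 0"
  shows "lfac (congr (rdiag a) :: ('f::rch, 'q) sqmat \<Rightarrow> _) = (\<Prod>i\<in>UNIV. a i) powr - hexp TYPE('f) TYPE('q)"
proof -
  obtain b0 :: 'f where b0: "b0 \<in> Basis" "1 \<bullet> b0 \<noteq> 0"
    using euclidean_all_zero_iff[of "1 :: 'f"] by auto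
  have b00: "b0 \<bullet> b0 = 1" using b0(1) by (rule inner_same_Basis)
  define im where "im y = y - (y \<bullet> 1) *\<^sub>R 1" for y :: 'f
  have im: "star (im y) = - im y" for y
  proof -
    have "y + star y = (y \<bullet> 1) *\<^sub>R 1 + (y \<bullet> 1) *\<^sub>R 1"
      unfolding star_plus_self of_real_def by (simp only: mult_2 scaleR_add_left)
    thus ?thesis by (simp add: im_def star_diff star_scaleR eq_neg_iff_add_eq_0 algebra_simps)
  qed
  have lin_im: "linear im" by (rule linearI) (simp_all add: im_def inner_add_left algebra_simps)
  define R where "R x = x - (x \<bullet> b0) *\<^sub>R b0" for x :: 'f
  have lin_R: "linear R" by (rule linearI) (simp_all add: R_def inner_add_left algebra_simps)
  define T where "T x = (x \<bullet> b0) *\<^sub>R 1 + im (R x)" for x :: 'f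
  have lin_T: "linear T"
    by (rule linearI) (simp_all add: T_def inner_add_left linear_add[OF lin_im] linear_add[OF lin_R]
        linear_cmul[OF lin_im] linear_cmul[OF lin_R] algebra_simps)
  have im1: "im x \<bullet> 1 = 0" for x by (simp add: im_def inner_diff_left dot_square_norm)
  have T0: "x = 0" if "T x = 0" for x
  proof -
    have "T x \<bullet> 1 = x \<bullet> b0" by (simp add: T_def inner_add_left im1 dot_square_norm)
    hence x0: "x \<bullet> b0 = 0" using that by simp
    hence "im x = 0" using that by (simp add: T_def R_def)
    hence xe: "x = (x \<bullet> 1) *\<^sub>R 1" by (simp add: im_def)
    have "x \<bullet> b0 = (x \<bullet> 1) * (1 \<bullet> b0)" by (subst xe) simp
    hence "x \<bullet> 1 = 0" using x0 b0(2) by simp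
    thus ?thesis using xe by simp
  qed
  define Q where "Q X = (\<chi> i j. if i < j then X $ i $ j + X $ j $ i
    else if j < i then star (X $ j $ i) - star (X $ i $ j) else T (X $ i $ i))" for X :: "('f, 'q) sqmat"
  define E where "E X = (\<chi> i j. if i < j then (a i * a j) *\<^sub>R X $ i $ j
    else if j < i then X $ i $ j else X $ i $ i + (((a i)\<^sup>2 - 1) * (X $ i $ i \<bullet> b0)) *\<^sub>R b0)" for X :: "('f, 'q) sqmat"
  have lin_Q: "linear Q"
    by (rule linearI) (auto simp: Q_def vec_eq_iff linear_add[OF lin_T] linear_cmul[OF lin_T] star_add star_scaleR algebra_simps)
  have lin_E: "linear E"
    by (rule linearI) (auto simp: E_def vec_eq_iff inner_add_left algebra_simps)
  have inj_Q: "inj Q"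
    unfolding linear_injective_0[OF lin_Q]
  proof (intro allI impI)
    fix X assume Q0: "Q X = 0"
    have off: "X $ i $ j = 0 \<and> X $ j $ i = 0" if "i < j" for i j
    proof -
      have nij: "\<not> j < i" using that by (simp add: not_less less_imp_le)
      have "Q X $ i $ j = 0" "Q X $ j $ i = 0" by (simp_all only: Q0 zero_index)
      hence 1: "X $ i $ j + X $ j $ i = 0" and "star (X $ i $ j) - star (X $ j $ i) = 0"
        using that nij by (simp_all add: Q_def)
      hence "X $ i $ j = X $ j $ i" by (metis eq_iff_diff_eq_0 star_star)
      thus ?thesis using 1 by (simp add: scaleR_2[symmetric])
    qed
    have "X $ i $ j = 0" for i j
    proof (cases i j rule: linorder_cases)
      case equal
      have "Q X $ i $ i = 0" by (simp only: Q0 zero_index)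
      thus ?thesis using equal T0 by (simp add: Q_def)
    qed (use off in auto)
    thus "X = 0" by (simp add: vec_eq_iff)
  qed
  have T_scale: "T (x + ((s - 1) * (x \<bullet> b0)) *\<^sub>R b0) = (s * (x \<bullet> b0)) *\<^sub>R 1 + im (R x)" for x s
  proof -
    have "R (x + ((s - 1) * (x \<bullet> b0)) *\<^sub>R b0) = R x"
      by (simp add: R_def inner_add_left b00 algebra_simps)
    moreover have "(x + ((s - 1) * (x \<bullet> b0)) *\<^sub>R b0) \<bullet> b0 = s * (x \<bullet> b0)"
      by (simp add: inner_add_left b00 algebra_simps)
    ultimately show ?thesis by (simp only: T_def)
  qed
  have congr_nth: "congr (rdiag a) Y $ i $ j = (a i * a j) *\<^sub>R hermp Y $ i $ j + skwp Y $ i $ j" for Y :: "('f, 'q) sqmat" and i j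
    by (simp add: congr_def rdiag_mult_nth mult.commute)
  have "congr (rdiag a) (Q X) $ i $ j = Q (E X) $ i $ j" for X i j
  proof (cases i j rule: linorder_cases)
    case less
    hence n: "\<not> j < i" by (simp add: not_less less_imp_le)
    from less n have "hermp (Q X) $ i $ j = X $ i $ j" "skwp (Q X) $ i $ j = X $ j $ i"
      by (simp_all add: hermp_def skwp_def Q_def star_diff)
    thus ?thesis using less n by (simp add: congr_nth) (simp add: Q_def E_def)
  next
    case greater
    hence n: "\<not> i < j" by (simp add: not_less less_imp_le)
    from greater n have "hermp (Q X) $ i $ j = star (X $ j $ i)" "skwp (Q X) $ i $ j = - star (X $ i $ j)"
      using scaleR_half_double[of "- star (X $ i $ j)"] by (simp_all add: hermp_def skwp_def Q_def star_add)
    thus ?thesis using greater n by (simp add: congr_nth) (simp add: Q_def E_def star_scaleR mult.commute)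
  next
    case equal
    have sT: "star (T x) = (x \<bullet> b0) *\<^sub>R 1 - im (R x)" for x
      by (simp add: T_def star_add star_scaleR im)
    have "hermp (Q X) $ j $ j = (X $ j $ j \<bullet> b0) *\<^sub>R 1" "skwp (Q X) $ j $ j = im (R (X $ j $ j))"
      by (simp_all add: hermp_def skwp_def Q_def sT) (simp_all add: T_def scaleR_2[symmetric])
    thus ?thesis using equal by (simp add: congr_nth) (simp add: Q_def E_def T_scale power2_eq_square)
  qed
  hence eq: "congr (rdiag a) (Q X) = Q (E X)" for X by (simp add: vec_eq_iff)
  define l where "l b = E b \<bullet> b" for b
  have Eax: "E (axis i (axis j e)) = (if i < j then a i * a j else if j < i then 1 else if e = b0 then (a i)\<^sup>2 else 1) *\<^sub>R axis i (axis j e)"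
    (is "_ = ?c i j e *\<^sub>R _") if e: "e \<in> Basis" for i j e
  proof -
    have eb: "e \<bullet> b0 = (if e = b0 then 1 else 0)" using e b0(1) by (simp add: inner_Basis)
    have "E (axis i (axis j e)) $ k $ m = (?c i j e *\<^sub>R axis i (axis j e)) $ k $ m" for k m
      by (cases k m rule: linorder_cases) (auto simp: E_def axis2_nth eb algebra_simps)
    thus ?thesis by (simp add: vec_eq_iff)
  qed
  have lax: "l (axis i (axis j e)) = (if i < j then a i * a j else if j < i then 1 else if e = b0 then (a i)\<^sup>2 else 1)"
    if "e \<in> Basis" for i j e
    unfolding l_def Eax[OF that] using that by (simp add: inner_axis_axis inner_same_Basis)
  have diag: "E b = l b *\<^sub>R b" "l b > 0" if "b \<in> Basis" for b
  proof -
    obtain i j e where b: "e \<in> Basis" "b = axis i (axis j e)" using \<open>b \<in> Basis\<close> by (rule Basis_vec_cases)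
    show "E b = l b *\<^sub>R b" unfolding b(2) Eax[OF b(1)] lax[OF b(1)] ..
    show "l b > 0" unfolding b(2) lax[OF b(1)] using a[of i] a[of j] by auto
  qed
  define D where "D = (\<Prod>i\<in>UNIV. a i)"
  have D: "D > 0" unfolding D_def by (rule prod_pos) (use a in auto)
  have s0: "a i \<noteq> 0" for i using a[of i] by simp
  have "rdiag a ** rdiag (\<lambda>i. 1 / a i) = (mat 1 :: ('f, 'q) sqmat)" by (simp add: rdiag_mult rdiag_1 s0)
  hence "lfac (congr (rdiag a) :: ('f, 'q) sqmat \<Rightarrow> _) = lfac E"
    by (intro lfac_conjugate[OF linear_congr inj_congr lin_E lfac_diagonal(2)[OF lin_E diag] lin_Q inj_Q eq])
  also have "\<dots> = 1 / (\<Prod>b\<in>Basis. l b)" by (rule lfac_diagonal(1)[OF lin_E diag])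
  also have "(\<Prod>b\<in>Basis. l b) = (\<Prod>i\<in>UNIV. \<Prod>j\<in>UNIV. \<Prod>e\<in>Basis. if i < j then a i * a j else if j < i then 1 else if e = b0 then (a i)\<^sup>2 else 1)"
    unfolding prod_Basis_vec by (intro prod.cong refl lax)
  also have "\<dots> = (\<Prod>i\<in>UNIV. \<Prod>j\<in>UNIV. (if i < j then a i * a j else 1) ^ DIM('f) * (if i = j then (a i)\<^sup>2 else 1))"
  proof (intro prod.cong refl)
    fix i j
    show "(\<Prod>e\<in>(Basis :: 'f set). if i < j then a i * a j else if j < i then 1 else if e = b0 then (a i)\<^sup>2 else 1) =
        (if i < j then a i * a j else 1) ^ DIM('f) * (if i = j then (a i)\<^sup>2 else 1)"
      by (cases i j rule: linorder_cases) (simp_all add: prod.delta b0(1))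
  qed
  also have "\<dots> = D ^ ((CARD('q) - 1) * DIM('f)) * D\<^sup>2"
    by (simp add: prod.distrib prod_power_distrib[symmetric] prod_upper_pairs D_def power_mult)
  also have "\<dots> = D ^ ((CARD('q) - 1) * DIM('f) + 2)" by (simp only: power_add)
  also have "\<dots> = D powr hexp TYPE('f) TYPE('q)"
  proof -
    have "hexp TYPE('f) TYPE('q) = real ((CARD('q) - 1) * DIM('f) + 2)"
      by (simp add: hexp_def of_nat_diff Suc_leI mult.commute)
    thus ?thesis by (simp only: powr_realpow[OF D])
  qed
  finally show ?thesis by (simp add: D_def powr_minus_divide)
qed

text \<open>Congruences by unitary matrices are isometries; singular values reduce the claim to positive
  diagonal matrices.\<close>

lemma lfac_congr:
  fixes g :: "('f::rch, 'q::{finite,linorder}) sqmat"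
  assumes "adet g \<noteq> 0"
  shows "lfac (congr g) = adet g powr - hexp TYPE('f) TYPE('q)"
proof -
  obtain W s U where W: "W \<in> unitary_group" and U: "U \<in> unitary_group" and s: "\<And>i. s i > 0"
    and g: "g = W ** rdiag s ** ctrans U"
    using singular_value_decomposition[of g] adet_nonzero_inj[OF assms] by metis
  have u: "lfac (congr V) = 1" "inj (congr V)" if "V \<in> unitary_group" for V :: "('f, 'q) sqmat"
    using lfac_isometry[OF linear_congr[of V]] norm_congr_unitary[OF that] by blast+
  have s0: "s i \<noteq> 0" for i using s[of i] by simp
  have d: "inj (congr (rdiag s) :: ('f, 'q) sqmat \<Rightarrow> _)"
    by (rule inj_congr[of _ "rdiag (\<lambda>i. 1 / s i)"]) (simp add: rdiag_mult rdiag_1 s0)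
  have U': "ctrans U \<in> unitary_group" by (rule unitary_group_ctrans[OF U])
  have "lfac (\<lambda>X. congr (ctrans U) (congr (rdiag s) X)) = lfac (congr (rdiag s) :: ('f, 'q) sqmat \<Rightarrow> _)"
    by (subst lfac_compose[OF linear_congr u(2)[OF U'] linear_congr d]) (simp add: u U')
  moreover have "inj (\<lambda>X. congr (ctrans U) (congr (rdiag s) X))" using inj_compose[OF u(2)[OF U'] d] by (simp add: o_def)
  moreover have "linear (\<lambda>X. congr (ctrans U) (congr (rdiag s) X))"
    using linear_compose[OF linear_congr linear_congr] by (simp add: o_def)
  ultimately have "lfac (\<lambda>X. congr (ctrans U) (congr (rdiag s) (congr W X))) = lfac (congr (rdiag s) :: ('f, 'q) sqmat \<Rightarrow> _)"
    using lfac_compose[OF _ _ linear_congr u(2)[OF W], of "\<lambda>X. congr (ctrans U) (congr (rdiag s) X)"]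
    by (simp add: u W)
  moreover have "(\<lambda>X. congr (ctrans U) (congr (rdiag s) (congr W X))) = congr g"
    by (simp add: g congr_congr matrix_mul_assoc)
  moreover have "adet g = (\<Prod>i\<in>UNIV. s i)"
    using s by (simp add: g adet_mult adet_unitary W U adet_rdiag prod_nonneg less_imp_le)
  ultimately show ?thesis using lfac_congr_rdiag[OF s, where 'f='f] by simp
qed

lemma nn_integral_congr:
  fixes g :: "('f::rch, 'q::{finite,linorder}) sqmat" and f :: "('f, 'q) sqmat \<Rightarrow> ennreal"
  assumes g: "adet g \<noteq> 0" and f: "f \<in> borel_measurable borel"
  shows "(\<integral>\<^sup>+X. f (congr g X) \<partial>lborel) = ennreal (adet g powr - hexp TYPE('f) TYPE('q)) * (\<integral>\<^sup>+X. f X \<partial>lborel)"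
proof -
  obtain h where "g ** h = mat 1" using adet_nonzero_inverse[OF g] by metis
  from nn_integral_lfac(2)[OF linear_congr inj_congr[OF this] f] show ?thesis by (simp add: lfac_congr[OF g])
qed

section \<open>Relatively invariant measures on positive definite matrices\<close>

lemma measurable_matrix_mult [measurable (raw)]:
  fixes f :: "'a \<Rightarrow> 'f::rch^'n::finite^'m::finite" and g :: "'a \<Rightarrow> 'f^'k::finite^'n"
  assumes "f \<in> borel_measurable M" "g \<in> borel_measurable M"
  shows "(\<lambda>x. f x ** g x) \<in> borel_measurable M"
  by (rule borel_measurable_continuous_Pair[OF assms]) (intro continuous_intros)

lemma measurable_ctrans [measurable (raw)]:
  fixes f :: "'a \<Rightarrow> 'f::rch^'n::finite^'m::finite"
  assumes "f \<in> borel_measurable M"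
  shows "(\<lambda>x. ctrans (f x)) \<in> borel_measurable M"
  by (rule measurable_compose[OF assms linear_borel[OF linear_ctrans]])

lemma measurable_hermp [measurable (raw)]:
  fixes f :: "'a \<Rightarrow> ('f::rch, 'n::finite) sqmat"
  assumes "f \<in> borel_measurable M"
  shows "(\<lambda>x. hermp (f x)) \<in> borel_measurable M" "(\<lambda>x. skwp (f x)) \<in> borel_measurable M"
  by (rule measurable_compose[OF assms linear_borel[OF linear_hermp]],
      rule measurable_compose[OF assms linear_borel[OF linear_skwp]])

lemma measurable_adet [measurable (raw)]:
  fixes f :: "'a \<Rightarrow> ('f::rch, 'n::finite) sqmat"
  assumes "f \<in> borel_measurable M"
  shows "(\<lambda>x. adet (f x)) \<in> borel_measurable M"
proof -
  have "continuous_on UNIV (adet :: ('f, 'n) sqmat \<Rightarrow> real)" by (intro continuous_intros)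
  from measurable_compose[OF assms borel_measurable_continuous_onI[OF this]] show ?thesis .
qed

lemma measurable_pos_def [measurable (raw)]:
  fixes f :: "'a \<Rightarrow> ('f::rch, 'n::finite) sqmat"
  assumes "f \<in> borel_measurable M"
  shows "Measurable.pred M (\<lambda>x. pos_def (f x))"
  by (rule measurable_compose[OF assms pos_def_borel])

text \<open>A bounded region of positive definite matrices, used to normalize. Instead of $1/3$ any positive number
  below $1/2$ would do: half the identity has to be an interior point.\<close>

definition cutoff :: "('f::rch, 'n::finite) sqmat \<Rightarrow> bool"
  where "cutoff A \<longleftrightarrow> pos_def (mat 1 - A) \<and> adet A > (1 / 3) ^ CARD('n)"

lemma measurable_cutoff [measurable (raw)]:
  fixes f :: "'a \<Rightarrow> ('f::rch, 'n::finite) sqmat"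
  assumes [measurable]: "f \<in> borel_measurable M"
  shows "Measurable.pred M (\<lambda>x. cutoff (f x))"
  unfolding cutoff_def by measurable

text \<open>A measure \<open>\<omega>\<close> on positive definite matrices (the image of a density \<open>w\<close> under \<open>p\<close>) that is
  multiplied by $|\det g|^{-m}$ under congruence by \<open>g\<close> is determined up to a constant: integrate
  the cutoff of $A$ times $h(gAg^*)$ over $A$ and over the Haar measure of the
  general linear group in both orders.\<close>

lemma relatively_invariant_integral:
  fixes w :: "'e::euclidean_space \<Rightarrow> ennreal" and p :: "'e \<Rightarrow> ('f::rch, 'n::finite) sqmat"
    and h :: "('f, 'n) sqmat \<Rightarrow> ennreal" and m :: real
  defines "D \<equiv> real DIM('f) * real CARD('n)"
  assumes w [measurable]: "w \<in> borel_measurable borel" and p [measurable]: "p \<in> borel_measurable borel"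
    and h [measurable]: "h \<in> borel_measurable borel"
    and pd: "AE x in lborel. w x \<noteq> 0 \<longrightarrow> pos_def (p x)"
    and cov: "\<And>g f. adet g \<noteq> 0 \<Longrightarrow> f \<in> borel_measurable borel \<Longrightarrow>
      (\<integral>\<^sup>+x. w x * f (ctrans g ** p x ** g) \<partial>lborel) = ennreal (adet g powr - m) * (\<integral>\<^sup>+x. w x * f (p x) \<partial>lborel)"
  shows "(\<integral>\<^sup>+x. w x * (if cutoff (p x) then 1 else 0) \<partial>lborel) *
      (\<integral>\<^sup>+g. ennreal (adet g powr - D) * h (g ** ctrans g) \<partial>lborel) =
    (\<integral>\<^sup>+g. ennreal (adet g powr (- D - m)) * (if pos_def (g ** ctrans g - mat 1) \<and> 1 > (1 / 3) ^ CARD('n) * (adet g)\<^sup>2 then 1 else 0)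
        \<partial>(lborel :: ('f, 'n) sqmat measure)) *
      (\<integral>\<^sup>+x. w x * (h (p x) * ennreal (adet (p x) powr (- m / 2))) \<partial>lborel)"
    (is "?a * ?C = ?\<Phi> * ?X")
proof -
  define \<delta> :: real where "\<delta> = (1 / 3) ^ CARD('n)"
  have sq: "\<exists>T. pos_def T \<and> ctrans T = T \<and> T ** T = B \<and> adet T > 0" if B: "pos_def B" for B :: "('f, 'n) sqmat"
  proof -
    obtain T where T: "pos_def T" "T ** T = B" using pos_def_sqrt[OF B] by metis
    show ?thesis using T pos_defD(1)[OF T(1)] fdet_pos_def(2)[OF T(1)] by blast
  qed
  define K where "K x g = (w x * (if cutoff (p x) then 1 else 0)) * (ennreal (adet g powr - D) * h (g ** p x ** ctrans g))"
    for x and g :: "('f, 'n) sqmat"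
  have Km [measurable]: "(\<lambda>(x, g). K x g) \<in> borel_measurable (borel \<Otimes>\<^sub>M borel)"
    unfolding K_def by measurable
  define N where "N x g = w x * (h (p x) * (ennreal (adet g powr (- D - m)) *
      (if pos_def (g ** ctrans g - p x) \<and> adet (p x) > \<delta> * (adet g)\<^sup>2 then 1 else 0)))"
    for x and g :: "('f, 'n) sqmat"
  have Nm [measurable]: "(\<lambda>(x, g). N x g) \<in> borel_measurable (borel \<Otimes>\<^sub>M borel)"
    unfolding N_def by measurable
  have "?a * ?C = (\<integral>\<^sup>+x. \<integral>\<^sup>+g. K x g \<partial>lborel \<partial>lborel)"
  proof -
    have "(\<integral>\<^sup>+x. \<integral>\<^sup>+g. K x g \<partial>lborel \<partial>lborel) = (\<integral>\<^sup>+x. (w x * (if cutoff (p x) then 1 else 0)) * ?C \<partial>lborel)"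
    proof (rule nn_integral_cong_AE, use pd in eventually_elim)
      fix x assume x: "w x \<noteq> 0 \<longrightarrow> pos_def (p x)"
      have 1: "(\<integral>\<^sup>+g. K x g \<partial>lborel) = (w x * (if cutoff (p x) then 1 else 0)) *
          (\<integral>\<^sup>+g. ennreal (adet g powr - D) * h (g ** p x ** ctrans g) \<partial>lborel)"
        unfolding K_def by (rule nn_integral_cmult) measurable
      show "(\<integral>\<^sup>+g. K x g \<partial>lborel) = (w x * (if cutoff (p x) then 1 else 0)) * ?C"
      proof (cases "w x = 0")
        case False
        then obtain T where T: "ctrans T = T" "T ** T = p x" "adet T > 0" using x sq by blast
        have "ennreal (adet g powr - D) * h (g ** p x ** ctrans g) =
            ennreal (adet T powr D) * (ennreal (adet (g ** T) powr - D) * h ((g ** T) ** ctrans (g ** T)))" for g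
        proof -
          have "g ** p x ** ctrans g = (g ** T) ** ctrans (g ** T)"
            unfolding T(2)[symmetric] by (simp add: ctrans_mult T(1) matrix_mul_assoc)
          moreover have "adet g powr - D = adet T powr D * adet (g ** T) powr - D"
            using T(3) by (simp add: adet_mult powr_mult powr_minus field_simps)
          ultimately show ?thesis by (simp add: ennreal_mult mult.assoc)
        qed
        hence "(\<integral>\<^sup>+g. ennreal (adet g powr - D) * h (g ** p x ** ctrans g) \<partial>lborel) =
            ennreal (adet T powr D) * (\<integral>\<^sup>+g. ennreal (adet (g ** T) powr - D) * h ((g ** T) ** ctrans (g ** T)) \<partial>lborel)"
          by (simp add: nn_integral_cmult)
        also have "(\<integral>\<^sup>+g. ennreal (adet (g ** T) powr - D) * h ((g ** T) ** ctrans (g ** T)) \<partial>lborel) = ennreal (adet T powr - D) * ?C"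
          unfolding D_def using T(3)
          by (intro nn_integral_matrix_right[where f="\<lambda>g. ennreal (adet g powr - (real DIM('f) * real CARD('n))) * h (g ** ctrans g)"]) auto
        also have "ennreal (adet T powr D) * (ennreal (adet T powr - D) * ?C) = ?C"
          using T(3) by (simp add: mult.assoc[symmetric] ennreal_mult[symmetric] powr_add[symmetric])
        finally show ?thesis unfolding 1 by simp
      qed (simp add: K_def)
    qed
    also have "\<dots> = ?a * ?C" by (rule nn_integral_multc) measurable
    finally show ?thesis by simp
  qed
  also have "\<dots> = (\<integral>\<^sup>+g. \<integral>\<^sup>+x. K x g \<partial>lborel \<partial>lborel)"
    by (rule lborel_pair.Fubini'[symmetric]) measurable
  also have "\<dots> = (\<integral>\<^sup>+g. \<integral>\<^sup>+x. N x g \<partial>lborel \<partial>lborel)"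
  proof (rule nn_integral_cong)
    fix g :: "('f, 'n) sqmat"
    show "(\<integral>\<^sup>+x. K x g \<partial>lborel) = (\<integral>\<^sup>+x. N x g \<partial>lborel)"
    proof (cases "adet g = 0")
      case True
      thus ?thesis by (simp add: K_def N_def)
    next
      case False
      hence g0: "adet g > 0" using adet_nonneg[of g] by linarith
      obtain g' where g': "ctrans g' ** ctrans g = mat 1"
        using adet_nonzero_inverse[OF False] by (metis ctrans_mult ctrans_mat1)
      define k where "k B = h B * (if pos_def (g ** ctrans g - B) \<and> adet B > \<delta> * (adet g)\<^sup>2 then 1 else 0)" for B
      have km [measurable]: "k \<in> borel_measurable borel" unfolding k_def by measurable
      have "cutoff A \<longleftrightarrow> pos_def (g ** ctrans g - g ** A ** ctrans g) \<and> adet (g ** A ** ctrans g) > \<delta> * (adet g)\<^sup>2" for A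
      proof -
        have "g ** ctrans g - g ** A ** ctrans g = ctrans (ctrans g) ** (mat 1 - A) ** ctrans g"
          by (simp add: matrix_diff_ldistrib matrix_diff_rdistrib)
        hence "pos_def (g ** ctrans g - g ** A ** ctrans g) \<longleftrightarrow> pos_def (mat 1 - A)"
          using pos_def_congruence_iff[OF g', of "mat 1 - A"] by simp
        moreover have "adet (g ** A ** ctrans g) > \<delta> * (adet g)\<^sup>2 \<longleftrightarrow> adet A > \<delta>"
          using g0 by (simp add: adet_mult power2_eq_square mult_ac)
        ultimately show ?thesis by (simp add: cutoff_def \<delta>_def)
      qed
      hence kk: "(if cutoff A then 1 else 0) * h (g ** A ** ctrans g) = k (g ** A ** ctrans g)" for A
        by (simp add: k_def)
      have "(\<integral>\<^sup>+x. K x g \<partial>lborel) = (\<integral>\<^sup>+x. ennreal (adet g powr - D) * (w x * k (g ** p x ** ctrans g)) \<partial>lborel)"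
        unfolding K_def kk[symmetric] by (intro nn_integral_cong) (simp add: mult_ac)
      also have "\<dots> = ennreal (adet g powr - D) * (\<integral>\<^sup>+x. w x * k (g ** p x ** ctrans g) \<partial>lborel)"
        by (rule nn_integral_cmult) measurable
      also have "(\<integral>\<^sup>+x. w x * k (g ** p x ** ctrans g) \<partial>lborel) = ennreal (adet g powr - m) * (\<integral>\<^sup>+x. w x * k (p x) \<partial>lborel)"
        using cov[of "ctrans g" k] False by simp
      also have "ennreal (adet g powr - D) * (ennreal (adet g powr - m) * (\<integral>\<^sup>+x. w x * k (p x) \<partial>lborel)) =
          ennreal (adet g powr (- D - m)) * (\<integral>\<^sup>+x. w x * k (p x) \<partial>lborel)"
        using g0 by (simp add: mult.assoc[symmetric] ennreal_mult[symmetric] powr_add[symmetric])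
      also have "\<dots> = (\<integral>\<^sup>+x. ennreal (adet g powr (- D - m)) * (w x * k (p x)) \<partial>lborel)"
        by (rule nn_integral_cmult[symmetric]) measurable
      also have "\<dots> = (\<integral>\<^sup>+x. N x g \<partial>lborel)"
        unfolding N_def k_def by (intro nn_integral_cong) (simp add: mult_ac)
      finally show ?thesis .
    qed
  qed
  also have "\<dots> = (\<integral>\<^sup>+x. \<integral>\<^sup>+g. N x g \<partial>lborel \<partial>lborel)"
    by (rule lborel_pair.Fubini') measurable
  also have "\<dots> = (\<integral>\<^sup>+x. ?\<Phi> * (w x * (h (p x) * ennreal (adet (p x) powr (- m / 2)))) \<partial>lborel)"
  proof (rule nn_integral_cong_AE, use pd in eventually_elim)
    fix x assume x: "w x \<noteq> 0 \<longrightarrow> pos_def (p x)"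
    define G where "G g = ennreal (adet g powr (- D - m)) * (if pos_def (g ** ctrans g - p x) \<and> adet (p x) > \<delta> * (adet g)\<^sup>2 then 1 else 0)"
      for g :: "('f, 'n) sqmat"
    have Gm [measurable]: "G \<in> borel_measurable borel" unfolding G_def by measurable
    have 1: "(\<integral>\<^sup>+g. N x g \<partial>lborel) = w x * (h (p x) * (\<integral>\<^sup>+g. G g \<partial>lborel))"
    proof -
      have "(\<integral>\<^sup>+g. N x g \<partial>lborel) = (\<integral>\<^sup>+g. (w x * h (p x)) * G g \<partial>lborel)"
        by (simp add: N_def G_def mult.assoc)
      also have "\<dots> = (w x * h (p x)) * (\<integral>\<^sup>+g. G g \<partial>lborel)" by (rule nn_integral_cmult) measurable
      finally show ?thesis by (simp add: mult.assoc)
    qed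
    show "(\<integral>\<^sup>+g. N x g \<partial>lborel) = ?\<Phi> * (w x * (h (p x) * ennreal (adet (p x) powr (- m / 2))))"
    proof (cases "w x = 0")
      case False
      then obtain T where T: "pos_def T" "ctrans T = T" "T ** T = p x" "adet T > 0" using x sq by blast
      obtain S where S: "S ** T = mat 1" using pos_def_inverse[OF T(1)] by metis
      have "G (T ** g) = ennreal (adet T powr (- D - m)) * (ennreal (adet g powr (- D - m)) *
          (if pos_def (g ** ctrans g - mat 1) \<and> 1 > (1 / 3) ^ CARD('n) * (adet g)\<^sup>2 then 1 else 0))" for g
      proof -
        have "(T ** g) ** ctrans (T ** g) - p x = ctrans T ** (g ** ctrans g - mat 1) ** T"
          unfolding T(3)[symmetric] by (simp add: ctrans_mult T(2) matrix_diff_ldistrib matrix_diff_rdistrib matrix_mul_assoc)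
        hence "pos_def ((T ** g) ** ctrans (T ** g) - p x) \<longleftrightarrow> pos_def (g ** ctrans g - mat 1)"
          using pos_def_congruence_iff[OF S, of "g ** ctrans g - mat 1"] by simp
        moreover have "adet (p x) > \<delta> * (adet (T ** g))\<^sup>2 \<longleftrightarrow> 1 > (1 / 3) ^ CARD('n) * (adet g)\<^sup>2"
        proof -
          have "\<delta> * (adet (T ** g))\<^sup>2 = (adet T * adet T) * (\<delta> * (adet g)\<^sup>2)"
            by (simp add: adet_mult power2_eq_square)
          moreover have "adet (p x) = (adet T * adet T) * 1" unfolding T(3)[symmetric] by (simp add: adet_mult)
          ultimately show ?thesis using T(4) by (simp only: \<delta>_def mult_less_cancel_left_pos mult_pos_pos)
        qed
        moreover have "adet (T ** g) powr (- D - m) = adet T powr (- D - m) * adet g powr (- D - m)"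
          by (simp add: adet_mult powr_mult)
        ultimately show ?thesis by (simp add: G_def ennreal_mult)
      qed
      hence "(\<integral>\<^sup>+g. G (T ** g) \<partial>lborel) = ennreal (adet T powr (- D - m)) * ?\<Phi>"
        by (simp add: nn_integral_cmult)
      moreover have "(\<integral>\<^sup>+g. G (T ** g) \<partial>lborel) = ennreal (adet T powr - D) * (\<integral>\<^sup>+g. G g \<partial>lborel)"
        unfolding D_def using T(4) by (intro nn_integral_matrix_left) auto
      ultimately have "ennreal (adet T powr D) * (ennreal (adet T powr - D) * (\<integral>\<^sup>+g. G g \<partial>lborel)) =
          ennreal (adet T powr D) * (ennreal (adet T powr (- D - m)) * ?\<Phi>)" by simp
      hence "(\<integral>\<^sup>+g. G g \<partial>lborel) = ennreal (adet T powr - m) * ?\<Phi>"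
        using T(4) by (simp add: mult.assoc[symmetric] ennreal_mult[symmetric] powr_add[symmetric])
      also have "adet T powr - m = adet (p x) powr (- m / 2)"
        unfolding T(3)[symmetric] using T(4) by (simp add: adet_mult powr_mult powr_add[symmetric])
      finally show ?thesis unfolding 1 by (simp add: mult_ac)
    qed (simp add: N_def)
  qed
  also have "\<dots> = ?\<Phi> * ?X" by (rule nn_integral_cmult) measurable
  finally show ?thesis .
qed

lemma norm_gram_bound:
  fixes Z :: "'f::rch^'n::finite^'m::finite"
  shows "(norm Z)\<^sup>2 \<le> norm (ctrans Z ** Z) * norm (mat 1 :: ('f, 'n) sqmat)"
proof -
  have "(norm Z)\<^sup>2 = (ctrans Z ** Z) \<bullet> (mat 1 :: ('f, 'n) sqmat)"
    by (simp add: power2_norm_eq_inner inner_matrix_left)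
  also have "\<dots> \<le> norm (ctrans Z ** Z) * norm (mat 1 :: ('f, 'n) sqmat)" by (rule norm_cauchy_schwarz)
  finally show ?thesis .
qed

text \<open>The constant \<open>\<Phi>\<close> in the previous lemma depends only on the multiplier. It is finite and positive,
  as one sees by inserting for \<open>h\<close> the indicator function of a neighbourhood of the identity.\<close>

lemma relatively_invariant_proportional:
  fixes w1 :: "'d::euclidean_space \<Rightarrow> ennreal" and p1 :: "'d \<Rightarrow> ('f::rch, 'n::finite) sqmat"
    and w2 :: "'e::euclidean_space \<Rightarrow> ennreal" and p2 :: "'e \<Rightarrow> ('f, 'n) sqmat"
  assumes m1: "w1 \<in> borel_measurable borel" "p1 \<in> borel_measurable borel"
    and pd1: "AE x in lborel. w1 x \<noteq> 0 \<longrightarrow> pos_def (p1 x)"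
    and cov1: "\<And>g f. adet g \<noteq> 0 \<Longrightarrow> f \<in> borel_measurable borel \<Longrightarrow>
      (\<integral>\<^sup>+x. w1 x * f (ctrans g ** p1 x ** g) \<partial>lborel) = ennreal (adet g powr - m) * (\<integral>\<^sup>+x. w1 x * f (p1 x) \<partial>lborel)"
    and a1: "0 < (\<integral>\<^sup>+x. w1 x * (if cutoff (p1 x) then 1 else 0) \<partial>lborel)" "(\<integral>\<^sup>+x. w1 x * (if cutoff (p1 x) then 1 else 0) \<partial>lborel) < \<infinity>"
    and m2: "w2 \<in> borel_measurable borel" "p2 \<in> borel_measurable borel"
    and pd2: "AE x in lborel. w2 x \<noteq> 0 \<longrightarrow> pos_def (p2 x)"
    and cov2: "\<And>g f. adet g \<noteq> 0 \<Longrightarrow> f \<in> borel_measurable borel \<Longrightarrow>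
      (\<integral>\<^sup>+x. w2 x * f (ctrans g ** p2 x ** g) \<partial>lborel) = ennreal (adet g powr - m) * (\<integral>\<^sup>+x. w2 x * f (p2 x) \<partial>lborel)"
    and a2: "0 < (\<integral>\<^sup>+x. w2 x * (if cutoff (p2 x) then 1 else 0) \<partial>lborel)" "(\<integral>\<^sup>+x. w2 x * (if cutoff (p2 x) then 1 else 0) \<partial>lborel) < \<infinity>"
  obtains c :: real where "c > 0" "\<And>h. h \<in> borel_measurable borel \<Longrightarrow>
    (\<integral>\<^sup>+x. w2 x * h (p2 x) \<partial>lborel) = ennreal c * (\<integral>\<^sup>+x. w1 x * h (p1 x) \<partial>lborel)"
proof -
  define D where "D = real DIM('f) * real CARD('n)"
  define C where "C h = (\<integral>\<^sup>+g. ennreal (adet g powr - D) * h (g ** ctrans g) \<partial>lborel)" for h :: "('f, 'n) sqmat \<Rightarrow> ennreal"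
  define \<Phi> where "\<Phi> = (\<integral>\<^sup>+g. ennreal (adet g powr (- D - m)) *
    (if pos_def (g ** ctrans g - mat 1) \<and> 1 > (1 / 3) ^ CARD('n) * (adet g)\<^sup>2 then 1 else 0) \<partial>(lborel :: ('f, 'n) sqmat measure))"
  obtain b1 where b1: "(\<integral>\<^sup>+x. w1 x * (if cutoff (p1 x) then 1 else 0) \<partial>lborel) = ennreal b1" "b1 > 0"
    using a1 by (cases "\<integral>\<^sup>+x. w1 x * (if cutoff (p1 x) then 1 else 0) \<partial>lborel") auto
  obtain b2 where b2: "(\<integral>\<^sup>+x. w2 x * (if cutoff (p2 x) then 1 else 0) \<partial>lborel) = ennreal b2" "b2 > 0"
    using a2 by (cases "\<integral>\<^sup>+x. w2 x * (if cutoff (p2 x) then 1 else 0) \<partial>lborel") auto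
  define X1 where "X1 h = (\<integral>\<^sup>+x. w1 x * (h (p1 x) * ennreal (adet (p1 x) powr (- m / 2))) \<partial>lborel)" for h
  define X2 where "X2 h = (\<integral>\<^sup>+x. w2 x * (h (p2 x) * ennreal (adet (p2 x) powr (- m / 2))) \<partial>lborel)" for h
  have e1: "ennreal b1 * C h = \<Phi> * X1 h" if hm: "h \<in> borel_measurable borel" for h
    unfolding b1(1)[symmetric] C_def \<Phi>_def X1_def D_def
    by (rule relatively_invariant_integral[OF m1 hm pd1]) (rule cov1; assumption)
  have e2: "ennreal b2 * C h = \<Phi> * X2 h" if hm: "h \<in> borel_measurable borel" for h
    unfolding b2(1)[symmetric] C_def \<Phi>_def X2_def D_def
    by (rule relatively_invariant_integral[OF m2 hm pd2]) (rule cov2; assumption)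
  have "\<exists>\<phi>. \<Phi> = ennreal \<phi> \<and> \<phi> > 0"
  proof -
    define Q where "Q = {g :: ('f, 'n) sqmat. norm (g ** ctrans g - mat 1) < 1 \<and> 1 / 2 < (adet g)\<^sup>2}"
    define h0 where "h0 A = (if norm (A - mat 1) < 1 \<and> 1 / 2 < adet A then 1 else 0 :: ennreal)" for A :: "('f, 'n) sqmat"
    have h0m [measurable]: "h0 \<in> borel_measurable borel" unfolding h0_def by measurable
    have Oo: "open Q" unfolding Q_def by (intro open_Collect_conj open_Collect_less continuous_intros)
    have O1: "mat 1 \<in> Q" by (simp add: Q_def)
    have h0O: "h0 (g ** ctrans g) = indicator Q g" for g
      by (simp add: h0_def Q_def adet_mult power2_eq_square indicator_def)
    have "bounded Q"
    proof (rule boundedI)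
      fix g assume g: "g \<in> Q"
      let ?n = "norm (mat 1 :: ('f, 'n) sqmat)"
      have "norm (g ** ctrans g) \<le> norm (g ** ctrans g - mat 1) + ?n" by (metis norm_triangle_sub add.commute)
      also have "\<dots> \<le> 1 + ?n" using g by (simp add: Q_def)
      finally have "norm (g ** ctrans g) \<le> 1 + ?n" .
      moreover have "(norm g)\<^sup>2 \<le> norm (g ** ctrans g) * ?n" using norm_gram_bound[of "ctrans g"] by simp
      ultimately have "(norm g)\<^sup>2 \<le> (1 + ?n) * ?n" by (meson mult_right_mono norm_ge_zero order_trans)
      thus "norm g \<le> sqrt ((1 + ?n) * ?n)" by (rule real_le_rsqrt)
    qed
    hence Of: "emeasure lborel Q < \<infinity>" by (rule emeasure_bounded_finite)
    have D0: "D \<ge> 0" by (simp add: D_def)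
    have bnd: "adet g powr - D \<le> 2 powr D" if "g \<in> Q" for g
    proof -
      have a: "1 / 2 < (adet g)\<^sup>2" using that by (simp add: Q_def)
      have "1 / 2 \<le> adet g"
      proof (rule ccontr)
        assume "\<not> 1 / 2 \<le> adet g"
        hence "(adet g)\<^sup>2 \<le> (1 / 2)\<^sup>2" by (intro power_mono) auto
        thus False using a by (simp add: power2_eq_square)
      qed
      hence "adet g powr - D \<le> (1 / 2) powr - D" using D0 by (intro powr_mono2') auto
      also have "\<dots> = 2 powr D" by (simp add: powr_minus powr_divide)
      finally show ?thesis .
    qed
    have "C h0 \<le> (\<integral>\<^sup>+g. ennreal (2 powr D) * indicator Q g \<partial>lborel)"
      unfolding C_def h0O by (intro nn_integral_mono) (auto simp: indicator_def intro!: ennreal_leI bnd)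
    also have "\<dots> = ennreal (2 powr D) * emeasure lborel Q" using Oo by (subst nn_integral_cmult_indicator) auto
    also have "\<dots> < \<infinity>" using Of by (simp add: ennreal_mult_less_top)
    finally have Cf: "C h0 < \<infinity>" .
    have C0: "C h0 \<noteq> 0"
    proof
      assume "C h0 = 0"
      hence "AE g in lborel. ennreal (adet g powr - D) * indicator Q g = 0"
        unfolding C_def h0O using Oo by (subst (asm) nn_integral_0_iff_AE) auto
      hence "AE g in lborel. g \<notin> Q"
      proof eventually_elim
        case (elim g)
        show ?case
        proof
          assume "g \<in> Q"
          hence "adet g powr - D = 0" using elim by simp
          moreover have "adet g \<noteq> 0" using \<open>g \<in> Q\<close> by (auto simp: Q_def)
          ultimately show False by simp
        qed
      qed
      hence "emeasure lborel Q = 0" using Oo by (subst (asm) AE_iff_measurable[of Q]) auto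
      thus False using emeasure_lborel_open_pos[OF Oo O1] by simp
    qed
    have "ennreal b1 * C h0 \<noteq> 0" "ennreal b1 * C h0 \<noteq> \<infinity>" using Cf C0 b1(2) by (auto simp: ennreal_mult_eq_top_iff)
    hence "\<Phi> \<noteq> 0" "\<Phi> \<noteq> \<infinity>" unfolding e1[OF h0m] by (auto simp: ennreal_mult_eq_top_iff)
    thus ?thesis by (cases \<Phi>) (auto simp: less_le)
  qed
  then obtain \<phi> where \<phi>: "\<Phi> = ennreal \<phi>" "\<phi> > 0" by blast
  show ?thesis
  proof (rule that[of "b2 / b1"])
    show "b2 / b1 > 0" using b1 b2 by simp
    fix h :: "('f, 'n) sqmat \<Rightarrow> ennreal" assume hm [measurable]: "h \<in> borel_measurable borel"
    define k where "k A = h A * ennreal (adet A powr (m / 2))" for A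
    have km: "k \<in> borel_measurable borel" unfolding k_def by measurable
    have kk: "k A * ennreal (adet A powr (- m / 2)) = h A" if "pos_def A" for A
      using fdet_pos_def(2)[OF that]
      by (simp add: k_def mult.assoc ennreal_mult[symmetric] powr_add[symmetric])
    have I1: "X1 k = (\<integral>\<^sup>+x. w1 x * h (p1 x) \<partial>lborel)" unfolding X1_def
      by (rule nn_integral_cong_AE, use pd1 in eventually_elim) (metis kk mult_zero_left)
    have I2: "X2 k = (\<integral>\<^sup>+x. w2 x * h (p2 x) \<partial>lborel)" unfolding X2_def
      by (rule nn_integral_cong_AE, use pd2 in eventually_elim) (metis kk mult_zero_left)
    have inv: "ennreal (1 / \<phi>) * (ennreal \<phi> * y) = y" for y
      using \<phi>(2) by (simp add: mult.assoc[symmetric] ennreal_mult[symmetric])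
    have x1: "X1 k = ennreal (b1 / \<phi>) * C k" and x2: "X2 k = ennreal (b2 / \<phi>) * C k"
      using arg_cong[OF e1[OF km], of "\<lambda>y. ennreal (1 / \<phi>) * y"] arg_cong[OF e2[OF km], of "\<lambda>y. ennreal (1 / \<phi>) * y"] \<phi>(2) b1(2) b2(2)
      by (simp_all add: \<phi>(1) inv) (simp_all add: mult.assoc[symmetric] ennreal_mult[symmetric])
    have "ennreal (b2 / b1) * X1 k = X2 k"
      unfolding x1 x2 using b1(2) b2(2) \<phi>(2) by (simp add: mult.assoc[symmetric] ennreal_mult[symmetric])
    thus "(\<integral>\<^sup>+x. w2 x * h (p2 x) \<partial>lborel) = ennreal (b2 / b1) * (\<integral>\<^sup>+x. w1 x * h (p1 x) \<partial>lborel)"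
      by (simp only: I1 I2)
  qed
qed

section \<open>The Wishart integral\<close>

text \<open>Written with \<open>vec\<close> for the same reason as \<open>sqmat\<close>.\<close>

type_synonym ('a, 'n, 'm) tallmat = "(('a, 'n) vec, 'm) vec"

text \<open>The density $\det^s$ on positive definite matrices, carried by all matrices with small skew part.\<close>

definition hdens :: "real \<Rightarrow> ('f::rch, 'n::finite) sqmat \<Rightarrow> ennreal"
  where "hdens s X = (if norm (skwp X) < 1 \<and> pos_def (hermp X) then ennreal (adet (hermp X) powr s) else 0)"

lemma measurable_hdens [measurable]: "hdens s \<in> borel_measurable borel"
  unfolding hdens_def by measurable

lemma pos_def_contraction:
  fixes A :: "('f::rch, 'n::finite) sqmat"
  assumes A: "pos_def A" and B: "pos_def (mat 1 - A)"
  shows "norm A \<le> norm (mat 1 :: ('f, 'n) sqmat)" "adet A \<le> 1"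
proof -
  obtain U a where U: "U \<in> unitary_group" and a: "\<And>i. a i > 0" and A': "A = U ** rdiag a ** ctrans U"
    using spectral_pos_def[OF A] by metis
  have "ctrans U ** (mat 1 - A) ** U = rdiag (\<lambda>i. 1 - a i)"
  proof -
    have "ctrans U ** (mat 1 - A) ** U = ctrans U ** U - (ctrans U ** U) ** rdiag a ** (ctrans U ** U)"
      unfolding A' by (simp add: matrix_diff_ldistrib matrix_diff_rdistrib matrix_mul_assoc)
    also have "\<dots> = rdiag (\<lambda>i. 1 - a i)"
      by (simp add: unitary_groupD[OF U] vec_eq_iff mat_nth rdiag_nth)
    finally show ?thesis .
  qed
  moreover have "pos_def (ctrans U ** (mat 1 - A) ** U)"
    using pos_def_congruence_iff[of "ctrans U" U "mat 1 - A"] B unitary_groupD[OF U] by simp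
  ultimately have a1: "a i \<le> 1" for i by (simp add: pos_def_rdiag less_imp_le)
  have "norm A = norm (rdiag a :: ('f, 'n) sqmat)"
    unfolding A' using U unitary_group_ctrans[OF U] by (simp add: norm_isometry_left norm_isometry_right unitary_groupD)
  also have "\<dots> \<le> norm (mat 1 :: ('f, 'n) sqmat)"
    by (rule norm_matrix_mono) (use a a1 in \<open>auto simp: rdiag_nth mat_nth abs_of_pos\<close>)
  finally show "norm A \<le> norm (mat 1 :: ('f, 'n) sqmat)" .
  have "adet A = \<bar>\<Prod>i\<in>UNIV. a i\<bar>"
    unfolding A' by (simp add: adet_mult adet_unitary[OF U] adet_rdiag)
  also have "\<dots> = (\<Prod>i\<in>UNIV. a i)" using a by (simp add: abs_of_pos prod_pos)
  also have "\<dots> \<le> 1" by (rule prod_le_1) (use a a1 in \<open>auto intro: less_imp_le\<close>)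
  finally show "adet A \<le> 1" .
qed

lemma pos_def_scalar_perturbation:
  fixes B :: "('f::rch, 'n::finite) sqmat"
  assumes B: "ctrans B = B" "norm B < r"
  shows "pos_def (r *\<^sub>R mat 1 + B)"
proof -
  obtain U b where U: "U \<in> unitary_group" and B': "B = U ** rdiag b ** ctrans U"
    using spectral_theorem[OF B(1)] by metis
  have n: "norm B = norm (rdiag b :: ('f, 'n) sqmat)"
    unfolding B' using U unitary_group_ctrans[OF U] by (simp add: norm_isometry_left norm_isometry_right unitary_groupD)
  have "\<bar>b i\<bar> < r" for i
  proof -
    have "\<bar>b i\<bar> = norm ((rdiag b :: ('f, 'n) sqmat) $ i $ i)" by (simp add: rdiag_nth)
    also have "\<dots> \<le> norm ((rdiag b :: ('f, 'n) sqmat) $ i)" by (rule Finite_Cartesian_Product.norm_nth_le)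
    also have "\<dots> \<le> norm B" unfolding n by (rule Finite_Cartesian_Product.norm_nth_le)
    finally show ?thesis using B(2) by simp
  qed
  hence "pos_def (rdiag (\<lambda>i. r + b i) :: ('f, 'n) sqmat)"
    by (auto simp: pos_def_rdiag abs_less_iff) (metis add.commute neg_less_iff_less minus_minus less_add_same_cancel1 add_less_cancel_left diff_gt_0_iff_gt diff_minus_eq_add)
  hence "pos_def (ctrans (ctrans U) ** rdiag (\<lambda>i. r + b i) ** ctrans U)"
    using pos_def_congruence_iff[of U "ctrans U" "rdiag (\<lambda>i. r + b i)"] unitary_groupD[OF U] by simp
  moreover have "U ** rdiag (\<lambda>i. r + b i) ** ctrans U = r *\<^sub>R mat 1 + B"
  proof -
    have "rdiag (\<lambda>i. r + b i) = r *\<^sub>R mat 1 + (rdiag b :: ('f, 'n) sqmat)"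
      by (auto simp: vec_eq_iff rdiag_nth mat_nth scaleR_conv_of_real[where 'a='f])
    thus ?thesis unfolding B'
      by (simp add: matrix_add_ldistrib matrix_add_rdistrib matrix_scaleR_left matrix_scaleR_right unitary_groupD[OF U])
  qed
  ultimately show ?thesis by simp
qed

lemma cutoff_half:
  fixes A :: "('f::rch, 'n::finite) sqmat"
  assumes A: "ctrans A = A" "norm (A - (1 / 2) *\<^sub>R mat 1) < 1 / 2" "adet A > (1 / 3) ^ CARD('n)"
  shows "pos_def A" "cutoff A"
proof -
  let ?B = "A - (1 / 2) *\<^sub>R mat 1"
  have B: "ctrans ?B = ?B" using A(1) by (simp add: ctrans_diff ctrans_scaleR)
  from pos_def_scalar_perturbation[OF B A(2)] show "pos_def A" by simp
  have "ctrans (- ?B) = - ?B" "norm (- ?B) < 1 / 2" using B A(2) by (simp_all only: ctrans_minus norm_minus_cancel)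
  from pos_def_scalar_perturbation[OF this] have "pos_def ((1 / 2) *\<^sub>R mat 1 + - ?B)" .
  also have "(1 / 2) *\<^sub>R mat 1 + - ?B = mat 1 - A"
    using scaleR_add_left[of "1/2" "1/2" "mat 1 :: ('f, 'n) sqmat"] by (simp add: algebra_simps)
  finally show "cutoff A" using A(3) by (simp add: cutoff_def)
qed

lemma adet_scaleR_1: "r > 0 \<Longrightarrow> adet (r *\<^sub>R mat 1 :: ('f::rch, 'n::finite) sqmat) = r ^ CARD('n)"
proof -
  assume "r > 0"
  have "r *\<^sub>R mat 1 = (rdiag (\<lambda>_. r) :: ('f, 'n) sqmat)"
    by (auto simp: vec_eq_iff rdiag_nth mat_nth scaleR_conv_of_real[where 'a='f])
  thus ?thesis using \<open>r > 0\<close> by (simp add: adet_rdiag)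
qed

lemma nn_integral_pos_open:
  fixes f :: "'a::euclidean_space \<Rightarrow> ennreal"
  assumes Q: "open Q" "x \<in> Q" and f: "f \<in> borel_measurable borel" and pos: "\<And>x. x \<in> Q \<Longrightarrow> f x \<noteq> 0"
  shows "0 < (\<integral>\<^sup>+x. f x \<partial>lborel)"
proof (rule ccontr)
  assume "\<not> ?thesis"
  hence "AE x in lborel. f x = 0" using f by (simp add: nn_integral_0_iff_AE)
  hence "AE x in lborel. x \<notin> Q" by eventually_elim (use pos in blast)
  hence "emeasure lborel Q = 0" using Q by (subst (asm) AE_iff_measurable[of Q]) auto
  thus False using emeasure_lborel_open_pos[OF Q] by simp
qed

lemma isometry_exists:
  assumes "CARD('q::finite) \<le> CARD('s::finite)"
  obtains E :: "'f::rch^'q^'s" where "ctrans E ** E = mat 1"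
proof -
  obtain \<iota> :: "'q \<Rightarrow> 's" where \<iota>: "inj \<iota>"
    using assms card_le_inj[of "UNIV :: 'q set" "UNIV :: 's set"] by auto
  define E where "E = (\<chi> a j. if a = \<iota> j then 1 else (0 :: 'f))"
  have "ctrans E ** E = mat 1"
    using \<iota> by (auto simp: vec_eq_iff matrix_nth E_def mat_nth inj_eq if_distrib[where f="\<lambda>x. star x * _"] cong: if_cong)
  thus ?thesis by (rule that)
qed

lemma hdens_congr:
  assumes g: "adet g \<noteq> 0"
  shows "hdens s X = ennreal (adet g powr (- 2 * s)) * hdens s (congr g X)"
proof -
  obtain h where "h ** g = mat 1" using adet_nonzero_inverse[OF g] by metis
  hence p: "pos_def (hermp (congr g X)) \<longleftrightarrow> pos_def (hermp X)" by (simp add: hermp_congr pos_def_congruence_iff)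
  have g0: "adet g > 0" using g adet_nonneg[of g] by linarith
  have "adet (hermp (congr g X)) powr s = adet g powr (2 * s) * adet (hermp X) powr s"
  proof -
    have "adet (hermp (congr g X)) = (adet g * adet g) * adet (hermp X)" by (simp add: hermp_congr adet_mult)
    hence "adet (hermp (congr g X)) powr s = (adet g powr s * adet g powr s) * adet (hermp X) powr s"
      by (simp only: powr_mult)
    also have "adet g powr s * adet g powr s = adet g powr (2 * s)" by (simp add: powr_add[symmetric])
    finally show ?thesis .
  qed
  hence "adet (hermp X) powr s = adet g powr (- 2 * s) * adet (hermp (congr g X)) powr s"
    using g0 by (simp add: mult.assoc[symmetric] powr_add[symmetric])
  thus ?thesis by (simp add: hdens_def p hermp_congr(2) ennreal_mult)
qed

text \<open>For \<open>Z\<close> with $n$ rows, the Gram matrix $Z^* Z$ of a Lebesgue distributed \<open>Z\<close> has the density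
  $\det(A)^{dn/2 - \kappa}$ with respect to Lebesgue measure on Hermitian matrices, up to a constant:
  both measures have the same behaviour under congruences.\<close>

lemma wishart_integral:
  fixes s :: real
  assumes qs: "CARD('q::{finite,linorder}) \<le> CARD('s::finite)"
    and s: "2 * s = real DIM('f::rch) * real CARD('s) - hexp TYPE('f) TYPE('q)"
  obtains c :: real where "c > 0" "\<And>h. h \<in> borel_measurable borel \<Longrightarrow>
    (\<integral>\<^sup>+Z. h (ctrans Z ** Z) \<partial>(lborel :: ('f, 'q, 's) tallmat measure)) =
      ennreal c * (\<integral>\<^sup>+X. hdens s X * h (hermp X) \<partial>(lborel :: ('f, 'q) sqmat measure))"
proof -
  define \<delta> :: real where "\<delta> = (1 / 3) ^ CARD('q)"
  have \<delta>: "\<delta> > 0" by (simp add: \<delta>_def)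
  have half: "adet ((1 / 2) *\<^sub>R mat 1 :: ('f, 'q) sqmat) > \<delta>"
    by (simp add: adet_scaleR_1 \<delta>_def power_strict_mono)
  let ?N = "norm (mat 1 :: ('f, 'q) sqmat)"
  have hm: "hermp \<in> borel_measurable (borel :: ('f, 'q) sqmat measure)" by measurable
  have gm: "(\<lambda>Z :: ('f, 'q, 's) tallmat. ctrans Z ** Z) \<in> borel_measurable borel" by measurable
  have pd1: "AE X in lborel. hdens s X \<noteq> 0 \<longrightarrow> pos_def (hermp (X :: ('f, 'q) sqmat))"
    by (simp add: hdens_def)
  have pd2: "AE Z in lborel. (1::ennreal) \<noteq> 0 \<longrightarrow> pos_def (ctrans Z ** (Z :: ('f, 'q, 's) tallmat))"
    using AE_gram_pos_def[OF qs, where 'f='f] by simp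
  have cov1: "(\<integral>\<^sup>+X. hdens s X * f (ctrans g ** hermp X ** g) \<partial>lborel) =
      ennreal (adet g powr - (real DIM('f) * real CARD('s))) * (\<integral>\<^sup>+X. hdens s X * f (hermp X) \<partial>lborel)"
    if g: "adet g \<noteq> 0" and f [measurable]: "f \<in> borel_measurable borel" for g :: "('f, 'q) sqmat" and f
  proof -
    have [measurable]: "congr g \<in> borel_measurable borel" by (rule linear_borel[OF linear_congr])
    have g0: "adet g > 0" using g adet_nonneg[of g] by linarith
    have "(\<integral>\<^sup>+X. hdens s X * f (ctrans g ** hermp X ** g) \<partial>lborel) =
        (\<integral>\<^sup>+X. ennreal (adet g powr (- 2 * s)) * (hdens s (congr g X) * f (hermp (congr g X))) \<partial>lborel)"
      by (rule nn_integral_cong, subst hdens_congr[OF g]) (simp only: hermp_congr mult.assoc)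
    also have "\<dots> = ennreal (adet g powr (- 2 * s)) * (\<integral>\<^sup>+X. hdens s (congr g X) * f (hermp (congr g X)) \<partial>lborel)"
      by (rule nn_integral_cmult) measurable
    also have "(\<integral>\<^sup>+X. hdens s (congr g X) * f (hermp (congr g X)) \<partial>lborel) =
        ennreal (adet g powr - hexp TYPE('f) TYPE('q)) * (\<integral>\<^sup>+X. hdens s X * f (hermp X) \<partial>lborel)"
      by (rule nn_integral_congr[OF g, of "\<lambda>X. hdens s X * f (hermp X)"]) measurable
    also have "ennreal (adet g powr (- 2 * s)) * (ennreal (adet g powr - hexp TYPE('f) TYPE('q)) * (\<integral>\<^sup>+X. hdens s X * f (hermp X) \<partial>lborel)) =
        ennreal (adet g powr (- 2 * s - hexp TYPE('f) TYPE('q))) * (\<integral>\<^sup>+X. hdens s X * f (hermp X) \<partial>lborel)"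
      by (simp add: mult.assoc[symmetric] ennreal_mult[symmetric] powr_add[symmetric])
    also have "- 2 * s - hexp TYPE('f) TYPE('q) = - (real DIM('f) * real CARD('s))" using s by simp
    finally show ?thesis .
  qed
  have cov2: "(\<integral>\<^sup>+Z. 1 * f (ctrans g ** (ctrans Z ** Z) ** g) \<partial>(lborel :: ('f, 'q, 's) tallmat measure)) =
      ennreal (adet g powr - (real DIM('f) * real CARD('s))) * (\<integral>\<^sup>+Z. 1 * f (ctrans Z ** Z) \<partial>(lborel :: ('f, 'q, 's) tallmat measure))"
    if g: "adet g \<noteq> 0" and f [measurable]: "f \<in> borel_measurable borel" for g :: "('f, 'q) sqmat" and f
  proof -
    have "(\<lambda>Z :: ('f, 'q, 's) tallmat. f (ctrans Z ** Z)) \<in> borel_measurable borel" by measurable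
    from nn_integral_matrix_right[OF g this] show ?thesis by (simp add: ctrans_mult matrix_mul_assoc)
  qed
  have fin1: "(\<integral>\<^sup>+X. hdens s X * (if cutoff (hermp X) then 1 else 0) \<partial>(lborel :: ('f, 'q) sqmat measure)) < \<infinity>"
  proof -
    have "hdens s X * (if cutoff (hermp X) then 1 else 0) \<le> ennreal (1 + \<delta> powr s) * indicator (cball 0 (?N + 1)) X"
      for X :: "('f, 'q) sqmat"
    proof (cases "norm (skwp X) < 1 \<and> pos_def (hermp X) \<and> cutoff (hermp X)")
      case True
      hence c: "norm (hermp X) \<le> ?N" "adet (hermp X) \<le> 1" "adet (hermp X) > \<delta>"
        using pos_def_contraction[of "hermp X"] by (auto simp: cutoff_def \<delta>_def)
      have "norm X \<le> norm (hermp X) + norm (skwp X)" by (metis hermp_add_skwp norm_triangle_ineq)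
      hence "X \<in> cball 0 (?N + 1)" using True c(1) by simp
      moreover have "adet (hermp X) powr s \<le> 1 + \<delta> powr s"
      proof (cases "s \<ge> 0")
        case True
        have "adet (hermp X) powr s \<le> 1 powr s" using c \<delta> True by (intro powr_mono2) auto
        thus ?thesis by (simp add: add_increasing2)
      next
        case False
        have "adet (hermp X) powr s \<le> \<delta> powr s" using c \<delta> False by (intro powr_mono2') auto
        thus ?thesis by simp
      qed
      ultimately show ?thesis using True by (simp add: hdens_def ennreal_leI del: ennreal_plus)
    qed (auto simp: hdens_def)
    hence "(\<integral>\<^sup>+X. hdens s X * (if cutoff (hermp X) then 1 else 0) \<partial>(lborel :: ('f, 'q) sqmat measure)) \<le>
        (\<integral>\<^sup>+X. ennreal (1 + \<delta> powr s) * indicator (cball 0 (?N + 1)) X \<partial>(lborel :: ('f, 'q) sqmat measure))"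
      by (intro nn_integral_mono) auto
    also have "\<dots> = ennreal (1 + \<delta> powr s) * emeasure lborel (cball (0 :: ('f, 'q) sqmat) (?N + 1))"
      by (subst nn_integral_cmult_indicator) auto
    also have "\<dots> < \<infinity>" using emeasure_lborel_cball_finite[of "0 :: ('f, 'q) sqmat" "?N + 1"] by (simp add: ennreal_mult_less_top)
    finally show ?thesis .
  qed
  have pos1: "0 < (\<integral>\<^sup>+X. hdens s X * (if cutoff (hermp X) then 1 else 0) \<partial>(lborel :: ('f, 'q) sqmat measure))"
  proof (rule nn_integral_pos_open)
    let ?Q = "{X :: ('f, 'q) sqmat. norm (hermp X - (1 / 2) *\<^sub>R mat 1) < 1 / 2 \<and> norm (skwp X) < 1 \<and> \<delta> < adet (hermp X)}"
    have ch: "continuous_on UNIV (hermp :: ('f, 'q) sqmat \<Rightarrow> _)" and cs: "continuous_on UNIV (skwp :: ('f, 'q) sqmat \<Rightarrow> _)"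
      by (simp_all add: linear_continuous_on linear_hermp linear_skwp linear_linear)
    show "open ?Q" by (intro open_Collect_conj open_Collect_less continuous_intros ch cs)
    show "(1 / 2) *\<^sub>R mat 1 \<in> ?Q"
      using half by (simp add: hermp_hermitian ctrans_scaleR)
    show "hdens s X * (if cutoff (hermp X) then 1 else 0) \<noteq> 0" if "X \<in> ?Q" for X
    proof -
      have "ctrans (hermp X) = hermp X" "norm (hermp X - (1 / 2) *\<^sub>R mat 1) < 1 / 2" "adet (hermp X) > (1 / 3) ^ CARD('q)"
        using that by (auto simp: \<delta>_def)
      note c = cutoff_half[OF this]
      thus ?thesis using that fdet_pos_def(2)[OF c(1)] by (simp add: hdens_def)
    qed
  qed measurable
  have fin2: "(\<integral>\<^sup>+Z. 1 * (if cutoff (ctrans Z ** Z) then 1 else 0) \<partial>(lborel :: ('f, 'q, 's) tallmat measure)) < \<infinity>"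
  proof -
    have "AE Z in lborel. (1::ennreal) * (if cutoff (ctrans Z ** Z) then 1 else 0) \<le> indicator (cball 0 ?N) (Z :: ('f, 'q, 's) tallmat)"
      using AE_gram_pos_def[OF qs, where 'f='f]
    proof eventually_elim
      case (elim Z)
      show ?case
      proof (cases "cutoff (ctrans Z ** Z)")
        case True
        hence "norm (ctrans Z ** Z) \<le> ?N" using pos_def_contraction[of "ctrans Z ** Z"] elim by (auto simp: cutoff_def)
        hence "(norm Z)\<^sup>2 \<le> ?N * ?N" using norm_gram_bound[of Z] by (meson mult_right_mono norm_ge_zero order_trans)
        hence "norm Z \<le> ?N" by (metis abs_le_square_iff abs_norm_cancel power2_eq_square)
        thus ?thesis by (simp add: indicator_def)
      qed simp
    qed
    hence "(\<integral>\<^sup>+Z. 1 * (if cutoff (ctrans Z ** Z) then 1 else 0) \<partial>(lborel :: ('f, 'q, 's) tallmat measure)) \<le>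
        (\<integral>\<^sup>+Z. indicator (cball 0 ?N) Z \<partial>(lborel :: ('f, 'q, 's) tallmat measure))"
      by (rule nn_integral_mono_AE)
    also have "\<dots> = emeasure lborel (cball (0 :: ('f, 'q, 's) tallmat) ?N)" by simp
    also have "\<dots> < \<infinity>" by (rule emeasure_lborel_cball_finite)
    finally show ?thesis .
  qed
  have pos2: "0 < (\<integral>\<^sup>+Z. 1 * (if cutoff (ctrans Z ** Z) then 1 else 0) \<partial>(lborel :: ('f, 'q, 's) tallmat measure))"
  proof -
    obtain E :: "('f, 'q, 's) tallmat" where E: "ctrans E ** E = mat 1" by (rule isometry_exists[OF qs])
    let ?Q = "{Z :: ('f, 'q, 's) tallmat. norm (ctrans Z ** Z - (1 / 2) *\<^sub>R mat 1) < 1 / 2 \<and> \<delta> < adet (ctrans Z ** Z)}"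
    show ?thesis
    proof (rule nn_integral_pos_open)
      show "open ?Q" by (intro open_Collect_conj open_Collect_less continuous_intros)
      have "ctrans (sqrt (1 / 2) *\<^sub>R E) ** (sqrt (1 / 2) *\<^sub>R E) = (1 / 2) *\<^sub>R mat 1"
        by (simp only: ctrans_scaleR matrix_scaleR_left matrix_scaleR_right E scaleR_scaleR real_sqrt_mult_self) simp
      thus "sqrt (1 / 2) *\<^sub>R E \<in> ?Q" using half by simp
      show "1 * (if cutoff (ctrans Z ** Z) then 1 else 0) \<noteq> (0 :: ennreal)" if "Z \<in> ?Q" for Z
      proof -
        have "ctrans (ctrans Z ** Z) = ctrans Z ** Z" by (simp add: ctrans_mult)
        moreover have "norm (ctrans Z ** Z - (1 / 2) *\<^sub>R mat 1) < 1 / 2" "adet (ctrans Z ** Z) > (1 / 3) ^ CARD('q)"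
          using that by (auto simp: \<delta>_def)
        ultimately have "cutoff (ctrans Z ** Z)" by (rule cutoff_half(2))
        thus ?thesis by simp
      qed
    qed measurable
  qed
  obtain c where c: "c > 0" "\<And>h. h \<in> borel_measurable borel \<Longrightarrow>
      (\<integral>\<^sup>+Z. 1 * h (ctrans Z ** Z) \<partial>(lborel :: ('f, 'q, 's) tallmat measure)) =
      ennreal c * (\<integral>\<^sup>+X. hdens s X * h (hermp X) \<partial>(lborel :: ('f, 'q) sqmat measure))"
    by (rule relatively_invariant_proportional[where ?w1.0="hdens s" and ?p1.0=hermp and ?w2.0="\<lambda>Z :: ('f, 'q, 's) tallmat. 1" and ?p2.0="\<lambda>Z :: ('f, 'q, 's) tallmat. ctrans Z ** Z",
        OF measurable_hdens hm pd1 cov1 pos1 fin1 _ gm pd2 cov2 pos2 fin2]) auto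
  show ?thesis by (rule that[of c]) (use c in simp_all)
qed

section \<open>Gram matrices of the two blocks\<close>

type_synonym ('a, 'q, 's) blocks = "('a, 'q) sqmat \<times> ('a, 'q, 's) tallmat"

definition gram :: "('f::rch, 'q::finite, 's::finite) blocks \<Rightarrow> ('f, 'q) sqmat"
  where "gram Z = ctrans (fst Z) ** fst Z + ctrans (snd Z) ** snd Z"

text \<open>The unnormalized density of the measure on the ball, extended by zero.\<close>

definition bdens :: "real \<Rightarrow> ('f::rch, 'q::finite) sqmat \<Rightarrow> ennreal"
  where "bdens s w = (if w \<in> B_ball then ennreal (adet (mat 1 - ctrans w ** w) powr s) else 0)"

lemma measurable_bdens [measurable]: "bdens s \<in> borel_measurable borel"
  unfolding bdens_def B_ball_def mem_Collect_eq by measurable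

lemma measurable_fst_borel [measurable (raw)]:
  "f \<in> borel_measurable M \<Longrightarrow> (\<lambda>x. fst (f x :: 'a::second_countable_topology \<times> 'b::second_countable_topology)) \<in> borel_measurable M"
  "f \<in> borel_measurable M \<Longrightarrow> (\<lambda>x. snd (f x :: 'a::second_countable_topology \<times> 'b::second_countable_topology)) \<in> borel_measurable M"
  by (erule measurable_compose, rule borel_measurable_continuous_onI, intro continuous_intros)+

lemma measurable_gram [measurable (raw)]:
  assumes [measurable]: "f \<in> borel_measurable M"
  shows "(\<lambda>x. gram (f x :: ('f::rch, 'q::finite, 's::finite) blocks)) \<in> borel_measurable M"
  unfolding gram_def by measurable

text \<open>The Wishart integral is applied to the second block for fixed first block \<open>z\<close>, followed by a shift
  of the Hermitian part by $z^* z$.\<close>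

lemma gram_integral:
  fixes s :: real
  assumes qs: "CARD('q::{finite,linorder}) \<le> CARD('s::finite)"
    and s: "2 * s = real DIM('f::rch) * real CARD('s) - hexp TYPE('f) TYPE('q)"
  obtains c :: real where "c > 0" "\<And>G. G \<in> borel_measurable borel \<Longrightarrow>
    (\<integral>\<^sup>+Z. G (fst Z, gram Z) \<partial>(lborel :: ('f, 'q, 's) blocks measure)) =
      ennreal c * (\<integral>\<^sup>+X. \<integral>\<^sup>+z. hdens s (X - ctrans z ** z) * G (z, hermp X) \<partial>lborel \<partial>(lborel :: ('f, 'q) sqmat measure))"
proof -
  obtain c :: real where c: "c > 0" "\<And>h. h \<in> borel_measurable borel \<Longrightarrow>
    (\<integral>\<^sup>+Z. h (ctrans Z ** Z) \<partial>(lborel :: ('f, 'q, 's) tallmat measure)) =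
      ennreal c * (\<integral>\<^sup>+X. hdens s X * h (hermp X) \<partial>(lborel :: ('f, 'q) sqmat measure))"
    by (rule wishart_integral[OF qs s], rule that) blast+
  show ?thesis
  proof (rule that[OF c(1)])
    fix G :: "('f, 'q) sqmat \<times> ('f, 'q) sqmat \<Rightarrow> ennreal" assume G [measurable]: "G \<in> borel_measurable borel"
    have m1 [measurable]: "(\<lambda>Z. G (fst Z, gram Z)) \<in> borel_measurable (borel :: ('f, 'q, 's) blocks measure)"
      by measurable
    have m2: "(\<lambda>Z. G (fst Z, gram Z)) \<in> borel_measurable (lborel \<Otimes>\<^sub>M (lborel :: ('f, 'q, 's) tallmat measure))"
      unfolding lborel_prod by simp
    have "(\<integral>\<^sup>+Z. G (fst Z, gram Z) \<partial>(lborel :: ('f, 'q, 's) blocks measure)) =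
        (\<integral>\<^sup>+z. \<integral>\<^sup>+y. G (z, gram (z, y)) \<partial>(lborel :: ('f, 'q, 's) tallmat measure) \<partial>lborel)"
      unfolding lborel_prod[symmetric]
      by (subst lborel.nn_integral_fst[symmetric]) (simp_all add: m2)
    also have "\<dots> = (\<integral>\<^sup>+z. ennreal c * (\<integral>\<^sup>+X. hdens s (X - ctrans z ** z) * G (z, hermp X) \<partial>(lborel :: ('f, 'q) sqmat measure)) \<partial>lborel)"
    proof (rule nn_integral_cong)
      fix z :: "('f, 'q) sqmat"
      have "(\<integral>\<^sup>+y. G (z, gram (z, y)) \<partial>(lborel :: ('f, 'q, 's) tallmat measure)) =
          ennreal c * (\<integral>\<^sup>+X. hdens s X * G (z, ctrans z ** z + hermp X) \<partial>(lborel :: ('f, 'q) sqmat measure))"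
        unfolding gram_def fst_conv snd_conv by (rule c(2)) measurable
      also have "(\<integral>\<^sup>+X. hdens s X * G (z, ctrans z ** z + hermp X) \<partial>(lborel :: ('f, 'q) sqmat measure)) =
          (\<integral>\<^sup>+X. hdens s (X + - (ctrans z ** z)) * G (z, ctrans z ** z + hermp (X + - (ctrans z ** z))) \<partial>lborel)"
        by (rule nn_integral_translate[symmetric]) measurable
      also have "\<dots> = (\<integral>\<^sup>+X. hdens s (X - ctrans z ** z) * G (z, hermp X) \<partial>lborel)"
      proof (rule nn_integral_cong)
        fix X :: "('f, 'q) sqmat"
        have "hermp (X + - (ctrans z ** z)) = hermp X - ctrans z ** z"
          using linear_diff[OF linear_hermp, of X "ctrans z ** z"] hermp_hermitian(1)[of "ctrans z ** z"]
          by (simp add: ctrans_mult)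
        thus "hdens s (X + - (ctrans z ** z)) * G (z, ctrans z ** z + hermp (X + - (ctrans z ** z))) = hdens s (X - ctrans z ** z) * G (z, hermp X)"
          by simp
      qed
      finally show "(\<integral>\<^sup>+y. G (z, gram (z, y)) \<partial>(lborel :: ('f, 'q, 's) tallmat measure)) =
        ennreal c * (\<integral>\<^sup>+X. hdens s (X - ctrans z ** z) * G (z, hermp X) \<partial>lborel)" .
    qed
    also have "\<dots> = ennreal c * (\<integral>\<^sup>+z. \<integral>\<^sup>+X. hdens s (X - ctrans z ** z) * G (z, hermp X) \<partial>(lborel :: ('f, 'q) sqmat measure) \<partial>lborel)"
      by (rule nn_integral_cmult) measurable
    also have "(\<integral>\<^sup>+z. \<integral>\<^sup>+X. hdens s (X - ctrans z ** z) * G (z, hermp X) \<partial>(lborel :: ('f, 'q) sqmat measure) \<partial>lborel) =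
        (\<integral>\<^sup>+X. \<integral>\<^sup>+z. hdens s (X - ctrans z ** z) * G (z, hermp X) \<partial>lborel \<partial>lborel)"
      by (rule lborel_pair.Fubini'[symmetric]) measurable
    finally show "(\<integral>\<^sup>+Z. G (fst Z, gram Z) \<partial>(lborel :: ('f, 'q, 's) blocks measure)) =
      ennreal c * (\<integral>\<^sup>+X. \<integral>\<^sup>+z. hdens s (X - ctrans z ** z) * G (z, hermp X) \<partial>lborel \<partial>(lborel :: ('f, 'q) sqmat measure))" .
  qed
qed

lemma inner_gram: "v \<bullet> ((ctrans w ** w) *v v) = (norm (w *v (v :: 'f::rch^'n::finite)))\<^sup>2"
  using inner_matrix_vec[of w v "w *v v"] by (simp add: power2_norm_eq_inner matrix_vector_mul_assoc[symmetric])

text \<open>For fixed $A = T^2$ the substitution $z = w T$ turns the conditional density into the density on the ball.\<close>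

lemma hdens_fibre_integral:
  fixes X T :: "('f::rch, 'q::{finite,linorder}) sqmat" and g :: "('f, 'q) sqmat \<Rightarrow> ennreal"
  assumes T: "pos_def T" "T ** T = hermp X" and g [measurable]: "g \<in> borel_measurable borel"
  shows "(\<integral>\<^sup>+z. hdens s (X - ctrans z ** z) * g z \<partial>lborel) =
    (if norm (skwp X) < 1 then ennreal (adet T powr (real DIM('f) * real CARD('q) + 2 * s)) else 0) *
      (\<integral>\<^sup>+w. bdens s w * g (w ** T) \<partial>lborel)"
proof -
  let ?D = "real DIM('f) * real CARD('q)"
  have T0: "adet T > 0" and Tc: "ctrans T = T" using fdet_pos_def(2)[OF T(1)] pos_defD(1)[OF T(1)] by auto
  obtain S where S: "S ** T = mat 1" using pos_def_inverse[OF T(1)] by metis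
  have pt: "hdens s (X - ctrans (w ** T) ** (w ** T)) =
      (if norm (skwp X) < 1 then ennreal (adet T powr (2 * s)) else 0) * bdens s w" for w
  proof -
    have 1: "hermp (X - ctrans (w ** T) ** (w ** T)) = ctrans T ** (mat 1 - ctrans w ** w) ** T"
    proof -
      have "hermp (X - ctrans (w ** T) ** (w ** T)) = hermp X - ctrans (w ** T) ** (w ** T)"
        by (simp add: linear_diff[OF linear_hermp] hermp_hermitian(1) ctrans_mult)
      thus ?thesis unfolding T(2)[symmetric]
        by (simp add: ctrans_mult Tc matrix_diff_ldistrib matrix_diff_rdistrib matrix_mul_assoc)
    qed
    have 2: "skwp (X - ctrans (w ** T) ** (w ** T)) = skwp X"
      by (simp add: linear_diff[OF linear_skwp] hermp_hermitian(2) ctrans_mult)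
    have 3: "pos_def (ctrans T ** (mat 1 - ctrans w ** w) ** T) \<longleftrightarrow> w \<in> B_ball"
      by (simp add: pos_def_congruence_iff[OF S] B_ball_def)
    have "adet (ctrans T ** (mat 1 - ctrans w ** w) ** T) = (adet T * adet T) * adet (mat 1 - ctrans w ** w)"
      by (simp add: adet_mult)
    hence 4: "adet (ctrans T ** (mat 1 - ctrans w ** w) ** T) powr s = adet T powr (2 * s) * adet (mat 1 - ctrans w ** w) powr s"
      using T0 by (simp only: powr_mult) (simp add: powr_add[symmetric])
    show ?thesis unfolding hdens_def bdens_def 1 2 3 4 by (simp add: ennreal_mult)
  qed
  have "(\<integral>\<^sup>+z. hdens s (X - ctrans z ** z) * g z \<partial>lborel) =
      ennreal (adet T powr ?D) * (ennreal (adet T powr - ?D) * (\<integral>\<^sup>+z. hdens s (X - ctrans z ** z) * g z \<partial>lborel))"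
    using T0 by (simp add: mult.assoc[symmetric] ennreal_mult[symmetric] powr_add[symmetric])
  also have "ennreal (adet T powr - ?D) * (\<integral>\<^sup>+z. hdens s (X - ctrans z ** z) * g z \<partial>lborel) =
      (\<integral>\<^sup>+w. hdens s (X - ctrans (w ** T) ** (w ** T)) * g (w ** T) \<partial>lborel)"
    by (rule nn_integral_matrix_right[symmetric]) (use T0 in simp, measurable)
  also have "\<dots> = (\<integral>\<^sup>+w. (if norm (skwp X) < 1 then ennreal (adet T powr (2 * s)) else 0) * (bdens s w * g (w ** T)) \<partial>lborel)"
    unfolding pt by (simp add: mult.assoc)
  also have "\<dots> = (if norm (skwp X) < 1 then ennreal (adet T powr (2 * s)) else 0) * (\<integral>\<^sup>+w. bdens s w * g (w ** T) \<partial>lborel)"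
    by (rule nn_integral_cmult) measurable
  finally show ?thesis
    by (simp add: powr_add ennreal_mult mult.assoc)
qed

text \<open>If $Z^* Z$ is within \<open>\<epsilon>\<close> of the identity then so is its root \<open>T\<close>. This bounds the integral of a function
  of the first block $w T$ by an integral over the ball, with a factor \<open>b\<close> that is the same for all \<open>g\<close> and is
  determined by the case \<open>g = 1\<close>.\<close>

lemma gram_window:
  fixes s \<epsilon> :: real
  assumes qs: "CARD('q::{finite,linorder}) \<le> CARD('s::finite)"
    and s: "2 * s = real DIM('f::rch) * real CARD('s) - hexp TYPE('f) TYPE('q)"
  obtains b :: ennreal where
    "\<And>g g'. g \<in> borel_measurable borel \<Longrightarrow> g' \<in> borel_measurable borel \<Longrightarrow>
      (\<And>w T. w \<in> B_ball \<Longrightarrow> norm (T - mat 1) < \<epsilon> \<Longrightarrow> g (w ** T) \<le> g' w) \<Longrightarrow>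
      (\<integral>\<^sup>+Z. (if norm (gram Z - mat 1) < \<epsilon> then 1 else 0) * g (fst Z) \<partial>(lborel :: ('f, 'q, 's) blocks measure)) \<le>
        b * (\<integral>\<^sup>+w. bdens s w * g' w \<partial>lborel)"
    "(\<integral>\<^sup>+Z. (if norm (gram Z - mat 1) < \<epsilon> then 1 else 0) \<partial>(lborel :: ('f, 'q, 's) blocks measure)) =
      b * (\<integral>\<^sup>+w. bdens s w \<partial>(lborel :: ('f, 'q) sqmat measure))"
proof -
  obtain c :: real where c: "c > 0" "\<And>G. G \<in> borel_measurable borel \<Longrightarrow>
    (\<integral>\<^sup>+Z. G (fst Z, gram Z) \<partial>(lborel :: ('f, 'q, 's) blocks measure)) =
      ennreal c * (\<integral>\<^sup>+X. \<integral>\<^sup>+z. hdens s (X - ctrans z ** z) * G (z, hermp X) \<partial>lborel \<partial>(lborel :: ('f, 'q) sqmat measure))"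
    by (rule gram_integral[OF qs s], rule that) blast+
  define \<beta> where "\<beta> X = (if pos_def (hermp X) \<and> norm (hermp X - mat 1) < \<epsilon> \<and> norm (skwp X) < 1
    then ennreal (adet (hermp X) powr ((real DIM('f) * real CARD('q) + 2 * s) / 2)) else 0)" for X :: "('f, 'q) sqmat"
  have [measurable]: "\<beta> \<in> borel_measurable borel" unfolding \<beta>_def by measurable
  have pd: "pos_def (hermp X)" if "hdens s (X - ctrans z ** z) \<noteq> 0" for X z :: "('f, 'q) sqmat"
  proof -
    have *: "pos_def (hermp X - ctrans z ** z)"
      using that by (simp add: hdens_def linear_diff[OF linear_hermp] hermp_hermitian(1) ctrans_mult split: if_splits)
    show ?thesis unfolding pos_def_def
    proof (intro conjI allI impI)
      fix v :: "('f, 'q) vec" assume "v \<noteq> 0"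
      have "0 < v \<bullet> ((hermp X - ctrans z ** z) *v v)" by (rule pos_defD(2)[OF * \<open>v \<noteq> 0\<close>])
      also have "\<dots> = v \<bullet> (hermp X *v v) - (norm (z *v v))\<^sup>2"
        by (simp add: matrix_vector_mult_diff_rdistrib inner_diff_right inner_gram)
      finally show "0 < v \<bullet> (hermp X *v v)" using zero_le_power2[of "norm (z *v v)"] by linarith
    qed simp
  qed
  have fib: "(\<integral>\<^sup>+z. hdens s (X - ctrans z ** z) * ((if norm (hermp X - mat 1) < \<epsilon> then 1 else 0) * g z) \<partial>lborel) =
      \<beta> X * (\<integral>\<^sup>+w. bdens s w * g (w ** T) \<partial>lborel)"
    if T: "pos_def T" "T ** T = hermp X" and g [measurable]: "g \<in> borel_measurable borel" for X T :: "('f, 'q) sqmat" and g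
  proof -
    have "hermp X = ctrans T ** T" using T pos_defD(1)[OF T(1)] by simp
    moreover have "pos_def (ctrans T ** T)"
      using pos_def_gram[of T] pos_defD(2)[OF T(1)] by (metis inner_zero_right less_irrefl)
    ultimately have pX: "pos_def (hermp X)" by simp
    have a: "adet T powr (real DIM('f) * real CARD('q) + 2 * s) = adet (hermp X) powr ((real DIM('f) * real CARD('q) + 2 * s) / 2)"
      unfolding T(2)[symmetric] adet_mult powr_mult powr_add[symmetric] by (rule arg_cong) argo
    show ?thesis
    proof (cases "norm (hermp X - mat 1) < \<epsilon>")
      case True
      thus ?thesis using hdens_fibre_integral[OF T g, of s] pX by (simp add: \<beta>_def a)
    qed (simp add: \<beta>_def)
  qed
  have nofib: "(\<integral>\<^sup>+z. hdens s (X - ctrans z ** z) * y z \<partial>lborel) = 0" if "\<not> pos_def (hermp X)" for X and y :: "('f, 'q) sqmat \<Rightarrow> ennreal"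
  proof -
    have "hdens s (X - ctrans z ** z) = 0" for z :: "('f, 'q) sqmat" using pd that by blast
    thus ?thesis by simp
  qed
  show ?thesis
  proof (rule that[of "ennreal c * (\<integral>\<^sup>+X. \<beta> X \<partial>lborel)"])
    fix g g' :: "('f, 'q) sqmat \<Rightarrow> ennreal"
    assume g [measurable]: "g \<in> borel_measurable borel" and g' [measurable]: "g' \<in> borel_measurable borel"
      and gg: "\<And>w T. w \<in> B_ball \<Longrightarrow> norm (T - mat 1) < \<epsilon> \<Longrightarrow> g (w ** T) \<le> g' w"
    have "(\<integral>\<^sup>+Z. (if norm (gram Z - mat 1) < \<epsilon> then 1 else 0) * g (fst Z) \<partial>(lborel :: ('f, 'q, 's) blocks measure)) =
        ennreal c * (\<integral>\<^sup>+X. \<integral>\<^sup>+z. hdens s (X - ctrans z ** z) * ((if norm (hermp X - mat 1) < \<epsilon> then 1 else 0) * g z) \<partial>lborel \<partial>(lborel :: ('f, 'q) sqmat measure))"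
      by (rule c(2)[of "\<lambda>(z, A). (if norm (A - mat 1) < \<epsilon> then 1 else 0) * g z", unfolded case_prod_conv]) (unfold case_prod_unfold, measurable)
    also have "\<dots> \<le> ennreal c * (\<integral>\<^sup>+X. \<beta> X * (\<integral>\<^sup>+w. bdens s w * g' w \<partial>lborel) \<partial>(lborel :: ('f, 'q) sqmat measure))"
    proof (intro mult_left_mono nn_integral_mono)
      fix X :: "('f, 'q) sqmat"
      show "(\<integral>\<^sup>+z. hdens s (X - ctrans z ** z) * ((if norm (hermp X - mat 1) < \<epsilon> then 1 else 0) * g z) \<partial>lborel) \<le>
          \<beta> X * (\<integral>\<^sup>+w. bdens s w * g' w \<partial>lborel)"
      proof (cases "pos_def (hermp X)")
        case True
        obtain T where T: "pos_def T" "T ** T = hermp X" "norm (T - mat 1) \<le> norm (hermp X - mat 1)" using pos_def_sqrt[OF True] by metis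
        show ?thesis unfolding fib[OF T(1,2) g]
        proof (cases "norm (hermp X - mat 1) < \<epsilon>")
          case True
          hence "norm (T - mat 1) < \<epsilon>" using T(3) by simp
          hence "bdens s w * g (w ** T) \<le> bdens s w * g' w" for w
            by (cases "w \<in> B_ball") (auto simp: bdens_def intro: mult_left_mono gg)
          thus "\<beta> X * (\<integral>\<^sup>+w. bdens s w * g (w ** T) \<partial>lborel) \<le> \<beta> X * (\<integral>\<^sup>+w. bdens s w * g' w \<partial>lborel)"
            by (rule mult_left_mono[OF nn_integral_mono]) auto
        qed (simp add: \<beta>_def)
      qed (simp add: nofib)
    qed simp
    also have "(\<integral>\<^sup>+X. \<beta> X * (\<integral>\<^sup>+w. bdens s w * g' w \<partial>lborel) \<partial>(lborel :: ('f, 'q) sqmat measure)) = (\<integral>\<^sup>+X. \<beta> X \<partial>lborel) * (\<integral>\<^sup>+w. bdens s w * g' w \<partial>lborel)"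
      by (rule nn_integral_multc) measurable
    finally show "(\<integral>\<^sup>+Z. (if norm (gram Z - mat 1) < \<epsilon> then 1 else 0) * g (fst Z) \<partial>(lborel :: ('f, 'q, 's) blocks measure)) \<le>
        ennreal c * (\<integral>\<^sup>+X. \<beta> X \<partial>lborel) * (\<integral>\<^sup>+w. bdens s w * g' w \<partial>lborel)" by (simp add: mult.assoc)
  next
    have "(\<integral>\<^sup>+Z. (if norm (gram Z - mat 1) < \<epsilon> then 1 else 0) * 1 \<partial>(lborel :: ('f, 'q, 's) blocks measure)) =
        ennreal c * (\<integral>\<^sup>+X. \<integral>\<^sup>+z. hdens s (X - ctrans z ** z) * ((if norm (hermp X - mat 1) < \<epsilon> then 1 else 0) * 1) \<partial>(lborel :: ('f, 'q) sqmat measure) \<partial>(lborel :: ('f, 'q) sqmat measure))"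
      by (rule c(2)[of "\<lambda>p. (if norm (snd p - mat 1) < \<epsilon> then 1 else 0) * 1", unfolded snd_conv]) measurable
    also have "(\<integral>\<^sup>+X. \<integral>\<^sup>+z. hdens s (X - ctrans z ** z) * ((if norm (hermp X - mat 1) < \<epsilon> then 1 else 0) * 1) \<partial>(lborel :: ('f, 'q) sqmat measure) \<partial>(lborel :: ('f, 'q) sqmat measure)) =
        (\<integral>\<^sup>+X. \<beta> X * (\<integral>\<^sup>+w. bdens s w \<partial>(lborel :: ('f, 'q) sqmat measure)) \<partial>(lborel :: ('f, 'q) sqmat measure))"
    proof (rule nn_integral_cong)
      fix X :: "('f, 'q) sqmat"
      show "(\<integral>\<^sup>+z. hdens s (X - ctrans z ** z) * ((if norm (hermp X - mat 1) < \<epsilon> then 1 else 0) * 1) \<partial>(lborel :: ('f, 'q) sqmat measure)) =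
          \<beta> X * (\<integral>\<^sup>+w. bdens s w \<partial>(lborel :: ('f, 'q) sqmat measure))"
      proof (cases "pos_def (hermp X)")
        case True
        obtain T where T: "pos_def T" "T ** T = hermp X" using pos_def_sqrt[OF True] by metis
        show ?thesis using fib[OF T, of "\<lambda>_. 1"] by simp
      next
        case False
        hence "\<beta> X = 0" by (simp add: \<beta>_def)
        thus ?thesis using nofib[OF False] by simp
      qed
    qed
    also have "\<dots> = (\<integral>\<^sup>+X. \<beta> X \<partial>lborel) * (\<integral>\<^sup>+w. bdens s w \<partial>(lborel :: ('f, 'q) sqmat measure))"
      by (rule nn_integral_multc) measurable
    finally show "(\<integral>\<^sup>+Z. (if norm (gram Z - mat 1) < \<epsilon> then 1 else 0) \<partial>(lborel :: ('f, 'q, 's) blocks measure)) =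
        ennreal c * (\<integral>\<^sup>+X. \<beta> X \<partial>lborel) * (\<integral>\<^sup>+w. bdens s w \<partial>(lborel :: ('f, 'q) sqmat measure))" by (simp add: mult.assoc)
  qed
qed

section \<open>The action of the maximal compact subgroup on pairs of blocks\<close>

definition stack :: "('f::rch, 'q::finite, 's::finite) blocks \<Rightarrow> ('f, 'q, 'q + 'q + 's) tallmat"
  where "stack Z = (\<chi> a. case a of Inl i \<Rightarrow> 0 | Inr (Inl i) \<Rightarrow> fst Z $ i | Inr (Inr i) \<Rightarrow> snd Z $ i)"

definition unstack :: "('f::rch, 'q::finite, 'q + 'q + 's::finite) tallmat \<Rightarrow> ('f, 'q, 's) blocks"
  where "unstack X = ((\<chi> i. X $ Inr (Inl i)), (\<chi> i. X $ Inr (Inr i)))"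

definition act :: "('f::rch, 'q::finite, 's::finite) bigmat \<Rightarrow> ('f, 'q, 's) blocks \<Rightarrow> ('f, 'q, 's) blocks"
  where "act k Z = unstack (k ** stack Z)"

definition midblk :: "('f::rch, 'q::finite, 's::finite) bigmat \<Rightarrow> ('f, 'q) sqmat"
  where "midblk k = (\<chi> i j. k $ Inr (Inl i) $ Inr (Inl j))"

lemma stack_nth [simp]: "stack Z $ Inl i = 0" "stack Z $ Inr (Inl i) = fst Z $ i" "stack Z $ Inr (Inr l) = snd Z $ l"
  by (simp_all add: stack_def)

lemma stack_unstack: "(\<And>i. X $ Inl i = 0) \<Longrightarrow> stack (unstack X) = X"
  by (simp add: vec_eq_iff stack_def unstack_def split: sum.split)

lemma linear_stack: "linear stack"
  by (rule linearI) (simp_all add: stack_def vec_eq_iff split: sum.split)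

lemma linear_unstack: "linear unstack"
  by (rule linearI) (simp_all add: unstack_def vec_eq_iff prod_eq_iff)

lemma linear_midblk: "linear midblk"
  by (rule linearI) (simp_all add: midblk_def vec_eq_iff)

lemma norm_sq_vec: "(norm (x :: 'a::real_normed_vector^'n::finite))\<^sup>2 = (\<Sum>i\<in>UNIV. (norm (x $ i))\<^sup>2)"
  by (simp add: norm_vec_def L2_set_def sum_nonneg)

lemma norm_stack: "norm (stack Z) = norm Z"
proof -
  have "(norm (stack Z))\<^sup>2 = (norm (fst Z))\<^sup>2 + (norm (snd Z))\<^sup>2"
    unfolding norm_sq_vec[of "stack Z"] norm_sq_vec[of "fst Z"] norm_sq_vec[of "snd Z"] by (simp add: sum_UNIV_Plus)
  thus ?thesis by (simp add: norm_prod_def real_sqrt_unique)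
qed

lemma gram_stack: "ctrans (stack Z) ** stack Z = gram Z"
  by (simp add: vec_eq_iff matrix_nth gram_def sum_UNIV_Plus)

lemma stack_act:
  assumes "k \<in> K_group"
  shows "stack (act k Z) = k ** stack Z"
  unfolding act_def
proof (rule stack_unstack)
  show "(k ** stack Z) $ Inl i = 0" for i
    using assms by (simp add: vec_eq_iff matrix_nth sum_UNIV_Plus K_group_def)
qed

lemma linear_act: "linear (act k)"
  by (rule linearI)
     (simp_all add: act_def linear_add[OF linear_stack] linear_add[OF linear_unstack] linear_cmul[OF linear_stack]
       linear_cmul[OF linear_unstack] matrix_add_ldistrib matrix_scaleR_right)

lemma norm_act: "k \<in> K_group \<Longrightarrow> norm (act k Z) = norm Z"
  by (simp only: norm_stack[symmetric] stack_act) (simp add: norm_isometry_left unitary_groupD(1)[OF K_groupD(2)])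

lemma gram_act: "k \<in> K_group \<Longrightarrow> gram (act k Z) = gram Z"
proof -
  assume k: "k \<in> K_group"
  have "ctrans (k ** stack Z) ** (k ** stack Z) = ctrans (stack Z) ** (ctrans k ** k) ** stack Z"
    by (simp add: ctrans_mult matrix_mul_assoc)
  thus ?thesis by (simp add: gram_stack[symmetric] stack_act[OF k] unitary_groupD(1)[OF K_groupD(2)[OF k]])
qed

lemma midblk_mult: "midblk k ** Y = fst (act k (Y, 0))"
  by (simp add: vec_eq_iff matrix_nth act_def unstack_def midblk_def sum_UNIV_Plus)

lemma norm_midblk_mult:
  fixes Y :: "('f::rch, 'q::finite) sqmat"
  assumes k: "k \<in> K_group"
  shows "norm (midblk k ** Y) \<le> norm Y"
proof -
  have "norm (midblk k ** Y) \<le> norm (act k (Y, 0))" unfolding midblk_mult by (cases "act k (Y, 0)") (simp add: norm_fst_le)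
  thus ?thesis by (simp add: norm_act[OF k])
qed

lemma measurable_act [measurable (raw)]:
  assumes [measurable]: "f \<in> borel_measurable M" "g \<in> borel_measurable M"
  shows "(\<lambda>x. act (f x) (g x)) \<in> borel_measurable M"
proof -
  have [measurable]: "(\<lambda>x. stack (g x)) \<in> borel_measurable M"
    by (rule measurable_compose[OF assms(2) linear_borel[OF linear_stack]])
  have m: "(\<lambda>x. f x ** stack (g x)) \<in> borel_measurable M" by measurable
  show ?thesis unfolding act_def by (rule measurable_compose[OF m linear_borel[OF linear_unstack]])
qed

lemma measurable_blk1 [measurable (raw)]: "f \<in> borel_measurable M \<Longrightarrow> (\<lambda>x. blk1 (f x)) \<in> borel_measurable M"
  by (erule measurable_compose) (rule linear_borel[OF linear_blk1])

lemma measurable_midblk [measurable (raw)]: "f \<in> borel_measurable M \<Longrightarrow> (\<lambda>x. midblk (f x)) \<in> borel_measurable M"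
  by (erule measurable_compose) (rule linear_borel[OF linear_midblk])

lemma measurable_haar_ident:
  assumes "normalized_haar S \<mu>"
  shows "(\<lambda>x. x) \<in> borel_measurable \<mu>"
proof -
  have "(\<lambda>x. x) \<in> borel_measurable (restrict_space borel S)" by (rule measurable_restrict_space1) simp
  moreover have "sets \<mu> = sets (restrict_space borel S)" using assms by (simp add: normalized_haar_def)
  ultimately show ?thesis using measurable_cong_sets by blast
qed

text \<open>Write $Z = V T$ with orthonormal columns \<open>V\<close>. These are the images of the standard ones
  under an element of \<open>K\<close> with trivial first block, which the right invariance absorbs.\<close>

lemma haar_act_gram:
  fixes \<mu>K :: "('f::rch, 'q::finite, 's::finite) bigmat measure"
  assumes \<mu>K: "normalized_haar K_group \<mu>K" and T: "pos_def T" "T ** T = gram Z"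
    and F [measurable]: "F \<in> borel_measurable borel"
  shows "(\<integral>\<^sup>+k. F (blk1 k, fst (act k Z)) \<partial>\<mu>K) = (\<integral>\<^sup>+k. F (blk1 k, midblk k ** T) \<partial>\<mu>K)"
proof -
  have sp: "space \<mu>K = K_group" using \<mu>K by (simp add: normalized_haar_def)
  have [measurable]: "(\<lambda>k. k) \<in> borel_measurable \<mu>K" by (rule measurable_haar_ident[OF \<mu>K])
  have Tc: "ctrans T = T" by (rule pos_defD(1)[OF T(1)])
  obtain S where S: "S ** T = mat 1" "T ** S = mat 1" using pos_def_inverse[OF T(1)] by (metis matrix_left_inverse_imp_right)
  define V where "V = stack Z ** S"
  have VT: "V ** T = stack Z" unfolding V_def by (simp add: matrix_mul_assoc[symmetric] S)
  have ST: "ctrans S ** T = mat 1" using arg_cong[OF S(2), of ctrans] by (simp add: ctrans_mult Tc)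
  have VV: "ctrans V ** V = mat 1"
  proof -
    have "ctrans V ** V = ctrans S ** (ctrans (stack Z) ** stack Z) ** S"
      unfolding V_def by (simp add: ctrans_mult matrix_mul_assoc)
    also have "\<dots> = (ctrans S ** T) ** (T ** S)" unfolding gram_stack T(2)[symmetric] by (simp add: matrix_mul_assoc)
    finally show ?thesis by (simp add: ST S)
  qed
  define v where "v j = (\<chi> a. V $ a $ j)" for j
  have "hdot (v i) (v j) = (ctrans V ** V) $ i $ j" for i j
    by (simp add: hdot_def v_def matrix_nth)
  hence h: "hdot (v i) (v j) = (if i = j then 1 else 0)" for i j by (simp add: VV mat_nth)
  have v0: "v j $ Inl i = 0" for i j by (simp add: v_def V_def matrix_nth)
  obtain g where g: "g \<in> K_group" "\<And>i. g *v axis (Inl i) 1 = axis (Inl i) 1" "\<And>j. g *v axis (Inr (Inl j)) 1 = v j"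
    using K_transitive[OF h v0] by metis
  have "blk1 g = mat 1"
  proof -
    have "blk1 g $ i $ j = (g *v axis (Inl j) 1) $ Inl i" for i j by (simp add: blk1_def matrix_vec_axis)
    thus ?thesis unfolding g(2) by (simp add: vec_eq_iff mat_nth axis_def)
  qed
  hence b: "blk1 (k ** g) = blk1 k" if "k \<in> K_group" for k using blk1_mult[OF that, of g] by simp
  have m: "midblk (k ** g) ** T = fst (act k Z)" for k
  proof -
    have gV: "g $ a $ Inr (Inl j) = V $ a $ j" for a j
    proof -
      have "g $ a $ Inr (Inl j) = (g *v axis (Inr (Inl j)) 1) $ a" by (simp add: matrix_vec_axis)
      thus ?thesis unfolding g(3) by (simp add: v_def)
    qed
    have "midblk (k ** g) $ i = (k ** V) $ Inr (Inl i)" for i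
      by (simp add: vec_eq_iff midblk_def matrix_nth gV)
    hence "(midblk (k ** g) ** T) $ i = ((k ** V) ** T) $ Inr (Inl i)" for i
      by (simp add: vec_eq_iff matrix_nth[of _ T])
    moreover have "(k ** V) ** T = k ** stack Z" by (simp add: matrix_mul_assoc[symmetric] VT)
    ultimately show ?thesis by (simp add: vec_eq_iff act_def unstack_def)
  qed
  have gm: "(\<lambda>k. k ** g) \<in> \<mu>K \<rightarrow>\<^sub>M \<mu>K"
  proof -
    have "(\<lambda>k. k ** g) \<in> restrict_space borel K_group \<rightarrow>\<^sub>M restrict_space borel K_group"
      by (rule measurable_restrict_space3)
         (use g(1) unitary_subgroup_K in \<open>auto simp: unitary_subgroup_def intro!: borel_measurable_continuous_onI continuous_intros\<close>)
    thus ?thesis using \<mu>K measurable_cong_sets unfolding normalized_haar_def by blast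
  qed
  have "(\<integral>\<^sup>+k. F (blk1 k, midblk k ** T) \<partial>\<mu>K) = (\<integral>\<^sup>+k. F (blk1 k, midblk k ** T) \<partial>distr \<mu>K \<mu>K (\<lambda>k. k ** g))"
    unfolding haar_right_translation[OF unitary_subgroup_K \<mu>K g(1)] ..
  also have "\<dots> = (\<integral>\<^sup>+k. F (blk1 (k ** g), midblk (k ** g) ** T) \<partial>\<mu>K)"
    by (rule nn_integral_distr[OF gm]) measurable
  also have "\<dots> = (\<integral>\<^sup>+k. F (blk1 k, fst (act k Z)) \<partial>\<mu>K)"
    by (rule nn_integral_cong) (simp add: sp b m)
  finally show ?thesis ..
qed

section \<open>Contractions and windows\<close>

lemma B_ball_contraction: "w \<in> B_ball \<Longrightarrow> norm (w *v v) \<le> norm (v :: 'f::rch^'n::finite)"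
proof (cases "v = 0")
  case False
  assume "w \<in> B_ball"
  hence "pos_def (mat 1 - ctrans w ** w)" by (simp add: B_ball_def)
  from pos_defD(2)[OF this False] have "0 < v \<bullet> v - (norm (w *v v))\<^sup>2"
    by (simp add: matrix_vector_mult_diff_rdistrib inner_diff_right inner_gram)
  hence "(norm (w *v v))\<^sup>2 \<le> (norm v)\<^sup>2" by (simp add: power2_norm_eq_inner)
  thus ?thesis by (rule power2_le_imp_le) simp
qed simp

lemma norm_contraction_left:
  fixes Y :: "'f::rch^'m::finite^'n::finite" and w :: "('f, 'n) sqmat"
  assumes w: "\<And>v. norm (w *v v) \<le> norm v"
  shows "norm (w ** Y) \<le> norm Y"
proof -
  have col: "norm X = L2_set (\<lambda>j. norm (\<chi> i. X $ i $ j)) UNIV" for X :: "'f^'m^'n"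
  proof -
    have "norm X = norm (ctrans X)" by simp
    also have "\<dots> = L2_set (\<lambda>j. norm (ctrans X $ j)) UNIV" by (rule norm_vec_def)
    finally show ?thesis by (simp add: norm_vec_def[of "ctrans X $ _"] norm_vec_def[of "\<chi> i. X $ i $ _"])
  qed
  have "(\<chi> i. (w ** Y) $ i $ j) = w *v (\<chi> i. Y $ i $ j)" for j
    by (simp add: vec_eq_iff matrix_nth matrix_vec_nth)
  thus ?thesis unfolding col[of "w ** Y"] col[of Y] by (intro L2_set_mono) (auto simp: w)
qed

lemma window_finite_positive:
  assumes "0 < \<epsilon>"
  shows "0 < (\<integral>\<^sup>+Z. (if norm (gram Z - mat 1) < \<epsilon> then 1 else 0) \<partial>(lborel :: ('f::rch, 'q::finite, 's::finite) blocks measure))"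
    and "(\<integral>\<^sup>+Z. (if norm (gram Z - mat 1) < \<epsilon> then 1 else 0) \<partial>(lborel :: ('f::rch, 'q::finite, 's::finite) blocks measure)) < \<infinity>"
proof -
  let ?I = "(\<integral>\<^sup>+Z. (if norm (gram Z - mat 1) < \<epsilon> then 1 else 0) \<partial>(lborel :: ('f, 'q, 's) blocks measure))"
  let ?Q = "{Z :: ('f, 'q, 's) blocks. norm (gram Z - mat 1) < \<epsilon>}"
  let ?N = "norm (mat 1 :: ('f, 'q) sqmat)"
  have Qo: "open ?Q" unfolding gram_def by (intro open_Collect_less continuous_intros)
  have "(mat 1, 0) \<in> ?Q" using assms by (simp add: gram_def)
  from nn_integral_pos_open[OF Qo this] show "0 < ?I" by simp
  have "bounded ?Q"
  proof (rule boundedI)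
    fix Z assume "Z \<in> ?Q"
    hence "norm (gram Z) \<le> \<epsilon> + ?N" using norm_triangle_sub[of "gram Z" "mat 1"] by simp
    moreover have "(norm Z)\<^sup>2 \<le> norm (gram Z) * ?N"
      using norm_gram_bound[of "stack Z"] by (simp add: norm_stack gram_stack)
    ultimately have "(norm Z)\<^sup>2 \<le> (\<epsilon> + ?N) * ?N" by (meson mult_right_mono norm_ge_zero order_trans)
    thus "norm Z \<le> sqrt ((\<epsilon> + ?N) * ?N)" by (rule real_le_rsqrt)
  qed
  hence "emeasure lborel ?Q < \<infinity>" by (rule emeasure_bounded_finite)
  moreover have "?I = (\<integral>\<^sup>+Z. indicator ?Q Z \<partial>lborel)" by (rule nn_integral_cong) (simp add: indicator_def)
  ultimately show "?I < \<infinity>" using Qo by simp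
qed

text \<open>Integrate $f$ over \<open>K\<close> and over the matrices \<open>Z\<close> with Gram matrix close to the
  identity, in both orders. In one order, the first block of the image of \<open>Z\<close> is almost
  distributed like the middle block of \<open>k\<close>, in the other one like the ball measure.\<close>

lemma block_inequality:
  fixes \<mu>K :: "('f::rch, 'q::{finite,linorder}, 's::finite) bigmat measure"
  assumes \<mu>K: "normalized_haar K_group \<mu>K" and qs: "CARD('q) \<le> CARD('s)"
    and s: "2 * s = real DIM('f) * real CARD('s) - hexp TYPE('f) TYPE('q)"
  shows "0 < (\<integral>\<^sup>+w. bdens s w \<partial>(lborel :: ('f, 'q) sqmat measure))" "(\<integral>\<^sup>+w. bdens s w \<partial>(lborel :: ('f, 'q) sqmat measure)) < \<infinity>"
    and "\<And>f f1 f2 \<epsilon>. 0 < \<epsilon> \<Longrightarrow> \<epsilon> \<le> 1 \<Longrightarrow> f \<in> borel_measurable borel \<Longrightarrow> f1 \<in> borel_measurable borel \<Longrightarrow> f2 \<in> borel_measurable borel \<Longrightarrow>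
      (\<And>u x y. dist x y < \<epsilon> \<Longrightarrow> f (u, x) \<le> f1 (u, y)) \<Longrightarrow> (\<And>u x y. dist x y < \<epsilon> \<Longrightarrow> f1 (u, x) \<le> f2 (u, y)) \<Longrightarrow>
      (\<integral>\<^sup>+w. bdens s w \<partial>(lborel :: ('f, 'q) sqmat measure)) * (\<integral>\<^sup>+k. f (blk1 k, midblk k) \<partial>\<mu>K) \<le>
      (\<integral>\<^sup>+k. (\<integral>\<^sup>+w. bdens s w * f2 (blk1 k, w) \<partial>lborel) \<partial>\<mu>K)"
proof -
  let ?\<kappa> = "\<integral>\<^sup>+w. bdens s w \<partial>(lborel :: ('f, 'q) sqmat measure)"
  define W where "W \<epsilon> Z = (if norm (gram Z - mat 1) < \<epsilon> then 1 else 0 :: ennreal)" for \<epsilon> and Z :: "('f, 'q, 's) blocks"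
  have Wm [measurable]: "W \<epsilon> \<in> borel_measurable borel" for \<epsilon> unfolding W_def by measurable
  have \<kappa>: "0 < ?\<kappa> \<and> ?\<kappa> < \<infinity>"
  proof -
    obtain b where b: "(\<integral>\<^sup>+Z. (if norm (gram Z - mat 1) < 1 then 1 else 0) \<partial>(lborel :: ('f, 'q, 's) blocks measure)) = b * ?\<kappa>"
      by (rule gram_window[OF qs s, of 1], rule that) blast+
    have "0 < b * ?\<kappa>" "b * ?\<kappa> < \<infinity>" unfolding b[symmetric] by (rule window_finite_positive; simp)+
    thus ?thesis by (auto simp: ennreal_mult_less_top ennreal_zero_less_mult_iff)
  qed
  thus "0 < ?\<kappa>" "?\<kappa> < \<infinity>" by auto
  fix f f1 f2 :: "('f, 'q) sqmat \<times> ('f, 'q) sqmat \<Rightarrow> ennreal" and \<epsilon> :: real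
  assume \<epsilon>: "0 < \<epsilon>" "\<epsilon> \<le> 1" and [measurable]: "f \<in> borel_measurable borel" "f1 \<in> borel_measurable borel" "f2 \<in> borel_measurable borel"
    and ff1: "\<And>u x y. dist x y < \<epsilon> \<Longrightarrow> f (u, x) \<le> f1 (u, y)" and f12: "\<And>u x y. dist x y < \<epsilon> \<Longrightarrow> f1 (u, x) \<le> f2 (u, y)"
  have sp: "space \<mu>K = K_group" using \<mu>K by (simp add: normalized_haar_def)
  interpret K: prob_space \<mu>K using \<mu>K by (simp add: normalized_haar_def)
  interpret P: pair_sigma_finite "lborel :: ('f, 'q, 's) blocks measure" \<mu>K ..
  have [measurable]: "(\<lambda>k. k) \<in> borel_measurable \<mu>K" by (rule measurable_haar_ident[OF \<mu>K])
  have [measurable]: "(\<lambda>x. snd x) \<in> borel_measurable ((lborel :: ('f, 'q, 's) blocks measure) \<Otimes>\<^sub>M \<mu>K)"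
    by (rule measurable_compose[OF measurable_snd]) measurable
  have [measurable]: "(\<lambda>x. fst x) \<in> borel_measurable ((lborel :: ('f, 'q, 's) blocks measure) \<Otimes>\<^sub>M \<mu>K)"
    by (rule measurable_compose[OF measurable_fst]) simp
  obtain b where b1: "\<And>g g'. g \<in> borel_measurable borel \<Longrightarrow> g' \<in> borel_measurable borel \<Longrightarrow>
      (\<And>w T. w \<in> B_ball \<Longrightarrow> norm (T - mat 1) < \<epsilon> \<Longrightarrow> g (w ** T) \<le> g' w) \<Longrightarrow>
      (\<integral>\<^sup>+Z. (if norm (gram Z - mat 1) < \<epsilon> then 1 else 0) * g (fst Z) \<partial>(lborel :: ('f, 'q, 's) blocks measure)) \<le>
        b * (\<integral>\<^sup>+w. bdens s w * g' w \<partial>lborel)"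
    and b2: "(\<integral>\<^sup>+Z. (if norm (gram Z - mat 1) < \<epsilon> then 1 else 0) \<partial>(lborel :: ('f, 'q, 's) blocks measure)) = b * ?\<kappa>"
    by (rule gram_window[OF qs s, of \<epsilon>], rule that) blast+
  have bk: "0 < b * ?\<kappa>" "b * ?\<kappa> < \<infinity>" unfolding b2[symmetric] by (rule window_finite_positive[OF \<epsilon>(1)])+
  hence b: "b \<noteq> 0" "b \<noteq> top" using \<kappa> by (auto simp: ennreal_mult_less_top ennreal_zero_less_mult_iff)
  let ?L = "\<integral>\<^sup>+k. f (blk1 k, midblk k) \<partial>\<mu>K"
  have "b * (?\<kappa> * ?L) = (\<integral>\<^sup>+Z. W \<epsilon> Z * ?L \<partial>lborel)"
    unfolding mult.assoc[symmetric] b2[symmetric] W_def by (rule nn_integral_multc[symmetric]) measurable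
  also have "\<dots> \<le> (\<integral>\<^sup>+Z. W \<epsilon> Z * (\<integral>\<^sup>+k. f1 (blk1 k, fst (act k Z)) \<partial>\<mu>K) \<partial>lborel)"
  proof (rule nn_integral_mono)
    fix Z :: "('f, 'q, 's) blocks"
    show "W \<epsilon> Z * ?L \<le> W \<epsilon> Z * (\<integral>\<^sup>+k. f1 (blk1 k, fst (act k Z)) \<partial>\<mu>K)"
    proof (cases "norm (gram Z - mat 1) < \<epsilon>")
      case True
      have "ctrans (gram Z - mat 1) = gram Z - mat 1"
        by (simp add: gram_def ctrans_diff ctrans_add ctrans_mult)
      from pos_def_scalar_perturbation[OF this, of 1] have "pos_def (gram Z)" using True \<epsilon> by simp
      then obtain T where T: "pos_def T" "T ** T = gram Z" "norm (T - mat 1) \<le> norm (gram Z - mat 1)" using pos_def_sqrt by metis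
      have "?L \<le> (\<integral>\<^sup>+k. f1 (blk1 k, midblk k ** T) \<partial>\<mu>K)"
      proof (rule nn_integral_mono)
        fix k assume "k \<in> space \<mu>K"
        hence k: "k \<in> K_group" by (simp add: sp)
        have "norm (midblk k ** T - midblk k) = norm (midblk k ** (T - mat 1))" by (simp add: matrix_diff_ldistrib)
        also have "\<dots> \<le> norm (T - mat 1)" by (rule norm_midblk_mult[OF k])
        also have "\<dots> < \<epsilon>" using T(3) True by simp
        finally have "dist (midblk k) (midblk k ** T) < \<epsilon>" by (simp add: dist_norm norm_minus_commute)
        thus "f (blk1 k, midblk k) \<le> f1 (blk1 k, midblk k ** T)" by (rule ff1)
      qed
      also have "\<dots> = (\<integral>\<^sup>+k. f1 (blk1 k, fst (act k Z)) \<partial>\<mu>K)"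
        by (rule haar_act_gram[OF \<mu>K T(1,2), symmetric]) measurable
      finally show ?thesis by (rule mult_left_mono) simp
    qed (simp add: W_def)
  qed
  also have "\<dots> = (\<integral>\<^sup>+Z. \<integral>\<^sup>+k. W \<epsilon> Z * f1 (blk1 k, fst (act k Z)) \<partial>\<mu>K \<partial>lborel)"
    by (intro nn_integral_cong nn_integral_cmult[symmetric]) measurable
  also have "\<dots> = (\<integral>\<^sup>+k. \<integral>\<^sup>+Z. W \<epsilon> Z * f1 (blk1 k, fst (act k Z)) \<partial>lborel \<partial>\<mu>K)"
    by (rule P.Fubini'[symmetric]) (unfold case_prod_unfold, measurable)
  also have "\<dots> \<le> (\<integral>\<^sup>+k. b * (\<integral>\<^sup>+w. bdens s w * f2 (blk1 k, w) \<partial>lborel) \<partial>\<mu>K)"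
  proof (rule nn_integral_mono)
    fix k assume "k \<in> space \<mu>K"
    hence k: "k \<in> K_group" by (simp add: sp)
    have m: "(\<lambda>Z. W \<epsilon> Z * f1 (blk1 k, fst Z)) \<in> borel_measurable borel" by measurable
    have "(\<integral>\<^sup>+Z. W \<epsilon> Z * f1 (blk1 k, fst (act k Z)) \<partial>lborel) = (\<integral>\<^sup>+Z. W \<epsilon> (act k Z) * f1 (blk1 k, fst (act k Z)) \<partial>lborel)"
      by (simp add: W_def gram_act[OF k])
    also have "\<dots> = (\<integral>\<^sup>+Z. W \<epsilon> Z * f1 (blk1 k, fst Z) \<partial>lborel)"
      by (rule nn_integral_isometry[OF linear_act norm_act[OF k] m])
    also have "\<dots> \<le> b * (\<integral>\<^sup>+w. bdens s w * f2 (blk1 k, w) \<partial>lborel)"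
      unfolding W_def
    proof (rule b1[of "\<lambda>z. f1 (blk1 k, z)" "\<lambda>w. f2 (blk1 k, w)"])
      fix w T :: "('f, 'q) sqmat" assume w: "w \<in> B_ball" and T: "norm (T - mat 1) < \<epsilon>"
      have "norm (w ** T - w) = norm (w ** (T - mat 1))" by (simp add: matrix_diff_ldistrib)
      also have "\<dots> \<le> norm (T - mat 1)" by (rule norm_contraction_left[OF B_ball_contraction[OF w]])
      finally have "dist (w ** T) w < \<epsilon>" using T by (simp add: dist_norm)
      thus "f1 (blk1 k, w ** T) \<le> f2 (blk1 k, w)" by (rule f12)
    qed measurable
    finally show "(\<integral>\<^sup>+Z. W \<epsilon> Z * f1 (blk1 k, fst (act k Z)) \<partial>lborel) \<le> b * (\<integral>\<^sup>+w. bdens s w * f2 (blk1 k, w) \<partial>lborel)" .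
  qed
  also have "\<dots> = b * (\<integral>\<^sup>+k. (\<integral>\<^sup>+w. bdens s w * f2 (blk1 k, w) \<partial>lborel) \<partial>\<mu>K)"
    by (rule nn_integral_cmult) measurable
  finally show "?\<kappa> * ?L \<le> (\<integral>\<^sup>+k. (\<integral>\<^sup>+w. bdens s w * f2 (blk1 k, w) \<partial>lborel) \<partial>\<mu>K)"
    using b by (simp add: ennreal_mult_le_mult_iff)
qed

section \<open>Comparison of measures by neighbourhoods\<close>

text \<open>The hypothesis for the complement of a neighbourhood of \<open>C\<close> is the same inequality with the two measures
  exchanged; for closed \<open>C\<close> the radius then tends to zero.\<close>

lemma prob_measure_eqI_neighbourhoods:
  fixes M N :: "'a::metric_space measure"
  assumes M: "prob_space M" "sets M = sets borel" and N: "prob_space N" "sets N = sets borel"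
    and le: "\<And>C \<epsilon>. C \<in> sets borel \<Longrightarrow> 0 < \<epsilon> \<Longrightarrow> \<epsilon> \<le> 1 \<Longrightarrow> emeasure M C \<le> emeasure N (\<Union>y\<in>C. ball y \<epsilon>)"
  shows "M = N"
proof -
  interpret M: prob_space M by fact
  interpret N: prob_space N by fact
  have sp: "space M = UNIV" "space N = UNIV" using sets_eq_imp_space_eq[OF M(2)] sets_eq_imp_space_eq[OF N(2)] by simp_all
  define U where "U C \<epsilon> = (\<Union>y\<in>C. ball y \<epsilon>)" for C :: "'a set" and \<epsilon>
  have Uo: "open (U C \<epsilon>)" for C \<epsilon> unfolding U_def by blast
  have Ub: "U C \<epsilon> \<in> sets borel" for C \<epsilon> by (rule borel_open[OF Uo])
  have le1: "measure M C \<le> measure N (U C \<epsilon>)" if "C \<in> sets borel" "0 < \<epsilon>" "\<epsilon> \<le> 1" for C \<epsilon>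
    using le[OF that] by (simp add: U_def[symmetric] M.emeasure_eq_measure N.emeasure_eq_measure)
  have le2: "measure N C \<le> measure M (U C \<epsilon>)" if C: "C \<in> sets borel" "0 < \<epsilon>" "\<epsilon> \<le> 1" for C \<epsilon>
  proof -
    have c: "- U C \<epsilon> \<in> sets borel" using Ub by auto
    have "U (- U C \<epsilon>) \<epsilon> \<inter> C = {}" by (auto simp: U_def) (metis dist_commute)
    hence "measure N (U (- U C \<epsilon>) \<epsilon>) \<le> measure N (- C)"
      by (intro N.finite_measure_mono) (use C N(2) in auto)
    hence "measure M (- U C \<epsilon>) \<le> measure N (- C)" using le1[OF c C(2,3)] by linarith
    moreover have "measure M (- U C \<epsilon>) = 1 - measure M (U C \<epsilon>)"
      using M.prob_compl[of "U C \<epsilon>"] Ub M(2) by (simp add: sp Compl_eq_Diff_UNIV)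
    moreover have "measure N (- C) = 1 - measure N C"
      using N.prob_compl[of C] C N(2) by (simp add: sp Compl_eq_Diff_UNIV)
    ultimately show ?thesis by linarith
  qed
  have closed_eq: "measure M C = measure N C" if C: "closed C" for C
  proof -
    define A where "A n = U C (1 / real (Suc n))" for n
    have AC: "(\<Inter>n. A n) = C"
    proof
      show "C \<subseteq> (\<Inter>n. A n)" by (force simp: A_def U_def)
      show "(\<Inter>n. A n) \<subseteq> C"
      proof
        fix x assume x: "x \<in> (\<Inter>n. A n)"
        have "\<exists>y\<in>C. dist y x < e" if e: "e > 0" for e
        proof -
          obtain n where "1 / real (Suc n) < e" using nat_approx_posE[OF e] by metis
          moreover obtain y where "y \<in> C" "dist y x < 1 / real (Suc n)" using x by (auto simp: A_def U_def)
          ultimately show ?thesis by force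
        qed
        thus "x \<in> C" using C closed_approachable by blast
      qed
    qed
    have "decseq A"
      by (intro decseq_SucI) (force simp: A_def U_def frac_le intro: less_le_trans)
    moreover have "range A \<subseteq> sets M" "range A \<subseteq> sets N" using Ub by (auto simp: A_def M(2) N(2))
    ultimately have lim: "(\<lambda>n. measure M (A n)) \<longlonglongrightarrow> measure M C" "(\<lambda>n. measure N (A n)) \<longlonglongrightarrow> measure N C"
      using M.finite_Lim_measure_decseq[of A] N.finite_Lim_measure_decseq[of A] by (simp_all add: AC)
    have Cb: "C \<in> sets borel" using C by simp
    have "measure N C \<le> measure M C"
      by (rule LIMSEQ_le_const[OF lim(1)]) (auto simp: A_def intro!: le2[OF Cb])
    moreover have "measure M C \<le> measure N C"
      by (rule LIMSEQ_le_const[OF lim(2)]) (auto simp: A_def intro!: le1[OF Cb])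
    ultimately show ?thesis by simp
  qed
  show ?thesis
  proof (rule measure_eqI_generator_eq[where E="Collect closed" and \<Omega>=UNIV and A="\<lambda>_. UNIV"])
    show "Int_stable (Collect (closed :: 'a set \<Rightarrow> bool))" by (auto simp: Int_stable_def)
    show "sets M = sigma_sets UNIV (Collect closed)" "sets N = sigma_sets UNIV (Collect closed)"
      unfolding M(2) N(2) by (subst borel_eq_closed, simp)+
    show "emeasure M X = emeasure N X" if "X \<in> Collect closed" for X
      using closed_eq[of X] that by (simp add: M.emeasure_eq_measure N.emeasure_eq_measure)
  qed (auto simp: M.emeasure_eq_measure)
qed

section \<open>The joint law of two blocks of a random element of the maximal compact subgroup\<close>

lemma measurable_B_ball [measurable]: "B_ball \<in> sets borel"
  unfolding B_ball_def by measurable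

lemma sets_m_measure: "space (m_measure p) = B_ball" "sets (m_measure p) = sets (restrict_space borel B_ball)"
  by (simp_all add: m_measure_def sets_restrict_space space_restrict_space)

lemma measurable_m_ident [measurable (raw)]: "(\<lambda>w. w) \<in> borel_measurable (m_measure p)"
proof -
  have "(\<lambda>w. w) \<in> borel_measurable (restrict_space borel B_ball)" by (rule measurable_restrict_space1) simp
  thus ?thesis using measurable_cong_sets[OF sets_m_measure(2) refl] by blast
qed

lemma m_measure_integral:
  fixes \<kappa> :: real and p :: nat and g :: "('f::rch, 'q::{finite,linorder}) sqmat \<Rightarrow> ennreal"
  defines "s \<equiv> real p * real DIM('f) / 2 - (real DIM('f) * (real CARD('q) - 1 / 2) + 1)"
  assumes \<kappa>: "\<kappa> > 0" "(\<integral>\<^sup>+w. bdens s w \<partial>(lborel :: ('f, 'q) sqmat measure)) = ennreal \<kappa>"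
    and g [measurable]: "g \<in> borel_measurable borel"
  shows "(\<integral>\<^sup>+w. g w \<partial>(m_measure p :: ('f, 'q) sqmat measure)) = ennreal (1 / \<kappa>) * (\<integral>\<^sup>+w. bdens s w * g w \<partial>lborel)"
proof -
  let ?R = "restrict_space lborel (B_ball :: ('f, 'q) sqmat set)"
  define h where "h w = adet (mat 1 - ctrans w ** w) powr s" for w :: "('f, 'q) sqmat"
  have [measurable]: "h \<in> borel_measurable borel" unfolding h_def by measurable
  have hR: "h \<in> borel_measurable ?R" by (rule measurable_restrict_space1) simp
  have sp: "space ?R = B_ball" by (simp add: space_restrict_space)
  have mh: "m_weight p w = h w" if "w \<in> B_ball" for w :: "('f, 'q) sqmat"
    using that Delta_CARD[of "mat 1 - ctrans w ** w"] by (simp add: m_weight_def h_def s_def Let_def B_ball_def)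
  have hb: "ennreal (h w) * indicator B_ball w = bdens s w" for w
    by (simp add: h_def bdens_def indicator_def)
  have R: "(\<integral>\<^sup>+w. f w \<partial>?R) = (\<integral>\<^sup>+w. f w * indicator B_ball w \<partial>lborel)" for f
    by (rule nn_integral_restrict_space) simp
  have "m_kappa TYPE(('f, 'q) sqmat) p = (\<integral>w. h w \<partial>?R)"
    unfolding m_kappa_def by (rule Bochner_Integration.integral_cong) (simp_all add: sp mh)
  also have "\<dots> = enn2real (\<integral>\<^sup>+w. ennreal (h w) \<partial>?R)"
    by (rule integral_eq_nn_integral[OF hR]) (simp add: h_def)
  also have "\<dots> = \<kappa>" unfolding R hb \<kappa>(2) using \<kappa>(1) by simp
  finally have k: "m_kappa TYPE(('f, 'q) sqmat) p = \<kappa>" .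
  have hk: "(\<lambda>w. ennreal (h w / \<kappa>)) \<in> borel_measurable ?R" by (rule measurable_restrict_space1) simp
  have "m_measure p = density ?R (\<lambda>w. ennreal (h w / \<kappa>))"
    unfolding m_measure_def k
  proof (rule density_cong)
    show "(\<lambda>w. ennreal (m_weight p w / \<kappa>)) \<in> borel_measurable ?R"
      using hk by (rule measurable_cong[THEN iffD1, rotated]) (simp add: sp mh)
    show "AE w in ?R. ennreal (m_weight p w / \<kappa>) = ennreal (h w / \<kappa>)"
      by (rule AE_I2) (simp add: sp mh)
  qed (rule hk)
  moreover have "g \<in> borel_measurable ?R" by (rule measurable_restrict_space1) simp
  ultimately have "(\<integral>\<^sup>+w. g w \<partial>(m_measure p)) = (\<integral>\<^sup>+w. ennreal (h w / \<kappa>) * g w \<partial>?R)"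
    by (simp add: nn_integral_density[OF hk])
  also have "\<dots> = (\<integral>\<^sup>+w. ennreal (h w / \<kappa>) * g w * indicator B_ball w \<partial>lborel)" by (rule R)
  also have "\<dots> = (\<integral>\<^sup>+w. ennreal (1 / \<kappa>) * (bdens s w * g w) \<partial>lborel)"
  proof (rule nn_integral_cong)
    fix w :: "('f, 'q) sqmat"
    have "ennreal (h w / \<kappa>) = ennreal (1 / \<kappa>) * ennreal (h w)" using \<kappa>(1) by (simp add: ennreal_mult[symmetric] h_def)
    thus "ennreal (h w / \<kappa>) * g w * indicator B_ball w = ennreal (1 / \<kappa>) * (bdens s w * g w)"
      by (simp add: hb[symmetric] mult_ac)
  qed
  also have "\<dots> = ennreal (1 / \<kappa>) * (\<integral>\<^sup>+w. bdens s w * g w \<partial>lborel)" by (rule nn_integral_cmult) measurable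
  finally show ?thesis .
qed

lemma bdens_unitary:
  assumes "u \<in> unitary_group"
  shows "bdens s (w ** u) = bdens s w"
proof -
  have "mat 1 - ctrans (w ** u) ** (w ** u) = ctrans u ** (mat 1 - ctrans w ** w) ** u"
    by (simp add: ctrans_mult matrix_diff_ldistrib matrix_diff_rdistrib matrix_mul_assoc unitary_groupD[OF assms])
  moreover have "pos_def (ctrans u ** (mat 1 - ctrans w ** w) ** u) \<longleftrightarrow> pos_def (mat 1 - ctrans w ** w)"
    by (rule pos_def_congruence_iff[OF unitary_groupD(1)[OF assms]])
  ultimately show ?thesis by (simp add: bdens_def B_ball_def adet_mult adet_unitary assms)
qed

text \<open>The blocks of \<open>k\<close> in the upper left corner and in the middle are jointly distributed like $(u, wu)$.
  Since the ball measure is invariant under $w \<mapsto> wu$, the law of $(u, w)$ is the same; the form with $wu$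
  is the one that occurs in the spherical function.\<close>

lemma law_of_blocks:
  fixes \<mu>K :: "('f::rch, 'q::{finite,linorder}, 's::finite) bigmat measure" and \<mu>U :: "('f, 'q) sqmat measure"
  assumes \<mu>K: "normalized_haar K_group \<mu>K" and \<mu>U: "normalized_haar unitary_group0 \<mu>U"
    and p: "p = CARD('q + 's)" "p \<ge> 2 * CARD('q)"
  shows "prob_space (m_measure p :: ('f, 'q) sqmat measure)"
    and "distr \<mu>K borel (\<lambda>k. (blk1 k, midblk k)) = distr (\<mu>U \<Otimes>\<^sub>M m_measure p) borel (\<lambda>(u, w). (u, w ** u))"
proof -
  let ?m = "m_measure p :: ('f, 'q) sqmat measure"
  define s where "s = real p * real DIM('f) / 2 - (real DIM('f) * (real CARD('q) - 1 / 2) + 1)"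
  have qs: "CARD('q) \<le> CARD('s)" using p by simp
  have s2: "2 * s = real DIM('f) * real CARD('s) - hexp TYPE('f) TYPE('q)"
    unfolding s_def hexp_def p(1) by (simp add: field_simps)
  note BI = block_inequality[OF \<mu>K qs s2]
  obtain \<kappa> where \<kappa>: "\<kappa> > 0" "(\<integral>\<^sup>+w. bdens s w \<partial>(lborel :: ('f, 'q) sqmat measure)) = ennreal \<kappa>"
    using BI(1,2) by (cases "\<integral>\<^sup>+w. bdens s w \<partial>(lborel :: ('f, 'q) sqmat measure)") auto
  note mi = m_measure_integral[OF \<kappa>[unfolded s_def], folded s_def]
  have inv: "ennreal (1 / \<kappa>) * (ennreal \<kappa> * y) = y" for y
    using \<kappa>(1) by (simp add: mult.assoc[symmetric] ennreal_mult[symmetric])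
  show pm: "prob_space ?m"
  proof
    have "emeasure ?m (space ?m) = (\<integral>\<^sup>+w. 1 \<partial>?m)" by simp
    also have "\<dots> = 1" using mi[of "\<lambda>_. 1"] inv[of 1] by (simp add: \<kappa>(2))
    finally show "emeasure ?m (space ?m) = 1" .
  qed
  interpret K: prob_space \<mu>K using \<mu>K by (simp add: normalized_haar_def)
  interpret U: prob_space \<mu>U using \<mu>U by (simp add: normalized_haar_def)
  interpret m: prob_space ?m by (rule pm)
  interpret P: pair_prob_space \<mu>U ?m ..
  have [measurable]: "(\<lambda>k. k) \<in> borel_measurable \<mu>K" by (rule measurable_haar_ident[OF \<mu>K])
  have [measurable]: "(\<lambda>u. u) \<in> borel_measurable \<mu>U" by (rule measurable_haar_ident[OF \<mu>U])
  have m1 [measurable]: "(\<lambda>k. (blk1 k, midblk k)) \<in> borel_measurable \<mu>K" by measurable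
  have [measurable]: "fst \<in> borel_measurable (\<mu>U \<Otimes>\<^sub>M ?m)" "snd \<in> borel_measurable (\<mu>U \<Otimes>\<^sub>M ?m)"
    using measurable_compose[OF measurable_fst \<open>(\<lambda>u. u) \<in> borel_measurable \<mu>U\<close>] measurable_compose[OF measurable_snd measurable_m_ident] by auto
  have m2 [measurable]: "(\<lambda>(u, w). (u, w ** u)) \<in> borel_measurable (\<mu>U \<Otimes>\<^sub>M ?m)"
    unfolding case_prod_unfold by measurable
  have bU: "blk1 \<in> \<mu>K \<rightarrow>\<^sub>M \<mu>U"
  proof -
    have "(blk1 :: ('f, 'q, 's) bigmat \<Rightarrow> _) \<in> restrict_space borel K_group \<rightarrow>\<^sub>M restrict_space borel unitary_group0"
      by (rule measurable_restrict_space3)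
         (use linear_borel[OF linear_blk1] blk1_K_unitary0 in auto)
    thus ?thesis using \<mu>K \<mu>U measurable_cong_sets unfolding normalized_haar_def by blast
  qed
  have spU: "space \<mu>U = unitary_group0" using \<mu>U by (simp add: normalized_haar_def)
  show "distr \<mu>K borel (\<lambda>k. (blk1 k, midblk k)) = distr (\<mu>U \<Otimes>\<^sub>M ?m) borel (\<lambda>(u, w). (u, w ** u))"
  proof (rule prob_measure_eqI_neighbourhoods)
    show "prob_space (distr \<mu>K borel (\<lambda>k. (blk1 k, midblk k)))" by (rule K.prob_space_distr[OF m1])
    show "prob_space (distr (\<mu>U \<Otimes>\<^sub>M ?m) borel (\<lambda>(u, w). (u, w ** u)))" by (rule P.prob_space_distr[OF m2])
    fix C :: "(('f, 'q) sqmat \<times> ('f, 'q) sqmat) set" and \<epsilon> :: real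
    assume C [measurable]: "C \<in> sets borel" and \<epsilon>: "0 < \<epsilon>" "\<epsilon> \<le> 1"
    define D where "D r = (\<Union>y\<in>C. ball y r)" for r
    have Do: "open (D r)" for r unfolding D_def by blast
    have [measurable]: "D r \<in> sets borel" for r by (rule borel_open[OF Do])
    let ?N = "distr (\<mu>U \<Otimes>\<^sub>M ?m) borel (\<lambda>(u, w). (u, w ** u))"
    have mD: "(\<lambda>x. indicator (D \<epsilon>) x :: ennreal) \<in> borel_measurable borel" by measurable
    have "emeasure ?N (D \<epsilon>) = (\<integral>\<^sup>+x. indicator (D \<epsilon>) x \<partial>?N)" by (simp)
    also have "\<dots> = (\<integral>\<^sup>+x. indicator (D \<epsilon>) (case x of (u, w) \<Rightarrow> (u, w ** u)) \<partial>(\<mu>U \<Otimes>\<^sub>M ?m))"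
      by (rule nn_integral_distr[OF m2]) measurable
    also have "\<dots> = (\<integral>\<^sup>+u. \<integral>\<^sup>+w. indicator (D \<epsilon>) (u, w ** u) \<partial>?m \<partial>\<mu>U)"
      by (subst m.nn_integral_fst[symmetric]) (use measurable_compose[OF m2 mD] in simp_all)
    also have "\<dots> = (\<integral>\<^sup>+u. ennreal (1 / \<kappa>) * (\<integral>\<^sup>+w. bdens s w * indicator (D \<epsilon>) (u, w) \<partial>lborel) \<partial>\<mu>U)"
    proof (rule nn_integral_cong)
      fix u assume "u \<in> space \<mu>U"
      hence u: "u \<in> unitary_group" using spU unitary0_subset by blast
      have "(\<integral>\<^sup>+w. indicator (D \<epsilon>) (u, w ** u) \<partial>?m) = ennreal (1 / \<kappa>) * (\<integral>\<^sup>+w. bdens s w * indicator (D \<epsilon>) (u, w ** u) \<partial>lborel)"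
        by (rule mi) measurable
      also have "(\<integral>\<^sup>+w. bdens s w * indicator (D \<epsilon>) (u, w ** u) \<partial>lborel) = (\<integral>\<^sup>+w. bdens s (w ** u) * indicator (D \<epsilon>) (u, w ** u) \<partial>lborel)"
        by (simp add: bdens_unitary[OF u])
      also have "\<dots> = (\<integral>\<^sup>+w. bdens s w * indicator (D \<epsilon>) (u, w) \<partial>lborel)"
        by (rule nn_integral_isometry[where L="\<lambda>w. w ** u" and f="\<lambda>w. bdens s w * indicator (D \<epsilon>) (u, w)"])
           (simp_all add: linear_matrix_right norm_isometry_right unitary_groupD[OF u])
      finally show "(\<integral>\<^sup>+w. indicator (D \<epsilon>) (u, w ** u) \<partial>?m) = ennreal (1 / \<kappa>) * (\<integral>\<^sup>+w. bdens s w * indicator (D \<epsilon>) (u, w) \<partial>lborel)" .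
    qed
    also have "\<dots> = ennreal (1 / \<kappa>) * (\<integral>\<^sup>+u. (\<integral>\<^sup>+w. bdens s w * indicator (D \<epsilon>) (u, w) \<partial>lborel) \<partial>\<mu>U)"
      by (rule nn_integral_cmult) measurable
    also have "(\<integral>\<^sup>+u. (\<integral>\<^sup>+w. bdens s w * indicator (D \<epsilon>) (u, w) \<partial>lborel) \<partial>\<mu>U) =
        (\<integral>\<^sup>+u. (\<integral>\<^sup>+w. bdens s w * indicator (D \<epsilon>) (u, w) \<partial>lborel) \<partial>distr \<mu>K \<mu>U blk1)"
      unfolding haar_blk1[OF \<mu>K \<mu>U] ..
    also have "\<dots> = (\<integral>\<^sup>+k. (\<integral>\<^sup>+w. bdens s w * indicator (D \<epsilon>) (blk1 k, w) \<partial>lborel) \<partial>\<mu>K)"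
      by (rule nn_integral_distr[OF bU]) measurable
    finally have N: "emeasure ?N (D \<epsilon>) = ennreal (1 / \<kappa>) * (\<integral>\<^sup>+k. (\<integral>\<^sup>+w. bdens s w * indicator (D \<epsilon>) (blk1 k, w) \<partial>lborel) \<partial>\<mu>K)" .
    have "ennreal \<kappa> * (\<integral>\<^sup>+k. indicator C (blk1 k, midblk k) \<partial>\<mu>K) \<le>
        (\<integral>\<^sup>+k. (\<integral>\<^sup>+w. bdens s w * indicator (D \<epsilon>) (blk1 k, w) \<partial>lborel) \<partial>\<mu>K)"
      unfolding \<kappa>(2)[symmetric]
    proof (rule BI(3)[of "\<epsilon> / 2" "indicator C" "indicator (D (\<epsilon> / 2))" "indicator (D \<epsilon>)"])
      fix u x y :: "('f, 'q) sqmat" assume d: "dist x y < \<epsilon> / 2"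
      have d': "dist (u, x) (u, y) < \<epsilon> / 2" using d by (simp add: dist_Pair_Pair)
      show "indicator C (u, x) \<le> (indicator (D (\<epsilon> / 2)) (u, y) :: ennreal)"
        using d' by (auto simp: indicator_def D_def intro!: bexI[of _ "(u, x)"])
      show "indicator (D (\<epsilon> / 2)) (u, x) \<le> (indicator (D \<epsilon>) (u, y) :: ennreal)"
      proof -
        have "(u, y) \<in> D \<epsilon>" if x: "(u, x) \<in> D (\<epsilon> / 2)"
        proof -
          obtain z where z: "z \<in> C" "dist z (u, x) < \<epsilon> / 2" using x unfolding D_def by auto
          have "dist z (u, y) < \<epsilon>" using dist_triangle[of z "(u, y)" "(u, x)"] z(2) d' by simp
          thus ?thesis using z(1) unfolding D_def by auto
        qed
        thus ?thesis by (simp add: indicator_def)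
      qed
    qed (use \<epsilon> in simp_all)
    from mult_left_mono[OF this, of "ennreal (1 / \<kappa>)"]
    have "(\<integral>\<^sup>+k. indicator C (blk1 k, midblk k) \<partial>\<mu>K) \<le> emeasure ?N (D \<epsilon>)" unfolding inv N by simp
    moreover have "emeasure (distr \<mu>K borel (\<lambda>k. (blk1 k, midblk k))) C = (\<integral>\<^sup>+k. indicator C (blk1 k, midblk k) \<partial>\<mu>K)"
    proof -
      have "emeasure (distr \<mu>K borel (\<lambda>k. (blk1 k, midblk k))) C = (\<integral>\<^sup>+x. indicator C x \<partial>distr \<mu>K borel (\<lambda>k. (blk1 k, midblk k)))" by simp
      also have "\<dots> = (\<integral>\<^sup>+k. indicator C (blk1 k, midblk k) \<partial>\<mu>K)" by (rule nn_integral_distr[OF m1]) measurable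
      finally show ?thesis .
    qed
    ultimately show "emeasure (distr \<mu>K borel (\<lambda>k. (blk1 k, midblk k))) C \<le> emeasure ?N (\<Union>y\<in>C. ball y \<epsilon>)"
      by (simp add: D_def)
  qed simp_all
qed

section \<open>The integrand\<close>

definition contractions :: "('f::rch, 'n::finite) sqmat set"
  where "contractions = {w. \<forall>v. norm (w *v v) \<le> norm v}"

lemma B_ball_contractions: "B_ball \<subseteq> contractions"
  using B_ball_contraction by (auto simp: contractions_def)

lemma compact_contractions: "compact (contractions :: ('f::rch, 'n::finite) sqmat set)"
proof (rule compact_eq_bounded_closed[THEN iffD2], intro conjI)
  show "bounded (contractions :: ('f, 'n) sqmat set)"
  proof (rule boundedI)
    fix w :: "('f, 'n) sqmat" assume "w \<in> contractions"
    hence "norm (w *v v) \<le> norm v" for v by (simp add: contractions_def)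
    from norm_contraction_left[of w "mat 1 :: ('f, 'n) sqmat", OF this] show "norm w \<le> norm (mat 1 :: ('f, 'n) sqmat)" by simp
  qed
  have eq: "(contractions :: ('f, 'n) sqmat set) = (\<Inter>v. {w. norm (w *v v) \<le> norm v})" by (auto simp: contractions_def)
  show "closed (contractions :: ('f, 'n) sqmat set)"
    unfolding eq by (intro closed_INT ballI closed_Collect_le continuous_intros)
qed

lemma unitary_contractions: "unitary_group \<subseteq> contractions"
  by (auto simp: contractions_def norm_isometry_vec unitary_groupD)

lemma compact_unitary_group: "compact (unitary_group :: ('f::rch, 'n::finite) sqmat set)"
proof -
  have "closed {X :: ('f, 'n) sqmat. ctrans X ** X = mat 1}"
    by (intro closed_Collect_eq continuous_intros)
  hence "closed (unitary_group :: ('f, 'n) sqmat set)" by (simp add: unitary_group_def)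
  hence "compact (contractions \<inter> (unitary_group :: ('f, 'n) sqmat set))" by (rule compact_Int_closed[OF compact_contractions])
  moreover have "contractions \<inter> (unitary_group :: ('f, 'n) sqmat set) = unitary_group" using unitary_contractions by blast
  ultimately show ?thesis by (simp only:)
qed

text \<open>If $\cosh(t_i) v_i = - \sinh(t_i) (wv)_i$ for all $i$ then $|v_i| \<le> |(wv)_i|$, strictly where $v_i \<noteq> 0$.\<close>

lemma cosh_sinh_inj:
  fixes w :: "('f::rch, 'q::finite) sqmat"
  assumes w: "w \<in> contractions" and 0: "cosh_sinh t w *v v = 0"
  shows "v = 0"
proof (rule ccontr)
  assume "v \<noteq> 0"
  then obtain i0 where i0: "v $ i0 \<noteq> 0" by (auto simp: vec_eq_iff)
  define y where "y = w *v v"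
  have eq: "cosh (t $ i) * norm (v $ i) = \<bar>sinh (t $ i)\<bar> * norm (y $ i)" for i
  proof -
    have "rdiag (\<lambda>i. cosh (t $ i)) *v v + rdiag (\<lambda>i. sinh (t $ i)) *v y = 0"
      using 0 by (simp add: cosh_sinh_def y_def matrix_vector_mult_add_rdistrib matrix_vector_mul_assoc)
    hence "(rdiag (\<lambda>i. cosh (t $ i)) *v v + rdiag (\<lambda>i. sinh (t $ i)) *v y) $ i = 0" by simp
    hence "cosh (t $ i) *\<^sub>R v $ i = - (sinh (t $ i) *\<^sub>R y $ i)"
      by (simp add: rdiag_vec eq_neg_iff_add_eq_0)
    from arg_cong[OF this, of norm] show ?thesis by simp
  qed
  have sc: "\<bar>sinh x\<bar> < cosh (x :: real)" for x
    using sinh_less_cosh_real[of x] sinh_less_cosh_real[of "- x"] by simp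
  have le: "norm (v $ i) \<le> norm (y $ i)" for i
  proof -
    have "cosh (t $ i) * norm (v $ i) \<le> cosh (t $ i) * norm (y $ i)"
      unfolding eq using sc[of "t $ i"] by (intro mult_right_mono) auto
    thus ?thesis by simp
  qed
  have lt: "norm (v $ i0) < norm (y $ i0)"
  proof (rule ccontr)
    assume "\<not> ?thesis"
    hence "cosh (t $ i0) * norm (y $ i0) \<le> cosh (t $ i0) * norm (v $ i0)" by simp
    hence "cosh (t $ i0) * norm (y $ i0) \<le> \<bar>sinh (t $ i0)\<bar> * norm (y $ i0)" by (simp add: eq)
    moreover have "norm (y $ i0) > 0" using le[of i0] i0 by (metis less_le_trans zero_less_norm_iff)
    ultimately show False using sc[of "t $ i0"] by simp
  qed
  have "(norm v)\<^sup>2 < (norm y)\<^sup>2"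
    unfolding norm_sq_vec by (rule sum_strict_mono_ex1) (auto intro!: bexI[of _ i0] power_mono power_strict_mono le lt)
  moreover have "norm y \<le> norm v" using w by (simp add: contractions_def y_def)
  ultimately show False by (meson norm_ge_zero not_less power_mono)
qed

lemma continuous_on_cosh_sinh [continuous_intros]:
  "continuous_on S f \<Longrightarrow> continuous_on S (\<lambda>x. cosh_sinh t (f x))"
  unfolding cosh_sinh_def by (intro continuous_intros)

lemma pos_def_cosh_sinh:
  fixes w :: "('f::rch, 'q::finite) sqmat"
  assumes "w \<in> contractions"
  shows "pos_def (ctrans (cosh_sinh t w) ** cosh_sinh t w)" "pos_def (cosh_sinh t w ** ctrans (cosh_sinh t w))"
proof -
  note inj = cosh_sinh_inj[OF assms]
  show "pos_def (ctrans (cosh_sinh t w) ** cosh_sinh t w)" by (rule pos_def_gram) (rule inj)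
  obtain Y where Y: "cosh_sinh t w ** Y = mat 1" "Y ** cosh_sinh t w = mat 1" by (rule inj_imp_matrix_inverse[OF inj])
  have YC: "ctrans Y ** ctrans (cosh_sinh t w) = mat 1" using arg_cong[OF Y(1), of ctrans] by (simp add: ctrans_mult)
  have inj2: "v = 0" if "ctrans (cosh_sinh t w) *v v = 0" for v
  proof -
    have "v = ctrans Y *v (ctrans (cosh_sinh t w) *v v)" by (simp add: matrix_vector_mul_assoc YC)
    thus ?thesis by (simp add: that)
  qed
  have "pos_def (ctrans (ctrans (cosh_sinh t w)) ** ctrans (cosh_sinh t w))" by (rule pos_def_gram) (rule inj2)
  thus "pos_def (cosh_sinh t w ** ctrans (cosh_sinh t w))" by simp
qed

lemma continuous_on_compress [continuous_intros]:
  fixes f :: "'a::topological_space \<Rightarrow> ('f::rch, 'n::finite) sqmat"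
  assumes "continuous_on S f"
  shows "continuous_on S (\<lambda>x. compress Q (f x))"
proof -
  have "continuous_on S (\<lambda>x. if Q i \<and> Q j then f x $ i $ j else if i = j then 1 else 0)" for i j
    by (cases "Q i \<and> Q j"; cases "i = j") (auto intro!: continuous_intros assms)
  thus ?thesis unfolding compress_def by (intro continuous_on_vec_lambda)
qed

text \<open>The power function written with real logarithms, which makes its continuity and measurability
  evident.\<close>

definition power_exp :: "(complex, 'q) vec \<Rightarrow> ('f::rch, 'q::{finite,linorder}) sqmat \<Rightarrow> complex"
  where "power_exp \<mu> x =
    (\<Prod>r = 1..<CARD('q). exp ((coord \<mu> r - coord \<mu> (r + 1)) * of_real (ln (adet (trunc r x))))) *
    exp (coord \<mu> CARD('q) * of_real (ln (adet (trunc CARD('q) x))))"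

lemma power_exp: "pos_def x \<Longrightarrow> Delta_power \<mu> x = power_exp \<mu> x"
proof -
  assume x: "pos_def x"
  have "complex_of_real (Delta r x) powr c = exp (c * of_real (ln (adet (trunc r x))))" for r c
    using Delta_pos_def[OF x, of r] by (simp add: powr_def Ln_of_real)
  thus ?thesis by (simp add: Delta_power_def power_exp_def)
qed

lemma continuous_on_power_exp:
  fixes f :: "'a::topological_space \<Rightarrow> ('f::rch, 'q::{finite,linorder}) sqmat"
  assumes f: "continuous_on S f" and pd: "\<And>x. x \<in> S \<Longrightarrow> pos_def (f x)"
  shows "continuous_on S (\<lambda>x. power_exp \<mu> (f x))"
proof -
  have "adet (trunc r (f x)) \<noteq> 0" if "x \<in> S" for r x
    using Delta_pos_def[OF pd[OF that], of r] by simp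
  thus ?thesis unfolding power_exp_def by (intro continuous_intros f) auto
qed

lemma measurable_power_exp [measurable (raw)]:
  fixes f :: "'a \<Rightarrow> ('f::rch, 'q::{finite,linorder}) sqmat"
  assumes [measurable]: "f \<in> borel_measurable M"
  shows "(\<lambda>x. power_exp \<mu> (f x)) \<in> borel_measurable M"
proof -
  have [measurable]: "(\<lambda>x. adet (trunc r (f x))) \<in> borel_measurable M" for r
  proof -
    have "continuous_on UNIV (\<lambda>x :: ('f, 'q) sqmat. adet (trunc r x))" by (intro continuous_intros)
    from measurable_compose[OF assms borel_measurable_continuous_onI[OF this]] show ?thesis .
  qed
  show ?thesis unfolding power_exp_def by measurable
qed

text \<open>The integrand is continuous on the compact product of the unitary group with the set of contractions.\<close>

lemma integrable_power_exp:
  fixes \<mu>U :: "('f::rch, 'q::{finite,linorder}) sqmat measure" and X :: "('f, 'q) sqmat \<Rightarrow> ('f, 'q) sqmat"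
  assumes \<mu>U: "normalized_haar unitary_group0 \<mu>U" and m: "prob_space (m_measure p :: ('f, 'q) sqmat measure)"
    and X: "continuous_on UNIV X" "\<And>w. w \<in> contractions \<Longrightarrow> pos_def (X w)"
  shows "integrable (\<mu>U \<Otimes>\<^sub>M m_measure p) (\<lambda>(u, w). power_exp \<mu> (ctrans u ** X w ** u))"
proof -
  let ?m = "m_measure p :: ('f, 'q) sqmat measure"
  interpret U: prob_space \<mu>U using \<mu>U by (simp add: normalized_haar_def)
  interpret m: prob_space ?m by (rule m)
  interpret P: pair_prob_space \<mu>U ?m ..
  have [measurable]: "fst \<in> borel_measurable (\<mu>U \<Otimes>\<^sub>M ?m)" "snd \<in> borel_measurable (\<mu>U \<Otimes>\<^sub>M ?m)"
    using measurable_compose[OF measurable_fst measurable_haar_ident[OF \<mu>U]] measurable_compose[OF measurable_snd measurable_m_ident] by auto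
  have [measurable]: "X \<in> borel_measurable borel" by (rule borel_measurable_continuous_onI[OF X(1)])
  have [measurable]: "(\<lambda>x. X (snd x)) \<in> borel_measurable (\<mu>U \<Otimes>\<^sub>M ?m)" by measurable
  let ?S = "unitary_group \<times> contractions :: (('f, 'q) sqmat \<times> ('f, 'q) sqmat) set"
  have "continuous_on ?S (\<lambda>x. power_exp \<mu> (ctrans (fst x) ** X (snd x) ** fst x))"
  proof (rule continuous_on_power_exp)
    show "continuous_on ?S (\<lambda>x. ctrans (fst x) ** X (snd x) ** fst x)"
      by (intro continuous_intros continuous_on_compose2[OF X(1)]) auto
    fix x assume "x \<in> ?S"
    hence x: "fst x \<in> unitary_group" "snd x \<in> contractions" by auto
    show "pos_def (ctrans (fst x) ** X (snd x) ** fst x)"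
      using pos_def_congruence_iff[OF unitary_groupD(1)[OF x(1)]] X(2)[OF x(2)] by simp
  qed
  hence "compact ((\<lambda>x. power_exp \<mu> (ctrans (fst x) ** X (snd x) ** fst x)) ` ?S)"
    by (intro compact_continuous_image compact_Times compact_unitary_group compact_contractions)
  then obtain B where B: "\<And>x. x \<in> ?S \<Longrightarrow> norm (power_exp \<mu> (ctrans (fst x) ** X (snd x) ** fst x)) \<le> B"
    by (meson bounded_iff compact_imp_bounded imageI)
  have sp: "space (\<mu>U \<Otimes>\<^sub>M ?m) \<subseteq> ?S"
    using \<mu>U unitary0_subset B_ball_contractions by (auto simp: space_pair_measure normalized_haar_def sets_m_measure)
  show ?thesis unfolding case_prod_unfold
  proof (rule P.integrable_const_bound[where B=B])
    show "AE x in \<mu>U \<Otimes>\<^sub>M ?m. norm (power_exp \<mu> (ctrans (fst x) ** X (snd x) ** fst x)) \<le> B"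
      by (rule AE_I2) (use sp B in blast)
  qed measurable
qed

section \<open>The spherical function\<close>

lemma a_elt_fmat: "a_elt t = fmat (\<lambda>a. cosh (wt t a)) (\<lambda>a. sinh (wt t a) * (case a of Inl _ \<Rightarrow> 1 | Inr _ \<Rightarrow> - 1))"
proof -
  have c: "exp x * (sqrt (1 / 2) * sqrt (1 / 2)) = exp x / 2" for x :: real by simp
  show ?thesis
    unfolding a_elt_eq cP_def fmat_rdiag Pmat_def fmat_mult
    by (rule fmat_eqI) (simp_all add: c cosh_def sinh_def wt_def mult_ac field_simps)
qed

lemma topblk_a_elt:
  assumes "k \<in> K_group"
  shows "topblk (a_elt t ** k) = rdiag (\<lambda>i. cosh (t $ i)) ** blk1 k + rdiag (\<lambda>i. sinh (t $ i)) ** midblk k"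
  using assms unfolding a_elt_fmat
  by (simp add: vec_eq_iff topblk_def fmat_left rdiag_mult_nth blk1_def midblk_def K_group_def wt_def)

lemma iwasawa_power_exp:
  assumes k: "k \<in> K_group"
  shows "exp (\<Sum>i\<in>UNIV. \<mu> $ i * of_real (iwasawa_H (a_elt t ** k) $ i)) =
    power_exp ((1 / 2) *s \<mu>) (ctrans (topblk (a_elt t ** k)) ** topblk (a_elt t ** k))"
proof -
  have g: "a_elt t ** k \<in> G_group" by (rule G_mult[OF a_elt_G K_groupD(1)[OF k]])
  obtain k' t' n where "k' \<in> K_group" "n \<in> N_group" "a_elt t ** k = k' ** a_elt t' ** n" by (rule iwasawa_exists[OF g])
  from topblk_minors(1)[OF this] show ?thesis by (simp add: iwasawa_Delta[OF g, symmetric] power_exp)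
qed

lemma haar_left_translation:
  fixes S :: "('f::rch, 'n::finite) sqmat set"
  assumes S: "unitary_subgroup S" and \<mu>: "normalized_haar S \<mu>" and h: "h \<in> S"
  shows "distr \<mu> \<mu> (\<lambda>k. h ** k) = \<mu>"
proof (rule haar_distr[OF \<mu> \<mu> S S])
  show "continuous_on UNIV (\<lambda>k. h ** k)" by (intro continuous_intros)
  show "(\<lambda>k. h ** k) ` S \<subseteq> S" using S h by (auto simp: unitary_subgroup_def)
  show "\<exists>h'\<in>S. \<forall>k\<in>S. h ** (h' ** k) = g ** (h ** k)" if g: "g \<in> S" for g
  proof (intro bexI ballI)
    have hu: "h \<in> unitary_group" using S h by (auto simp: unitary_subgroup_def)
    show "ctrans h ** g ** h \<in> S" using S h g by (auto simp: unitary_subgroup_def)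
    have "h ** (ctrans h ** g ** h ** k) = (h ** ctrans h) ** g ** h ** k" for k by (simp add: matrix_mul_assoc)
    thus "h ** (ctrans h ** g ** h ** k) = g ** (h ** k)" for k
      by (simp add: unitary_groupD[OF hu] matrix_mul_assoc)
  qed
qed

lemma continuous_on_rdiag:
  assumes "\<And>i. continuous_on S (\<lambda>x. a x i)"
  shows "continuous_on S (\<lambda>x. rdiag (a x) :: ('f::rch, 'n::finite) sqmat)"
proof -
  have "continuous_on S (\<lambda>x. if i = j then of_real (a x i) else (0 :: 'f))" for i j
    by (cases "i = j") (auto intro!: continuous_intros assms)
  thus ?thesis unfolding rdiag_def by (intro continuous_on_vec_lambda)
qed

text \<open>By the singular value decomposition $M M^* = v M^* M v^*$ with unitary \<open>v\<close>. Over the reals the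
  determinant of \<open>v\<close> is the sign of that of \<open>M\<close>, which is positive as \<open>M\<close> is connected to the identity
  through invertible matrices.\<close>

lemma cosh_sinh_swap:
  fixes w :: "('f::rch, 'q::finite) sqmat"
  assumes w: "w \<in> contractions"
  obtains v where "v \<in> unitary_group0"
    "cosh_sinh t w ** ctrans (cosh_sinh t w) = v ** (ctrans (cosh_sinh t w) ** cosh_sinh t w) ** ctrans v"
proof -
  define M where "M = cosh_sinh t w"
  have inj: "v = 0" if "M *v v = 0" for v using cosh_sinh_inj[OF w] that by (simp add: M_def)
  obtain W s U where W: "W \<in> unitary_group" and U: "U \<in> unitary_group" and s: "\<And>i. s i > 0"
    and M: "M = W ** rdiag s ** ctrans U"
    using singular_value_decomposition[OF inj] by metis
  define v where "v = W ** ctrans U"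
  have vu: "v \<in> unitary_group" unfolding v_def by (intro unitary_group_mult unitary_group_ctrans W U)
  have sw: "M ** ctrans M = v ** (ctrans M ** M) ** ctrans v"
  proof -
    have "M ** ctrans M = W ** rdiag s ** (ctrans U ** U) ** rdiag s ** ctrans W"
      unfolding M by (simp add: ctrans_mult matrix_mul_assoc)
    moreover have "v ** (ctrans M ** M) ** ctrans v =
        W ** (ctrans U ** U) ** rdiag s ** (ctrans W ** W) ** rdiag s ** (ctrans U ** U) ** ctrans W"
      unfolding M v_def by (simp add: ctrans_mult matrix_mul_assoc)
    ultimately show ?thesis by (simp add: unitary_groupD[OF U] unitary_groupD[OF W])
  qed
  have v0: "v \<in> unitary_group0"
  proof (cases "2 \<le> DIM('f)")
    case True
    thus ?thesis by (rule unitary0_full[OF _ vu])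
  next
    case False
    hence d: "DIM('f) = 1" using DIM_positive[where 'a='f] by linarith
    let ?f = "\<lambda>r. cosh_sinh (r *\<^sub>R t) (r *\<^sub>R w)"
    have cont: "continuous_on {0..1} ?f"
      unfolding cosh_sinh_def by (intro continuous_intros continuous_on_rdiag)
    have one: "cdet (?f 0) = 1" by (simp add: cosh_sinh_def rdiag_1)
    have nz: "cdet (?f r) \<noteq> 0" if r: "r \<in> {0..1}" for r
    proof -
      have "norm ((r *\<^sub>R w) *v v) \<le> norm v" for v
      proof -
        have "(r *\<^sub>R w) *v v = r *\<^sub>R (w *v v)" by (simp add: vec_eq_iff matrix_vec_nth scaleR_sum_right)
        hence "norm ((r *\<^sub>R w) *v v) = r * norm (w *v v)" using r by simp
        also have "\<dots> \<le> 1 * norm v" using r w by (intro mult_mono) (auto simp: contractions_def)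
        finally show ?thesis by simp
      qed
      hence rw: "r *\<^sub>R w \<in> contractions" by (simp add: contractions_def)
      obtain Y where "?f r ** Y = mat 1" by (rule inj_imp_matrix_inverse[OF cosh_sinh_inj[OF rw]])
      hence "cdet (?f r) * cdet Y = 1" by (simp add: cdet_mult[symmetric])
      thus ?thesis by auto
    qed
    have "Re (cdet (?f 1)) > 0"
      by (rule cdet_positive_connected[OF d connected_Icc cont _ one nz]) auto
    hence M0: "Re (cdet M) > 0" by (simp add: M_def)
    have "cdet M = cdet W * of_real (\<Prod>i\<in>UNIV. s i) * cdet (ctrans U)"
      unfolding M by (simp add: cdet_mult cdet_rdiag d del: of_real_prod)
    also have "\<dots> = of_real (\<Prod>i\<in>UNIV. s i) * cdet v" by (simp add: v_def cdet_mult del: of_real_prod)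
    finally have "Re (cdet M) = (\<Prod>i\<in>UNIV. s i) * Re (cdet v)" by (simp del: of_real_prod)
    moreover have "(\<Prod>i\<in>UNIV. s i) > 0" by (rule prod_pos) (use s in auto)
    ultimately have "Re (cdet v) > 0" using M0 by (simp add: zero_less_mult_iff)
    from unitary0_real[OF d vu cdet_unitary_positive[OF d vu this]] show ?thesis .
  qed
  show ?thesis by (rule that[OF v0 sw[unfolded M_def]])
qed

theorem corollary2p2:
  fixes l :: "(complex, 'q::{finite,linorder}) vec"
    and t :: "(real, 'q) vec"
    and p :: nat
    and \<mu>K :: "('f::rch, 'q, 's::finite) bigmat measure"
    and \<mu>U :: "('f, 'q) sqmat measure"
  assumes "p = CARD('q + 's)" and "p \<ge> 2 * CARD('q)"
    and "normalized_haar K_group \<mu>K"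
    and "normalized_haar unitary_group0 \<mu>U"
  shows "integrable (\<mu>U \<Otimes>\<^sub>M m_measure p)
             (\<lambda>(u, w). Delta_power ((1 / 2) *s (\<i> *s l - rho_BC DIM('f) p)) (g_mat t u w)) \<and>
         spherical_function \<mu>K l (a_elt t) =
             (\<integral>(u, w). Delta_power ((1 / 2) *s (\<i> *s l - rho_BC DIM('f) p)) (g_mat t u w)
               \<partial>(\<mu>U \<Otimes>\<^sub>M m_measure p)) \<and>
         integrable (\<mu>U \<Otimes>\<^sub>M m_measure p)
             (\<lambda>(u, w). Delta_power ((1 / 2) *s (\<i> *s l - rho_BC DIM('f) p)) (g_tilde t u w)) \<and>
         spherical_function \<mu>K l (a_elt t) =
             (\<integral>(u, w). Delta_power ((1 / 2) *s (\<i> *s l - rho_BC DIM('f) p)) (g_tilde t u w)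
               \<partial>(\<mu>U \<Otimes>\<^sub>M m_measure p))"
proof -
  let ?m = "m_measure p :: ('f, 'q) sqmat measure"
  note \<mu>K = assms(3) and \<mu>U = assms(4)
  note law = law_of_blocks[OF \<mu>K \<mu>U assms(1,2)]
  interpret U: prob_space \<mu>U using \<mu>U by (simp add: normalized_haar_def)
  interpret m: prob_space ?m by (rule law(1))
  interpret P: pair_prob_space \<mu>U ?m ..
  define \<mu> where "\<mu> = \<i> *s l - rho_BC DIM('f) p"
  define C where "C = (cosh_sinh t :: ('f, 'q) sqmat \<Rightarrow> _)"
  define f where "f u w = power_exp ((1 / 2) *s \<mu>) (ctrans u ** (ctrans (C w) ** C w) ** u)" for u w
  define f' where "f' u w = power_exp ((1 / 2) *s \<mu>) (ctrans u ** (C w ** ctrans (C w)) ** u)" for u w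
  have spU: "space \<mu>U = unitary_group0" using \<mu>U by (simp add: normalized_haar_def)
  have sp: "u \<in> unitary_group \<and> w \<in> contractions" if "(u, w) \<in> space (\<mu>U \<Otimes>\<^sub>M ?m)" for u w
    using that spU unitary0_subset B_ball_contractions by (auto simp: space_pair_measure sets_m_measure)
  have cC: "continuous_on UNIV C" unfolding C_def by (intro continuous_intros)
  have int_f: "integrable (\<mu>U \<Otimes>\<^sub>M ?m) (\<lambda>(u, w). f u w)"
    unfolding f_def by (rule integrable_power_exp[OF \<mu>U law(1)]) (auto intro!: continuous_intros cC simp: pos_def_cosh_sinh C_def)
  have int_f': "integrable (\<mu>U \<Otimes>\<^sub>M ?m) (\<lambda>(u, w). f' u w)"
    unfolding f'_def by (rule integrable_power_exp[OF \<mu>U law(1)]) (auto intro!: continuous_intros cC simp: pos_def_cosh_sinh C_def)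
  have Df: "Delta_power ((1 / 2) *s \<mu>) (g_mat t u w) = f u w \<and> Delta_power ((1 / 2) *s \<mu>) (g_tilde t u w) = f' u w"
    if "(u, w) \<in> space (\<mu>U \<Otimes>\<^sub>M ?m)" for u w
  proof -
    have u: "u \<in> unitary_group" and w: "w \<in> contractions" using sp[OF that] by auto
    have "pos_def (ctrans u ** (ctrans (C w) ** C w) ** u)" "pos_def (ctrans u ** (C w ** ctrans (C w)) ** u)"
      using pos_def_congruence_iff[OF unitary_groupD(1)[OF u]] pos_def_cosh_sinh[OF w] by (simp_all add: C_def)
    moreover have "g_mat t u w = ctrans u ** (ctrans (C w) ** C w) ** u" "g_tilde t u w = ctrans u ** (C w ** ctrans (C w)) ** u"
      by (simp_all add: g_mat_def g_tilde_def C_def matrix_inv_unitary[OF u] matrix_mul_assoc)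
    ultimately show ?thesis by (simp add: power_exp f_def f'_def)
  qed
  have sph: "spherical_function \<mu>K l (a_elt t) = (\<integral>(u, w). f u w \<partial>(\<mu>U \<Otimes>\<^sub>M ?m))"
  proof -
    have spK: "space \<mu>K = K_group" using \<mu>K by (simp add: normalized_haar_def)
    define A where "A y = rdiag (\<lambda>i. cosh (t $ i)) ** fst y + rdiag (\<lambda>i. sinh (t $ i)) ** snd y" for y :: "('f, 'q) sqmat \<times> ('f, 'q) sqmat"
    define \<Phi> where "\<Phi> y = power_exp ((1 / 2) *s \<mu>) (ctrans (A y) ** A y)" for y
    have [measurable]: "A \<in> borel_measurable borel"
      unfolding A_def by (intro borel_measurable_continuous_onI continuous_intros)
    have \<Phi>m: "\<Phi> \<in> borel_measurable borel" unfolding \<Phi>_def by measurable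
    have [measurable]: "(\<lambda>k. k) \<in> borel_measurable \<mu>K" by (rule measurable_haar_ident[OF \<mu>K])
    have m1: "(\<lambda>k. (blk1 k, midblk k)) \<in> borel_measurable \<mu>K" by measurable
    have [measurable]: "fst \<in> borel_measurable (\<mu>U \<Otimes>\<^sub>M ?m)" "snd \<in> borel_measurable (\<mu>U \<Otimes>\<^sub>M ?m)"
      using measurable_compose[OF measurable_fst measurable_haar_ident[OF \<mu>U]] measurable_compose[OF measurable_snd measurable_m_ident] by auto
    have m2: "(\<lambda>(u, w). (u, w ** u)) \<in> borel_measurable (\<mu>U \<Otimes>\<^sub>M ?m)"
      unfolding case_prod_unfold by measurable
    have "spherical_function \<mu>K l (a_elt t) = (\<integral>k. \<Phi> (blk1 k, midblk k) \<partial>\<mu>K)"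
      unfolding spherical_function_def assms(1)[symmetric] \<mu>_def[symmetric]
      by (rule Bochner_Integration.integral_cong) (simp_all add: spK iwasawa_power_exp topblk_a_elt \<Phi>_def A_def)
    also have "\<dots> = (\<integral>y. \<Phi> y \<partial>distr \<mu>K borel (\<lambda>k. (blk1 k, midblk k)))"
      by (rule integral_distr[OF m1 \<Phi>m, symmetric])
    also have "\<dots> = (\<integral>x. \<Phi> (case x of (u, w) \<Rightarrow> (u, w ** u)) \<partial>(\<mu>U \<Otimes>\<^sub>M ?m))"
      unfolding law(2) by (rule integral_distr[OF m2 \<Phi>m])
    also have "\<dots> = (\<integral>(u, w). f u w \<partial>(\<mu>U \<Otimes>\<^sub>M ?m))"
    proof (rule Bochner_Integration.integral_cong[OF refl])
      fix x :: "('f, 'q) sqmat \<times> ('f, 'q) sqmat"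
      obtain u w where x: "x = (u, w)" by (cases x)
      \<comment> \<open>This is where the form $(u, wu)$ of the law is used.\<close>
      have "A (u, w ** u) = C w ** u"
        by (simp add: A_def C_def cosh_sinh_def matrix_add_rdistrib matrix_mul_assoc)
      thus "\<Phi> (case x of (u, w) \<Rightarrow> (u, w ** u)) = (case x of (u, w) \<Rightarrow> f u w)"
        by (simp add: x \<Phi>_def f_def ctrans_mult matrix_mul_assoc)
    qed
    finally show ?thesis .
  qed
  \<comment> \<open>For fixed \<open>w\<close> the two matrices are conjugate by some \<open>v\<close>, which the invariance of \<open>\<mu>U\<close> absorbs.\<close>
  have swap: "(\<integral>(u, w). f' u w \<partial>(\<mu>U \<Otimes>\<^sub>M ?m)) = (\<integral>(u, w). f u w \<partial>(\<mu>U \<Otimes>\<^sub>M ?m))"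
  proof -
    have "(\<integral>u. f' u w \<partial>\<mu>U) = (\<integral>u. f u w \<partial>\<mu>U)" if "w \<in> space ?m" for w
    proof -
      have "w \<in> contractions" using that B_ball_contractions by (auto simp: sets_m_measure)
      then obtain v where v: "v \<in> unitary_group0" and Mv: "C w ** ctrans (C w) = v ** (ctrans (C w) ** C w) ** ctrans v"
        using cosh_sinh_swap[of w t] unfolding C_def by metis
      have v': "ctrans v \<in> unitary_group0" by (rule unitary0_ctrans[OF v])
      have "(\<lambda>k. ctrans v ** k) \<in> restrict_space borel unitary_group0 \<rightarrow>\<^sub>M restrict_space borel unitary_group0"
        by (rule measurable_restrict_space3)
           (use v' unitary0_mult in \<open>auto intro!: borel_measurable_continuous_onI continuous_intros\<close>)
      hence vm: "(\<lambda>k. ctrans v ** k) \<in> \<mu>U \<rightarrow>\<^sub>M \<mu>U"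
        using \<mu>U measurable_cong_sets unfolding normalized_haar_def by blast
      have [measurable]: "(\<lambda>u. u) \<in> borel_measurable \<mu>U" by (rule measurable_haar_ident[OF \<mu>U])
      have fm: "(\<lambda>u. f u w) \<in> borel_measurable \<mu>U" unfolding f_def by measurable
      have "(\<integral>u. f u w \<partial>\<mu>U) = (\<integral>u. f u w \<partial>distr \<mu>U \<mu>U (\<lambda>k. ctrans v ** k))"
        unfolding haar_left_translation[OF unitary_subgroup_unitary0 \<mu>U v'] ..
      also have "\<dots> = (\<integral>u. f (ctrans v ** u) w \<partial>\<mu>U)" by (rule integral_distr[OF vm fm])
      also have "\<dots> = (\<integral>u. f' u w \<partial>\<mu>U)"
        unfolding f_def f'_def Mv by (simp add: ctrans_mult matrix_mul_assoc)
      finally show ?thesis ..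
    qed
    hence "(\<integral>w. (\<integral>u. f' u w \<partial>\<mu>U) \<partial>?m) = (\<integral>w. (\<integral>u. f u w \<partial>\<mu>U) \<partial>?m)"
      by (rule Bochner_Integration.integral_cong[OF refl])
    thus ?thesis using P.integral_snd[OF int_f] P.integral_snd[OF int_f'] by simp
  qed
  have cong: "integrable (\<mu>U \<Otimes>\<^sub>M ?m) (\<lambda>(u, w). Delta_power ((1 / 2) *s \<mu>) (g_mat t u w)) \<longleftrightarrow> integrable (\<mu>U \<Otimes>\<^sub>M ?m) (\<lambda>(u, w). f u w)"
    "integrable (\<mu>U \<Otimes>\<^sub>M ?m) (\<lambda>(u, w). Delta_power ((1 / 2) *s \<mu>) (g_tilde t u w)) \<longleftrightarrow> integrable (\<mu>U \<Otimes>\<^sub>M ?m) (\<lambda>(u, w). f' u w)"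
    "(\<integral>(u, w). Delta_power ((1 / 2) *s \<mu>) (g_mat t u w) \<partial>(\<mu>U \<Otimes>\<^sub>M ?m)) = (\<integral>(u, w). f u w \<partial>(\<mu>U \<Otimes>\<^sub>M ?m))"
    "(\<integral>(u, w). Delta_power ((1 / 2) *s \<mu>) (g_tilde t u w) \<partial>(\<mu>U \<Otimes>\<^sub>M ?m)) = (\<integral>(u, w). f' u w \<partial>(\<mu>U \<Otimes>\<^sub>M ?m))"
    using Df by (auto intro!: Bochner_Integration.integral_cong Bochner_Integration.integrable_cong)
  show ?thesis unfolding \<mu>_def[symmetric] cong using int_f int_f' sph swap by simp
qed

end
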